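(* Let $(N,\Pi)$ be a Beurling generalized number system satisfying the logarithmic density bounds $\int_{1^-}^{x}\frac{\mathrm{d}N(u)}{u}\asymp\log x$ (for large $x$). Let $\mathrm{d}G=\exp^{\ast}(g\,\mathrm{d}\Pi)$ be a multiplicative arithmetic measure with $g=g_1+g_2$, where $|g_1(x)|\le 1$, $\int_1^x|g_1(u)|\log u\,\mathrm{d}\Pi(u)\ll x$, and $\int_1^\infty x^{-1}|g_2(x)|\,\mathrm{d}\Pi(x)<\infty$. Let $c,\alpha\in\mathbb{R}$ and let $L$ be a slowly varying function with $|L(u)|=1$. Then $$\int_1^x\frac{G(u)}{u}\,\mathrm{d}u=\frac{c\,x^{1+i\alpha}}{(1+i\alpha)^2}L(\log x)+o(x)\quad(x\to\infty)$$ holds if and only if $$\widehat{G}(s)=\frac{c}{s-1-i\alpha}L\Big(\frac{1}{\sigma-1}\Big)+o\Big(\frac{1}{\sigma-1}\Big)\quad(\sigma\to1^+)$$ holds uniformly for $t$ in compact intervals, where $s=\sigma+it$.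
   Context: A Beurling generalized number system is a pair of non-decreasing right-continuous functions $N$ and $\Pi$ supported on $[1,\infty)$ with $N(1)=1$, $\Pi(1)=0$, subject to $\mathrm{d}N=\exp^{\ast}(\mathrm{d}\Pi)$, where $\exp^{\ast}(\mu)=\delta_1+\mu+\mu\ast\mu/2!+\cdots$ is the exponential with respect to the multiplicative convolution of measures on $[1,\infty)$. A (complex) measure $\mathrm{d}G$ on $[1,\infty)$ is arithmetic if it is absolutely continuous with respect to $\mathrm{d}N$, and multiplicative if $\mathrm{d}G=\exp^{\ast}(g\,\mathrm{d}\Pi)$ for some function $g$. We write $G(x)=\int_{1^-}^x\mathrm{d}G$ and $\widehat{G}(s)=\int_{1^-}^\infty x^{-s}\mathrm{d}G(x)$. A function $L$ is slowly varying if it is measurable and $L(\lambda u)/L(u)\to1$ as $u\to\infty$ for every $\lambda>0$. *)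

theory Defs
  imports "HOL-Analysis.Analysis" "HOL-Library.Landau_Symbols"
begin

text \<open>
  The complex measures on \<open>[1,\<infinity>)\<close> considered here are in general only locally finite
  (already \<open>dN\<close> has infinite mass), so such a measure is a set function that is meaningful on the
  bounded Borel subsets of \<open>[1,\<infinity>)\<close>; its values on all other sets are irrelevant.
\<close>

type_synonym cmeasure = "real set \<Rightarrow> complex"

definition bdd_borel :: "real set set" where
  "bdd_borel = {B \<in> sets borel. B \<subseteq> {1..} \<and> bounded B}"

definition complex_measure :: "cmeasure \<Rightarrow> bool" where
  "complex_measure \<mu> \<longleftrightarrow>
     (\<forall>A :: nat \<Rightarrow> real set. range A \<subseteq> bdd_borel \<longrightarrow> disjoint_family A \<longrightarrow> bounded (\<Union>n. A n) \<longrightarrow>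
        (\<lambda>n. \<mu> (A n)) sums \<mu> (\<Union>n. A n))"

text \<open>
  Integration against a complex measure goes through the Jordan decomposition: the positive
  variation of a signed measure is \<open>\<nu>\<^sup>+(B) = sup {\<nu>(A) | A \<subseteq> B}\<close>, and \<open>\<nu>\<^sup>- = (-\<nu>)\<^sup>+\<close>.
  As \<open>A\<close> ranges over \<open>bdd_borel\<close>, the variations live on \<open>[1,\<infinity>)\<close>.
\<close>

definition pos_variation :: "(real set \<Rightarrow> real) \<Rightarrow> real measure" where
  "pos_variation \<nu> = measure_of UNIV (sets borel) (\<lambda>B. SUP A\<in>{A \<in> bdd_borel. A \<subseteq> B}. ennreal (\<nu> A))"

definition cm_integral :: "cmeasure \<Rightarrow> (real \<Rightarrow> complex) \<Rightarrow> complex" where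
  "cm_integral \<mu> h =
     (LINT x|pos_variation (\<lambda>A. Re (\<mu> A)). h x) - (LINT x|pos_variation (\<lambda>A. - Re (\<mu> A)). h x)
     + \<i> * ((LINT x|pos_variation (\<lambda>A. Im (\<mu> A)). h x) - (LINT x|pos_variation (\<lambda>A. - Im (\<mu> A)). h x))"

definition mult_conv :: "cmeasure \<Rightarrow> cmeasure \<Rightarrow> cmeasure" where
  "mult_conv \<mu> \<nu> B = cm_integral \<mu> (\<lambda>u. \<nu> {v \<in> {1..}. u * v \<in> B})"

definition dirac_one :: cmeasure where
  "dirac_one B = indicator B 1"

definition exp_star :: "cmeasure \<Rightarrow> cmeasure" where
  "exp_star \<mu> B = (\<Sum>n. ((mult_conv \<mu> ^^ n) dirac_one) B / fact n)"

definition stieltjes :: "(real \<Rightarrow> real) \<Rightarrow> cmeasure" where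
  "stieltjes F B = complex_of_real (measure (interval_measure F) B)"

definition stieltjes_density :: "(real \<Rightarrow> complex) \<Rightarrow> (real \<Rightarrow> real) \<Rightarrow> cmeasure" where
  "stieltjes_density g F B = (LINT x:B|interval_measure F. g x)"

text \<open>Since \<open>N\<close> vanishes on \<open>(-\<infinity>,1)\<close> and \<open>N(1) = 1\<close>, the measure \<open>interval_measure N\<close> has the
  unit atom at \<open>1\<close> demanded by \<open>\<integral>\<close> starting at \<open>1\<^sup>-\<close>; \<open>dP\<close> has no atom at \<open>1\<close>.\<close>

definition beurling_system :: "(real \<Rightarrow> real) \<Rightarrow> (real \<Rightarrow> real) \<Rightarrow> bool" where
  "beurling_system N P \<longleftrightarrow>
     mono N \<and> mono P \<and>
     (\<forall>x. continuous (at_right x) N) \<and> (\<forall>x. continuous (at_right x) P) \<and>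
     (\<forall>x<1. N x = 0) \<and> (\<forall>x<1. P x = 0) \<and> N 1 = 1 \<and> P 1 = 0 \<and>
     (\<forall>B\<in>bdd_borel. stieltjes N B = exp_star (stieltjes P) B)"

definition arithmetic_measure :: "(real \<Rightarrow> real) \<Rightarrow> cmeasure \<Rightarrow> bool" where
  "arithmetic_measure N dG \<longleftrightarrow>
     complex_measure dG \<and> (\<forall>B\<in>bdd_borel. B \<in> null_sets (interval_measure N) \<longrightarrow> dG B = 0)"

definition multiplicative_with :: "(real \<Rightarrow> real) \<Rightarrow> (real \<Rightarrow> complex) \<Rightarrow> cmeasure \<Rightarrow> bool" where
  "multiplicative_with P g dG \<longleftrightarrow> (\<forall>B\<in>bdd_borel. dG B = exp_star (stieltjes_density g P) B)"

definition summatory :: "cmeasure \<Rightarrow> real \<Rightarrow> complex" where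
  "summatory dG x = dG {1..x}"

definition mellin_stieltjes :: "cmeasure \<Rightarrow> complex \<Rightarrow> complex" where
  "mellin_stieltjes dG s = cm_integral dG (\<lambda>x. complex_of_real x powr (- s))"

text \<open>Slowly varying functions are taken as functions on \<open>(0,\<infinity>)\<close>; values at \<open>u \<le> 0\<close> play no role.
  Measurability is Lebesgue measurability.\<close>

definition slowly_varying :: "(real \<Rightarrow> complex) \<Rightarrow> bool" where
  "slowly_varying L \<longleftrightarrow>
     L \<in> borel_measurable (lebesgue_on {0<..}) \<and>
     (\<forall>l>0. ((\<lambda>u. L (l * u) / L u) \<longlongrightarrow> 1) at_top)"

end

theory Submission
  imports Defs "HOL-Probability.Characteristic_Functions"
begin

text \<open>
  In the logarithmic variable \<open>y = log u\<close>, and after multiplication by \<open>exp (- \<beta> * y)\<close> with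
  \<open>\<beta> = 1 + i \<alpha>\<close>, the measure of primes becomes a kernel \<open>k1 + k2\<close>, where \<open>k2\<close> has finite mass, and the
  averaged summatory function becomes a bounded function \<open>\<psi>\<close> whose Laplace transform is
  \<open>\<Phi> s / (\<beta> + s)\<^sup>2\<close>, with \<open>\<Phi> s\<close> the Mellin transform at \<open>\<beta> + s\<close>. The implication from \<open>\<psi>\<close> to
  \<open>\<Phi>\<close> is dominated convergence.

  For the converse, the part \<open>\<psi>1\<close> of \<open>\<psi>\<close> that belongs to \<open>k1\<close> satisfies
  \<open>y * \<psi>1 y = \<integral> \<psi>1 (y - v) * v dk1(v) + O(1)\<close>. Halasz's method applied to the increments of \<open>\<psi>1\<close>
  (Cauchy--Schwarz, Plancherel on the line \<open>\<sigma> = 1 / y\<close>, and splitting \<open>|\<Phi>|\<^sup>2\<close> as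
  \<open>|\<Phi>|^(1/2)\<close> times the square of \<open>|\<Phi>|^(3/4)\<close>, the hypothesis being used only for the first factor)
  shows that \<open>\<psi>1 y - \<psi>1 (y - u)\<close> is small for \<open>u \<le> \<epsilon> * y\<close>. Convolution with the finite kernel \<open>k2\<close>
  preserves this, so \<open>\<psi>\<close> stays close to its averages over \<open>[(1 - \<epsilon>) * y, y]\<close>, and the latter are
  determined by \<open>\<Phi>\<close> on the real axis through Karamata's Tauberian argument.
\<close>

section \<open>Exponentials of convolution operators on the half-line\<close>

text \<open>Increments of \<open>\<psi>1\<close> are studied instead of values because they bring
  the factor \<open>1 - exp (- u * s)\<close>, which for \<open>u \<le> \<epsilon> * y\<close>
  cancels the singularity of \<open>c / s\<close> at the origin, the one place where
  \<open>\<Phi>\<close> may be as large as \<open>1 / \<sigma>\<close>. The average defining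
  \<open>\<psi>1\<close> makes it Lipschitz and gives its transform extra decay for large
  \<open>|t|\<close>, where the hypothesis is not uniform. The exponent \<open>3/4\<close> answers
  two demands: the majorant of the convolution exponential of \<open>\<kappa> * |k1|\<close> is
  \<open>O (y powr (\<kappa> - 1))\<close>, whose damped square integral has order
  \<open>\<sigma> powr (1 - 2 * \<kappa>)\<close> once \<open>\<kappa> > 1/2\<close>, while
  \<open>\<kappa> < 1\<close> leaves a positive power of \<open>|\<Phi>|\<close> for the hypothesis;
  at \<open>3/4\<close> both factors compete at \<open>\<sigma> powr (- 1/2)\<close>. The
  logarithmic density enters as the bound \<open>O (1 / \<sigma>)\<close> for the zeta function at
  \<open>1 + \<sigma>\<close>. The obstacle is that \<open>g\<^sub>2\<close> obeys no Chebyshev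
  bound, so the identity for \<open>y * \<psi>1 y\<close> is exploited for \<open>k1\<close> alone
  and \<open>k2\<close> is restored afterwards; \<open>|exp (kh2 s)|\<close> lies between positive
  constants, so bounds on \<open>\<Phi>\<close> carry over to \<open>exp (kh s)\<close>.\<close>

definition loc_kernel :: "real measure \<Rightarrow> (real \<Rightarrow> 'a::{real_normed_field, banach, second_countable_topology}) \<Rightarrow> bool" where
  "loc_kernel m k \<longleftrightarrow> sigma_finite_measure m \<and> sets m = sets borel \<and> k \<in> borel_measurable borel \<and>
     (\<forall>v<0. k v = 0) \<and> (\<forall>y. integrable m (\<lambda>v. indicator {..y} v *\<^sub>R k v))"

text \<open>Kernels and functions are controlled on each \<open>{..y}\<close> only, with no
  condition at infinity. This suffices for convolution, because vanishing on the negative axis cuts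
  the integral down to \<open>0 \<le> v \<le> y\<close>. The base measure of a kernel is arbitrary,
  so that prime measures with atoms and Lebesgue densities are treated alike.\<close>

definition loc_bdd :: "(real \<Rightarrow> 'a::{real_normed_field, banach, second_countable_topology}) \<Rightarrow> bool" where
  "loc_bdd f \<longleftrightarrow> f \<in> borel_measurable borel \<and> (\<forall>y<0. f y = 0) \<and> (\<forall>y. \<exists>M. \<forall>x\<le>y. norm (f x) \<le> M)"

definition lconv :: "real measure \<Rightarrow> (real \<Rightarrow> 'a) \<Rightarrow> (real \<Rightarrow> 'a) \<Rightarrow> real \<Rightarrow> 'a::{real_normed_field, banach, second_countable_topology}" where
  "lconv m k f y = (\<integral>v. f (y - v) * k v \<partial>m)"

text \<open>The exponential series of the operator \<open>lconv m k\<close>, applied to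
  \<open>f\<close>. Letting operators act on functions avoids convolution powers of
  measures.\<close>

definition xconv :: "real measure \<Rightarrow> (real \<Rightarrow> 'a) \<Rightarrow> (real \<Rightarrow> 'a) \<Rightarrow> real \<Rightarrow> 'a::{real_normed_field, banach, second_countable_topology}" where
  "xconv m k f y = (\<Sum>n. (lconv m k ^^ n) f y /\<^sub>R fact n)"

definition kmass :: "real measure \<Rightarrow> (real \<Rightarrow> 'a::{real_normed_field, banach, second_countable_topology}) \<Rightarrow> real \<Rightarrow> real" where
  "kmass m k y = (\<integral>v. indicator {..y} v * norm (k v) \<partial>m)"

lemma loc_kernelD:
  assumes "loc_kernel m k"
  shows "sigma_finite_measure m" "sets m = sets borel" "k \<in> borel_measurable borel"
    "\<And>v. v < 0 \<Longrightarrow> k v = 0" "integrable m (\<lambda>v. indicator {..y} v *\<^sub>R k v)"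
  using assms by (auto simp: loc_kernel_def)

lemma loc_bddD:
  assumes "loc_bdd f"
  shows "f \<in> borel_measurable borel" "\<And>v. v < 0 \<Longrightarrow> f v = 0"
  using assms by (auto simp: loc_bdd_def)

lemma loc_bddE:
  assumes "loc_bdd f"
  obtains M where "\<And>x. x \<le> y \<Longrightarrow> norm (f x) \<le> M" "0 \<le> M"
proof -
  obtain M where M: "\<And>x. x \<le> y \<Longrightarrow> norm (f x) \<le> M" using assms unfolding loc_bdd_def by blast
  moreover have "0 \<le> M" using M[of y] norm_ge_zero order_trans by blast
  ultimately show ?thesis using that by blast
qed

lemma loc_bddI:
  assumes "f \<in> borel_measurable borel" "\<And>v. v < 0 \<Longrightarrow> f v = 0" "\<And>y. \<exists>M. \<forall>x\<le>y. norm (f x) \<le> M"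
  shows "loc_bdd f"
  using assms by (auto simp: loc_bdd_def)

lemma loc_bdd_scaleR:
  assumes f: "loc_bdd f"
  shows "loc_bdd (\<lambda>y. (c::real) *\<^sub>R f y)"
proof (rule loc_bddI)
  note [measurable] = loc_bddD(1)[OF f]
  show "(\<lambda>y. c *\<^sub>R f y) \<in> borel_measurable borel" by measurable
  show "c *\<^sub>R f v = 0" if "v < 0" for v using loc_bddD(2)[OF f that] by simp
  fix y
  obtain M where M: "\<And>x. x \<le> y \<Longrightarrow> norm (f x) \<le> M" using loc_bddE[OF f] by metis
  show "\<exists>M. \<forall>x\<le>y. norm (c *\<^sub>R f x) \<le> M"
    using M by (intro exI[of _ "\<bar>c\<bar> * M"]) (auto intro: mult_left_mono)
qed

lemma loc_kernel_norm:
  assumes "loc_kernel m k" shows "loc_kernel m (\<lambda>v. norm (k v))"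
proof -
  have "integrable m (\<lambda>v. indicator {..y} v *\<^sub>R norm (k v))" for y
    using integrable_norm[OF loc_kernelD(5)[OF assms, of y]]
    by (rule Bochner_Integration.integrable_cong[THEN iffD1, rotated -1]) (auto simp: indicator_def)
  then show ?thesis using assms by (auto simp: loc_kernel_def)
qed

lemma loc_bdd_norm:
  assumes "loc_bdd f" shows "loc_bdd (\<lambda>v. norm (f v))"
  using assms by (auto simp: loc_bdd_def)

lemma kmass_integrable:
  assumes "loc_kernel m k" shows "integrable m (\<lambda>v. indicator {..y} v * norm (k v))"
  using loc_kernelD(5)[OF loc_kernel_norm[OF assms], of y] by simp

lemma lconv_integrable:
  fixes k :: "real \<Rightarrow> 'a::{real_normed_field, banach, second_countable_topology}"
  assumes k: "loc_kernel m k" and f: "loc_bdd f"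
  shows "integrable m (\<lambda>v. f (y - v) * k v)"
proof -
  note [measurable_cong] = loc_kernelD(2)[OF k]
  note [measurable] = loc_kernelD(3)[OF k] loc_bddD(1)[OF f]
  obtain M where M: "\<And>x. x \<le> y \<Longrightarrow> norm (f x) \<le> M" "0 \<le> M" using loc_bddE[OF f] by metis
  show ?thesis
  proof (rule Bochner_Integration.integrable_bound)
    show "integrable m (\<lambda>v. M *\<^sub>R (indicator {..y} v *\<^sub>R k v))"
      using loc_kernelD(5)[OF k, of y] by (rule integrable_scaleR_right)
    show "(\<lambda>v. f (y - v) * k v) \<in> borel_measurable m" by measurable
    show "AE v in m. norm (f (y - v) * k v) \<le> norm (M *\<^sub>R (indicator {..y} v *\<^sub>R k v))"
    proof (rule AE_I2)
      fix v
      show "norm (f (y - v) * k v) \<le> norm (M *\<^sub>R (indicator {..y} v *\<^sub>R k v))"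
        using M loc_kernelD(4)[OF k, of v] loc_bddD(2)[OF f, of "y - v"]
        by (cases "v < 0"; cases "y < v") (auto simp: norm_mult mult_right_mono)
    qed
  qed
qed

lemma lconv_bound:
  assumes k: "loc_kernel m k" and f: "loc_bdd f" and M: "\<And>x. x \<le> y \<Longrightarrow> norm (f x) \<le> M" and "x \<le> y"
  shows "norm (lconv m k f x) \<le> M * kmass m k y"
proof -
  have "norm (lconv m k f x) \<le> (\<integral>v. norm (f (x - v) * k v) \<partial>m)"
    unfolding lconv_def by (rule integral_norm_bound)
  also have "\<dots> \<le> (\<integral>v. M * (indicator {..y} v * norm (k v)) \<partial>m)"
  proof (rule integral_mono)
    show "integrable m (\<lambda>v. norm (f (x - v) * k v))" using lconv_integrable[OF k f] by auto
    show "integrable m (\<lambda>v. M * (indicator {..y} v * norm (k v)))" using kmass_integrable[OF k] by auto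
    fix v
    have "0 \<le> M" using M[of y] norm_ge_zero order_trans by blast
    then show "norm (f (x - v) * k v) \<le> M * (indicator {..y} v * norm (k v))"
      using M[of "x - v"] loc_kernelD(4)[OF k, of v] loc_bddD(2)[OF f, of "x - v"] \<open>x \<le> y\<close>
      by (cases "v < 0"; cases "x < v") (auto simp: norm_mult mult_right_mono indicator_def)
  qed
  also have "\<dots> = M * kmass m k y" by (simp add: kmass_def)
  finally show ?thesis .
qed

lemma loc_bdd_lconv:
  assumes k: "loc_kernel m k" and f: "loc_bdd f"
  shows "loc_bdd (lconv m k f)"
proof (rule loc_bddI)
  interpret sigma_finite_measure m using loc_kernelD(1)[OF k] .
  note [measurable_cong] = loc_kernelD(2)[OF k]
  note [measurable] = loc_kernelD(3)[OF k] loc_bddD(1)[OF f]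
  show "lconv m k f \<in> borel_measurable borel" unfolding lconv_def by measurable
  show "lconv m k f v = 0" if "v < 0" for v
  proof -
    have "f (v - x) * k x = 0" for x
      using loc_kernelD(4)[OF k, of x] loc_bddD(2)[OF f, of "v - x"] that by (cases "x < 0") auto
    then show ?thesis unfolding lconv_def by (simp only: Bochner_Integration.integral_zero)
  qed
  show "\<exists>M. \<forall>x\<le>y. norm (lconv m k f x) \<le> M" for y
    by (rule loc_bddE[OF f, of y]) (metis lconv_bound[OF k f])
qed

lemma loc_bdd_lconv_pow:
  assumes k: "loc_kernel m k" and f: "loc_bdd f"
  shows "loc_bdd ((lconv m k ^^ n) f)"
  by (induction n) (auto simp: f loc_bdd_lconv[OF k])

text \<open>The same mass on \<open>{..y}\<close> serves at every iteration, since arguments only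
  move to the left; hence the series of \<open>xconv\<close> is dominated by an ordinary exponential
  series.\<close>

lemma lconv_pow_bound:
  assumes k: "loc_kernel m k" and f: "loc_bdd f" and M: "\<And>x. x \<le> y \<Longrightarrow> norm (f x) \<le> M" and "x \<le> y"
  shows "norm ((lconv m k ^^ n) f x) \<le> M * kmass m k y ^ n"
  using \<open>x \<le> y\<close>
proof (induction n arbitrary: x)
  case 0 then show ?case using M by simp
next
  case (Suc n)
  have "norm (lconv m k ((lconv m k ^^ n) f) x) \<le> M * kmass m k y ^ n * kmass m k y"
    by (rule lconv_bound[OF k loc_bdd_lconv_pow[OF k f] Suc.IH Suc.prems])
  then show ?case by (simp add: mult_ac)
qed

lemma summable_exp_real: "summable (\<lambda>n. x ^ n /\<^sub>R fact n :: real)"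
  using summable_exp_generic[of x] by simp

lemma suminf_exp_real: "(\<Sum>n. x ^ n /\<^sub>R fact n :: real) = exp x"
  by (simp add: exp_def)

lemma xconv_summable_norm:
  assumes k: "loc_kernel m k" and f: "loc_bdd f"
  shows "summable (\<lambda>n. norm ((lconv m k ^^ n) f y /\<^sub>R fact n))"
proof -
  obtain M where M: "\<And>x. x \<le> y \<Longrightarrow> norm (f x) \<le> M" "0 \<le> M" using loc_bddE[OF f] by metis
  show ?thesis
  proof (rule summable_comparison_test')
    show "summable (\<lambda>n. M * (kmass m k y ^ n /\<^sub>R fact n))"
      using summable_exp_real by (rule summable_mult)
    show "norm (norm ((lconv m k ^^ n) f y /\<^sub>R fact n)) \<le> M * (kmass m k y ^ n /\<^sub>R fact n)" if "0 \<le> n" for n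
      using lconv_pow_bound[OF k f, of y M y n] M(1) by (simp add: field_simps)
  qed
qed

lemma xconv_summable:
  assumes k: "loc_kernel m k" and f: "loc_bdd f"
  shows "summable (\<lambda>n. (lconv m k ^^ n) f y /\<^sub>R fact n)"
  using xconv_summable_norm[OF assms] by (rule summable_norm_cancel)

lemma xconv_bound:
  assumes k: "loc_kernel m k" and f: "loc_bdd f" and M: "\<And>x. x \<le> y \<Longrightarrow> norm (f x) \<le> M" and "x \<le> y"
  shows "norm (xconv m k f x) \<le> M * exp (kmass m k y)"
proof -
  have "norm (xconv m k f x) \<le> (\<Sum>n. norm ((lconv m k ^^ n) f x /\<^sub>R fact n))"
    unfolding xconv_def by (rule summable_norm[OF xconv_summable_norm[OF k f]])
  also have "\<dots> \<le> (\<Sum>n. M * (kmass m k y ^ n /\<^sub>R fact n))"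
    using lconv_pow_bound[OF k f M \<open>x \<le> y\<close>] xconv_summable_norm[OF k f, of x] summable_mult[OF summable_exp_real]
    by (intro suminf_le) (auto simp: field_simps)
  also have "\<dots> = M * exp (kmass m k y)"
    by (subst suminf_mult[OF summable_exp_real]) (simp only: suminf_exp_real)
  finally show ?thesis .
qed

lemma loc_bdd_xconv:
  assumes k: "loc_kernel m k" and f: "loc_bdd f"
  shows "loc_bdd (xconv m k f)"
proof (rule loc_bddI)
  note [measurable] = loc_bddD(1)[OF loc_bdd_lconv_pow[OF k f]]
  show "xconv m k f \<in> borel_measurable borel" unfolding xconv_def by measurable
  show "xconv m k f v = 0" if "v < 0" for v
    using loc_bddD(2)[OF loc_bdd_lconv_pow[OF k f] that] by (simp add: xconv_def)
  show "\<exists>M. \<forall>x\<le>y. norm (xconv m k f x) \<le> M" for y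
    by (rule loc_bddE[OF f, of y]) (metis xconv_bound[OF k f])
qed

text \<open>Fubini for the two kernel measures; the symmetric double integral is read in both
  orders.\<close>

lemma lconv_commute:
  fixes k :: "real \<Rightarrow> 'a::{real_normed_field, banach, second_countable_topology}"
  assumes k: "loc_kernel m k" and l: "loc_kernel m' l" and f: "loc_bdd f"
  shows "lconv m k (lconv m' l f) = lconv m' l (lconv m k f)"
proof
  fix y
  interpret M1: sigma_finite_measure m using loc_kernelD(1)[OF k] .
  interpret M2: sigma_finite_measure m' using loc_kernelD(1)[OF l] .
  interpret pair_sigma_finite m m' ..
  note [measurable_cong] = loc_kernelD(2)[OF k] loc_kernelD(2)[OF l]
  note [measurable] = loc_kernelD(3)[OF k] loc_kernelD(3)[OF l] loc_bddD(1)[OF f]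
  have i1: "integrable m' (\<lambda>w. f (x - w) * l w)" for x by (rule lconv_integrable[OF l f])
  have i2: "integrable m (\<lambda>w. f (x - w) * k w)" for x by (rule lconv_integrable[OF k f])
  have int: "integrable (m \<Otimes>\<^sub>M m') (\<lambda>(v, w). f (y - v - w) * l w * k v)"
  proof (rule Fubini_integrable)
    show "(\<lambda>(v, w). f (y - v - w) * l w * k v) \<in> borel_measurable (m \<Otimes>\<^sub>M m')" by measurable
    \<comment> \<open>Absolute integrability comes for free: the iterated integral of the norms is
      again a convolution, of normed kernels with a normed function.\<close>
    have "integrable m (\<lambda>v. lconv m' (\<lambda>w. norm (l w)) (\<lambda>w. norm (f w)) (y - v) * norm (k v))"
      by (intro lconv_integrable loc_bdd_lconv loc_kernel_norm loc_bdd_norm k l f)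
    then show "integrable m (\<lambda>x. \<integral>w. norm (case (x, w) of (v, w) \<Rightarrow> f (y - v - w) * l w * k v) \<partial>m')"
      by (simp add: lconv_def norm_mult)
    show "AE x in m. integrable m' (\<lambda>w. case (x, w) of (v, w) \<Rightarrow> f (y - v - w) * l w * k v)"
      using i1 by (intro AE_I2) auto
  qed
  have "lconv m k (lconv m' l f) y = (\<integral>v. (\<integral>w. f (y - v - w) * l w * k v \<partial>m') \<partial>m)"
    unfolding lconv_def using i1 by simp
  also have "\<dots> = (\<integral>w. (\<integral>v. f (y - v - w) * l w * k v \<partial>m) \<partial>m')"
    using Fubini_integral[OF int] by simp
  also have "\<dots> = (\<integral>w. (\<integral>v. f (y - w - v) * k v * l w \<partial>m) \<partial>m')"
    by (intro Bochner_Integration.integral_cong refl) (simp add: algebra_simps)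
  also have "\<dots> = lconv m' l (lconv m k f) y"
    unfolding lconv_def using i2 by simp
  finally show "lconv m k (lconv m' l f) y = lconv m' l (lconv m k f) y" .
qed

lemma lconv_pow_commute:
  assumes k: "loc_kernel m k" and l: "loc_kernel m' l" and f: "loc_bdd f"
  shows "(lconv m k ^^ n) (lconv m' l f) = lconv m' l ((lconv m k ^^ n) f)"
  by (induction n) (auto simp: lconv_commute[OF k l loc_bdd_lconv_pow[OF k f]])

lemma lconv_add:
  assumes k: "loc_kernel m k" and f: "loc_bdd f" and g: "loc_bdd g"
  shows "lconv m k (\<lambda>y. f y + g y) y = lconv m k f y + lconv m k g y"
  unfolding lconv_def using lconv_integrable[OF k f] lconv_integrable[OF k g]
  by (simp add: distrib_right)

lemma lconv_diff:
  assumes k: "loc_kernel m k" and f: "loc_bdd f" and g: "loc_bdd g"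
  shows "lconv m k (\<lambda>y. f y - g y) y = lconv m k f y - lconv m k g y"
  unfolding lconv_def using lconv_integrable[OF k f] lconv_integrable[OF k g]
  by (simp add: left_diff_distrib)

lemma lconv_scaleR:
  "lconv m k (\<lambda>y. c *\<^sub>R f y) y = c *\<^sub>R lconv m k f y"
  unfolding lconv_def by simp

lemma lconv_shift: "lconv m k (\<lambda>y. f (y - u)) y = lconv m k f (y - u)"
  unfolding lconv_def by (simp add: algebra_simps)

text \<open>Termwise convolution of the exponential series, justified by the bound on the powers. It
  yields both that exponentials commute with convolutions and the derivation formula for
  \<open>xconv\<close>.\<close>

lemma xconv_lconv_sums:
  assumes k: "loc_kernel m k" and l: "loc_kernel m' l" and f: "loc_bdd f"
  shows "(\<lambda>n. lconv m' l ((lconv m k ^^ n) f) y /\<^sub>R fact n) sums lconv m' l (xconv m k f) y"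
proof -
  obtain M where M: "\<And>x. x \<le> y \<Longrightarrow> norm (f x) \<le> M" "0 \<le> M" using loc_bddE[OF f] by metis
  let ?F = "\<lambda>n v. ((lconv m k ^^ n) f (y - v) /\<^sub>R fact n) * l v"
  have int: "integrable m' (?F n)" for n
    using lconv_integrable[OF l loc_bdd_lconv_pow[OF k f, of n], of y] by simp
  have "(\<lambda>n. integral\<^sup>L m' (?F n)) sums (\<integral>v. (\<Sum>n. ?F n v) \<partial>m')"
  proof (rule sums_integral[OF int])
    show "AE v in m'. summable (\<lambda>n. norm (?F n v))"
      using summable_mult2[OF xconv_summable_norm[OF k f]] by (intro AE_I2) (simp only: norm_mult)
    show "summable (\<lambda>n. \<integral>v. norm (?F n v) \<partial>m')"
    proof (rule summable_comparison_test')
      show "summable (\<lambda>n. (M * kmass m' l y) * (kmass m k y ^ n /\<^sub>R fact n))"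
        using summable_exp_real by (rule summable_mult)
      fix n :: nat
      have "(\<integral>v. norm ((lconv m k ^^ n) f (y - v)) * norm (l v) \<partial>m') \<le> (M * kmass m k y ^ n) * kmass m' (\<lambda>v. norm (l v)) y"
        using lconv_bound[OF loc_kernel_norm[OF l] loc_bdd_norm[OF loc_bdd_lconv_pow[OF k f, of n]], of y "M * kmass m k y ^ n" y]
          lconv_pow_bound[OF k f M(1)] by (simp add: lconv_def)
      then show "norm (\<integral>v. norm (?F n v) \<partial>m') \<le> (M * kmass m' l y) * (kmass m k y ^ n /\<^sub>R fact n)"
        by (simp add: norm_mult kmass_def field_simps)
    qed
  qed
  also have "(\<integral>v. (\<Sum>n. ?F n v) \<partial>m') = lconv m' l (xconv m k f) y"
    unfolding lconv_def xconv_def by (simp add: suminf_mult2[OF xconv_summable[OF k f], unfolded lconv_def])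
  also have "(\<lambda>n. integral\<^sup>L m' (?F n)) = (\<lambda>n. lconv m' l ((lconv m k ^^ n) f) y /\<^sub>R fact n)"
    by (simp add: lconv_def)
  finally show ?thesis .
qed

lemma xconv_lconv:
  assumes k: "loc_kernel m k" and l: "loc_kernel m' l" and f: "loc_bdd f"
  shows "xconv m k (lconv m' l f) = lconv m' l (xconv m k f)"
proof
  fix y
  show "xconv m k (lconv m' l f) y = lconv m' l (xconv m k f) y"
    using sums_unique[OF xconv_lconv_sums[OF assms, of y]]
    by (simp add: xconv_def lconv_pow_commute[OF assms])
qed

section \<open>Multiplication by the variable as a derivation of convolution\<close>

lemma loc_kernel_times_id:
  assumes k: "loc_kernel m k"
  shows "loc_kernel m (\<lambda>v. v *\<^sub>R k v)"
proof -
  note [measurable_cong] = loc_kernelD(2)[OF k]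
  note [measurable] = loc_kernelD(3)[OF k]
  have "integrable m (\<lambda>v. indicator {..y} v *\<^sub>R (v *\<^sub>R k v))" for y
  proof (rule Bochner_Integration.integrable_bound)
    show "integrable m (\<lambda>v. \<bar>y\<bar> *\<^sub>R (indicator {..y} v *\<^sub>R k v))"
      using loc_kernelD(5)[OF k, of y] by (rule integrable_scaleR_right)
    show "AE v in m. norm (indicator {..y} v *\<^sub>R (v *\<^sub>R k v)) \<le> norm (\<bar>y\<bar> *\<^sub>R (indicator {..y} v *\<^sub>R k v))"
    proof (rule AE_I2)
      fix v
      show "norm (indicator {..y} v *\<^sub>R (v *\<^sub>R k v)) \<le> norm (\<bar>y\<bar> *\<^sub>R (indicator {..y} v *\<^sub>R k v))"
        using loc_kernelD(4)[OF k, of v]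
        by (cases "v < 0"; cases "y < v") (auto simp: mult_right_mono)
    qed
  qed measurable
  then show ?thesis using k by (auto simp: loc_kernel_def)
qed

lemma loc_bdd_times_id:
  assumes f: "loc_bdd f"
  shows "loc_bdd (\<lambda>v. v *\<^sub>R f v)"
proof (rule loc_bddI)
  note [measurable] = loc_bddD(1)[OF f]
  show "(\<lambda>v. v *\<^sub>R f v) \<in> borel_measurable borel" by measurable
  show "v *\<^sub>R f v = 0" if "v < 0" for v using loc_bddD(2)[OF f that] by simp
  fix y
  obtain M where M: "\<And>x. x \<le> y \<Longrightarrow> norm (f x) \<le> M" "0 \<le> M" using loc_bddE[OF f] by metis
  have "norm (x *\<^sub>R f x) \<le> \<bar>y\<bar> * M" if "x \<le> y" for x
  proof (cases "x < 0")
    case True then show ?thesis using loc_bddD(2)[OF f True] M by simp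
  next
    case False
    then show ?thesis using M(1)[OF that] M(2) that by (auto intro!: mult_mono)
  qed
  then show "\<exists>M. \<forall>x\<le>y. norm (x *\<^sub>R f x) \<le> M" by blast
qed

text \<open>Write \<open>y = (y - v) + v\<close> under the integral sign.\<close>

lemma lconv_times_id:
  assumes k: "loc_kernel m k" and f: "loc_bdd f"
  shows "y *\<^sub>R lconv m k f y = lconv m k (\<lambda>y. y *\<^sub>R f y) y + lconv m (\<lambda>v. v *\<^sub>R k v) f y"
proof -
  have "lconv m k (\<lambda>y. y *\<^sub>R f y) y + lconv m (\<lambda>v. v *\<^sub>R k v) f y
      = (\<integral>v. ((y - v) *\<^sub>R f (y - v)) * k v + f (y - v) * (v *\<^sub>R k v) \<partial>m)"
    unfolding lconv_def
    by (intro Bochner_Integration.integral_add[symmetric] lconv_integrable[OF k loc_bdd_times_id[OF f]]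
        lconv_integrable[OF loc_kernel_times_id[OF k] f])
  also have "\<dots> = (\<integral>v. y *\<^sub>R (f (y - v) * k v) \<partial>m)"
    by (intro Bochner_Integration.integral_cong refl) (simp add: algebra_simps scaleR_left_diff_distrib)
  finally show ?thesis by (simp add: lconv_def)
qed

text \<open>The Leibniz rule for a power; because convolutions commute, all terms with a
  differentiated kernel coincide, which accounts for the factor \<open>Suc n\<close>.\<close>

lemma lconv_pow_times_id:
  assumes k: "loc_kernel m k" and f: "loc_bdd f"
  shows "y *\<^sub>R (lconv m k ^^ Suc n) f y
    = (lconv m k ^^ Suc n) (\<lambda>y. y *\<^sub>R f y) y + real (Suc n) *\<^sub>R lconv m (\<lambda>v. v *\<^sub>R k v) ((lconv m k ^^ n) f) y"
proof (induction n arbitrary: y)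
  case 0
  then show ?case using lconv_times_id[OF k f] by simp
next
  case (Suc n)
  let ?S = "lconv m k" and ?l = "\<lambda>v. v *\<^sub>R k v" and ?Y = "\<lambda>y. y *\<^sub>R f y"
  note l = loc_kernel_times_id[OF k]
  note bd = loc_bdd_lconv_pow[OF k f]
  have "y *\<^sub>R (?S ^^ Suc (Suc n)) f y = ?S (\<lambda>y. y *\<^sub>R (?S ^^ Suc n) f y) y + lconv m ?l ((?S ^^ Suc n) f) y"
    using lconv_times_id[OF k bd[of "Suc n"]] by simp
  also have "(\<lambda>y. y *\<^sub>R (?S ^^ Suc n) f y) = (\<lambda>y. (?S ^^ Suc n) ?Y y + real (Suc n) *\<^sub>R lconv m ?l ((?S ^^ n) f) y)"
    by (rule ext) (rule Suc.IH)
  also have "?S \<dots> y = ?S ((?S ^^ Suc n) ?Y) y + ?S (\<lambda>y. real (Suc n) *\<^sub>R lconv m ?l ((?S ^^ n) f) y) y"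
  proof (rule lconv_add[OF k])
    show "loc_bdd ((?S ^^ Suc n) ?Y)" by (intro loc_bdd_lconv_pow[OF k] loc_bdd_times_id f)
    have *: "loc_bdd (lconv m ?l ((?S ^^ n) f))" by (intro loc_bdd_lconv[OF l] bd)
    show "loc_bdd (\<lambda>y. real (Suc n) *\<^sub>R lconv m ?l ((?S ^^ n) f) y)"
      by (rule loc_bdd_scaleR[OF *])
  qed
  also have "?S (\<lambda>y. real (Suc n) *\<^sub>R lconv m ?l ((?S ^^ n) f) y) y = real (Suc n) *\<^sub>R lconv m ?l ((?S ^^ Suc n) f) y"
    by (simp only: lconv_scaleR lconv_commute[OF k l bd] funpow.simps o_apply)
  finally show ?case by (simp add: algebra_simps scaleR_conv_of_real)
qed

text \<open>The derivative of an exponential: the factor \<open>Suc n\<close> of the Leibniz rule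
  turns \<open>fact (Suc n)\<close> into \<open>fact n\<close>. For a multiplicative measure this is
  the identity behind the logarithmic derivative of its Euler product.\<close>

lemma xconv_times_id:
  assumes k: "loc_kernel m k" and f: "loc_bdd f"
  shows "y *\<^sub>R xconv m k f y = xconv m k (\<lambda>y. y *\<^sub>R f y) y + lconv m (\<lambda>v. v *\<^sub>R k v) (xconv m k f) y"
proof -
  let ?S = "lconv m k" and ?l = "\<lambda>v. v *\<^sub>R k v" and ?Y = "\<lambda>y. y *\<^sub>R f y"
  note l = loc_kernel_times_id[OF k]
  have s1: "(\<lambda>n. y *\<^sub>R ((?S ^^ n) f y /\<^sub>R fact n)) sums (y *\<^sub>R xconv m k f y)"
    unfolding xconv_def by (intro sums_scaleR_right summable_sums xconv_summable[OF k f])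
  have s2: "(\<lambda>n. (?S ^^ n) ?Y y /\<^sub>R fact n) sums xconv m k ?Y y"
    unfolding xconv_def by (intro summable_sums xconv_summable[OF k loc_bdd_times_id[OF f]])
  have s3: "(\<lambda>n. y *\<^sub>R ((?S ^^ n) f y /\<^sub>R fact n) - (?S ^^ n) ?Y y /\<^sub>R fact n) sums (y *\<^sub>R xconv m k f y - xconv m k ?Y y)"
    by (rule sums_diff[OF s1 s2])
  \<comment> \<open>The index may be shifted without changing the sum, since at \<open>n = 0\<close>
    both terms equal \<open>y *\<^sub>R f y\<close> and cancel.\<close>
  have "(\<lambda>n. y *\<^sub>R ((?S ^^ Suc n) f y /\<^sub>R fact (Suc n)) - (?S ^^ Suc n) ?Y y /\<^sub>R fact (Suc n)) sums (y *\<^sub>R xconv m k f y - xconv m k ?Y y)"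
    by (subst sums_Suc_iff) (use s3 in simp)
  moreover have "y *\<^sub>R ((?S ^^ Suc n) f y /\<^sub>R fact (Suc n)) - (?S ^^ Suc n) ?Y y /\<^sub>R fact (Suc n)
      = lconv m ?l ((?S ^^ n) f) y /\<^sub>R fact n" for n
  proof -
    have "y *\<^sub>R ((?S ^^ Suc n) f y /\<^sub>R fact (Suc n)) - (?S ^^ Suc n) ?Y y /\<^sub>R fact (Suc n)
       = (y *\<^sub>R (?S ^^ Suc n) f y - (?S ^^ Suc n) ?Y y) /\<^sub>R fact (Suc n)"
      by (simp add: scaleR_right_diff_distrib mult.commute)
    also have "\<dots> = (real (Suc n) *\<^sub>R lconv m ?l ((?S ^^ n) f) y) /\<^sub>R fact (Suc n)"
      by (subst lconv_pow_times_id[OF k f]) simp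
    also have "\<dots> = lconv m ?l ((?S ^^ n) f) y /\<^sub>R fact n"
      by (simp del: of_nat_Suc)
    finally show ?thesis .
  qed
  ultimately have "(\<lambda>n. lconv m ?l ((?S ^^ n) f) y /\<^sub>R fact n) sums (y *\<^sub>R xconv m k f y - xconv m k ?Y y)"
    by simp
  from sums_unique2[OF this xconv_lconv_sums[OF k l f]] show ?thesis by (simp add: algebra_simps)
qed

lemma loc_bdd_add:
  assumes f: "loc_bdd f" and g: "loc_bdd g"
  shows "loc_bdd (\<lambda>y. f y + g y)"
proof (rule loc_bddI)
  note [measurable] = loc_bddD(1)[OF f] loc_bddD(1)[OF g]
  show "(\<lambda>y. f y + g y) \<in> borel_measurable borel" by measurable
  show "f v + g v = 0" if "v < 0" for v using loc_bddD(2)[OF f that] loc_bddD(2)[OF g that] by simp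
  fix y
  obtain M M' where "\<And>x. x \<le> y \<Longrightarrow> norm (f x) \<le> M" "\<And>x. x \<le> y \<Longrightarrow> norm (g x) \<le> M'"
    using loc_bddE[OF f] loc_bddE[OF g] by metis
  then show "\<exists>M. \<forall>x\<le>y. norm (f x + g x) \<le> M"
    by (intro exI[of _ "M + M'"]) (meson add_mono norm_triangle_ineq order_trans)
qed

lemma loc_bdd_diff:
  assumes f: "loc_bdd f" and g: "loc_bdd g"
  shows "loc_bdd (\<lambda>y. f y - g y)"
  using loc_bdd_add[OF f loc_bdd_scaleR[OF g, of "-1"]] by simp

lemma loc_bdd_mult_ctns:
  fixes h :: "real \<Rightarrow> 'a::{real_normed_field, banach, second_countable_topology}"
  assumes f: "loc_bdd f" and h: "continuous_on UNIV h"
  shows "loc_bdd (\<lambda>y. h y * f y)"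
proof (rule loc_bddI)
  have [measurable]: "h \<in> borel_measurable borel" using h by (rule borel_measurable_continuous_onI)
  note [measurable] = loc_bddD(1)[OF f]
  show "(\<lambda>y. h y * f y) \<in> borel_measurable borel" by measurable
  show "h v * f v = 0" if "v < 0" for v using loc_bddD(2)[OF f that] by simp
  fix y
  obtain M where M: "\<And>x. x \<le> y \<Longrightarrow> norm (f x) \<le> M" "0 \<le> M" using loc_bddE[OF f] by metis
  have "compact (h ` {0..y})"
    using h by (intro compact_continuous_image) (auto intro: continuous_on_subset)
  then obtain K where K: "\<And>x. 0 \<le> x \<Longrightarrow> x \<le> y \<Longrightarrow> norm (h x) \<le> K"
    by (metis bounded_iff compact_imp_bounded imageI atLeastAtMost_iff)
  have "norm (h x * f x) \<le> \<bar>K\<bar> * M" if "x \<le> y" for x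
  proof (cases "x < 0")
    case True
    then show ?thesis using loc_bddD(2)[OF f True] M by simp
  next
    case False
    then have "norm (h x) \<le> \<bar>K\<bar>" using K[of x] that by simp
    then show ?thesis using M(1)[OF that] M(2) by (simp add: norm_mult mult_mono)
  qed
  then show "\<exists>M. \<forall>x\<le>y. norm (h x * f x) \<le> M" by blast
qed

lemma loc_kernel_mult_ctns:
  fixes h :: "real \<Rightarrow> 'a::{real_normed_field, banach, second_countable_topology}"
  assumes k: "loc_kernel m k" and h: "continuous_on UNIV h"
  shows "loc_kernel m (\<lambda>y. h y * k y)"
proof -
  have [measurable]: "h \<in> borel_measurable borel" using h by (rule borel_measurable_continuous_onI)
  note [measurable_cong] = loc_kernelD(2)[OF k]
  note [measurable] = loc_kernelD(3)[OF k]
  have "integrable m (\<lambda>v. indicator {..y} v *\<^sub>R (h v * k v))" for y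
  proof -
    have "compact (h ` {0..y})"
      using h by (intro compact_continuous_image) (auto intro: continuous_on_subset)
    then obtain K where K: "\<And>x. 0 \<le> x \<Longrightarrow> x \<le> y \<Longrightarrow> norm (h x) \<le> K"
      by (metis bounded_iff compact_imp_bounded imageI atLeastAtMost_iff)
    show ?thesis
    proof (rule Bochner_Integration.integrable_bound)
      show "integrable m (\<lambda>v. \<bar>K\<bar> *\<^sub>R (indicator {..y} v *\<^sub>R k v))"
        using loc_kernelD(5)[OF k, of y] by (rule integrable_scaleR_right)
      show "AE v in m. norm (indicator {..y} v *\<^sub>R (h v * k v)) \<le> norm (\<bar>K\<bar> *\<^sub>R (indicator {..y} v *\<^sub>R k v))"
      proof (rule AE_I2)
        fix v
        have "norm (h v) \<le> \<bar>K\<bar>" if "0 \<le> v" "v \<le> y" using K[OF that] by simp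
        then show "norm (indicator {..y} v *\<^sub>R (h v * k v)) \<le> norm (\<bar>K\<bar> *\<^sub>R (indicator {..y} v *\<^sub>R k v))"
          using loc_kernelD(4)[OF k, of v]
          by (cases "v < 0"; cases "y < v") (auto simp: norm_mult mult_right_mono)
      qed
    qed measurable
  qed
  then show ?thesis using k by (auto simp: loc_kernel_def)
qed

text \<open>Exponential weights are multiplicative,
  \<open>exp (- s * (y - v)) * exp (- s * v) = exp (- s * y)\<close>, so they pass through every
  convolution. Laplace transforms at \<open>s\<close> are thereby reduced to plain integrals of
  twisted objects.\<close>

lemma lconv_pow_twist:
  fixes k :: "real \<Rightarrow> 'a::{real_normed_field, banach, second_countable_topology}"
  shows "(lconv m (\<lambda>v. exp (- s * of_real v) * k v) ^^ n) (\<lambda>y. exp (- s * of_real y) * f y)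
    = (\<lambda>y. exp (- s * of_real y) * (lconv m k ^^ n) f y)"
proof (induction n)
  case (Suc n)
  have "lconv m (\<lambda>v. exp (- s * of_real v) * k v) (\<lambda>y. exp (- s * of_real y) * g y)
    = (\<lambda>y. exp (- s * of_real y) * lconv m k g y)" for g
  proof
    fix y
    have "exp (- s * of_real (y - v)) * g (y - v) * (exp (- s * of_real v) * k v)
        = exp (- s * of_real y) * (g (y - v) * k v)" for v
    proof -
      have "exp (- s * of_real (y - v)) * exp (- s * of_real v) = exp (- s * of_real y)"
        by (simp add: exp_add[symmetric] algebra_simps)
      then show ?thesis by (metis (no_types, lifting) mult.assoc mult.left_commute)
    qed
    then show "lconv m (\<lambda>v. exp (- s * of_real v) * k v) (\<lambda>y. exp (- s * of_real y) * g y) y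
      = exp (- s * of_real y) * lconv m k g y"
      unfolding lconv_def by (simp only: integral_mult_right_zero)
  qed
  then show ?case using Suc by simp
qed simp

lemma xconv_twist:
  fixes k :: "real \<Rightarrow> 'a::{real_normed_field, banach, second_countable_topology}"
  assumes k: "loc_kernel m k" and f: "loc_bdd f"
  shows "xconv m (\<lambda>v. exp (- s * of_real v) * k v) (\<lambda>y. exp (- s * of_real y) * f y) y
    = exp (- s * of_real y) * xconv m k f y"
  unfolding xconv_def lconv_pow_twist
  by (subst suminf_mult[OF xconv_summable[OF k f], symmetric]) simp

section \<open>Total integrals of convolution exponentials, and majorants\<close>

lemma integrable_lborel_shift:
  fixes g :: "real \<Rightarrow> 'b::{banach, second_countable_topology}"
  shows "integrable lborel g \<Longrightarrow> integrable lborel (\<lambda>y. g (y - v))"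
  using lborel_integrable_real_affine[of g 1 "-v"] by simp

lemma integral_lborel_shift:
  fixes g :: "real \<Rightarrow> 'b::{banach, second_countable_topology}"
  shows "(\<integral>y. g (y - v) \<partial>lborel) = (\<integral>y. g y \<partial>lborel)"
  using lborel_integral_real_affine[of 1 g "-v"] by simp

text \<open>Fubini and translation invariance of Lebesgue measure. The last claim provides the
  domination needed to sum over the powers.\<close>

lemma lconv_integral:
  fixes k :: "real \<Rightarrow> 'a::{real_normed_field, banach, second_countable_topology}"
  assumes k: "loc_kernel m k" and f: "loc_bdd f"
    and ik: "integrable m k" and jf: "integrable lborel f"
  shows "integrable lborel (lconv m k f)"
    and "(\<integral>y. lconv m k f y \<partial>lborel) = (\<integral>v. k v \<partial>m) * (\<integral>y. f y \<partial>lborel)"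
    and "(\<integral>y. norm (lconv m k f y) \<partial>lborel) \<le> (\<integral>v. norm (k v) \<partial>m) * (\<integral>y. norm (f y) \<partial>lborel)"
proof -
  interpret M1: sigma_finite_measure m using loc_kernelD(1)[OF k] .
  interpret pair_sigma_finite m lborel ..
  note [measurable_cong] = loc_kernelD(2)[OF k]
  note [measurable] = loc_kernelD(3)[OF k] loc_bddD(1)[OF f]
  note sh = integrable_lborel_shift integral_lborel_shift
  have int: "integrable (m \<Otimes>\<^sub>M lborel) (\<lambda>(v, y). f (y - v) * k v)"
  proof (rule Fubini_integrable)
    show "(\<lambda>(v, y). f (y - v) * k v) \<in> borel_measurable (m \<Otimes>\<^sub>M lborel)" by measurable
    show "integrable m (\<lambda>x. \<integral>w. norm (case (x, w) of (v, y) \<Rightarrow> f (y - v) * k v) \<partial>lborel)"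
      using sh(2)[of "\<lambda>y. norm (f y)"] ik by (simp add: norm_mult integrable_norm)
    show "AE x in m. integrable lborel (\<lambda>w. case (x, w) of (v, y) \<Rightarrow> f (y - v) * k v)"
      using sh(1)[OF jf] by (intro AE_I2) simp
  qed
  show "integrable lborel (lconv m k f)"
    using integrable_snd[OF int] by (simp add: lconv_def[abs_def])
  show "(\<integral>y. lconv m k f y \<partial>lborel) = (\<integral>v. k v \<partial>m) * (\<integral>y. f y \<partial>lborel)"
    unfolding lconv_def Fubini_integral[OF int]
    using sh(2)[of f] ik jf by (simp add: mult.commute)
  have int': "integrable (m \<Otimes>\<^sub>M lborel) (\<lambda>(v, y). norm (f (y - v)) * norm (k v))"
    using integrable_norm[OF int] by (simp add: norm_mult case_prod_unfold)
  have "(\<integral>y. norm (lconv m k f y) \<partial>lborel) \<le> (\<integral>y. (\<integral>v. norm (f (y - v)) * norm (k v) \<partial>m) \<partial>lborel)"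
  proof (rule integral_mono)
    show "integrable lborel (\<lambda>y. norm (lconv m k f y))" using \<open>integrable lborel (lconv m k f)\<close> by simp
    show "integrable lborel (\<lambda>y. \<integral>v. norm (f (y - v)) * norm (k v) \<partial>m)" using integrable_snd[OF int'] by simp
    show "norm (lconv m k f y) \<le> (\<integral>v. norm (f (y - v)) * norm (k v) \<partial>m)" for y
      unfolding lconv_def using integral_norm_bound[of m "\<lambda>v. f (y - v) * k v"] by (simp add: norm_mult)
  qed
  also have "\<dots> = (\<integral>v. norm (k v) \<partial>m) * (\<integral>y. norm (f y) \<partial>lborel)"
    unfolding Fubini_integral[OF int'] using sh(2)[of "\<lambda>y. norm (f y)"] by (simp add: mult.commute)
  finally show "(\<integral>y. norm (lconv m k f y) \<partial>lborel) \<le> (\<integral>v. norm (k v) \<partial>m) * (\<integral>y. norm (f y) \<partial>lborel)" .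
qed

lemma lconv_pow_integral:
  fixes k :: "real \<Rightarrow> 'a::{real_normed_field, banach, second_countable_topology}"
  assumes k: "loc_kernel m k" and f: "loc_bdd f"
    and ik: "integrable m k" and jf: "integrable lborel f"
  shows "integrable lborel ((lconv m k ^^ n) f) \<and>
    (\<integral>y. (lconv m k ^^ n) f y \<partial>lborel) = (\<integral>v. k v \<partial>m) ^ n * (\<integral>y. f y \<partial>lborel) \<and>
    (\<integral>y. norm ((lconv m k ^^ n) f y) \<partial>lborel) \<le> (\<integral>v. norm (k v) \<partial>m) ^ n * (\<integral>y. norm (f y) \<partial>lborel)"
proof (induction n)
  case 0 then show ?case using jf by simp
next
  case (Suc n)
  let ?g = "(lconv m k ^^ n) f"
  note * = lconv_integral[OF k loc_bdd_lconv_pow[OF k f] ik, of n]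
  have "(\<integral>y. norm (lconv m k ?g y) \<partial>lborel) \<le> (\<integral>v. norm (k v) \<partial>m) * (\<integral>y. norm (?g y) \<partial>lborel)"
    using *(3) Suc by blast
  also have "\<dots> \<le> (\<integral>v. norm (k v) \<partial>m) * ((\<integral>v. norm (k v) \<partial>m) ^ n * (\<integral>y. norm (f y) \<partial>lborel))"
    using Suc by (intro mult_left_mono) auto
  finally show ?case using *(1,2) Suc by (simp add: mult.assoc)
qed

text \<open>For kernels twisted by \<open>exp (- s * v)\<close> this expresses a Laplace transform
  as the exponential of the transform of the kernel, in the role of an Euler product.\<close>

lemma xconv_integral:
  fixes k :: "real \<Rightarrow> 'a::{real_normed_field, banach, second_countable_topology}"
  assumes k: "loc_kernel m k" and f: "loc_bdd f"
    and ik: "integrable m k" and jf: "integrable lborel f"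
  shows "integrable lborel (xconv m k f)"
    and "(\<integral>y. xconv m k f y \<partial>lborel) = exp (\<integral>v. k v \<partial>m) * (\<integral>y. f y \<partial>lborel)"
proof -
  note P = lconv_pow_integral[OF assms]
  let ?F = "\<lambda>n y. (lconv m k ^^ n) f y /\<^sub>R fact n"
  have int: "integrable lborel (?F n)" for n using P[of n] by simp
  have ae: "AE y in lborel. summable (\<lambda>n. norm (?F n y))"
    by (intro AE_I2 xconv_summable_norm[OF k f])
  have sm: "summable (\<lambda>n. \<integral>y. norm (?F n y) \<partial>lborel)"
  proof (rule summable_comparison_test')
    show "summable (\<lambda>n. ((\<integral>v. norm (k v) \<partial>m) ^ n /\<^sub>R fact n) * (\<integral>y. norm (f y) \<partial>lborel))"
      using summable_exp_real by (rule summable_mult2)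
    show "norm (\<integral>y. norm (?F n y) \<partial>lborel) \<le> ((\<integral>v. norm (k v) \<partial>m) ^ n /\<^sub>R fact n) * (\<integral>y. norm (f y) \<partial>lborel)" for n
      using P[of n] by (simp add: field_simps)
  qed
  show "integrable lborel (xconv m k f)"
    using integrable_suminf[OF int ae sm] by (simp add: xconv_def[abs_def])
  have "(\<integral>y. xconv m k f y \<partial>lborel) = (\<Sum>n. \<integral>y. ?F n y \<partial>lborel)"
    unfolding xconv_def by (rule integral_suminf[OF int ae sm])
  also have "\<dots> = (\<Sum>n. ((\<integral>v. k v \<partial>m) ^ n /\<^sub>R fact n) * (\<integral>y. f y \<partial>lborel))"
    using P by simp
  also have "\<dots> = exp (\<integral>v. k v \<partial>m) * (\<integral>y. f y \<partial>lborel)"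
    by (subst suminf_mult2[OF summable_exp_generic, symmetric]) (simp add: exp_def)
  finally show "(\<integral>y. xconv m k f y \<partial>lborel) = exp (\<integral>v. k v \<partial>m) * (\<integral>y. f y \<partial>lborel)" .
qed

lemma lconv_le:
  fixes b h :: "real \<Rightarrow> real"
  assumes k: "loc_kernel m k" and f: "loc_bdd f" and b: "loc_kernel m b" and h: "loc_bdd h"
    and kb: "\<And>v. norm (k v) \<le> b v" and fh: "\<And>v. v \<le> y \<Longrightarrow> norm (f v) \<le> h v"
  shows "norm (lconv m k f y) \<le> lconv m b h y"
proof -
  have "norm (lconv m k f y) \<le> (\<integral>v. norm (f (y - v) * k v) \<partial>m)"
    unfolding lconv_def by (rule integral_norm_bound)
  also have "\<dots> \<le> (\<integral>v. h (y - v) * b v \<partial>m)"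
  proof (rule integral_mono)
    show "norm (f (y - v) * k v) \<le> h (y - v) * b v" for v
    proof (cases "v < 0")
      case True
      have "0 \<le> b v" using kb[of v] norm_ge_zero order_trans by blast
      moreover have "b v = 0" "k v = 0" using loc_kernelD(4)[OF b True] loc_kernelD(4)[OF k True] by auto
      ultimately show ?thesis by simp
    next
      case False
      then show ?thesis unfolding norm_mult
        using kb[of v] fh[of "y - v"] order_trans[OF norm_ge_zero fh[of "y - v"]]
        by (intro mult_mono) auto
    qed
  qed (use lconv_integrable[OF k f] lconv_integrable[OF b h] in auto)
  finally show ?thesis by (simp add: lconv_def)
qed

lemma lconv_pow_le:
  fixes b h :: "real \<Rightarrow> real"
  assumes k: "loc_kernel m k" and f: "loc_bdd f" and b: "loc_kernel m b" and h: "loc_bdd h"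
    and kb: "\<And>v. norm (k v) \<le> b v" and fh: "\<And>v. norm (f v) \<le> h v"
  shows "norm ((lconv m k ^^ n) f y) \<le> (lconv m b ^^ n) h y"
proof (induction n arbitrary: y)
  case (Suc n)
  show ?case using lconv_le[OF k loc_bdd_lconv_pow[OF k f] b loc_bdd_lconv_pow[OF b h] kb Suc] by simp
qed (use fh in simp)

lemma xconv_le:
  fixes b h :: "real \<Rightarrow> real"
  assumes k: "loc_kernel m k" and f: "loc_bdd f" and b: "loc_kernel m b" and h: "loc_bdd h"
    and kb: "\<And>v. norm (k v) \<le> b v" and fh: "\<And>v. norm (f v) \<le> h v"
  shows "norm (xconv m k f y) \<le> xconv m b h y"
proof -
  have "norm (xconv m k f y) \<le> (\<Sum>n. norm ((lconv m k ^^ n) f y /\<^sub>R fact n))"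
    unfolding xconv_def by (rule summable_norm[OF xconv_summable_norm[OF k f]])
  also have "\<dots> \<le> xconv m b h y"
    unfolding xconv_def
    using lconv_pow_le[OF assms, of _ y] xconv_summable_norm[OF k f, of y] xconv_summable[OF b h, of y]
    by (intro suminf_le) (auto intro!: mult_left_mono)
  finally show ?thesis .
qed

lemma xconv_scaleR:
  assumes "loc_kernel m k" "loc_bdd f"
  shows "xconv m k (\<lambda>y. c *\<^sub>R f y) y = c *\<^sub>R xconv m k f y"
proof -
  have "(lconv m k ^^ n) (\<lambda>y. c *\<^sub>R f y) = (\<lambda>y. c *\<^sub>R (lconv m k ^^ n) f y)" for n
    by (induction n) (auto simp: lconv_scaleR)
  then show ?thesis
    unfolding xconv_def
    by (subst suminf_scaleR_right[OF xconv_summable[OF assms]]) (simp add: mult.commute)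
qed

text \<open>Rankin's trick for convolutions: \<open>exp (\<sigma> * y)\<close> is an eigenfunction
  of convolution with \<open>norm k\<close>, and every convolution costs the same factor, the
  transform of \<open>norm k\<close> at \<open>\<sigma>\<close>.\<close>

lemma xconv_exp_bound:
  fixes k :: "real \<Rightarrow> 'a::{real_normed_field, banach, second_countable_topology}"
  assumes k: "loc_kernel m k" and f: "loc_bdd f"
    and ib: "integrable m (\<lambda>v. exp (- \<sigma> * v) * norm (k v))"
    and fh: "\<And>y. norm (f y) \<le> M * exp (\<sigma> * y)"
  shows "norm (xconv m k f y) \<le> M * exp (\<sigma> * y) * exp (\<integral>v. exp (- \<sigma> * v) * norm (k v) \<partial>m)"
proof -
  let ?I = "\<integral>v. exp (- \<sigma> * v) * norm (k v) \<partial>m"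
  have pw: "norm ((lconv m k ^^ n) f y) \<le> M * exp (\<sigma> * y) * ?I ^ n" for n y
  proof (induction n arbitrary: y)
    case 0 then show ?case using fh by simp
  next
    case (Suc n)
    have "norm (lconv m k ((lconv m k ^^ n) f) y) \<le> (\<integral>v. norm ((lconv m k ^^ n) f (y - v) * k v) \<partial>m)"
      unfolding lconv_def by (rule integral_norm_bound)
    also have "\<dots> \<le> (\<integral>v. (M * exp (\<sigma> * y) * ?I ^ n) * (exp (- \<sigma> * v) * norm (k v)) \<partial>m)"
    proof (rule integral_mono)
      fix v
      have "norm ((lconv m k ^^ n) f (y - v)) * norm (k v) \<le> (M * exp (\<sigma> * (y - v)) * ?I ^ n) * norm (k v)"
        using Suc by (intro mult_right_mono) auto
      also have "exp (\<sigma> * (y - v)) = exp (\<sigma> * y) * exp (- \<sigma> * v)"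
        by (simp add: exp_add[symmetric] algebra_simps)
      finally show "norm ((lconv m k ^^ n) f (y - v) * k v) \<le> (M * exp (\<sigma> * y) * ?I ^ n) * (exp (- \<sigma> * v) * norm (k v))"
        by (simp add: norm_mult mult_ac)
    qed (use lconv_integrable[OF k loc_bdd_lconv_pow[OF k f]] ib in auto)
    also have "\<dots> = M * exp (\<sigma> * y) * ?I ^ Suc n" by simp
    finally show ?case by simp
  qed
  have "norm (xconv m k f y) \<le> (\<Sum>n. norm ((lconv m k ^^ n) f y /\<^sub>R fact n))"
    unfolding xconv_def by (rule summable_norm[OF xconv_summable_norm[OF k f]])
  also have "\<dots> \<le> (\<Sum>n. (M * exp (\<sigma> * y)) * (?I ^ n /\<^sub>R fact n))"
  proof (rule suminf_le)
    show "norm ((lconv m k ^^ n) f y /\<^sub>R fact n) \<le> (M * exp (\<sigma> * y)) * (?I ^ n /\<^sub>R fact n)" for n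
      using pw[of n y] by (simp add: field_simps)
  qed (rule xconv_summable_norm[OF k f], rule summable_mult[OF summable_exp_real])
  also have "\<dots> = M * exp (\<sigma> * y) * exp ?I"
    by (subst suminf_mult[OF summable_exp_real]) (simp only: suminf_exp_real)
  finally show ?thesis .
qed

section \<open>The Plancherel formula\<close>

definition fourier :: "(real \<Rightarrow> complex) \<Rightarrow> real \<Rightarrow> complex" where
  "fourier f t = (\<integral>y. cis (- (t * y)) * f y \<partial>lborel)"

text \<open>Its Fourier transform is the squared modulus of \<open>fourier f\<close>, and its value
  at \<open>0\<close> is the square integral of \<open>f\<close>; the Plancherel formula thus
  becomes Fourier inversion at the single point \<open>0\<close>.\<close>

definition autocorr :: "(real \<Rightarrow> complex) \<Rightarrow> real \<Rightarrow> complex" where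
  "autocorr f u = (\<integral>y. f (y + u) * cnj (f y) \<partial>lborel)"

lemma borel_measurable_cis [measurable]: "cis \<in> borel_measurable borel"
  by (intro borel_measurable_continuous_onI continuous_intros)

lemma borel_measurable_cnj [measurable]: "cnj \<in> borel_measurable borel"
  by (intro borel_measurable_continuous_onI continuous_intros)

lemma integrable_cis_mult:
  fixes f :: "real \<Rightarrow> complex"
  assumes "integrable lborel f" shows "integrable lborel (\<lambda>y. cis (- (t * y)) * f y)"
  by (rule Bochner_Integration.integrable_bound[OF assms]) (use assms in \<open>auto simp: norm_mult\<close>)

lemma autocorr_integrable_pair:
  fixes f :: "real \<Rightarrow> complex"
  assumes f: "integrable lborel f"
  shows "integrable (lborel \<Otimes>\<^sub>M lborel) (\<lambda>(u, y). f (y + u) * cnj (f y))"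
proof -
  have [measurable]: "f \<in> borel_measurable borel" using f by auto
  have "integrable (lborel \<Otimes>\<^sub>M lborel) (\<lambda>(y, u). f (y + u) * cnj (f y))"
  proof (rule lborel_pair.Fubini_integrable)
    show "integrable lborel (\<lambda>y. \<integral>u. norm (case (y, u) of (y, u) \<Rightarrow> f (y + u) * cnj (f y)) \<partial>lborel)"
    proof -
      have "(\<integral>u. norm (f (y + u)) \<partial>lborel) = (\<integral>u. norm (f u) \<partial>lborel)" for y
        using integral_lborel_shift[of "\<lambda>u. norm (f u)" "-y"] by (simp add: add.commute)
      then show ?thesis using f by (simp add: norm_mult)
    qed
    show "AE y in lborel. integrable lborel (\<lambda>u. case (y, u) of (y, u) \<Rightarrow> f (y + u) * cnj (f y))"
      using integrable_lborel_shift[OF f, of "- y" for y] by (intro AE_I2) (simp add: add.commute)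
  qed measurable
  then show ?thesis by (subst lborel_pair.integrable_product_swap_iff[symmetric]) (simp add: case_prod_unfold)
qed

lemma autocorr_integrable:
  assumes f: "integrable lborel f"
  shows "integrable lborel (autocorr f)"
  using lborel_pair.integrable_fst[OF autocorr_integrable_pair[OF f]] by (simp add: autocorr_def[abs_def])

lemma autocorr_integral:
  assumes f: "integrable lborel f"
  shows "(\<integral>u. autocorr f u \<partial>lborel) = (\<integral>y. f y \<partial>lborel) * cnj (\<integral>y. f y \<partial>lborel)"
proof -
  have "(\<integral>u. autocorr f u \<partial>lborel) = (\<integral>y. (\<integral>u. f (y + u) * cnj (f y) \<partial>lborel) \<partial>lborel)"
    unfolding autocorr_def using lborel_pair.Fubini_integral[OF autocorr_integrable_pair[OF f]] by simp
  also have "(\<lambda>y. \<integral>u. f (y + u) * cnj (f y) \<partial>lborel) = (\<lambda>y. (\<integral>u. f u \<partial>lborel) * cnj (f y))"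
    using integral_lborel_shift[of f "-y" for y] by (simp add: add.commute)
  finally show ?thesis by simp
qed

text \<open>The integral of an autocorrelation is the squared modulus of the integral of the
  function. This is applied to \<open>f\<close> modulated by a character, which multiplies the
  autocorrelation by the same character.\<close>

lemma fourier_norm_sq:
  assumes f: "integrable lborel f"
  shows "complex_of_real ((norm (fourier f t))\<^sup>2) = (\<integral>u. cis (- (t * u)) * autocorr f u \<partial>lborel)"
proof -
  let ?g = "\<lambda>y. cis (- (t * y)) * f y"
  have "autocorr ?g u = cis (- (t * u)) * autocorr f u" for u
  proof -
    have "cis (- (t * (y + u))) * f (y + u) * cnj (cis (- (t * y)) * f y) = cis (- (t * u)) * (f (y + u) * cnj (f y))" for y
    proof -
      have "cis (- (t * (y + u))) * cnj (cis (- (t * y))) = cis (- (t * u))"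
        by (simp add: cis_cnj cis_mult algebra_simps)
      then have "f (y + u) * cnj (f y) * (cis (- (t * (y + u))) * cnj (cis (- (t * y)))) = f (y + u) * cnj (f y) * cis (- (t * u))"
        by (simp only:)
      then show ?thesis by (simp only: complex_cnj_mult mult_ac)
    qed
    then show ?thesis unfolding autocorr_def by (simp only: integral_mult_right_zero)
  qed
  then show ?thesis
    using autocorr_integral[OF integrable_cis_mult[OF f, of t]]
    by (simp add: fourier_def complex_norm_square del: of_real_power)
qed

lemma integrable_times_pair:
  fixes a b :: "real \<Rightarrow> 'a::{real_normed_field, banach, second_countable_topology}"
  assumes a: "integrable lborel a" and b: "integrable lborel b"
  shows "integrable (lborel \<Otimes>\<^sub>M lborel) (\<lambda>(x, y). a x * b y)"
proof -
  have [measurable]: "a \<in> borel_measurable borel" "b \<in> borel_measurable borel" using a b by auto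
  show ?thesis
    by (rule lborel_pair.Fubini_integrable) (use a b in \<open>auto simp: norm_mult intro!: AE_I2\<close>)
qed

text \<open>The Fourier transform of \<open>exp (- t^2 / 2)\<close>. Its mass \<open>2 * pi\<close>
  is where the constant of the Plancherel formula comes from.\<close>

definition gauss :: "real \<Rightarrow> real" where "gauss w = sqrt (2 * pi) * exp (- w\<^sup>2 / 2)"

lemma gauss_eq: "gauss w = 2 * pi * std_normal_density w"
proof -
  have "sqrt (2 * pi) * sqrt (2 * pi) = 2 * pi" by simp
  then show ?thesis
    by (simp add: gauss_def std_normal_density_def field_simps)
qed

lemma gauss_integrable: "integrable lborel gauss"
  unfolding gauss_eq[abs_def] using integrable_normal_density[of 1 0] by simp

lemma gauss_integral: "(\<integral>w. gauss w \<partial>lborel) = 2 * pi"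
  unfolding gauss_eq using integral_normal_density[of 1 0] by simp

lemma gauss_nonneg: "0 \<le> gauss w" by (simp add: gauss_def)

lemma gauss_measurable [measurable]: "gauss \<in> borel_measurable borel"
  using gauss_integrable by auto

text \<open>The characteristic function of the standard normal distribution, rescaled by
  \<open>e\<close>.\<close>

lemma gauss_fourier:
  assumes e: "0 < e"
  shows "(\<integral>t. complex_of_real (exp (- (e * t)\<^sup>2 / 2)) * cis (- (t * u)) \<partial>lborel) = complex_of_real (gauss (u / e) / e)"
proof -
  have "exp (- ((- u / e)\<^sup>2) / 2) = (CLINT x|std_normal_distribution. iexp ((- u / e) * x))"
    using fun_cong[OF char_std_normal_distribution, of "- u / e"] by (simp add: char_def)
  also have "\<dots> = (\<integral>x. std_normal_density x *\<^sub>R iexp ((- u / e) * x) \<partial>lborel)"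
    by (subst integral_density) (auto simp: normal_density_nonneg)
  also have "\<dots> = \<bar>e\<bar> *\<^sub>R (\<integral>t. std_normal_density (0 + e * t) *\<^sub>R iexp ((- u / e) * (0 + e * t)) \<partial>lborel)"
    using e by (subst lborel_integral_real_affine[of e _ 0]) auto
  also have "(\<lambda>t. std_normal_density (0 + e * t) *\<^sub>R iexp ((- u / e) * (0 + e * t)))
     = (\<lambda>t. complex_of_real (1 / sqrt (2 * pi)) * (complex_of_real (exp (- (e * t)\<^sup>2 / 2)) * cis (- (t * u))))"
    using e by (auto simp: fun_eq_iff std_normal_density_def cis_conv_exp scaleR_conv_of_real mult.commute)
  finally have "exp (- (u / e)\<^sup>2 / 2) = complex_of_real (e / sqrt (2 * pi)) * (\<integral>t. complex_of_real (exp (- (e * t)\<^sup>2 / 2)) * cis (- (t * u)) \<partial>lborel)"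
    using e by (simp add: scaleR_conv_of_real)
  then show ?thesis using e by (simp add: gauss_def field_simps)
qed

lemma gaussian_integrable:
  assumes e: "0 < e" shows "integrable lborel (\<lambda>t::real. exp (- (e * t)\<^sup>2 / 2))"
proof -
  have "integrable lborel (\<lambda>t. gauss (0 + e * t) / sqrt (2 * pi))"
    using lborel_integrable_real_affine[OF gauss_integrable, of e 0] e by (intro integrable_divide) auto
  then show ?thesis by (simp add: gauss_def)
qed

lemma fourier_measurable [measurable]:
  assumes f [measurable]: "f \<in> borel_measurable borel"
  shows "fourier f \<in> borel_measurable borel"
  unfolding fourier_def[abs_def] by measurable

text \<open>The Gaussian factor makes the double integral over \<open>u\<close> and \<open>t\<close>
  absolutely convergent, so Fubini moves the Fourier transform from the autocorrelation onto the
  Gaussian; the substitution \<open>u = e * w\<close> then concentrates it at the origin.\<close>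

lemma fourier_gauss:
  assumes f: "integrable lborel f" and e: "0 < e"
  shows "integrable lborel (\<lambda>t. (norm (fourier f t))\<^sup>2 * exp (- (e * t)\<^sup>2 / 2))"
    and "complex_of_real (\<integral>t. (norm (fourier f t))\<^sup>2 * exp (- (e * t)\<^sup>2 / 2) \<partial>lborel)
      = (\<integral>w. gauss w *\<^sub>R autocorr f (e * w) \<partial>lborel)"
proof -
  have [measurable]: "f \<in> borel_measurable borel" using f by auto
  have [measurable]: "autocorr f \<in> borel_measurable borel" using autocorr_integrable[OF f] by auto
  let ?g = "\<lambda>t::real. complex_of_real (exp (- (e * t)\<^sup>2 / 2))"
  have g: "integrable lborel ?g" using gaussian_integrable[OF e] by auto
  have int: "integrable (lborel \<Otimes>\<^sub>M lborel) (\<lambda>(u, t). autocorr f u * (?g t * cis (- (t * u))))"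
    by (rule Bochner_Integration.integrable_bound[OF integrable_times_pair[OF autocorr_integrable[OF f] g]])
       (auto simp: norm_mult)
  have eq: "(\<integral>u. autocorr f u * (?g t * cis (- (t * u))) \<partial>lborel) = complex_of_real ((norm (fourier f t))\<^sup>2 * exp (- (e * t)\<^sup>2 / 2))" for t
  proof -
    have "(\<integral>u. autocorr f u * (?g t * cis (- (t * u))) \<partial>lborel) = (\<integral>u. ?g t * (cis (- (t * u)) * autocorr f u) \<partial>lborel)"
      by (simp add: mult_ac)
    also have "\<dots> = ?g t * complex_of_real ((norm (fourier f t))\<^sup>2)"
      unfolding fourier_norm_sq[OF f] by (rule integral_mult_right_zero)
    finally show ?thesis by simp
  qed
  have "integrable lborel (\<lambda>t. complex_of_real ((norm (fourier f t))\<^sup>2 * exp (- (e * t)\<^sup>2 / 2)))"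
    using lborel_pair.integrable_snd[OF int] by (simp only: eq)
  then show "integrable lborel (\<lambda>t. (norm (fourier f t))\<^sup>2 * exp (- (e * t)\<^sup>2 / 2))"
    by (simp only: complex_of_real_integrable_eq)
  have "complex_of_real (\<integral>t. (norm (fourier f t))\<^sup>2 * exp (- (e * t)\<^sup>2 / 2) \<partial>lborel)
     = (\<integral>t. (\<integral>u. autocorr f u * (?g t * cis (- (t * u))) \<partial>lborel) \<partial>lborel)"
    unfolding eq by (rule integral_complex_of_real[symmetric])
  also have "\<dots> = (\<integral>u. (\<integral>t. autocorr f u * (?g t * cis (- (t * u))) \<partial>lborel) \<partial>lborel)"
    by (rule lborel_pair.Fubini_integral[OF int])
  also have "\<dots> = (\<integral>u. autocorr f u * complex_of_real (gauss (u / e) / e) \<partial>lborel)"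
    using gauss_fourier[OF e] by (simp only: integral_mult_right_zero)
  also have "\<dots> = \<bar>e\<bar> *\<^sub>R (\<integral>w. autocorr f (0 + e * w) * complex_of_real (gauss ((0 + e * w) / e) / e) \<partial>lborel)"
    using e by (intro lborel_integral_real_affine) auto
  also have "\<dots> = (\<integral>w. gauss w *\<^sub>R autocorr f (e * w) \<partial>lborel)"
    using e by (subst integral_scaleR_right[symmetric]) (simp add: scaleR_conv_of_real mult_ac)
  finally show "complex_of_real (\<integral>t. (norm (fourier f t))\<^sup>2 * exp (- (e * t)\<^sup>2 / 2) \<partial>lborel)
      = (\<integral>w. gauss w *\<^sub>R autocorr f (e * w) \<partial>lborel)" .
qed

lemma autocorr_norm_le:
  assumes f: "f \<in> borel_measurable borel" and f2: "integrable lborel (\<lambda>y. (norm (f y))\<^sup>2)"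
  shows "norm (autocorr f u) \<le> (\<integral>y. (norm (f y))\<^sup>2 \<partial>lborel)"
proof -
  note [measurable] = f
  have sh: "integrable lborel (\<lambda>y. (norm (f (y + u)))\<^sup>2)"
    using integrable_lborel_shift[OF f2, of "-u"] by simp
  have le: "norm (f (y + u) * cnj (f y)) \<le> ((norm (f (y + u)))\<^sup>2 + (norm (f y))\<^sup>2) / 2" for y
    using sum_squares_bound[of "norm (f (y + u))" "norm (f y)"] by (simp add: norm_mult)
  have int: "integrable lborel (\<lambda>y. ((norm (f (y + u)))\<^sup>2 + (norm (f y))\<^sup>2) / 2)"
    using sh f2 by (intro integrable_divide Bochner_Integration.integrable_add)
  have "norm (autocorr f u) \<le> (\<integral>y. norm (f (y + u) * cnj (f y)) \<partial>lborel)"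
    unfolding autocorr_def by (rule integral_norm_bound)
  also have "\<dots> \<le> (\<integral>y. ((norm (f (y + u)))\<^sup>2 + (norm (f y))\<^sup>2) / 2 \<partial>lborel)"
    by (rule integral_mono'[OF int le]) auto
  also have "\<dots> = ((\<integral>y. (norm (f (y + u)))\<^sup>2 \<partial>lborel) + (\<integral>y. (norm (f y))\<^sup>2 \<partial>lborel)) / 2"
    by (simp only: integral_divide_zero Bochner_Integration.integral_add[OF sh f2])
  also have "(\<integral>y. (norm (f (y + u)))\<^sup>2 \<partial>lborel) = (\<integral>y. (norm (f y))\<^sup>2 \<partial>lborel)"
    using integral_lborel_shift[of "\<lambda>y. (norm (f y))\<^sup>2" "-u"] by simp
  finally show ?thesis by simp
qed

text \<open>An inequality that holds without continuity, as needed for \<open>\<gamma>1\<close> and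
  \<open>\<gamma>34\<close>, which may jump. The damped integrals increase as the Gaussian widens
  and are bounded because the autocorrelation never exceeds the square integral; monotone
  convergence concludes.\<close>

lemma fourier_L2:
  assumes f: "integrable lborel f" and f2: "integrable lborel (\<lambda>y. (norm (f y))\<^sup>2)"
  shows "integrable lborel (\<lambda>t. (norm (fourier f t))\<^sup>2)"
    and "(\<integral>t. (norm (fourier f t))\<^sup>2 \<partial>lborel) \<le> 2 * pi * (\<integral>y. (norm (f y))\<^sup>2 \<partial>lborel)"
    and "(\<lambda>n. \<integral>t. (norm (fourier f t))\<^sup>2 * exp (- (1 / real (Suc n) * t)\<^sup>2 / 2) \<partial>lborel)
      \<longlonglongrightarrow> (\<integral>t. (norm (fourier f t))\<^sup>2 \<partial>lborel)"
proof -
  have [measurable]: "f \<in> borel_measurable borel" using f by auto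
  let ?F = "\<lambda>n t. (norm (fourier f t))\<^sup>2 * exp (- (1 / real (Suc n) * t)\<^sup>2 / 2)"
  let ?I = "\<lambda>n. \<integral>t. ?F n t \<partial>lborel"
  let ?C = "2 * pi * (\<integral>y. (norm (f y))\<^sup>2 \<partial>lborel)"
  have int: "integrable lborel (?F n)" for n using fourier_gauss(1)[OF f, of "1 / real (Suc n)"] by simp
  have bd: "?I n \<le> ?C" for n
  proof -
    have "0 \<le> ?I n" by (rule integral_nonneg_AE) auto
    then have "?I n = norm (complex_of_real (?I n))" by simp
    also have "complex_of_real (?I n) = (\<integral>w. gauss w *\<^sub>R autocorr f (1 / real (Suc n) * w) \<partial>lborel)"
      by (rule fourier_gauss(2)[OF f]) simp
    also have "norm \<dots> \<le> (\<integral>w. norm (gauss w *\<^sub>R autocorr f (1 / real (Suc n) * w)) \<partial>lborel)"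
      by (rule integral_norm_bound)
    also have "\<dots> \<le> (\<integral>w. gauss w * (\<integral>y. (norm (f y))\<^sup>2 \<partial>lborel) \<partial>lborel)"
      using autocorr_norm_le[OF _ f2] gauss_nonneg gauss_integrable
      by (intro integral_mono') (auto intro!: mult_left_mono)
    also have "\<dots> = ?C" by (simp add: gauss_integral)
    finally show ?thesis .
  qed
  have "mono (\<lambda>n. ?F n t)" for t
  proof (rule monoI)
    fix m n :: nat assume "m \<le> n"
    have "(1 / real (Suc n) * t)\<^sup>2 \<le> (1 / real (Suc m) * t)\<^sup>2"
      using \<open>m \<le> n\<close> unfolding power_mult_distrib
      by (intro mult_right_mono power_mono) (auto simp: field_simps)
    then show "?F m t \<le> ?F n t" by (intro mult_left_mono) auto
  qed
  then have mono: "AE t in lborel. mono (\<lambda>n. ?F n t)" by simp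
  have "(\<lambda>n. ?F n t) \<longlonglongrightarrow> (norm (fourier f t))\<^sup>2 * exp (- (0 * t)\<^sup>2 / 2)" for t
    by (intro tendsto_intros LIMSEQ_Suc[OF lim_1_over_n, simplified] tendsto_cong[THEN iffD1, rotated, OF LIMSEQ_inverse_real_of_nat]) (auto simp: inverse_eq_divide)
  then have lim: "AE t in lborel. (\<lambda>n. ?F n t) \<longlonglongrightarrow> (norm (fourier f t))\<^sup>2" by simp
  have "incseq ?I"
  proof (rule incseq_SucI)
    show "?I n \<le> ?I (Suc n)" for n
      using monoD[OF \<open>\<And>t. mono (\<lambda>n. ?F n t)\<close>, of n "Suc n"] by (intro integral_mono int) auto
  qed
  then obtain L where L: "?I \<longlonglongrightarrow> L" using incseq_convergent[of ?I ?C] bd by blast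
  note * = integrable_monotone_convergence[OF int mono lim L] integral_monotone_convergence[OF int mono lim L]
  show "integrable lborel (\<lambda>t. (norm (fourier f t))\<^sup>2)" using * by simp
  have LI: "(\<integral>t. (norm (fourier f t))\<^sup>2 \<partial>lborel) = L" using * by simp
  show "?I \<longlonglongrightarrow> (\<integral>t. (norm (fourier f t))\<^sup>2 \<partial>lborel)" using L LI by simp
  show "(\<integral>t. (norm (fourier f t))\<^sup>2 \<partial>lborel) \<le> ?C"
    unfolding LI using L bd by (intro LIMSEQ_le_const2) auto
qed

lemma bounded_integrable_square:
  fixes f :: "real \<Rightarrow> complex"
  assumes f: "integrable lborel f" and M: "\<And>y. norm (f y) \<le> M"
  shows "integrable lborel (\<lambda>y. (norm (f y))\<^sup>2)"
proof (rule Bochner_Integration.integrable_bound)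
  have [measurable]: "f \<in> borel_measurable borel" using f by auto
  show "(\<lambda>y. (norm (f y))\<^sup>2) \<in> borel_measurable lborel" by measurable
  show "integrable lborel (\<lambda>y. M * norm (f y))" using f by auto
  show "AE y in lborel. norm ((norm (f y))\<^sup>2) \<le> norm (M * norm (f y))"
    using M by (intro AE_I2) (auto simp: power2_eq_square abs_mult intro!: mult_right_mono order_trans[OF M abs_ge_self])
qed

text \<open>Continuity of \<open>f\<close> makes the autocorrelation at \<open>e * w\<close>
  converge to its value at \<open>0\<close>, so the limit of the damped integrals can be evaluated
  exactly.\<close>

lemma plancherel:
  assumes f: "integrable lborel f" and M: "\<And>y. norm (f y) \<le> M" and cont: "continuous_on UNIV f"
  shows "(\<integral>t. (norm (fourier f t))\<^sup>2 \<partial>lborel) = 2 * pi * (\<integral>y. (norm (f y))\<^sup>2 \<partial>lborel)"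
proof -
  have [measurable]: "f \<in> borel_measurable borel" using f by auto
  have [measurable]: "autocorr f \<in> borel_measurable borel" using autocorr_integrable[OF f] by auto
  note f2 = bounded_integrable_square[OF f M]
  have A0: "autocorr f 0 = complex_of_real (\<integral>y. (norm (f y))\<^sup>2 \<partial>lborel)"
  proof -
    have "autocorr f 0 = (\<integral>y. complex_of_real ((norm (f y))\<^sup>2) \<partial>lborel)"
      unfolding autocorr_def by (simp only: complex_norm_square add_0_right)
    then show ?thesis by (simp only: integral_complex_of_real)
  qed
  have e0: "(\<lambda>n. 1 / real (Suc n)) \<longlonglongrightarrow> 0"
    using LIMSEQ_inverse_real_of_nat by (simp add: inverse_eq_divide)
  have A: "(\<lambda>n. autocorr f (1 / real (Suc n) * w)) \<longlonglongrightarrow> autocorr f 0" for w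
    unfolding autocorr_def
  proof (rule integral_dominated_convergence)
    show "integrable lborel (\<lambda>y. M * norm (f y))" using f by auto
    show "AE y in lborel. (\<lambda>n. f (y + 1 / real (Suc n) * w) * cnj (f y)) \<longlonglongrightarrow> f (y + 0) * cnj (f y)"
    proof (rule AE_I2)
      fix y
      have "(\<lambda>n. y + 1 / real (Suc n) * w) \<longlonglongrightarrow> y + 0 * w" by (intro tendsto_intros e0)
      then have "(\<lambda>n. f (y + 1 / real (Suc n) * w)) \<longlonglongrightarrow> f (y + 0)"
        using cont by (intro continuous_on_tendsto_compose[OF cont]) auto
      then show "(\<lambda>n. f (y + 1 / real (Suc n) * w) * cnj (f y)) \<longlonglongrightarrow> f (y + 0) * cnj (f y)"
        by (intro tendsto_intros)
    qed
    show "AE y in lborel. norm (f (y + 1 / real (Suc n) * w) * cnj (f y)) \<le> M * norm (f y)" for n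
      using M by (intro AE_I2) (auto simp: norm_mult intro!: mult_right_mono)
  qed measurable
  have "(\<lambda>n. \<integral>w. gauss w *\<^sub>R autocorr f (1 / real (Suc n) * w) \<partial>lborel) \<longlonglongrightarrow> (\<integral>w. gauss w *\<^sub>R autocorr f 0 \<partial>lborel)"
  proof (rule integral_dominated_convergence)
    show "integrable lborel (\<lambda>w. gauss w * (\<integral>y. (norm (f y))\<^sup>2 \<partial>lborel))" using gauss_integrable by auto
    show "AE w in lborel. (\<lambda>n. gauss w *\<^sub>R autocorr f (1 / real (Suc n) * w)) \<longlonglongrightarrow> gauss w *\<^sub>R autocorr f 0"
      by (intro AE_I2 tendsto_intros A)
    show "AE w in lborel. norm (gauss w *\<^sub>R autocorr f (1 / real (Suc n) * w)) \<le> gauss w * (\<integral>y. (norm (f y))\<^sup>2 \<partial>lborel)" for n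
      using autocorr_norm_le[OF _ f2] gauss_nonneg by (auto intro!: mult_left_mono)
  qed measurable
  also have "(\<integral>w. gauss w *\<^sub>R autocorr f 0 \<partial>lborel) = complex_of_real (2 * pi * (\<integral>y. (norm (f y))\<^sup>2 \<partial>lborel))"
    using gauss_integrable by (simp add: A0 gauss_integral scaleR_conv_of_real)
  finally have "(\<lambda>n. complex_of_real (\<integral>t. (norm (fourier f t))\<^sup>2 * exp (- (1 / real (Suc n) * t)\<^sup>2 / 2) \<partial>lborel))
    \<longlonglongrightarrow> complex_of_real (2 * pi * (\<integral>y. (norm (f y))\<^sup>2 \<partial>lborel))"
    by (subst fourier_gauss(2)[OF f]) auto
  then have "(\<lambda>n. \<integral>t. (norm (fourier f t))\<^sup>2 * exp (- (1 / real (Suc n) * t)\<^sup>2 / 2) \<partial>lborel)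
    \<longlonglongrightarrow> 2 * pi * (\<integral>y. (norm (f y))\<^sup>2 \<partial>lborel)"
    by (simp only: tendsto_of_real_iff)
  from LIMSEQ_unique[OF fourier_L2(3)[OF f f2] this] show ?thesis .
qed

text \<open>Plancherel gives vanishing almost everywhere; the zero set is closed and of full
  measure, hence everything. This serves as the uniqueness theorem for Laplace transforms.\<close>

lemma fourier_zero_imp_zero:
  assumes f: "integrable lborel f" and M: "\<And>y. norm (f y) \<le> M" and cont: "continuous_on UNIV f"
    and z: "\<And>t. fourier f t = 0"
  shows "f y = 0"
proof -
  note f2 = bounded_integrable_square[OF f M]
  have "(\<integral>y. (norm (f y))\<^sup>2 \<partial>lborel) = 0" using plancherel[OF f M cont] z by simp
  then have "AE y in lborel. f y = 0"
    using integral_nonneg_eq_0_iff_AE[OF f2] by simp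
  then have "f = (\<lambda>_. 0)"
    proof (intro ext)
    fix x
    have "closed {x. f x = 0}" using cont by (intro closed_Collect_eq) auto
    moreover have "AE x in lebesgue. x \<in> {x. f x = 0}" using \<open>AE y in lborel. f y = 0\<close> by (auto intro: AE_completion)
    ultimately show "f x = 0" using mem_closed_if_AE_lebesgue by blast
  qed
  then show ?thesis by simp
qed

section \<open>Exponential kernels\<close>

text \<open>The unit step for \<open>b = 0\<close>, and in general the function with transform
  \<open>1 / (b + s)\<close>. After the normalizing factor \<open>exp (- \<beta> * y)\<close>,
  convolution with \<open>edk \<beta>\<close> is the passage from \<open>G\<close> to the integral
  of \<open>G u / u\<close>.\<close>

definition edk :: "'a \<Rightarrow> real \<Rightarrow> 'a::{real_normed_field, banach, second_countable_topology}" where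
  "edk b y = indicator {0..} y *\<^sub>R exp (- b * of_real y)"

lemma edk_neg: "y < 0 \<Longrightarrow> edk b y = 0"
  and edk_nonneg: "0 \<le> y \<Longrightarrow> edk b y = exp (- b * of_real y)"
  by (auto simp: edk_def)

lemma loc_bdd_indicator: "loc_bdd (\<lambda>y. indicator {0..} y *\<^sub>R (1::'a::{real_normed_field, banach, second_countable_topology}))"
  by (rule loc_bddI) (auto intro!: exI[of _ 1] simp: indicator_def)

lemma continuous_on_exp_of_real: "continuous_on UNIV (\<lambda>y. exp (- b * of_real y :: 'a::{real_normed_field, banach}))"
  by (intro continuous_intros)

lemma loc_bdd_edk: "loc_bdd (edk b)"
  using loc_bdd_mult_ctns[OF loc_bdd_indicator continuous_on_exp_of_real, of b]
  by (simp add: edk_def[abs_def])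

lemma loc_kernel_lborel:
  assumes f: "loc_bdd f" shows "loc_kernel lborel f"
proof -
  note [measurable] = loc_bddD(1)[OF f]
  have "integrable lborel (\<lambda>v. indicator {..y} v *\<^sub>R f v)" for y
  proof -
    obtain M where M: "\<And>x. x \<le> y \<Longrightarrow> norm (f x) \<le> M" "0 \<le> M" using loc_bddE[OF f] by metis
    have "integrable lborel (\<lambda>v. indicator {0..y} v *\<^sub>R M)"
      by (intro integrable_scaleR_left integrable_real_indicator) (auto simp: emeasure_lborel_Icc_eq)
    then show ?thesis
      by (rule Bochner_Integration.integrable_bound)
         (use M loc_bddD(2)[OF f] in \<open>auto simp: indicator_def not_le\<close>)
  qed
  then show ?thesis
    using loc_bddD[OF f] lborel.sigma_finite_measure_axioms by (auto simp: loc_kernel_def)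
qed

lemma lconv_lborel_sym: "lconv lborel k f = lconv lborel f k"
proof
  fix y
  show "lconv lborel k f y = lconv lborel f k y"
    unfolding lconv_def
    by (subst lborel_integral_real_affine[of "-1" _ y]) (simp_all add: mult.commute[of "k _"])
qed

lemma edk_conv_self: "lconv lborel (edk b) (edk b) y = y *\<^sub>R edk b y"
proof (cases "y < 0")
  case True
  then show ?thesis
    using loc_bddD(2)[OF loc_bdd_lconv[OF loc_kernel_lborel[OF loc_bdd_edk] loc_bdd_edk] True, of b b] by (simp add: edk_neg)
next
  case False
  have "edk b (y - v) * edk b v = indicator {0..y} v *\<^sub>R edk b y" for v
    using False by (auto simp: edk_def indicator_def exp_add[symmetric] algebra_simps)
  then show ?thesis using False by (simp add: lconv_def)
qed

text \<open>The derivation rule applied to \<open>edk b\<close> convolved with itself yields two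
  equal terms with sum \<open>y^2 * edk b y\<close>, so no integral has to be computed.\<close>

lemma edk_conv_times_id:
  "lconv lborel (edk b) (\<lambda>y. y *\<^sub>R edk b y) y = (y\<^sup>2 / 2) *\<^sub>R edk b y"
proof -
  let ?r = "\<lambda>y. y *\<^sub>R edk b y"
  note k = loc_kernel_lborel[OF loc_bdd_edk, of b]
  have "y *\<^sub>R ?r y = lconv lborel (edk b) ?r y + lconv lborel ?r (edk b) y"
    using lconv_times_id[OF k loc_bdd_edk, of y b] by (simp only: edk_conv_self)
  also have "lconv lborel ?r (edk b) = lconv lborel (edk b) ?r" by (rule lconv_lborel_sym)
  finally have "2 *\<^sub>R lconv lborel (edk b) ?r y = (y * y) *\<^sub>R edk b y" by (simp add: scaleR_2)
  then have "(1 / 2) *\<^sub>R (2 *\<^sub>R lconv lborel (edk b) ?r y) = (1 / 2) *\<^sub>R ((y * y) *\<^sub>R edk b y)" by (simp only:)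
  then show ?thesis by (simp add: power2_eq_square)
qed

lemma integral_exp_interval:
  fixes b :: complex
  assumes "0 \<le> y" "b \<noteq> 0"
  shows "(\<integral>v. indicator {0..y} v *\<^sub>R exp (- b * of_real v) \<partial>lborel) = (1 - exp (- b * of_real y)) / b"
proof -
  have "(\<integral>v. indicator {0..y} v *\<^sub>R exp (- b * of_real v) \<partial>lborel)
      = (\<lambda>v. - exp (- b * of_real v) / b) y - (\<lambda>v. - exp (- b * of_real v) / b) 0"
  proof (rule integral_FTC_atLeastAtMost[OF assms(1)])
    fix x assume "0 \<le> x" "x \<le> y"
    show "((\<lambda>v. - exp (- b * of_real v) / b) has_vector_derivative exp (- b * of_real x)) (at x within {0..y})"
      using assms(2)
      by (auto intro!: derivative_eq_intros has_vector_derivative_real_field)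
  qed (auto intro!: continuous_intros)
  then show ?thesis by (simp add: diff_divide_distrib)
qed

lemma norm_exp_le_1: "0 \<le> Re s \<Longrightarrow> 0 \<le> y \<Longrightarrow> norm (exp (- s * complex_of_real y)) \<le> 1"
  by simp

lemma norm_edk: "norm (edk b y) = edk (Re b) y"
  by (auto simp: edk_def indicator_def)

lemma edk_real_nonneg: "0 \<le> edk (a::real) y" by (auto simp: edk_def)

lemma edk_integrable_real:
  assumes "0 < (a::real)" shows "integrable lborel (edk a)"
proof -
  have "integrable lborel (\<lambda>y. exponential_density a y / a)"
  proof -
    interpret prob_space "density lborel (exponential_density a)" by (rule prob_space_exponential_density[OF assms])
    have "(\<integral>\<^sup>+y. ennreal (exponential_density a y) \<partial>lborel) = 1"
      using emeasure_space_1 by (simp add: emeasure_density)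
    then have "integrable lborel (exponential_density a)"
      using exponential_density_nonneg[OF assms] by (intro integrableI_nonneg) auto
    then show ?thesis by simp
  qed
  moreover have "exponential_density a y / a = edk a y" for y
    using assms by (auto simp: exponential_density_def edk_def indicator_def)
  ultimately show ?thesis by simp
qed

lemma edk_integral:
  assumes b: "0 < Re b"
  shows "integrable lborel (edk b)" "(\<integral>y. edk b y \<partial>lborel) = 1 / b"
proof -
  have [measurable]: "edk b \<in> borel_measurable borel" by (rule loc_bddD(1)[OF loc_bdd_edk])
  show i: "integrable lborel (edk b)"
    by (rule Bochner_Integration.integrable_bound[OF edk_integrable_real[OF b]]) (auto simp: norm_edk)
  have "(\<lambda>n. \<integral>v. indicator {0..real n} v *\<^sub>R exp (- b * of_real v) \<partial>lborel) \<longlonglongrightarrow> (\<integral>y. edk b y \<partial>lborel)"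
  proof (rule integral_dominated_convergence)
    show "integrable lborel (edk (Re b))" using edk_integrable_real[OF b] .
    show "AE v in lborel. norm (indicator {0..real n} v *\<^sub>R exp (- b * of_real v)) \<le> edk (Re b) v" for n
      by (intro AE_I2) (auto simp: edk_def indicator_def)
    show "AE v in lborel. (\<lambda>n. indicator {0..real n} v *\<^sub>R exp (- b * of_real v)) \<longlonglongrightarrow> edk b v"
    proof (rule AE_I2)
      fix v :: real
      have "\<forall>\<^sub>F n in sequentially. indicator {0..real n} v *\<^sub>R exp (- b * of_real v) = edk b v"
        using eventually_ge_at_top[of "nat \<lceil>v\<rceil>"]
      proof eventually_elim
        case (elim n)
        then have "v \<le> real n" by linarith
        then show ?case by (auto simp: edk_def indicator_def)
      qed
      then show "(\<lambda>n. indicator {0..real n} v *\<^sub>R exp (- b * of_real v)) \<longlonglongrightarrow> edk b v"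
        by (rule tendsto_eventually)
    qed
  qed measurable
  moreover have "(\<lambda>n. (1 - exp (- b * of_real (real n))) / b) \<longlonglongrightarrow> (1 - 0) / b"
  proof (intro tendsto_intros)
    have "(\<lambda>n. exp (- Re b * real n)) \<longlonglongrightarrow> 0"
      using b by real_asymp
    then have "(\<lambda>n. norm (exp (- b * of_real (real n)))) \<longlonglongrightarrow> 0" by simp
    then show "(\<lambda>n. exp (- b * of_real (real n))) \<longlonglongrightarrow> 0" by (rule tendsto_norm_zero_cancel)
  qed (use b in auto)
  moreover have "(\<integral>v. indicator {0..real n} v *\<^sub>R exp (- b * of_real v) \<partial>lborel) = (1 - exp (- b * of_real (real n))) / b" for n
    using b by (intro integral_exp_interval) auto
  ultimately show "(\<integral>y. edk b y \<partial>lborel) = 1 / b"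
    by (auto dest: LIMSEQ_unique)
qed

lemma edk_integral_real:
  assumes "0 < (a::real)" shows "(\<integral>y. edk a y \<partial>lborel) = 1 / a"
proof -
  have "edk (complex_of_real a) y = complex_of_real (edk a y)" for y
    by (simp add: edk_def scaleR_conv_of_real exp_of_real[symmetric])
  then have "complex_of_real (\<integral>y. edk a y \<partial>lborel) = complex_of_real (1 / a)"
    using edk_integral(2)[of "complex_of_real a"] assms by simp
  then show ?thesis by (simp only: of_real_eq_iff)
qed

lemma norm_one_minus_exp_le:
  assumes "0 \<le> Re z" shows "norm (1 - exp (- z)) \<le> norm z"
proof -
  have "norm (exp (- z) - exp 0) \<le> 1 * norm (- z - 0)"
  proof (rule field_differentiable_bound[where S="{w. Re w \<le> 0}" and f'=exp])
    show "convex {w. Re w \<le> 0}" by (rule convex_halfspace_Re_le)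
  qed (use assms in \<open>auto intro!: derivative_eq_intros\<close>)
  then show ?thesis by (simp add: norm_minus_commute)
qed

text \<open>The bound holds since \<open>edk 1\<close> dominates the kernel and has mass
  \<open>1\<close>. For the increments, the value at \<open>y\<close> is
  \<open>exp (- \<beta> * u)\<close> times the value at \<open>y - u\<close> plus an integral over
  the last stretch of length \<open>u\<close>; the latter is at most \<open>C * u\<close>, and the
  former differs from the value at \<open>y - u\<close> by at most
  \<open>norm \<beta> * u * C\<close>.\<close>

lemma conv_edk_lipschitz:
  assumes g: "loc_bdd g" and C: "\<And>y. norm (g y) \<le> C" and \<beta>: "1 \<le> Re \<beta>"
  shows "norm (lconv lborel (edk \<beta>) g y) \<le> C"
    and "0 \<le> u \<Longrightarrow> norm (lconv lborel (edk \<beta>) g y - lconv lborel (edk \<beta>) g (y - u)) \<le> C * (1 + norm \<beta>) * u"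
proof -
  note [measurable] = loc_bddD(1)[OF g] loc_bddD(1)[OF loc_bdd_edk[of \<beta>]]
  have C0: "0 \<le> C" using C[of 0] norm_ge_zero order_trans by blast
  note k = loc_kernel_lborel[OF loc_bdd_edk, of \<beta>]
  let ?p = "lconv lborel (edk \<beta>) g"
  have bd: "norm (?p y) \<le> C" for y
  proof -
    have "norm (?p y) \<le> (\<integral>v. norm (g (y - v) * edk \<beta> v) \<partial>lborel)"
      unfolding lconv_def by (rule integral_norm_bound)
    also have "\<dots> \<le> (\<integral>v. C * edk 1 v \<partial>lborel)"
    proof (rule integral_mono')
      fix v
      have "edk (Re \<beta>) v \<le> edk 1 v" using \<beta> mult_right_mono[OF \<beta>, of v] by (auto simp: edk_def indicator_def)
      then show "norm (g (y - v) * edk \<beta> v) \<le> C * edk 1 v"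
        unfolding norm_mult norm_edk using C C0 by (intro mult_mono edk_real_nonneg)
      show "0 \<le> C * edk 1 v" using C0 by (intro mult_nonneg_nonneg edk_real_nonneg)
    qed (use edk_integrable_real[of 1] in simp)
    also have "\<dots> = C" by (simp add: edk_integral_real)
    finally show ?thesis .
  qed
  show "norm (?p y) \<le> C" by (rule bd)
  assume u: "0 \<le> u"
  have sym: "?p y = (\<integral>v. edk \<beta> (y - v) * g v \<partial>lborel)" for y
    by (subst lconv_lborel_sym) (simp add: lconv_def)
  have int: "integrable lborel (\<lambda>v. edk \<beta> (y - v) * g v)" for y
    by (rule lconv_integrable[OF loc_kernel_lborel[OF g] loc_bdd_edk])
  have split: "edk \<beta> (y - v) * g v = exp (- \<beta> * of_real u) * (edk \<beta> (y - u - v) * g v)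
       + indicator {y - u<..y} v *\<^sub>R (exp (- \<beta> * of_real (y - v)) * g v)" for v
  proof -
    have e: "exp (- \<beta> * of_real (y - v)) = exp (- \<beta> * of_real u) * exp (- \<beta> * of_real (y - u - v))"
      unfolding exp_add[symmetric] by (simp add: algebra_simps)
    consider "v \<le> y - u" | "y - u < v" "v \<le> y" | "y < v" by linarith
    then show ?thesis
    proof cases
      case 1
      then have "edk \<beta> (y - v) = exp (- \<beta> * of_real u) * edk \<beta> (y - u - v)"
        using u e by (simp add: edk_nonneg)
      then show ?thesis using 1 by simp
    qed (use u in \<open>auto simp: edk_neg edk_nonneg\<close>)
  qed
  have int2: "integrable lborel (\<lambda>v. indicator {y - u<..y} v *\<^sub>R (exp (- \<beta> * of_real (y - v)) * g v))"
  proof -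
    have "integrable lborel (\<lambda>v. edk \<beta> (y - v) * g v - exp (- \<beta> * of_real u) * (edk \<beta> (y - u - v) * g v))"
      using int by (intro Bochner_Integration.integrable_diff integrable_mult_right)
    then show ?thesis unfolding split by simp
  qed
  have "?p y = exp (- \<beta> * of_real u) * ?p (y - u)
      + (\<integral>v. indicator {y - u<..y} v *\<^sub>R (exp (- \<beta> * of_real (y - v)) * g v) \<partial>lborel)"
    unfolding sym split using int int2 by simp
  moreover have "norm (\<integral>v. indicator {y - u<..y} v *\<^sub>R (exp (- \<beta> * of_real (y - v)) * g v) \<partial>lborel) \<le> C * u"
  proof -
    have "norm (\<integral>v. indicator {y - u<..y} v *\<^sub>R (exp (- \<beta> * of_real (y - v)) * g v) \<partial>lborel)
       \<le> (\<integral>v. norm (indicator {y - u<..y} v *\<^sub>R (exp (- \<beta> * of_real (y - v)) * g v)) \<partial>lborel)"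
      by (rule integral_norm_bound)
    also have "\<dots> \<le> (\<integral>v. indicator {y - u<..y} v * C \<partial>lborel)"
    proof (rule integral_mono')
      show "norm (indicator {y - u<..y} v *\<^sub>R (exp (- \<beta> * of_real (y - v)) * g v)) \<le> indicator {y - u<..y} v * C" for v
      proof (cases "v \<in> {y - u<..y}")
        case True
        then have "norm (exp (- \<beta> * of_real (y - v))) \<le> 1" using \<beta> by (intro norm_exp_le_1) auto
        then have "norm (exp (- \<beta> * of_real (y - v))) * norm (g v) \<le> 1 * C"
          using C by (intro mult_mono) auto
        then show ?thesis using True by (simp add: norm_mult)
      qed simp
      show "integrable lborel (\<lambda>v. indicator {y - u<..y} v * C)"
        using u by (intro integrable_mult_left integrable_real_indicator) (auto simp: emeasure_lborel_Ioc)
    qed (use C0 in auto)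
    also have "\<dots> = C * u" using u by simp
    finally show ?thesis .
  qed
  moreover have "norm ((1 - exp (- (\<beta> * of_real u))) * ?p (y - u)) \<le> (norm \<beta> * u) * C"
    unfolding norm_mult using norm_one_minus_exp_le[of "\<beta> * of_real u"] u \<beta> bd C0
    by (intro mult_mono) (auto simp: norm_mult)
  moreover have "norm (p - q) \<le> A + B"
    if "p = e * q + I" "norm I \<le> A" "norm ((1 - e) * q) \<le> B" for p q e I :: complex and A B
  proof -
    have "p - q = I - (1 - e) * q" unfolding that(1) by (simp add: algebra_simps)
    then show ?thesis using that(2,3) norm_triangle_ineq4[of I "(1 - e) * q"] by simp
  qed
  ultimately have "norm (?p y - ?p (y - u)) \<le> C * u + (norm \<beta> * u) * C"
    by simp
  then show "norm (?p y - ?p (y - u)) \<le> C * (1 + norm \<beta>) * u" by (simp add: algebra_simps)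
qed

lemma continuous_on_lipschitz_shift:
  fixes f :: "real \<Rightarrow> complex"
  assumes "\<And>y u. 0 \<le> u \<Longrightarrow> norm (f y - f (y - u)) \<le> L * u"
  shows "continuous_on UNIV f"
proof -
  have "norm (f y - f x) \<le> (\<bar>L\<bar> + 1) * \<bar>y - x\<bar>" for x y
  proof -
    have "norm (f y - f x) \<le> L * \<bar>y - x\<bar>"
      using assms[of "y - x" y] assms[of "x - y" x] by (cases "x \<le> y") (auto simp: norm_minus_commute)
    also have "\<dots> \<le> (\<bar>L\<bar> + 1) * \<bar>y - x\<bar>" by (intro mult_right_mono) auto
    finally show ?thesis .
  qed
  then show ?thesis
    unfolding continuous_on_iff dist_norm
  proof (intro ballI allI impI, goal_cases)
    case (1 x e)
    show ?case
    proof (intro exI[of _ "e / (\<bar>L\<bar> + 1)"] conjI ballI impI)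
      show "0 < e / (\<bar>L\<bar> + 1)" using 1 by simp
      fix y assume "norm (y - x) < e / (\<bar>L\<bar> + 1)"
      then have "(\<bar>L\<bar> + 1) * \<bar>y - x\<bar> < e" by (simp add: field_simps)
      then show "norm (f y - f x) < e" using \<open>norm (f y - f x) \<le> _\<close> by linarith
    qed
  qed
qed

lemma edk_twist: "exp (- s * of_real y) * edk b y = edk (b + s) y"
proof -
  have "exp (- (b + s) * of_real y) = exp (- s * of_real y) * exp (- b * of_real y)"
    unfolding exp_add[symmetric] by (simp add: algebra_simps)
  then show ?thesis by (simp add: edk_def indicator_def)
qed

section \<open>Halasz's method in the time domain\<close>

lemma loc_bdd_shift:
  assumes f: "loc_bdd f" and u: "0 \<le> u"
  shows "loc_bdd (\<lambda>y. f (y - u))"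
proof (rule loc_bddI)
  note [measurable] = loc_bddD(1)[OF f]
  show "(\<lambda>y. f (y - u)) \<in> borel_measurable borel" by measurable
  show "f (v - u) = 0" if "v < 0" for v using loc_bddD(2)[OF f, of "v - u"] that u by simp
  fix y
  obtain M where M: "\<And>x. x \<le> y \<Longrightarrow> norm (f x) \<le> M" using loc_bddE[OF f] by metis
  then show "\<exists>M. \<forall>x\<le>y. norm (f (x - u)) \<le> M" using u by (intro exI[of _ M]) auto
qed

lemma edk0: "edk 0 y = indicator {0..} y" for y :: real by (auto simp: edk_def indicator_def)

text \<open>\<open>cheb\<close> is the Chebyshev-type bound for \<open>g\<^sub>1\<close>, divided by
  \<open>x = exp y\<close>, and \<open>zeta_le\<close> encodes that the zeta function at
  \<open>1 + \<sigma>\<close> is \<open>O (1 / \<sigma>)\<close>. All of it is stated for the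
  normalized kernel, so no primes appear until the end.\<close>

locale halasz_kernel =
  fixes Q :: "real measure" and k1 :: "real \<Rightarrow> complex" and \<beta> :: complex and C1 CZ :: real
  assumes k1: "loc_kernel Q k1" and \<beta>: "Re \<beta> = 1"
    and cheb: "\<And>y. lconv Q (\<lambda>v. v *\<^sub>R norm (k1 v)) (edk 1) y \<le> C1"
    and zeta: "\<And>\<sigma>. 0 < \<sigma> \<Longrightarrow> \<sigma> \<le> 1 \<Longrightarrow> integrable Q (\<lambda>v. exp (- \<sigma> * v) * norm (k1 v))"
    and zeta_le: "\<And>\<sigma>. 0 < \<sigma> \<Longrightarrow> \<sigma> \<le> 1 \<Longrightarrow> exp (\<integral>v. exp (- \<sigma> * v) * norm (k1 v) \<partial>Q) \<le> CZ / \<sigma>"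
begin

lemma CZ_pos: "0 < CZ"
  by (rule less_le_trans[OF exp_gt_zero]) (use zeta_le[of 1] in simp)

lemma loc_kernel_norm_k1: "loc_kernel Q (\<lambda>v. norm (k1 v))" by (rule loc_kernel_norm[OF k1])

lemma k_neg: "v < 0 \<Longrightarrow> k1 v = 0" using loc_kernelD(4)[OF k1] .

lemma loc_kernel_times_norm_k1: "loc_kernel Q (\<lambda>v. v *\<^sub>R norm (k1 v))" by (rule loc_kernel_times_id[OF loc_kernel_norm_k1])

lemma vnk1_nonneg: "0 \<le> v *\<^sub>R norm (k1 v)" using k_neg[of v] by (cases "v < 0") auto

lemma cheb_nonneg: "0 \<le> lconv Q (\<lambda>v. v *\<^sub>R norm (k1 v)) (edk 1) y"
  unfolding lconv_def using vnk1_nonneg edk_real_nonneg by (intro integral_nonneg_AE AE_I2 mult_nonneg_nonneg)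

lemma C1_nonneg: "0 \<le> C1" using cheb[of 0] cheb_nonneg[of 0] by simp

lemma loc_kernel_scaled: "loc_kernel Q (\<lambda>v. \<kappa> * norm (k1 v))"
  using loc_kernel_mult_ctns[OF loc_kernel_norm_k1, of "\<lambda>_. \<kappa>"] by simp

text \<open>The normalized summatory function of the nonnegative multiplicative measure with kernel
  \<open>\<kappa> * norm k1\<close>; it dominates its complex counterparts, whatever their
  phases.\<close>

definition majorant where "majorant \<kappa> = xconv Q (\<lambda>v. \<kappa> * norm (k1 v)) (edk 1)"

text \<open>\<open>C1 + 1\<close> comes from the logarithmic derivative, \<open>exp 1\<close> from
  Rankin's trick at \<open>\<sigma> * y = 1\<close>, and the power of \<open>CZ\<close> from the
  zeta bound.\<close>

definition majorant_const where "majorant_const \<kappa> = (C1 + 1) * exp 1 * CZ powr \<kappa>"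

lemma majorant_const_nonneg: "0 \<le> majorant_const \<kappa>" using C1_nonneg by (simp add: majorant_const_def)

text \<open>Rankin's trick: the unit step is at most \<open>exp (\<sigma> * y)\<close>, and
  multiplying the kernel by \<open>\<kappa>\<close> raises the zeta bound to the power
  \<open>\<kappa>\<close>.\<close>

lemma xconv_exp_le:
  fixes f :: "real \<Rightarrow> real"
  assumes \<kappa>: "0 < \<kappa>" and \<sigma>: "0 < \<sigma>" "\<sigma> \<le> 1" and f: "loc_bdd f" "\<And>y. norm (f y) \<le> edk 0 y" and y: "0 \<le> y"
  shows "norm (xconv Q (\<lambda>v. \<kappa> * norm (k1 v)) f y) \<le> exp (\<sigma> * y) * (CZ / \<sigma>) powr \<kappa>"
proof -
  have "norm (xconv Q (\<lambda>v. \<kappa> * norm (k1 v)) f y)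
     \<le> 1 * exp (\<sigma> * y) * exp (\<integral>v. exp (- \<sigma> * v) * norm (\<kappa> * norm (k1 v)) \<partial>Q)"
  proof (rule xconv_exp_bound[OF loc_kernel_scaled f(1)])
    show "integrable Q (\<lambda>v. exp (- \<sigma> * v) * norm (\<kappa> * norm (k1 v)))"
      using integrable_mult_right[OF zeta[OF \<sigma>], of "\<bar>\<kappa>\<bar>"] by (simp add: abs_mult mult_ac)
    show "norm (f y) \<le> 1 * exp (\<sigma> * y)" for y
      using f(2)[of y] \<sigma> by (cases "y < 0") (auto simp: edk_neg edk0 intro: order_trans)
  qed
  also have "(\<integral>v. exp (- \<sigma> * v) * norm (\<kappa> * norm (k1 v)) \<partial>Q) = (\<integral>v. exp (- \<sigma> * v) * norm (k1 v) \<partial>Q) * \<kappa>"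
    unfolding integral_mult_left_zero[symmetric]
    using \<kappa> by (intro Bochner_Integration.integral_cong refl) (simp add: abs_mult mult_ac)
  also have "exp \<dots> = exp (\<integral>v. exp (- \<sigma> * v) * norm (k1 v) \<partial>Q) powr \<kappa>"
    by (simp add: powr_def mult.commute)
  also have "1 * exp (\<sigma> * y) * \<dots> \<le> exp (\<sigma> * y) * (CZ / \<sigma>) powr \<kappa>"
    using zeta_le[OF \<sigma>] \<kappa> by (auto intro!: mult_left_mono powr_mono2)
  finally show ?thesis .
qed

text \<open>For \<open>y \<le> 1\<close> the choice \<open>\<sigma> = 1 / y\<close> would leave the
  admissible range, so \<open>\<sigma> = 1\<close> is taken.\<close>

lemma majorant_le_const:
  assumes \<kappa>: "0 < \<kappa>" "\<kappa> \<le> 1" and y: "0 \<le> y" "y \<le> 1"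
  shows "majorant \<kappa> y \<le> majorant_const \<kappa>"
proof -
  have "norm (xconv Q (\<lambda>v. \<kappa> * norm (k1 v)) (edk 1) y) \<le> exp (1 * y) * (CZ / 1) powr \<kappa>"
    using y \<kappa> by (intro xconv_exp_le loc_bdd_edk) (auto simp: edk_def indicator_def)
  also have "\<dots> \<le> exp 1 * CZ powr \<kappa>" using y by (intro mult_mono) auto
  also have "\<dots> \<le> (C1 + 1) * (exp 1 * CZ powr \<kappa>)"
    using C1_nonneg by (simp add: mult_le_cancel_right1 algebra_simps)
  finally show ?thesis by (simp add: majorant_def majorant_const_def mult_ac)
qed

text \<open>The Hall--Tenenbaum bound: the logarithmic derivative and Rankin's trick at \<open>\<sigma> = 1 / y\<close>.\<close>

lemma majorant_le_powr:
  assumes \<kappa>: "0 < \<kappa>" "\<kappa> \<le> 1" and y: "0 < y"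
  shows "majorant \<kappa> y \<le> majorant_const \<kappa> * y powr (\<kappa> - 1)"
proof (cases "y \<le> 1")
  case True
  have "1 \<le> y powr (\<kappa> - 1)"
    using powr_mono'[of "\<kappa> - 1" 0 y] True y \<kappa> by simp
  then have "majorant_const \<kappa> * 1 \<le> majorant_const \<kappa> * y powr (\<kappa> - 1)"
    using majorant_const_nonneg by (intro mult_left_mono)
  then show ?thesis using majorant_le_const[OF \<kappa>, of y] True y by simp
next
  case False
  let ?b = "\<lambda>v. \<kappa> * norm (k1 v)"
  let ?m = "xconv Q ?b (edk 0) y"
  have vb: "loc_kernel Q (\<lambda>v. v *\<^sub>R ?b v)" by (rule loc_kernel_times_id[OF loc_kernel_scaled])
  have "y *\<^sub>R majorant \<kappa> y = xconv Q ?b (\<lambda>y. y *\<^sub>R edk 1 y) y + lconv Q (\<lambda>v. v *\<^sub>R ?b v) (majorant \<kappa>) y"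
    unfolding majorant_def by (rule xconv_times_id[OF loc_kernel_scaled loc_bdd_edk])
  moreover have "xconv Q ?b (\<lambda>y. y *\<^sub>R edk 1 y) y \<le> ?m"
  proof -
    have "norm (xconv Q ?b (\<lambda>y. y *\<^sub>R edk 1 y) y) \<le> ?m"
    proof (rule xconv_le[OF loc_kernel_scaled loc_bdd_times_id[OF loc_bdd_edk] loc_kernel_scaled loc_bdd_edk])
      show "norm (v *\<^sub>R edk (1::real) v) \<le> edk 0 v" for v :: real
      proof (cases "v < 0")
        case False
        have "v \<le> exp v" using exp_ge_add_one_self[of v] by linarith
        then show ?thesis using False by (simp add: edk_def exp_minus field_simps)
      qed (simp add: edk_neg)
    qed (use \<kappa> in auto)
    then show ?thesis by simp
  qed
  moreover have "lconv Q (\<lambda>v. v *\<^sub>R ?b v) (majorant \<kappa>) y \<le> C1 * ?m"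
  proof -
    have "lconv Q (\<lambda>v. v *\<^sub>R ?b v) (majorant \<kappa>) y = xconv Q ?b (lconv Q (\<lambda>v. v *\<^sub>R ?b v) (edk 1)) y"
      unfolding majorant_def by (simp only: xconv_lconv[OF loc_kernel_scaled vb loc_bdd_edk])
    also have "\<dots> \<le> norm \<dots>" by simp
    also have "\<dots> \<le> xconv Q ?b (\<lambda>y. C1 *\<^sub>R edk 0 y) y"
    proof (rule xconv_le[OF loc_kernel_scaled loc_bdd_lconv[OF vb loc_bdd_edk] loc_kernel_scaled loc_bdd_scaleR[OF loc_bdd_edk]])
      fix v
      have eq: "lconv Q (\<lambda>v. v *\<^sub>R ?b v) (edk 1) v = \<kappa> * lconv Q (\<lambda>v. v *\<^sub>R norm (k1 v)) (edk 1) v"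
        unfolding lconv_def integral_mult_right_zero[symmetric]
        by (intro Bochner_Integration.integral_cong refl) (simp add: mult_ac)
      have "\<kappa> * lconv Q (\<lambda>v. v *\<^sub>R norm (k1 v)) (edk 1) v \<le> 1 * C1"
        using \<kappa> cheb cheb_nonneg by (intro mult_mono) auto
      then show "norm (lconv Q (\<lambda>v. v *\<^sub>R ?b v) (edk 1) v) \<le> C1 *\<^sub>R edk 0 v"
      proof (cases "v < 0")
        case True
        then show ?thesis
          unfolding loc_bddD(2)[OF loc_bdd_lconv[OF vb loc_bdd_edk] True] by (simp add: edk_neg)
      next
        case False
        then show ?thesis
          unfolding eq using \<kappa> cheb_nonneg[of v] \<open>_ \<le> 1 * C1\<close> by (simp add: edk0)
      qed
    qed (use \<kappa> in auto)
    also have "\<dots> = C1 * ?m" by (simp only: xconv_scaleR[OF loc_kernel_scaled loc_bdd_edk]) simp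
    finally show ?thesis .
  qed
  ultimately have 1: "y * majorant \<kappa> y \<le> (C1 + 1) * ?m" by (simp add: algebra_simps)
  have "norm ?m \<le> exp ((1 / y) * y) * (CZ / (1 / y)) powr \<kappa>"
    using False \<kappa> by (intro xconv_exp_le loc_bdd_edk) (auto simp: edk0)
  then have "?m \<le> exp 1 * (CZ powr \<kappa> * y powr \<kappa>)"
    using False CZ_pos by (simp add: powr_mult)
  then have "(C1 + 1) * ?m \<le> (C1 + 1) * (exp 1 * (CZ powr \<kappa> * y powr \<kappa>))"
    using C1_nonneg by (intro mult_left_mono) auto
  with 1 have "y * majorant \<kappa> y \<le> majorant_const \<kappa> * y powr \<kappa>" by (simp add: majorant_const_def mult_ac)
  moreover have "y powr \<kappa> = y * y powr (\<kappa> - 1)" using y by (simp add: powr_diff)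
  ultimately show ?thesis using y by (simp add: mult.left_commute)
qed

text \<open>\<open>\<gamma>1 y\<close> is \<open>exp (- \<beta> * y)\<close> times the summatory
  function at \<open>exp y\<close> of the measure built from \<open>g\<^sub>1\<close> alone, and
  \<open>\<psi>1\<close> is its average. \<open>\<gamma>34\<close> does the same for the measure
  whose transform is the \<open>3/4\<close> power.\<close>

definition \<gamma>1 where "\<gamma>1 = xconv Q k1 (edk \<beta>)"
definition \<psi>1 where "\<psi>1 = lconv lborel (edk \<beta>) \<gamma>1"
definition \<gamma>34 where "\<gamma>34 = xconv Q (\<lambda>v. (3/4) * k1 v) (edk \<beta>)"

lemma loc_kernel_34: "loc_kernel Q (\<lambda>v. (3/4) * k1 v)"
  using loc_kernel_mult_ctns[OF k1, of "\<lambda>_. 3/4"] by simp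

lemma loc_bdd_\<gamma>1: "loc_bdd \<gamma>1" unfolding \<gamma>1_def by (rule loc_bdd_xconv[OF k1 loc_bdd_edk])
lemma loc_bdd_\<gamma>34: "loc_bdd \<gamma>34" unfolding \<gamma>34_def by (rule loc_bdd_xconv[OF loc_kernel_34 loc_bdd_edk])
lemma loc_bdd_\<psi>1: "loc_bdd \<psi>1" unfolding \<psi>1_def
  by (rule loc_bdd_lconv[OF loc_kernel_lborel[OF loc_bdd_edk] loc_bdd_\<gamma>1])

abbreviation "D \<equiv> majorant_const 1"
definition "\<Lambda> = D * (1 + norm \<beta>)"

text \<open>The case \<open>\<kappa> = 1\<close> of the majorant, where the power of
  \<open>y\<close> is constant.\<close>

lemma \<gamma>1_le: "norm (\<gamma>1 y) \<le> D"
proof (cases "y < 0")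
  case True
  then show ?thesis using loc_bddD(2)[OF loc_bdd_\<gamma>1 True] majorant_const_nonneg by simp
next
  case False
  have "norm (\<gamma>1 y) \<le> majorant 1 y"
    unfolding \<gamma>1_def majorant_def by (intro xconv_le k1 loc_kernel_scaled loc_bdd_edk) (auto simp: norm_edk \<beta>)
  also have "\<dots> \<le> D"
    using majorant_le_powr[of 1 y] majorant_le_const[of 1 0] False by (cases "y = 0") auto
  finally show ?thesis .
qed

text \<open>Squaring turns the exponent \<open>3/4 - 1\<close> into \<open>- 1/2\<close>, which is
  integrable at the origin and saves a factor \<open>sqrt \<sigma>\<close> in the damped square
  integral.\<close>

lemma \<gamma>34_le:
  assumes "0 < y" shows "(norm (\<gamma>34 y))\<^sup>2 \<le> (majorant_const (3/4))\<^sup>2 * y powr (-1/2)"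
proof -
  have "norm (\<gamma>34 y) \<le> majorant (3/4) y"
    unfolding \<gamma>34_def majorant_def by (intro xconv_le loc_kernel_34 loc_kernel_scaled loc_bdd_edk) (auto simp: norm_edk \<beta> norm_mult)
  also have "\<dots> \<le> majorant_const (3/4) * y powr (3/4 - 1)" using majorant_le_powr[of "3/4" y] assms by simp
  finally have "(norm (\<gamma>34 y))\<^sup>2 \<le> (majorant_const (3/4) * y powr (-1/4))\<^sup>2" by (intro power_mono) auto
  also have "\<dots> = (majorant_const (3/4))\<^sup>2 * y powr (-1/2)"
    using assms by (simp add: power_mult_distrib power2_eq_square flip: powr_add)
  finally show ?thesis .
qed

lemma \<gamma>34_bdd: "norm (\<gamma>34 y) \<le> majorant_const (3/4)"
proof (cases "y < 0")
  case True
  then show ?thesis using loc_bddD(2)[OF loc_bdd_\<gamma>34 True] majorant_const_nonneg by simp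
next
  case False
  have "norm (\<gamma>34 y) \<le> majorant (3/4) y"
    unfolding \<gamma>34_def majorant_def by (intro xconv_le loc_kernel_34 loc_kernel_scaled loc_bdd_edk) (auto simp: norm_edk \<beta> norm_mult)
  also have "\<dots> \<le> majorant_const (3/4)"
  proof (cases "y \<le> 1")
    case True then show ?thesis using majorant_le_const[of "3/4" y] False by simp
  next
    case F: False
    have "y powr (3/4 - 1) \<le> 1" using F powr_mono[of "3/4 - 1" 0 y] by simp
    then have "majorant_const (3/4) * y powr (3/4 - 1) \<le> majorant_const (3/4) * 1" using majorant_const_nonneg by (intro mult_left_mono)
    then show ?thesis using majorant_le_powr[of "3/4" y] F by simp
  qed
  finally show ?thesis .
qed

lemma \<psi>1_le: "norm (\<psi>1 y) \<le> D"
  unfolding \<psi>1_def using conv_edk_lipschitz(1)[OF loc_bdd_\<gamma>1 \<gamma>1_le eq_refl[OF \<beta>[symmetric]]] .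

lemma \<psi>1_lip: "0 \<le> u \<Longrightarrow> norm (\<psi>1 y - \<psi>1 (y - u)) \<le> \<Lambda> * u"
  unfolding \<psi>1_def \<Lambda>_def using conv_edk_lipschitz(2)[OF loc_bdd_\<gamma>1 \<gamma>1_le eq_refl[OF \<beta>[symmetric]]] .

lemma \<Lambda>_nonneg: "0 \<le> \<Lambda>" using majorant_const_nonneg by (simp add: \<Lambda>_def)

text \<open>Multiplication by \<open>y\<close> is a derivation of convolution, so this is the identity
  \<open>- \<Psi>' = (2 / (\<beta> + s) - kh') * \<Psi>\<close> for the Laplace transform \<open>\<Psi>\<close> of \<open>\<psi>1\<close>.\<close>

lemma \<psi>1_functional_equation: "y *\<^sub>R \<psi>1 y = 2 *\<^sub>R lconv lborel (edk \<beta>) \<psi>1 y + lconv Q (\<lambda>v. v *\<^sub>R k1 v) \<psi>1 y"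
proof -
  let ?r = "lconv lborel (edk \<beta>) (edk \<beta>)"
  note e = loc_kernel_lborel[OF loc_bdd_edk, of \<beta>]
  have r: "loc_bdd ?r" by (rule loc_bdd_lconv[OF e loc_bdd_edk])
  have \<psi>1: "\<psi>1 = xconv Q k1 ?r"
    unfolding \<psi>1_def \<gamma>1_def by (rule xconv_lconv[OF k1 e loc_bdd_edk, symmetric])
  have "y *\<^sub>R xconv Q k1 ?r y = xconv Q k1 (\<lambda>y. y *\<^sub>R ?r y) y + lconv Q (\<lambda>v. v *\<^sub>R k1 v) (xconv Q k1 ?r) y"
    by (rule xconv_times_id[OF k1 r])
  also have "(\<lambda>y. y *\<^sub>R ?r y) = (\<lambda>y. 2 *\<^sub>R lconv lborel (edk \<beta>) ?r y)"
  proof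
    fix y
    have "?r = (\<lambda>y. y *\<^sub>R edk \<beta> y)" by (rule ext) (rule edk_conv_self)
    then show "y *\<^sub>R ?r y = 2 *\<^sub>R lconv lborel (edk \<beta>) ?r y"
      by (simp only: edk_conv_times_id) (simp add: power2_eq_square)
  qed
  also have "xconv Q k1 \<dots> y = 2 *\<^sub>R lconv lborel (edk \<beta>) (xconv Q k1 ?r) y"
    by (simp add: xconv_scaleR[OF k1 loc_bdd_lconv[OF e r]] xconv_lconv[OF k1 e r])
  finally show ?thesis unfolding \<psi>1 .
qed

definition \<theta> where "\<theta> u y = \<psi>1 y - \<psi>1 (y - u)"

lemma loc_bdd_\<theta>: "0 \<le> u \<Longrightarrow> loc_bdd (\<theta> u)"
  unfolding \<theta>_def[abs_def] by (intro loc_bdd_diff loc_bdd_\<psi>1 loc_bdd_shift)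

lemma \<theta>_le: "norm (\<theta> u y) \<le> 2 * D"
  unfolding \<theta>_def using norm_triangle_ineq4[of "\<psi>1 y" "\<psi>1 (y - u)"] \<psi>1_le[of y] \<psi>1_le[of "y - u"] by linarith

lemma \<theta>_lip:
  assumes "0 \<le> w" shows "norm (\<theta> u y - \<theta> u (y - w)) \<le> 2 * \<Lambda> * w"
proof -
  have "\<theta> u y - \<theta> u (y - w) = (\<psi>1 y - \<psi>1 (y - w)) - (\<psi>1 (y - u) - \<psi>1 ((y - u) - w))"
    by (simp add: \<theta>_def algebra_simps)
  then show ?thesis
    using norm_triangle_ineq4[of "\<psi>1 y - \<psi>1 (y - w)" "\<psi>1 (y - u) - \<psi>1 ((y - u) - w)"]
      \<psi>1_lip[OF assms, of y] \<psi>1_lip[OF assms, of "y - u"] by simp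
qed

text \<open>The average over \<open>[y - \<eta>, y]\<close> replaces the pointwise value, at the cost of a Lipschitz error:
  this turns an integral against the prime measure into one against Lebesgue measure.\<close>

lemma \<theta>_smooth:
  assumes u: "0 \<le> u" and \<eta>: "0 < \<eta>" "\<eta> \<le> 1"
  shows "norm (\<theta> u y) \<le> (exp 1 / \<eta>) * lconv lborel (edk 1) (\<lambda>y. norm (\<theta> u y)) y + (2 * \<Lambda> * \<eta>) * edk 0 y"
proof (cases "y < 0")
  case True
  have "loc_bdd (\<lambda>y. norm (\<theta> u y))" by (rule loc_bdd_norm[OF loc_bdd_\<theta>[OF u]])
  then show ?thesis
    using True loc_bddD(2)[OF loc_bdd_\<theta>[OF u] True]
      loc_bddD(2)[OF loc_bdd_lconv[OF loc_kernel_lborel[OF loc_bdd_edk[of "1::real"]] \<open>loc_bdd (\<lambda>y. norm (\<theta> u y))\<close>] True]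
    by (simp add: edk_neg)
next
  case False
  let ?t = "\<lambda>y. norm (\<theta> u y)"
  have t: "loc_bdd ?t" by (rule loc_bdd_norm[OF loc_bdd_\<theta>[OF u]])
  have "\<eta> * (exp (-1) * (?t y - 2 * \<Lambda> * \<eta>)) = (\<integral>w. indicator {0..\<eta>} w * (exp (-1) * (?t y - 2 * \<Lambda> * \<eta>)) \<partial>lborel)"
    using \<eta> by simp
  also have "\<dots> \<le> (\<integral>w. ?t (y - w) * edk 1 w \<partial>lborel)"
  proof (rule integral_mono)
    show "integrable lborel (\<lambda>w. ?t (y - w) * edk 1 w)"
      by (rule lconv_integrable[OF loc_kernel_lborel[OF loc_bdd_edk] t])
    show "integrable lborel (\<lambda>w. indicator {0..\<eta>} w * (exp (-1) * (?t y - 2 * \<Lambda> * \<eta>)))"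
      by (intro integrable_mult_left integrable_real_indicator) (auto simp: emeasure_lborel_Icc_eq)
    show "indicator {0..\<eta>} w * (exp (-1) * (?t y - 2 * \<Lambda> * \<eta>)) \<le> ?t (y - w) * edk 1 w" for w
    proof (cases "w \<in> {0..\<eta>}")
      case True
      have "?t y - ?t (y - w) \<le> norm (\<theta> u y - \<theta> u (y - w))" by (rule norm_triangle_ineq2)
      also have "\<dots> \<le> 2 * \<Lambda> * w" using True by (intro \<theta>_lip) auto
      also have "\<dots> \<le> 2 * \<Lambda> * \<eta>" using True \<Lambda>_nonneg by (intro mult_left_mono) auto
      finally have 1: "?t y - 2 * \<Lambda> * \<eta> \<le> ?t (y - w)" by simp
      have "exp (-1) * (?t y - 2 * \<Lambda> * \<eta>) \<le> exp (-1) * ?t (y - w)" using 1 by simp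
      also have "\<dots> \<le> exp (- w) * ?t (y - w)" using True \<eta> by (intro mult_right_mono) auto
      finally show ?thesis using True by (simp add: edk_nonneg mult.commute)
    next
      case False
      then show ?thesis by (simp add: edk_real_nonneg)
    qed
  qed
  finally have "\<eta> * (exp (-1) * (?t y - 2 * \<Lambda> * \<eta>)) \<le> lconv lborel (edk 1) ?t y" by (simp add: lconv_def)
  then have "?t y - 2 * \<Lambda> * \<eta> \<le> (exp 1 / \<eta>) * lconv lborel (edk 1) ?t y"
    using \<eta> by (simp add: exp_minus field_simps)
  then show ?thesis using False by (simp add: edk0)
qed

lemma lconv_edk0:
  fixes k :: "real \<Rightarrow> real"
  shows "lconv lborel k (edk 0) y = (\<integral>v. indicator {..y} v * k v \<partial>lborel)"
  unfolding lconv_def by (intro Bochner_Integration.integral_cong refl) (simp add: edk0 indicator_def)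

text \<open>Both sides in fact agree. The unit step is expressed through \<open>edk 1\<close>
  because that is the window for which \<open>cheb\<close> is stated.\<close>

lemma edk0_le: "edk (0::real) y \<le> edk 1 y + lconv lborel (edk 0) (edk 1) y"
proof (cases "y < 0")
  case True
  then show ?thesis
    using loc_bddD(2)[OF loc_bdd_lconv[OF loc_kernel_lborel[OF loc_bdd_edk] loc_bdd_edk] True, of "0::real" 1] by (simp add: edk_neg)
next
  case False
  have "lconv lborel (edk 0) (edk 1) y = (\<integral>v. indicator {0..y} v *\<^sub>R exp (- v) \<partial>lborel)"
    unfolding lconv_lborel_sym[of "edk 0"] lconv_edk0
    by (auto simp: edk_def indicator_def intro!: Bochner_Integration.integral_cong)
  also have "\<dots> = (\<lambda>v. - exp (- v)) y - (\<lambda>v. - exp (- v)) 0"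
  proof (rule integral_FTC_atLeastAtMost)
    show "((\<lambda>v. - exp (- v)) has_vector_derivative exp (- x)) (at x within {0..y})" for x :: real
      by (auto intro!: derivative_eq_intros simp flip: has_real_derivative_iff_has_vector_derivative)
  qed (use False in \<open>auto intro!: continuous_intros\<close>)
  finally show ?thesis using False by (simp add: edk_nonneg)
qed

text \<open>Subtracting the functional equations at \<open>y\<close> and \<open>y - u\<close> leaves
  the convolution of \<open>v * k1\<close> with \<open>\<theta> u\<close>. Smoothing
  \<open>\<theta> u\<close> at scale \<open>\<eta>\<close> lets the Chebyshev bound replace the
  prime measure by Lebesgue measure; the Lipschitz error meets a total prime mass of at most
  \<open>C1 * (1 + y)\<close>, and the convolutions with \<open>edk \<beta>\<close> contribute
  \<open>4 * D\<close>.\<close>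

lemma osc_ineq:
  assumes u: "0 \<le> u" and \<eta>: "0 < \<eta>" "\<eta> \<le> 1" and y: "0 \<le> y"
  shows "norm (y *\<^sub>R \<psi>1 y - (y - u) *\<^sub>R \<psi>1 (y - u))
    \<le> (exp 1 * C1 / \<eta>) * (\<integral>v. indicator {..y} v * norm (\<theta> u v) \<partial>lborel) + 2 * \<Lambda> * \<eta> * C1 * (1 + y) + 4 * D"
proof -
  let ?l = "\<lambda>v. v *\<^sub>R k1 v" and ?nl = "\<lambda>v. v *\<^sub>R norm (k1 v)" and ?t = "\<lambda>y. norm (\<theta> u y)"
  note l = loc_kernel_times_id[OF k1]
  note e = loc_kernel_lborel[OF loc_bdd_edk]
  have t: "loc_bdd ?t" by (rule loc_bdd_norm[OF loc_bdd_\<theta>[OF u]])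
  have S\<theta>: "lconv Q ?l (\<theta> u) y = lconv Q ?l \<psi>1 y - lconv Q ?l \<psi>1 (y - u)"
    unfolding \<theta>_def[abs_def]
    by (subst lconv_diff[OF l loc_bdd_\<psi>1 loc_bdd_shift[OF loc_bdd_\<psi>1 u]]) (simp add: lconv_shift)
  have "norm (lconv Q ?l (\<theta> u) y)
     \<le> lconv Q ?nl (\<lambda>y. (exp 1 / \<eta>) *\<^sub>R lconv lborel (edk 1) ?t y + (2 * \<Lambda> * \<eta>) *\<^sub>R edk 0 y) y"
  proof (rule lconv_le[OF l loc_bdd_\<theta>[OF u] loc_kernel_times_norm_k1])
    show "loc_bdd (\<lambda>y. (exp 1 / \<eta>) *\<^sub>R lconv lborel (edk 1) ?t y + (2 * \<Lambda> * \<eta>) *\<^sub>R edk 0 y)"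
      by (intro loc_bdd_add loc_bdd_scaleR loc_bdd_lconv e t loc_bdd_edk)
    show "norm (v *\<^sub>R k1 v) \<le> v *\<^sub>R norm (k1 v)" for v using k_neg[of v] by (cases "v < 0") auto
    show "norm (\<theta> u v) \<le> (exp 1 / \<eta>) *\<^sub>R lconv lborel (edk 1) ?t v + (2 * \<Lambda> * \<eta>) *\<^sub>R edk 0 v" for v
      using \<theta>_smooth[OF u \<eta>] by simp
  qed
  also have "\<dots> = (exp 1 / \<eta>) * lconv Q ?nl (lconv lborel (edk 1) ?t) y + (2 * \<Lambda> * \<eta>) * lconv Q ?nl (edk 0) y"
    by (subst lconv_add[OF loc_kernel_times_norm_k1 loc_bdd_scaleR[OF loc_bdd_lconv[OF e t]] loc_bdd_scaleR[OF loc_bdd_edk]])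
       (simp only: lconv_scaleR, simp)
  finally have main0: "norm (lconv Q ?l (\<theta> u) y)
    \<le> (exp 1 / \<eta>) * lconv Q ?nl (lconv lborel (edk 1) ?t) y + (2 * \<Lambda> * \<eta>) * lconv Q ?nl (edk 0) y" .
  \<comment> \<open>Commutativity moves the window from \<open>\<theta> u\<close> to the prime
    kernel, where it forms exactly the quantity bounded by \<open>cheb\<close>.\<close>
  have main1: "lconv Q ?nl (lconv lborel (edk 1) ?t) y \<le> C1 * (\<integral>v. indicator {..y} v * ?t v \<partial>lborel)"
  proof -
    have "lconv Q ?nl (lconv lborel (edk 1) ?t) y = lconv lborel ?t (lconv Q ?nl (edk 1)) y"
      using lconv_commute[OF loc_kernel_times_norm_k1 loc_kernel_lborel[OF t] loc_bdd_edk, of 1] by (simp add: lconv_lborel_sym[of "edk 1"])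
    also have "\<dots> \<le> lconv lborel ?t (\<lambda>y. C1 *\<^sub>R edk 0 y) y"
    proof -
      have "norm (lconv lborel ?t (lconv Q ?nl (edk 1)) y) \<le> lconv lborel ?t (\<lambda>y. C1 *\<^sub>R edk 0 y) y"
      proof (rule lconv_le[OF loc_kernel_lborel[OF t] loc_bdd_lconv[OF loc_kernel_times_norm_k1 loc_bdd_edk] loc_kernel_lborel[OF t] loc_bdd_scaleR[OF loc_bdd_edk]])
        show "norm (lconv Q ?nl (edk 1) v) \<le> C1 *\<^sub>R edk 0 v" for v
          using cheb[of v] cheb_nonneg[of v] loc_bddD(2)[OF loc_bdd_lconv[OF loc_kernel_times_norm_k1 loc_bdd_edk], of v 1]
          by (cases "v < 0") (auto simp: edk0)
      qed auto
      then show ?thesis by simp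
    qed
    finally show ?thesis by (simp only: lconv_scaleR lconv_edk0) simp
  qed
  \<comment> \<open>The window itself costs \<open>C1\<close>, and integrating the Chebyshev bound
    over \<open>[0, y]\<close> costs \<open>C1 * y\<close>.\<close>
  have main2: "lconv Q ?nl (edk 0) y \<le> C1 * (1 + y)"
  proof -
    have c0: "lconv Q ?nl (edk 1) v \<le> C1 *\<^sub>R edk 0 v" "0 \<le> lconv Q ?nl (edk 1) v" for v
      using cheb[of v] cheb_nonneg[of v] loc_bddD(2)[OF loc_bdd_lconv[OF loc_kernel_times_norm_k1 loc_bdd_edk], of v 1]
      by (cases "v < 0"; auto simp: edk0)+
    have "lconv Q ?nl (edk 0) y \<le> norm (lconv Q ?nl (edk 0) y)" by simp
    also have "\<dots> \<le> lconv Q ?nl (\<lambda>y. edk 1 y + lconv lborel (edk 0) (edk 1) y) y"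
      using edk0_le vnk1_nonneg
      by (intro lconv_le[OF loc_kernel_times_norm_k1 loc_bdd_edk loc_kernel_times_norm_k1] loc_bdd_add loc_bdd_edk loc_bdd_lconv e) (auto simp: edk_real_nonneg)
    also have "\<dots> = lconv Q ?nl (edk 1) y + lconv lborel (edk 0) (lconv Q ?nl (edk 1)) y"
      by (subst lconv_add[OF loc_kernel_times_norm_k1 loc_bdd_edk loc_bdd_lconv[OF e loc_bdd_edk]])
         (simp only: lconv_commute[OF loc_kernel_times_norm_k1 e loc_bdd_edk])
    also have "lconv lborel (edk 0) (lconv Q ?nl (edk 1)) y \<le> lconv lborel (edk 0) (\<lambda>y. C1 *\<^sub>R edk 0 y) y"
    proof -
      have "norm (lconv lborel (edk 0) (lconv Q ?nl (edk 1)) y) \<le> lconv lborel (edk 0) (\<lambda>y. C1 *\<^sub>R edk 0 y) y"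
        using c0 by (intro lconv_le e loc_bdd_lconv[OF loc_kernel_times_norm_k1 loc_bdd_edk] loc_bdd_scaleR loc_bdd_edk) (auto simp: edk_real_nonneg)
      then show ?thesis by simp
    qed
    also have "\<dots> = C1 * y" using edk_conv_self[of "0::real" y] y by (simp only: lconv_scaleR) (simp add: edk0)
    finally show ?thesis using cheb[of y] by (simp add: algebra_simps)
  qed
  have main: "norm (lconv Q ?l (\<theta> u) y)
    \<le> (exp 1 / \<eta>) * (C1 * (\<integral>v. indicator {..y} v * ?t v \<partial>lborel)) + (2 * \<Lambda> * \<eta>) * (C1 * (1 + y))"
    using \<eta> \<Lambda>_nonneg
    by (intro order_trans[OF main0] add_mono mult_left_mono main1 main2) auto
  let ?q = "lconv lborel (edk \<beta>) \<psi>1"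
  have q: "norm (?q z) \<le> D" for z using conv_edk_lipschitz(1)[OF loc_bdd_\<psi>1 \<psi>1_le eq_refl[OF \<beta>[symmetric]]] .
  have split: "y *\<^sub>R \<psi>1 y - (y - u) *\<^sub>R \<psi>1 (y - u) = lconv Q ?l (\<theta> u) y + 2 *\<^sub>R (?q y - ?q (y - u))"
    unfolding S\<theta> by (subst (1 2) \<psi>1_functional_equation) (simp add: scaleR_right_diff_distrib)
  have "norm (?q y - ?q (y - u)) \<le> 2 * D"
    using norm_triangle_ineq4[of "?q y" "?q (y - u)"] q[of y] q[of "y - u"] by linarith
  then have "norm (2 *\<^sub>R (?q y - ?q (y - u))) \<le> 4 * D" by (simp only: norm_scaleR)
  then have "norm (y *\<^sub>R \<psi>1 y - (y - u) *\<^sub>R \<psi>1 (y - u))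
    \<le> (exp 1 / \<eta>) * (C1 * (\<integral>v. indicator {..y} v * ?t v \<partial>lborel)) + (2 * \<Lambda> * \<eta>) * (C1 * (1 + y)) + 4 * D"
    unfolding split using main norm_triangle_ineq[of "lconv Q ?l (\<theta> u) y" "2 *\<^sub>R (?q y - ?q (y - u))"] by linarith
  then show ?thesis by (simp only: mult.assoc times_divide_eq_left times_divide_eq_right)
qed

end

section \<open>Laplace transforms and mean squares on vertical lines\<close>

definition lap :: "(real \<Rightarrow> complex) \<Rightarrow> complex \<Rightarrow> complex" where
  "lap f s = (\<integral>y. exp (- s * of_real y) * f y \<partial>lborel)"

lemma fourier_lap: "fourier (\<lambda>y. exp (- complex_of_real \<sigma> * of_real y) * f y) t = lap f (Complex \<sigma> t)"
proof -
  have "cis (- (t * y)) * exp (- complex_of_real \<sigma> * of_real y) = exp (- Complex \<sigma> t * of_real y)" for y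
    by (simp add: cis_conv_exp exp_add[symmetric] complex_eq_iff Complex_eq algebra_simps)
  then show ?thesis unfolding fourier_def lap_def
    by (intro Bochner_Integration.integral_cong refl) (metis mult.assoc)
qed

lemma sqrt_integral:
  assumes c: "0 \<le> c"
  shows "integrable lborel (\<lambda>x. indicator {0..c} x * x powr (-1/2))"
    and "(\<integral>x. indicator {0..c} x * x powr (-1/2) \<partial>lborel) = 2 * sqrt c"
proof -
  let ?f = "\<lambda>x::real. indicator {0..c} x * x powr (-1/2)"
  have "((\<lambda>x. x powr (-1/2)) has_integral (c powr (-1/2 + 1) / (-1/2 + 1))) {0..c}"
    by (rule has_integral_powr_from_0) (use c in auto)
  then have "(?f has_integral (c powr (-1/2 + 1) / (-1/2 + 1))) {0..c}"
    by (rule has_integral_eq[rotated]) auto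
  then have "(?f has_integral (c powr (-1/2 + 1) / (-1/2 + 1))) UNIV"
    by (rule has_integral_on_superset) auto
  moreover have "c powr (-1/2 + 1) / (-1/2 + 1) = 2 * sqrt c"
    using c by (simp add: powr_half_sqrt mult.commute)
  ultimately have hi: "(?f has_integral 2 * sqrt c) UNIV" by metis
  have nn: "(\<integral>\<^sup>+x. ennreal (?f x) \<partial>lborel) = ennreal (2 * sqrt c)"
    by (rule nn_integral_has_integral_lborel[OF _ _ hi]) auto
  show "integrable lborel ?f"
  proof (rule integrableI_nonneg)
    show "(\<integral>\<^sup>+x. ennreal (?f x) \<partial>lborel) < \<infinity>" unfolding nn by simp
  qed auto
  show "(\<integral>x. ?f x \<partial>lborel) = 2 * sqrt c"
    by (subst integral_eq_nn_integral) (use c nn in auto)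
qed

context halasz_kernel begin

text \<open>The logarithm of the transform belonging to \<open>g\<^sub>1\<close>:
  \<open>exp (kh s)\<close> is to \<open>\<psi>1\<close> what \<open>\<Phi> s\<close> is to
  \<open>\<psi>\<close>.\<close>

definition kh where "kh s = (\<integral>v. exp (- s * of_real v) * k1 v \<partial>Q)"

lemma twist_int:
  assumes s: "0 < Re s" "Re s \<le> 1"
  shows "integrable Q (\<lambda>v. exp (- s * of_real v) * k1 v)"
proof (rule Bochner_Integration.integrable_bound[OF zeta[OF s]])
  note [measurable_cong] = loc_kernelD(2)[OF k1]
  note [measurable] = loc_kernelD(3)[OF k1]
  show "(\<lambda>v. exp (- s * of_real v) * k1 v) \<in> borel_measurable Q" by measurable
qed (auto simp: norm_mult)

text \<open>The multiplier \<open>c\<close> covers \<open>\<gamma>1\<close> and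
  \<open>\<gamma>34\<close> at once. Scaling the kernel produces the power
  \<open>exp (c * kh s)\<close> directly, so no branch of a complex power has to be chosen.\<close>

lemma \<gamma>_lap:
  assumes s: "0 < Re s" "Re s \<le> 1"
  shows "integrable lborel (\<lambda>y. exp (- s * of_real y) * xconv Q (\<lambda>v. c * k1 v) (edk \<beta>) y)"
    and "lap (xconv Q (\<lambda>v. c * k1 v) (edk \<beta>)) s = exp (c * kh s) / (\<beta> + s)"
proof -
  have c: "loc_kernel Q (\<lambda>v. c * k1 v)"
    using loc_kernel_mult_ctns[OF k1, of "\<lambda>_. c"] by simp
  have ck: "loc_kernel Q (\<lambda>v. exp (- s * of_real v) * (c * k1 v))"
    by (rule loc_kernel_mult_ctns[OF c continuous_on_exp_of_real])
  have eq: "(\<lambda>y. exp (- s * of_real y) * xconv Q (\<lambda>v. c * k1 v) (edk \<beta>) y)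
     = xconv Q (\<lambda>v. exp (- s * of_real v) * (c * k1 v)) (edk (\<beta> + s))"
    by (rule ext, rule sym) (rule xconv_twist[OF c loc_bdd_edk, of s \<beta>, unfolded edk_twist])
  have eq2: "(\<lambda>v. exp (- s * of_real v) * (c * k1 v)) = (\<lambda>v. c * (exp (- s * of_real v) * k1 v))"
    by (simp add: fun_eq_iff mult_ac)
  have int: "integrable Q (\<lambda>v. exp (- s * of_real v) * (c * k1 v))"
    unfolding eq2 using twist_int[OF s] by (rule integrable_mult_right)
  have re: "0 < Re (\<beta> + s)" using s \<beta> by simp
  note * = xconv_integral[OF ck loc_bdd_edk int edk_integral(1)[OF re]]
  show "integrable lborel (\<lambda>y. exp (- s * of_real y) * xconv Q (\<lambda>v. c * k1 v) (edk \<beta>) y)"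
    unfolding eq by (rule *(1))
  have "(\<integral>v. exp (- s * of_real v) * (c * k1 v) \<partial>Q) = c * kh s"
    unfolding eq2 kh_def by (rule integral_mult_right_zero)
  then show "lap (xconv Q (\<lambda>v. c * k1 v) (edk \<beta>)) s = exp (c * kh s) / (\<beta> + s)"
    unfolding lap_def eq *(2) edk_integral(2)[OF re] by simp
qed

lemma conv_edk_lap:
  assumes s: "0 < Re s" and g: "loc_bdd g" and int: "integrable lborel (\<lambda>y. exp (- s * of_real y) * g y)"
  shows "integrable lborel (\<lambda>y. exp (- s * of_real y) * lconv lborel (edk \<beta>) g y)"
    and "lap (lconv lborel (edk \<beta>) g) s = lap g s / (\<beta> + s)"
proof -
  have eq: "(\<lambda>y. exp (- s * of_real y) * lconv lborel (edk \<beta>) g y)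
     = lconv lborel (edk (\<beta> + s)) (\<lambda>y. exp (- s * of_real y) * g y)"
    using lconv_pow_twist[where m=lborel and s=s and k="edk \<beta>" and n=1 and f=g]
    by (simp only: One_nat_def funpow.simps o_apply id_apply edk_twist)
  have re: "0 < Re (\<beta> + s)" using s \<beta> by simp
  note * = lconv_integral[OF loc_kernel_lborel[OF loc_bdd_edk] loc_bdd_mult_ctns[OF g continuous_on_exp_of_real]
     edk_integral(1)[OF re] int]
  show "integrable lborel (\<lambda>y. exp (- s * of_real y) * lconv lborel (edk \<beta>) g y)"
    unfolding eq by (rule *(1))
  show "lap (lconv lborel (edk \<beta>) g) s = lap g s / (\<beta> + s)"
    unfolding lap_def eq *(2) edk_integral(2)[OF re] by simp
qed

lemma \<psi>1_lap:
  assumes s: "0 < Re s" "Re s \<le> 1"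
  shows "integrable lborel (\<lambda>y. exp (- s * of_real y) * \<psi>1 y)" "lap \<psi>1 s = exp (kh s) / (\<beta> + s)\<^sup>2"
proof -
  have "integrable lborel (\<lambda>y. exp (- s * of_real y) * \<gamma>1 y)" "lap \<gamma>1 s = exp (kh s) / (\<beta> + s)"
    using \<gamma>_lap[OF s, of 1] by (simp_all add: \<gamma>1_def)
  then show "integrable lborel (\<lambda>y. exp (- s * of_real y) * \<psi>1 y)" "lap \<psi>1 s = exp (kh s) / (\<beta> + s)\<^sup>2"
    using conv_edk_lap[OF s(1) loc_bdd_\<gamma>1] by (simp_all add: \<psi>1_def power2_eq_square)
qed

lemma \<theta>_lap:
  assumes s: "0 < Re s" "Re s \<le> 1"
  shows "integrable lborel (\<lambda>y. exp (- s * of_real y) * \<theta> u y)"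
    and "lap (\<theta> u) s = (1 - exp (- (of_real u * s))) * (exp (kh s) / (\<beta> + s)\<^sup>2)"
proof -
  let ?p = "\<lambda>y. exp (- s * of_real y) * \<psi>1 y"
  note p = \<psi>1_lap[OF s]
  have e: "exp (- (s * of_real y)) = exp (- (of_real u * s)) * exp (- (s * (of_real y - of_real u)))" for y
    unfolding exp_add[symmetric] by (simp add: algebra_simps)
  have eq: "(\<lambda>y. exp (- s * of_real y) * \<theta> u y) = (\<lambda>y. ?p y - exp (- (of_real u * s)) * ?p (y - u))"
  proof
    fix y
    show "exp (- s * of_real y) * \<theta> u y = ?p y - exp (- (of_real u * s)) * ?p (y - u)"
      unfolding \<theta>_def right_diff_distrib by (simp add: e[of y])
  qed
  have p': "integrable lborel (\<lambda>y. exp (- (of_real u * s)) * ?p (y - u))"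
    by (intro integrable_mult_right integrable_lborel_shift p(1))
  show "integrable lborel (\<lambda>y. exp (- s * of_real y) * \<theta> u y)"
    unfolding eq by (intro Bochner_Integration.integrable_diff p(1) p')
  have "lap (\<theta> u) s = lap \<psi>1 s - exp (- (of_real u * s)) * (\<integral>y. ?p (y - u) \<partial>lborel)"
    unfolding lap_def eq using p(1) p' by (simp only: Bochner_Integration.integral_diff integral_mult_right_zero)
  also have "(\<integral>y. ?p (y - u) \<partial>lborel) = lap \<psi>1 s" unfolding lap_def by (rule integral_lborel_shift)
  finally show "lap (\<theta> u) s = (1 - exp (- (of_real u * s))) * (exp (kh s) / (\<beta> + s)\<^sup>2)"
    unfolding p(2)[symmetric] left_diff_distrib mult_1_left .
qed

lemma norm_exp_real_twist: "norm (exp (- complex_of_real \<sigma> * of_real y) * f y) = exp (- \<sigma> * y) * norm (f y)"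
  by (simp add: norm_mult)

lemma twist_bdd:
  assumes \<sigma>: "0 < \<sigma>" and f: "loc_bdd f" "\<And>y. norm (f y) \<le> M"
  shows "norm (exp (- complex_of_real \<sigma> * of_real y) * f y) \<le> M * edk \<sigma> y"
  using loc_bddD(2)[OF f(1), of y] f(2)[of y]
  by (cases "y < 0") (auto simp: norm_mult edk_neg edk_nonneg mult.commute)

text \<open>The Fourier inequality together with \<open>norm (\<gamma>1 y) \<le> D\<close>; the
  squared damping has integral \<open>1 / (2 * \<sigma>)\<close>.\<close>

lemma transform_L2_bound:
  assumes \<sigma>: "0 < \<sigma>" "\<sigma> \<le> 1"
  shows "integrable lborel (\<lambda>t. (norm (exp (kh (Complex \<sigma> t)) / (\<beta> + Complex \<sigma> t)))\<^sup>2)"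
    and "(\<integral>t. (norm (exp (kh (Complex \<sigma> t)) / (\<beta> + Complex \<sigma> t)))\<^sup>2 \<partial>lborel) \<le> pi * D\<^sup>2 / \<sigma>"
proof -
  let ?f = "\<lambda>y. exp (- complex_of_real \<sigma> * of_real y) * \<gamma>1 y"
  have eq: "fourier ?f t = exp (kh (Complex \<sigma> t)) / (\<beta> + Complex \<sigma> t)" for t
  proof -
    have "lap \<gamma>1 (Complex \<sigma> t) = exp (kh (Complex \<sigma> t)) / (\<beta> + Complex \<sigma> t)"
      using \<gamma>_lap(2)[of "Complex \<sigma> t" 1] \<sigma> by (simp add: \<gamma>1_def)
    then show ?thesis by (simp only: fourier_lap)
  qed
  have f: "integrable lborel ?f" using \<gamma>_lap(1)[of "complex_of_real \<sigma>" 1] \<sigma> by (simp add: \<gamma>1_def)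
  have [measurable]: "\<gamma>1 \<in> borel_measurable borel" by (rule loc_bddD(1)[OF loc_bdd_\<gamma>1])
  have bd: "(norm (?f y))\<^sup>2 \<le> D\<^sup>2 * edk (2 * \<sigma>) y" for y
  proof -
    have "(norm (?f y))\<^sup>2 \<le> (D * edk \<sigma> y)\<^sup>2"
      by (intro power_mono twist_bdd \<sigma> loc_bdd_\<gamma>1 \<gamma>1_le) auto
    also have "\<dots> = D\<^sup>2 * edk (2 * \<sigma>) y"
      by (auto simp: edk_def indicator_def power_mult_distrib exp_double[symmetric] mult_ac)
    finally show ?thesis .
  qed
  have i: "integrable lborel (\<lambda>y. D\<^sup>2 * edk (2 * \<sigma>) y)"
    using \<sigma> by (intro integrable_mult_right edk_integrable_real) auto
  have f2: "integrable lborel (\<lambda>y. (norm (?f y))\<^sup>2)"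
  proof (rule bounded_integrable_square[OF f])
    fix y
    have "norm (?f y) \<le> D * edk \<sigma> y" by (intro twist_bdd \<sigma> loc_bdd_\<gamma>1 \<gamma>1_le)
    also have "\<dots> \<le> D * 1"
      using \<sigma> majorant_const_nonneg by (intro mult_left_mono) (auto simp: edk_def indicator_def)
    finally show "norm (?f y) \<le> D" by simp
  qed
  note L = fourier_L2[OF f f2]
  show "integrable lborel (\<lambda>t. (norm (exp (kh (Complex \<sigma> t)) / (\<beta> + Complex \<sigma> t)))\<^sup>2)"
    using L(1) unfolding eq .
  have "(\<integral>y. (norm (?f y))\<^sup>2 \<partial>lborel) \<le> (\<integral>y. D\<^sup>2 * edk (2 * \<sigma>) y \<partial>lborel)"
    by (rule integral_mono[OF f2 i bd])
  also have "\<dots> = D\<^sup>2 / (2 * \<sigma>)" using \<sigma> by (simp add: edk_integral_real)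
  finally have "2 * pi * (\<integral>y. (norm (?f y))\<^sup>2 \<partial>lborel) \<le> 2 * pi * (D\<^sup>2 / (2 * \<sigma>))"
    by (intro mult_left_mono) auto
  with L(2) show "(\<integral>t. (norm (exp (kh (Complex \<sigma> t)) / (\<beta> + Complex \<sigma> t)))\<^sup>2 \<partial>lborel) \<le> pi * D\<^sup>2 / \<sigma>"
    unfolding eq by simp
qed

text \<open>The bound \<open>1 / sqrt \<sigma>\<close> instead of \<open>1 / \<sigma>\<close> is the
  gain bought by the exponent \<open>3/4\<close>; it leaves room for a factor that is small compared
  with \<open>1 / sqrt \<sigma>\<close>.\<close>

lemma transform_34_L2_bound:
  assumes \<sigma>: "0 < \<sigma>" "\<sigma> \<le> 1"
  shows "integrable lborel (\<lambda>t. (norm (exp ((3/4) * kh (Complex \<sigma> t)) / (\<beta> + Complex \<sigma> t)))\<^sup>2)"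
    and "(\<integral>t. (norm (exp ((3/4) * kh (Complex \<sigma> t)) / (\<beta> + Complex \<sigma> t)))\<^sup>2 \<partial>lborel) \<le> 6 * pi * (majorant_const (3/4))\<^sup>2 / sqrt \<sigma>"
proof -
  let ?f = "\<lambda>y. exp (- complex_of_real \<sigma> * of_real y) * \<gamma>34 y"
  have eq: "fourier ?f t = exp ((3/4) * kh (Complex \<sigma> t)) / (\<beta> + Complex \<sigma> t)" for t
    unfolding fourier_lap \<gamma>34_def by (rule \<gamma>_lap(2)) (use \<sigma> in auto)
  have f: "integrable lborel ?f" using \<gamma>_lap(1)[of "complex_of_real \<sigma>" "3/4"] \<sigma> by (simp add: \<gamma>34_def)
  have [measurable]: "\<gamma>34 \<in> borel_measurable borel" by (rule loc_bddD(1)[OF loc_bdd_\<gamma>34])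
  have f2: "integrable lborel (\<lambda>y. (norm (?f y))\<^sup>2)"
  proof (rule bounded_integrable_square[OF f])
    fix y
    have "norm (?f y) \<le> majorant_const (3/4) * edk \<sigma> y" by (intro twist_bdd \<sigma> loc_bdd_\<gamma>34 \<gamma>34_bdd)
    also have "\<dots> \<le> majorant_const (3/4) * 1"
      using \<sigma> majorant_const_nonneg by (intro mult_left_mono) (auto simp: edk_def indicator_def)
    finally show "norm (?f y) \<le> majorant_const (3/4)" by simp
  qed
  \<comment> \<open>Split at \<open>1 / \<sigma>\<close>: below it the damping is dropped and the
    power is integrated, above it the power is at most \<open>sqrt \<sigma>\<close> and the damping
    is integrated.\<close>
  let ?g = "\<lambda>y. (majorant_const (3/4))\<^sup>2 * (indicator {0..1 / \<sigma>} y * y powr (-1/2) + sqrt \<sigma> * edk (2 * \<sigma>) y)"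
  have s: "integrable lborel (\<lambda>y. indicator {0..1 / \<sigma>} y * y powr (-1/2))" "integrable lborel (edk (2 * \<sigma>))"
    using sqrt_integral(1)[of "1 / \<sigma>"] edk_integrable_real[of "2 * \<sigma>"] \<sigma> by simp_all
  have g: "integrable lborel ?g" using s by (intro integrable_mult_right Bochner_Integration.integrable_add)
  \<comment> \<open>The origin is excluded, since \<open>y powr (-1/2)\<close> takes the value
    \<open>0\<close> there and gives no bound; a single point is negligible.\<close>
  have bd: "(norm (?f y))\<^sup>2 \<le> ?g y" if "y \<noteq> 0" for y
  proof (cases "y < 0")
    case True
    then show ?thesis using loc_bddD(2)[OF loc_bdd_\<gamma>34 True] \<sigma> by (simp add: edk_real_nonneg)
  next
    case False
    then have y: "0 < y" using that by simp
    have "(norm (?f y))\<^sup>2 = exp (- (2 * \<sigma> * y)) * (norm (\<gamma>34 y))\<^sup>2"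
      by (simp add: norm_mult power_mult_distrib exp_double[symmetric])
    also have "\<dots> \<le> exp (- (2 * \<sigma> * y)) * ((majorant_const (3/4))\<^sup>2 * y powr (-1/2))"
      using \<gamma>34_le[OF y] by (intro mult_left_mono) auto
    also have "\<dots> \<le> ?g y"
    proof (cases "y \<le> 1 / \<sigma>")
      case True
      have "exp (- (2 * \<sigma> * y)) * y powr (-1/2) \<le> 1 * y powr (-1/2)" using \<sigma> y by (intro mult_right_mono) auto
      also have "\<dots> \<le> indicator {0..1 / \<sigma>} y * y powr (-1/2) + sqrt \<sigma> * edk (2 * \<sigma>) y"
        using True y \<sigma> by (simp add: edk_real_nonneg)
      finally have "(majorant_const (3/4))\<^sup>2 * (exp (- (2 * \<sigma> * y)) * y powr (-1/2)) \<le> ?g y"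
        by (rule mult_left_mono) simp
      then show ?thesis by (simp only: mult.left_commute)
    next
      case False
      have "y powr (-1/2) \<le> (1 / \<sigma>) powr (-1/2)" using False \<sigma> by (intro powr_mono2') auto
      also have "\<dots> = sqrt \<sigma>" using \<sigma> by (simp add: powr_divide powr_minus powr_half_sqrt divide_simps)
      finally have "exp (- (2 * \<sigma> * y)) * y powr (-1/2) \<le> edk (2 * \<sigma>) y * sqrt \<sigma>"
        using y by (simp add: edk_nonneg)
      also have "\<dots> \<le> indicator {0..1 / \<sigma>} y * y powr (-1/2) + sqrt \<sigma> * edk (2 * \<sigma>) y" by simp
      finally have "(majorant_const (3/4))\<^sup>2 * (exp (- (2 * \<sigma> * y)) * y powr (-1/2)) \<le> ?g y"
        by (rule mult_left_mono) simp
      then show ?thesis by (simp only: mult.left_commute)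
    qed
    finally show ?thesis .
  qed
  note L = fourier_L2[OF f f2]
  show "integrable lborel (\<lambda>t. (norm (exp ((3/4) * kh (Complex \<sigma> t)) / (\<beta> + Complex \<sigma> t)))\<^sup>2)"
    using L(1) unfolding eq .
  have "(\<integral>y. (norm (?f y))\<^sup>2 \<partial>lborel) \<le> (\<integral>y. ?g y \<partial>lborel)"
  proof (rule integral_mono_AE[OF f2 g])
    show "AE y in lborel. (norm (?f y))\<^sup>2 \<le> ?g y"
      using AE_lborel_singleton[of 0] by eventually_elim (rule bd)
  qed
  also have "\<dots> = (majorant_const (3/4))\<^sup>2 * (2 * sqrt (1 / \<sigma>) + sqrt \<sigma> * (1 / (2 * \<sigma>)))"
    using s sqrt_integral(2)[of "1 / \<sigma>"] edk_integral_real[of "2 * \<sigma>"] \<sigma> by simp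
  also have "sqrt \<sigma> * (1 / (2 * \<sigma>)) = (1/2) * (1 / sqrt \<sigma>)"
    using \<sigma> by (simp add: field_simps)
  also have "2 * sqrt (1 / \<sigma>) + (1/2) * (1 / sqrt \<sigma>) \<le> 3 / sqrt \<sigma>"
    using \<sigma> by (simp add: real_sqrt_divide field_simps)
  finally have "(\<integral>y. (norm (?f y))\<^sup>2 \<partial>lborel) \<le> (majorant_const (3/4))\<^sup>2 * (3 / sqrt \<sigma>)"
    by (simp add: mult_left_mono)
  then have "2 * pi * (\<integral>y. (norm (?f y))\<^sup>2 \<partial>lborel) \<le> 2 * pi * ((majorant_const (3/4))\<^sup>2 * (3 / sqrt \<sigma>))"
    by (intro mult_left_mono) auto
  with L(2) show "(\<integral>t. (norm (exp ((3/4) * kh (Complex \<sigma> t)) / (\<beta> + Complex \<sigma> t)))\<^sup>2 \<partial>lborel) \<le> 6 * pi * (majorant_const (3/4))\<^sup>2 / sqrt \<sigma>"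
    unfolding eq by simp
qed

lemma \<theta>_continuous: "continuous_on UNIV (\<theta> u)"
  by (rule continuous_on_lipschitz_shift) (rule \<theta>_lip)

lemma norm_Complex_ge_Re: "\<bar>\<sigma>\<bar> \<le> norm (Complex \<sigma> t)" and norm_Complex_ge_Im: "\<bar>t\<bar> \<le> norm (Complex \<sigma> t)"
  using abs_Re_le_cmod[of "Complex \<sigma> t"] abs_Im_le_cmod[of "Complex \<sigma> t"] by auto

text \<open>Plancherel moves the question to the line. The first term of the bound comes from
  \<open>|t| > T\<close>, the second from \<open>|t| \<le> T\<close>. The hypothesis
  \<open>small\<close> is set up so that its square root bounds the square of the difference factor
  times \<open>|exp kh|^(1/2)\<close>.\<close>

lemma \<theta>_L2:
  assumes \<sigma>: "0 < \<sigma>" "\<sigma> \<le> 1" and u: "0 \<le> u" and T: "2 * \<bar>Im \<beta>\<bar> \<le> T" "0 < T" and W: "0 \<le> W"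
    and small: "\<And>t. \<bar>t\<bar> \<le> T \<Longrightarrow>
      (norm (1 - exp (- (of_real u * Complex \<sigma> t))))^4 * norm (exp (kh (Complex \<sigma> t))) \<le> W\<^sup>2 / \<sigma>"
  shows "integrable lborel (\<lambda>y. (exp (- \<sigma> * y) * norm (\<theta> u y))\<^sup>2)"
    and "(\<integral>y. (exp (- \<sigma> * y) * norm (\<theta> u y))\<^sup>2 \<partial>lborel) \<le> (8 * D\<^sup>2 / T\<^sup>2 + 3 * (majorant_const (3/4))\<^sup>2 * W) / \<sigma>"
proof -
  let ?f = "\<lambda>y. exp (- complex_of_real \<sigma> * of_real y) * \<theta> u y"
  let ?s = "\<lambda>t. Complex \<sigma> t"
  let ?A = "\<lambda>t. (norm (exp (kh (?s t)) / (\<beta> + ?s t)))\<^sup>2"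
  let ?B = "\<lambda>t. (norm (exp ((3/4) * kh (?s t)) / (\<beta> + ?s t)))\<^sup>2"
  let ?F = "\<lambda>t. (1 - exp (- (of_real u * ?s t))) * (exp (kh (?s t)) / (\<beta> + ?s t)\<^sup>2)"
  have eq: "fourier ?f t = ?F t" for t
    unfolding fourier_lap by (rule \<theta>_lap(2)) (use \<sigma> in auto)
  have f: "integrable lborel ?f" by (rule \<theta>_lap(1)) (use \<sigma> in auto)
  have cont: "continuous_on UNIV ?f"
    by (intro continuous_intros \<theta>_continuous)
  have bd: "norm (?f y) \<le> 2 * D" for y
  proof -
    have "norm (?f y) \<le> (2 * D) * edk \<sigma> y" by (intro twist_bdd \<sigma> loc_bdd_\<theta> u \<theta>_le)
    also have "\<dots> \<le> (2 * D) * 1"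
      using \<sigma> majorant_const_nonneg by (intro mult_left_mono) (auto simp: edk_def indicator_def)
    finally show ?thesis by simp
  qed
  have nf: "norm (?f y) = exp (- \<sigma> * y) * norm (\<theta> u y)" for y by (rule norm_exp_real_twist)
  have f2: "integrable lborel (\<lambda>y. (norm (?f y))\<^sup>2)" by (rule bounded_integrable_square[OF f bd])
  then show "integrable lborel (\<lambda>y. (exp (- \<sigma> * y) * norm (\<theta> u y))\<^sup>2)" unfolding nf .
  have re1: "1 \<le> norm (\<beta> + ?s t)" for t
    using abs_Re_le_cmod[of "\<beta> + ?s t"] \<beta> \<sigma> by simp
  have pw: "(norm (?F t))\<^sup>2 \<le> (16 / T\<^sup>2) * ?A t + (W / sqrt \<sigma>) * ?B t" for t
  proof -
    let ?e = "norm (1 - exp (- (of_real u * ?s t)))" and ?b = "norm (\<beta> + ?s t)"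
    \<comment> \<open>A fourth root of \<open>|exp kh|\<close>: the exponents \<open>1/2\<close>,
      \<open>3/4\<close> and \<open>1\<close> become the integral powers \<open>2\<close>,
      \<open>3\<close> and \<open>4\<close> of \<open>a\<close>.\<close>
    define a where "a = exp (Re (kh (?s t)) / 4)"
    have a1: "norm (exp (kh (?s t))) = a ^ 4"
      by (simp add: a_def exp_of_nat_mult[symmetric])
    have a3: "norm (exp ((3/4) * kh (?s t))) = a ^ 3"
      by (simp add: a_def exp_of_nat_mult[symmetric])
    have e2: "?e \<le> 2"
    proof -
      have "norm (exp (- (of_real u * ?s t))) \<le> 1" using u \<sigma> by simp
      then show ?thesis
        using order_trans[OF norm_triangle_ineq4 add_mono[OF eq_refl[OF norm_one]]] by fastforce
    qed
    have b: "1 \<le> ?b" by (rule re1)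
    have F: "(norm (?F t))\<^sup>2 = ?e\<^sup>2 * (a ^ 4)\<^sup>2 / (?b\<^sup>2)\<^sup>2"
      by (simp only: norm_mult norm_divide norm_power a1 power_mult_distrib power_divide times_divide_eq_right)
    have A: "?A t = (a ^ 4)\<^sup>2 / ?b\<^sup>2" by (simp only: norm_divide a1 power_divide)
    have B: "?B t = (a ^ 3)\<^sup>2 / ?b\<^sup>2" by (simp only: norm_divide a3 power_divide)
    show ?thesis
    proof (cases "\<bar>t\<bar> \<le> T")
      case True
      have "(?e\<^sup>2 * a\<^sup>2)\<^sup>2 = ?e ^ 4 * a ^ 4" by (simp add: power_mult_distrib flip: power_mult)
      also have "\<dots> \<le> W\<^sup>2 / \<sigma>" using small[OF True] unfolding a1 .
      also have "\<dots> = (W / sqrt \<sigma>)\<^sup>2" using \<sigma> by (simp add: power_divide)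
      finally have e: "?e\<^sup>2 * a\<^sup>2 \<le> W / sqrt \<sigma>"
        by (rule power2_le_imp_le) (use W \<sigma> in auto)
      \<comment> \<open>The decisive splitting \<open>a^8 = a^2 * (a^3)^2\<close>: the first factor
        is bounded pointwise, the second in mean square.\<close>
      have "(norm (?F t))\<^sup>2 = (?e\<^sup>2 * a\<^sup>2) * ((a ^ 3)\<^sup>2 / (?b\<^sup>2)\<^sup>2)"
        unfolding F by (simp add: power2_eq_square eval_nat_numeral)
      also have "\<dots> \<le> (W / sqrt \<sigma>) * ((a ^ 3)\<^sup>2 / ?b\<^sup>2)"
      proof (intro mult_mono e divide_left_mono)
        show "?b\<^sup>2 \<le> (?b\<^sup>2)\<^sup>2" using b by (intro self_le_power) (auto simp: one_le_power)
      qed (use b W \<sigma> in auto)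
      also have "\<dots> = (W / sqrt \<sigma>) * ?B t" unfolding B ..
      finally show ?thesis by (smt (verit) T(2) divide_nonneg_nonneg mult_nonneg_nonneg zero_le_power2)
    next
      case False
      \<comment> \<open>High frequencies need no smallness of the transform: the surplus factor
        \<open>1 / ?b^2\<close> gives \<open>4 / T^2\<close>, because
        \<open>T \<ge> 2 * |Im \<beta>|\<close>, and \<open>?e \<le> 2\<close> gives another
        \<open>4\<close>.\<close>
      have "T / 2 \<le> \<bar>t + Im \<beta>\<bar>" using False T by linarith
      also have "\<dots> \<le> ?b" using abs_Im_le_cmod[of "\<beta> + ?s t"] by (simp add: add.commute)
      finally have "(T / 2)\<^sup>2 \<le> ?b\<^sup>2" using T by (intro power_mono) auto
      then have "4 / ?b\<^sup>2 \<le> 4 / (T / 2)\<^sup>2"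
        using T b by (intro divide_left_mono mult_pos_pos zero_less_power) auto
      then have bT: "4 / ?b\<^sup>2 \<le> 16 / T\<^sup>2" by (simp add: power_divide)
      have "?e\<^sup>2 \<le> 2\<^sup>2" using e2 by (intro power_mono) auto
      then have "(norm (?F t))\<^sup>2 \<le> 4 * (a ^ 4)\<^sup>2 / (?b\<^sup>2)\<^sup>2"
        unfolding F by (intro divide_right_mono mult_right_mono) auto
      also have "\<dots> = (4 / ?b\<^sup>2) * ?A t" unfolding A by (simp add: power2_eq_square)
      also have "\<dots> \<le> (16 / T\<^sup>2) * ?A t" using bT by (intro mult_right_mono) auto
      finally show ?thesis using W \<sigma> by (smt (verit) divide_nonneg_nonneg mult_nonneg_nonneg zero_le_power2 real_sqrt_ge_zero)
    qed
  qed
  note a = transform_L2_bound[OF \<sigma>] and b = transform_34_L2_bound[OF \<sigma>]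
  have "2 * pi * (\<integral>y. (norm (?f y))\<^sup>2 \<partial>lborel) = (\<integral>t. (norm (?F t))\<^sup>2 \<partial>lborel)"
    using plancherel[OF f bd cont] unfolding eq by simp
  also have "\<dots> \<le> (\<integral>t. (16 / T\<^sup>2) * ?A t + (W / sqrt \<sigma>) * ?B t \<partial>lborel)"
  proof (rule integral_mono[OF _ _ pw])
    show "integrable lborel (\<lambda>t. (norm (?F t))\<^sup>2)" using fourier_L2(1)[OF f f2] unfolding eq .
  qed (intro Bochner_Integration.integrable_add integrable_mult_right a(1) b(1))
  also have "\<dots> = (16 / T\<^sup>2) * (\<integral>t. ?A t \<partial>lborel) + (W / sqrt \<sigma>) * (\<integral>t. ?B t \<partial>lborel)"
    by (subst Bochner_Integration.integral_add[OF integrable_mult_right[OF a(1)] integrable_mult_right[OF b(1)]])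
       (simp only: integral_mult_right_zero)
  also have "\<dots> \<le> (16 / T\<^sup>2) * (pi * D\<^sup>2 / \<sigma>) + (W / sqrt \<sigma>) * (6 * pi * (majorant_const (3/4))\<^sup>2 / sqrt \<sigma>)"
    using W \<sigma> by (intro add_mono mult_left_mono a(2) b(2)) auto
  also have "\<dots> = 2 * pi * ((8 * D\<^sup>2 / T\<^sup>2 + 3 * (majorant_const (3/4))\<^sup>2 * W) / \<sigma>)"
    using \<sigma> T by (simp add: field_simps)
  finally show "(\<integral>y. (exp (- \<sigma> * y) * norm (\<theta> u y))\<^sup>2 \<partial>lborel) \<le> (8 * D\<^sup>2 / T\<^sup>2 + 3 * (majorant_const (3/4))\<^sup>2 * W) / \<sigma>"
    unfolding nf by (simp only: mult_le_cancel_left_pos[OF mult_pos_pos[OF zero_less_numeral pi_gt_zero]])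
qed

text \<open>From mean square to mean by \<open>x \<le> \<rho> / 2 + x^2 / (2 * \<rho>)\<close>, a
  form of Cauchy--Schwarz with a free parameter. On \<open>[0, y]\<close> the damping at
  \<open>\<sigma> = 1 / y\<close> is at least \<open>exp (- 1)\<close>, whence the factor
  \<open>exp 2\<close>.\<close>

lemma \<theta>_avg:
  assumes y: "1 \<le> y" and u: "0 \<le> u" and \<rho>: "0 < \<rho>"
    and int: "integrable lborel (\<lambda>v. (exp (- (1 / y) * v) * norm (\<theta> u v))\<^sup>2)"
  shows "(\<integral>v. indicator {..y} v * norm (\<theta> u v) \<partial>lborel)
    \<le> y * \<rho> / 2 + exp 2 / (2 * \<rho>) * (\<integral>v. (exp (- (1 / y) * v) * norm (\<theta> u v))\<^sup>2 \<partial>lborel)"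
proof -
  let ?g = "\<lambda>v. (exp (- (1 / y) * v) * norm (\<theta> u v))\<^sup>2"
  have i0: "integrable lborel (\<lambda>v. indicator {0..y} v * (\<rho> / 2))"
    by (intro integrable_mult_left integrable_real_indicator) (auto simp: emeasure_lborel_Icc_eq)
  have i1: "integrable lborel (\<lambda>v. exp 2 / (2 * \<rho>) * ?g v)" using int by (rule integrable_mult_right)
  have "(\<integral>v. indicator {..y} v * norm (\<theta> u v) \<partial>lborel)
    \<le> (\<integral>v. indicator {0..y} v * (\<rho> / 2) + exp 2 / (2 * \<rho>) * ?g v \<partial>lborel)"
  proof (rule integral_mono')
    show "integrable lborel (\<lambda>v. indicator {0..y} v * (\<rho> / 2) + exp 2 / (2 * \<rho>) * ?g v)"
      using i0 i1 by (rule Bochner_Integration.integrable_add)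
    show "indicator {..y} v * norm (\<theta> u v) \<le> indicator {0..y} v * (\<rho> / 2) + exp 2 / (2 * \<rho>) * ?g v" for v
    proof (cases "0 \<le> v \<and> v \<le> y")
      case True
      have "v * 2 / y \<le> 2" using True y by (simp add: divide_le_eq)
      then have "exp (-2) \<le> exp (- (1 / y) * v * 2)" unfolding exp_le_cancel_iff by simp
      then have "exp (-2) * (norm (\<theta> u v))\<^sup>2 \<le> ?g v"
        by (simp add: power_mult_distrib exp_double[symmetric] mult_right_mono mult.commute)
      then have "(norm (\<theta> u v))\<^sup>2 \<le> exp 2 * ?g v" by (simp add: exp_minus field_simps)
      then have "(norm (\<theta> u v))\<^sup>2 / (2 * \<rho>) \<le> exp 2 / (2 * \<rho>) * ?g v" using \<rho> by (simp add: divide_right_mono)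
      moreover have "norm (\<theta> u v) \<le> \<rho> / 2 + (norm (\<theta> u v))\<^sup>2 / (2 * \<rho>)"
        using \<rho> zero_le_power2[of "norm (\<theta> u v) - \<rho>"] by (simp add: field_simps power2_eq_square)
      ultimately show ?thesis using True by simp
    next
      case False
      then show ?thesis using loc_bddD(2)[OF loc_bdd_\<theta>[OF u], of v] \<rho> by (cases "v < 0") auto
    qed
  qed (use \<rho> in auto)
  also have "\<dots> = y * \<rho> / 2 + exp 2 / (2 * \<rho>) * (\<integral>v. ?g v \<partial>lborel)"
    using y by (subst Bochner_Integration.integral_add[OF i0 i1]) (simp only: integral_mult_right_zero, simp)
  finally show ?thesis .
qed

text \<open>The parameters form a chain in which each depends only on earlier ones:
  \<open>\<eta>\<close> (smoothing), \<open>\<rho>\<close> (mean square to mean),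
  \<open>\<mu>\<close> (mean square), \<open>T\<close> (high frequencies), \<open>W\<close> (low
  frequencies), and finally \<open>\<epsilon>\<close>. The hypothesis is invoked for a single pair,
  \<open>T\<close> and \<open>W^2 / 32\<close>, and \<open>\<sigma> = 1 / y\<close> links it to
  large \<open>y\<close>.\<close>

theorem slow_oscillation:
  assumes c0: "0 \<le> c0"
    and hyp: "\<And>T e. 0 < e \<Longrightarrow> \<exists>\<sigma>0>0. \<forall>\<sigma> t. 0 < \<sigma> \<longrightarrow> \<sigma> \<le> \<sigma>0 \<longrightarrow> \<bar>t\<bar> \<le> T \<longrightarrow>
      norm (exp (kh (Complex \<sigma> t))) \<le> c0 / norm (Complex \<sigma> t) + e / \<sigma>"
    and \<delta>: "0 < \<delta>"
  shows "\<exists>\<epsilon>>0. \<exists>y0. \<forall>y\<ge>y0. \<forall>u. 0 \<le> u \<longrightarrow> u \<le> \<epsilon> * y \<longrightarrow> norm (\<psi>1 y - \<psi>1 (y - u)) \<le> \<delta>"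
proof -
  \<comment> \<open>Five errors of size \<open>d * y\<close>: two from the mean of
    \<open>\<theta> u\<close>, one from the smoothing, one from \<open>4 * D\<close>, and one from
    the term \<open>u * \<psi>1 (y - u)\<close> that appears on passing to
    \<open>y * (\<psi>1 y - \<psi>1 (y - u))\<close>.\<close>
  define d where "d = \<delta> / 5"
  have d: "0 < d" using \<delta> by (simp add: d_def)
  \<comment> \<open>The \<open>+ 1\<close> in the denominators below allows the coefficients to
    vanish.\<close>
  have frac: "a * (e / (a + 1)) \<le> e" if "0 \<le> a" "0 < e" for a e :: real
    using that by (simp add: field_simps)
  define \<eta> where "\<eta> = min 1 (d / (4 * \<Lambda> * C1 + 1))"
  have LC: "0 \<le> 4 * \<Lambda> * C1" using \<Lambda>_nonneg C1_nonneg by simp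
  have "0 < 4 * \<Lambda> * C1 + 1" using LC by linarith
  then have \<eta>: "0 < \<eta>" "\<eta> \<le> 1" using d by (simp_all add: \<eta>_def)
  have \<eta>d: "4 * \<Lambda> * C1 * \<eta> \<le> d"
    using mult_left_mono[of \<eta> "d / (4 * \<Lambda> * C1 + 1)", OF _ LC] frac[OF LC d] by (auto simp: \<eta>_def)
  define A where "A = exp 1 * C1 / \<eta>"
  have A: "0 \<le> A" using C1_nonneg \<eta> by (simp add: A_def)
  define \<rho> where "\<rho> = d / (A + 1)"
  have \<rho>: "0 < \<rho>" using A d by (simp add: \<rho>_def)
  have A\<rho>: "A * \<rho> \<le> d" using frac[OF A d] by (simp add: \<rho>_def)
  define G where "G = A * (exp 2 / (2 * \<rho>))"
  have G: "0 \<le> G" using A \<rho> by (simp add: G_def)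
  define \<mu> where "\<mu> = d / (G + 1)"
  have \<mu>: "0 < \<mu>" using G d by (simp add: \<mu>_def)
  have G\<mu>: "G * \<mu> \<le> d" using frac[OF G d] by (simp add: \<mu>_def)
  define T where "T = 2 * \<bar>Im \<beta>\<bar> + 1 + 16 * D\<^sup>2 / \<mu>"
  have T: "2 * \<bar>Im \<beta>\<bar> \<le> T" "1 \<le> T" "16 * D\<^sup>2 / \<mu> \<le> T" using \<mu> by (auto simp: T_def)
  have T\<mu>: "8 * D\<^sup>2 / T\<^sup>2 \<le> \<mu> / 2"
  proof -
    have "16 * D\<^sup>2 \<le> T * \<mu>" using T(3) \<mu> by (simp add: field_simps)
    also have "\<dots> \<le> T\<^sup>2 * \<mu>" using T(2) \<mu> by (intro mult_right_mono) (auto simp: power2_eq_square)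
    finally show ?thesis using T(2) by (simp add: field_simps)
  qed
  let ?h = "3 * (majorant_const (3/4))\<^sup>2"
  define W where "W = (\<mu> / 2) / (?h + 1)"
  have W: "0 < W" using \<mu> by (simp add: W_def add_nonneg_pos)
  have W\<mu>: "?h * W \<le> \<mu> / 2" unfolding W_def by (rule frac) (use \<mu> in auto)
  \<comment> \<open>\<open>32 = 2 * 16\<close>: the fourth power of the difference factor is at most
    \<open>16\<close>, and half of \<open>W^2 / \<sigma>\<close> is reserved for the pole.\<close>
  obtain \<sigma>0 where \<sigma>0: "0 < \<sigma>0" and hyp': "\<And>\<sigma> t. 0 < \<sigma> \<Longrightarrow> \<sigma> \<le> \<sigma>0 \<Longrightarrow> \<bar>t\<bar> \<le> T \<Longrightarrow>
      norm (exp (kh (Complex \<sigma> t))) \<le> c0 / norm (Complex \<sigma> t) + (W\<^sup>2 / 32) / \<sigma>"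
    using hyp[of "W\<^sup>2 / 32" T] W by auto
  \<comment> \<open>The first bound absorbs the pole contribution \<open>8 * c0 * u\<close>, the
    second the term \<open>u * \<psi>1 (y - u)\<close>.\<close>
  define \<epsilon> where "\<epsilon> = min (W\<^sup>2 / 2 / (8 * c0 + 1)) (d / (D + 1))"
  have \<epsilon>: "0 < \<epsilon>" using W c0 d majorant_const_nonneg[of 1] by (auto simp: \<epsilon>_def)
  have \<epsilon>W: "8 * c0 * \<epsilon> \<le> W\<^sup>2 / 2"
    using mult_left_mono[of \<epsilon> "W\<^sup>2 / 2 / (8 * c0 + 1)" "8 * c0"] frac[of "8 * c0" "W\<^sup>2 / 2"] W c0 by (auto simp: \<epsilon>_def)
  have \<epsilon>D: "D * \<epsilon> \<le> d"
    using mult_left_mono[of \<epsilon> "d / (D + 1)" D] frac[of D d] d majorant_const_nonneg[of 1] by (auto simp: \<epsilon>_def)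
  define y0 where "y0 = max 1 (max (1 / \<sigma>0) (4 * D / d))"
  show ?thesis
  proof (rule exI[of _ \<epsilon>], rule conjI[OF \<epsilon>], rule exI[of _ y0], intro allI impI)
    fix y u assume yy: "y0 \<le> y" and u: "0 \<le> u" "u \<le> \<epsilon> * y"
    have y: "1 \<le> y" "1 / y \<le> \<sigma>0" "4 * D \<le> d * y"
    proof -
      show 1: "1 \<le> y" using yy by (simp add: y0_def)
      have "1 / \<sigma>0 \<le> y" using yy by (simp add: y0_def)
      then show "1 / y \<le> \<sigma>0" using \<sigma>0 1 by (simp add: field_simps)
      have "4 * D / d \<le> y" using yy by (simp add: y0_def)
      then show "4 * D \<le> d * y" using d by (simp add: field_simps)
    qed
    define \<sigma> where "\<sigma> = 1 / y"
    have \<sigma>: "0 < \<sigma>" "\<sigma> \<le> 1" "\<sigma> \<le> \<sigma>0" "y = 1 / \<sigma>" using y by (auto simp: \<sigma>_def)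
    have small: "(norm (1 - exp (- (of_real u * Complex \<sigma> t))))^4 * norm (exp (kh (Complex \<sigma> t))) \<le> W\<^sup>2 / \<sigma>"
      if t: "\<bar>t\<bar> \<le> T" for t
    proof -
      let ?e = "norm (1 - exp (- (of_real u * Complex \<sigma> t)))" and ?n = "norm (Complex \<sigma> t)"
      have n: "0 < ?n" using norm_Complex_ge_Re[of \<sigma> t] \<sigma> by linarith
      have e2: "?e \<le> 2"
      proof -
        have "norm (exp (- (of_real u * Complex \<sigma> t))) \<le> 1" using u \<sigma> by simp
        then show ?thesis
          using order_trans[OF norm_triangle_ineq4 add_mono[OF eq_refl[OF norm_one]]] by fastforce
      qed
      have "?e \<le> norm (of_real u * Complex \<sigma> t)" using u \<sigma> by (intro norm_one_minus_exp_le) auto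
      then have e1: "?e \<le> u * ?n" using u by (simp add: norm_mult)
      have e4: "?e ^ 4 \<le> 16" using power_mono[OF e2, of 4] by simp
      \<comment> \<open>Three of the four factors are bounded by \<open>2\<close> and the remaining
        one by \<open>u * ?n\<close>, which cancels the pole \<open>c0 / ?n\<close>.\<close>
      have e3: "?e ^ 4 \<le> 8 * (u * ?n)"
      proof -
        have "?e ^ 3 * ?e \<le> 2 ^ 3 * (u * ?n)" by (intro mult_mono power_mono e2 e1) auto
        then show ?thesis by (simp add: eval_nat_numeral mult_ac)
      qed
      have "?e ^ 4 * norm (exp (kh (Complex \<sigma> t))) \<le> ?e ^ 4 * (c0 / ?n + (W\<^sup>2 / 32) / \<sigma>)"
        using hyp'[OF \<sigma>(1,3) t] by (intro mult_left_mono) auto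
      also have "\<dots> = ?e ^ 4 * (c0 / ?n) + ?e ^ 4 * ((W\<^sup>2 / 32) / \<sigma>)" by (simp add: distrib_left)
      also have "\<dots> \<le> 8 * (u * ?n) * (c0 / ?n) + 16 * ((W\<^sup>2 / 32) / \<sigma>)"
        using c0 n \<sigma> by (intro add_mono mult_right_mono e3 e4) auto
      also have "\<dots> = 8 * c0 * u + W\<^sup>2 / 2 / \<sigma>" using n by simp
      also have "8 * c0 * u \<le> 8 * c0 * (\<epsilon> * y)" using c0 u by (intro mult_left_mono) auto
      also have "\<dots> = 8 * c0 * \<epsilon> / \<sigma>" unfolding \<sigma>(4) by simp
      also have "\<dots> \<le> W\<^sup>2 / 2 / \<sigma>" using \<epsilon>W \<sigma> by (intro divide_right_mono) auto
      finally show ?thesis by (simp add: add_divide_distrib[symmetric])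
    qed
    have T0: "0 < T" using T by simp
    note L2 = \<theta>_L2[OF \<sigma>(1,2) u(1) T(1) T0 less_imp_le[OF W] small]
    have "(8 * D\<^sup>2 / T\<^sup>2 + ?h * W) / \<sigma> \<le> \<mu> / \<sigma>"
      using T\<mu> W\<mu> \<sigma> by (intro divide_right_mono) auto
    then have I2: "(\<integral>v. (exp (- \<sigma> * v) * norm (\<theta> u v))\<^sup>2 \<partial>lborel) \<le> \<mu> * y" using L2(2) \<sigma>(4) by simp
    let ?I = "\<integral>v. indicator {..y} v * norm (\<theta> u v) \<partial>lborel"
    have "?I \<le> y * \<rho> / 2 + exp 2 / (2 * \<rho>) * (\<integral>v. (exp (- \<sigma> * v) * norm (\<theta> u v))\<^sup>2 \<partial>lborel)"
      unfolding \<sigma>_def by (rule \<theta>_avg[OF y(1) u(1) \<rho>]) (use L2(1) in \<open>simp only: \<sigma>_def\<close>)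
    also have "\<dots> \<le> y * \<rho> / 2 + exp 2 / (2 * \<rho>) * (\<mu> * y)"
      using I2 \<rho> by (intro add_left_mono mult_left_mono) auto
    finally have "A * ?I \<le> A * (y * \<rho> / 2 + exp 2 / (2 * \<rho>) * (\<mu> * y))" using A by (rule mult_left_mono)
    also have "\<dots> = y * (A * \<rho>) / 2 + y * (G * \<mu>)" by (simp add: G_def field_simps)
    also have "\<dots> \<le> y * d + y * d"
    proof -
      have "y * (A * \<rho>) / 2 \<le> y * (A * \<rho>)" using y A \<rho> by simp
      then show ?thesis using mult_left_mono[OF A\<rho>, of y] mult_left_mono[OF G\<mu>, of y] y by linarith
    qed
    finally have AI: "A * ?I \<le> 2 * d * y" by simp
    have "2 * \<Lambda> * \<eta> * C1 * (1 + y) \<le> 2 * \<Lambda> * \<eta> * C1 * (2 * y)"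
      using y \<Lambda>_nonneg \<eta> C1_nonneg by (intro mult_left_mono) auto
    also have "\<dots> = (4 * \<Lambda> * C1 * \<eta>) * y" by simp
    also have "\<dots> \<le> d * y" using \<eta>d y by (intro mult_right_mono) auto
    finally have E: "2 * \<Lambda> * \<eta> * C1 * (1 + y) \<le> d * y" .
    have y00: "0 \<le> y" using y by simp
    have "norm (y *\<^sub>R \<psi>1 y - (y - u) *\<^sub>R \<psi>1 (y - u)) \<le> 4 * d * y"
      using osc_ineq[OF u(1) \<eta> y00] AI E y(3) unfolding A_def by linarith
    moreover have "norm (u *\<^sub>R \<psi>1 (y - u)) \<le> d * y"
    proof -
      have "norm (u *\<^sub>R \<psi>1 (y - u)) \<le> (\<epsilon> * y) * D"
        unfolding norm_scaleR using u y \<epsilon> by (intro mult_mono \<psi>1_le) auto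
      also have "\<dots> = (D * \<epsilon>) * y" by simp
      also have "\<dots> \<le> d * y" using \<epsilon>D y by (intro mult_right_mono) auto
      finally show ?thesis .
    qed
    moreover have "y *\<^sub>R (\<psi>1 y - \<psi>1 (y - u)) = (y *\<^sub>R \<psi>1 y - (y - u) *\<^sub>R \<psi>1 (y - u)) - u *\<^sub>R \<psi>1 (y - u)"
      by (simp add: scaleR_left_diff_distrib scaleR_right_diff_distrib)
    ultimately have "norm (y *\<^sub>R (\<psi>1 y - \<psi>1 (y - u))) \<le> 5 * d * y"
      using norm_triangle_ineq4[of "y *\<^sub>R \<psi>1 y - (y - u) *\<^sub>R \<psi>1 (y - u)" "u *\<^sub>R \<psi>1 (y - u)"] by simp
    then have "y * norm (\<psi>1 y - \<psi>1 (y - u)) \<le> y * \<delta>" using y by (simp add: d_def mult.commute)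
    then show "norm (\<psi>1 y - \<psi>1 (y - u)) \<le> \<delta>" using y by simp
  qed
qed

end

section \<open>The Tauberian argument\<close>

lemma continuous_AE_zero:
  fixes g :: "real \<Rightarrow> real"
  assumes "continuous_on UNIV g" "AE u in lborel. g u = 0"
  shows "g x = 0"
proof -
  have "closed {x. g x = 0}" using assms(1) by (intro closed_Collect_eq) auto
  moreover have "AE x in lebesgue. x \<in> {x. g x = 0}" using assms(2) by (auto intro: AE_completion)
  ultimately show "g x = 0" using mem_closed_if_AE_lebesgue by blast
qed

text \<open>Karamata's argument: Laplace transforms at the integers determine the averages against
  \<open>p (exp (- u)) * exp (- u)\<close> for polynomials \<open>p\<close>, hence for a bump near \<open>u = 1\<close>.\<close>

lemma karamata:
  fixes \<psi> L :: "real \<Rightarrow> complex"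
  assumes meas: "\<psi> \<in> borel_measurable borel" and M: "\<And>y. norm (\<psi> y) \<le> M"
    and L: "\<And>u. 0 < u \<Longrightarrow> norm (L u) = 1"
    and lim: "\<And>n. ((\<lambda>r. \<integral>u. (\<psi> (r * u) - K * L r) * edk (of_nat (Suc n)) u \<partial>lborel) \<longlongrightarrow> 0) at_top"
    and osc: "\<And>\<delta>. 0 < \<delta> \<Longrightarrow> \<exists>\<epsilon>>0. \<exists>y0. \<forall>y\<ge>y0. \<forall>u. 0 \<le> u \<longrightarrow> u \<le> \<epsilon> * y \<longrightarrow> norm (\<psi> y - \<psi> (y - u)) \<le> \<delta>"
  shows "((\<lambda>y. \<psi> y - K * L y) \<longlongrightarrow> 0) at_top"
proof (rule tendstoI)
  fix e :: real assume e: "0 < e"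
  define \<delta> where "\<delta> = e / 4"
  have \<delta>: "0 < \<delta>" using e by (simp add: \<delta>_def)
  obtain \<epsilon>' y0 where \<epsilon>': "0 < \<epsilon>'" and osc': "\<And>y u. y0 \<le> y \<Longrightarrow> 0 \<le> u \<Longrightarrow> u \<le> \<epsilon>' * y \<Longrightarrow> norm (\<psi> y - \<psi> (y - u)) \<le> \<delta>"
    using osc[OF \<delta>] by metis
  define \<epsilon> where "\<epsilon> = min \<epsilon>' (1/2)"
  have \<epsilon>: "0 < \<epsilon>" "\<epsilon> \<le> 1/2" "\<epsilon> \<le> \<epsilon>'" using \<epsilon>' by (auto simp: \<epsilon>_def)
  note [measurable] = meas
  \<comment> \<open>In the variable \<open>w = exp (- u)\<close>, the interval from \<open>a\<close>
    to \<open>b\<close> corresponds to \<open>1 - \<epsilon> \<le> u \<le> 1\<close>. The bump sits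
    to the left of \<open>u = 1\<close> because slow oscillation compares \<open>\<psi> y\<close>
    with earlier values.\<close>
  define a b where "a = exp (-1::real)" and "b = exp (- (1 - \<epsilon>))"
  define \<tau> where "\<tau> = (\<lambda>w::real. max 0 ((w - a) * (b - w)))"
  define g where "g = (\<lambda>u::real. \<tau> (exp (- u)) * exp (- u))"
  have ab: "0 < a" "a < b" "b \<le> 1" using \<epsilon> by (auto simp: a_def b_def)
  have \<tau>0: "0 \<le> \<tau> w" for w by (simp add: \<tau>_def)
  have cont\<tau>: "continuous_on S \<tau>" for S unfolding \<tau>_def by (intro continuous_intros)
  have contg: "continuous_on UNIV g" unfolding g_def
    by (intro continuous_intros continuous_on_compose2[OF cont\<tau>[of UNIV]]) auto
  have g0: "0 \<le> g u" for u using \<tau>0 by (simp add: g_def)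
  have gsupp: "1 - \<epsilon> \<le> u \<and> u \<le> 1" if "g u \<noteq> 0" for u
  proof -
    have "0 < (exp (- u) - a) * (b - exp (- u))" using that by (cases "(exp (- u) - a) * (b - exp (- u)) \<le> 0") (auto simp: g_def \<tau>_def)
    then have "a < exp (- u) \<and> exp (- u) < b"
      using ab by (auto simp: zero_less_mult_iff)
    then show ?thesis by (simp add: a_def b_def)
  qed
  have [measurable]: "g \<in> borel_measurable borel" using contg by (rule borel_measurable_continuous_onI)
  have gedk: "g u = \<tau> (exp (- u)) * edk 1 u" for u
    using gsupp[of u] \<epsilon> by (cases "u < 0") (auto simp: edk_neg edk_nonneg g_def)
  have \<tau>1: "\<tau> w \<le> 1" if "0 \<le> w" "w \<le> 1" for w
  proof -
    have "(w - a) * (b - w) \<le> \<bar>w - a\<bar> * \<bar>b - w\<bar>" by (metis abs_ge_self abs_mult)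
    also have "\<dots> \<le> 1 * 1" using that ab by (intro mult_mono) auto
    finally show ?thesis by (simp add: \<tau>_def)
  qed
  have intg: "integrable lborel g"
  proof (rule Bochner_Integration.integrable_bound[OF edk_integrable_real[of 1]])
    show "AE u in lborel. norm (g u) \<le> norm (edk (1::real) u)"
    proof (rule AE_I2)
      fix u
      show "norm (g u) \<le> norm (edk (1::real) u)"
        using \<tau>1[of "exp (- u)"] \<tau>0[of "exp (- u)"] unfolding gedk
        by (cases "u < 0") (auto simp: edk_neg edk_nonneg)
    qed
  qed auto
  define I where "I = (\<integral>u. g u \<partial>lborel)"
  have I: "0 < I"
  proof -
    have "0 \<le> I" unfolding I_def using g0 by (intro integral_nonneg_AE) auto
    moreover have "I \<noteq> 0"
    proof
      assume "I = 0"
      then have "AE u in lborel. g u = 0"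
        using integral_nonneg_eq_0_iff_AE[OF intg] g0 by (simp add: I_def)
      then have "g (- ln ((a + b) / 2)) = 0" using continuous_AE_zero[OF contg] by blast
      moreover have "0 < (a + b) / 2" using ab by simp
      ultimately have "\<tau> ((a + b) / 2) = 0" by (simp add: g_def)
      moreover have "0 < ((a + b) / 2 - a) * (b - (a + b) / 2)"
        using ab by (intro mult_pos_pos) (auto simp: field_simps)
      ultimately show False by (simp add: \<tau>_def max_def split: if_splits)
    qed
    ultimately show ?thesis by simp
  qed
  have M0: "0 \<le> M" using M[of 0] norm_ge_zero order_trans by blast
  have f_bd: "norm (\<psi> (r * u) - K * L r) \<le> M + norm K" if "0 < r" for r u
    using norm_triangle_ineq4[of "\<psi> (r * u)" "K * L r"] M[of "r * u"] L[OF that] by (simp add: norm_mult)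
  have int_edk: "integrable lborel (\<lambda>u. (\<psi> (r * u) - K * L r) * edk (complex_of_real x) u)" if "0 < r" "0 < x" for r and x :: real
  proof (rule Bochner_Integration.integrable_bound)
    show "integrable lborel (\<lambda>u. (M + norm K) * edk x u)" using edk_integrable_real[OF that(2)] by simp
    have [measurable]: "(edk (complex_of_real x)) \<in> borel_measurable borel" by (rule loc_bddD(1)[OF loc_bdd_edk])
    show "(\<lambda>u. (\<psi> (r * u) - K * L r) * edk (complex_of_real x) u) \<in> borel_measurable lborel" by measurable
    show "AE u in lborel. norm ((\<psi> (r * u) - K * L r) * edk (complex_of_real x) u) \<le> norm ((M + norm K) * edk x u)"
      using f_bd[OF that(1)] M0 edk_real_nonneg[of x]
      by (intro AE_I2) (auto simp: norm_mult norm_edk abs_mult intro!: mult_right_mono)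
  qed
  define J where "J = (\<lambda>r. \<integral>u. (\<psi> (r * u) - K * L r) * complex_of_real (g u) \<partial>lborel)"
  have "(J \<longlongrightarrow> 0) at_top"
  proof (rule tendstoI)
    fix e' :: real assume e': "0 < e'"
    define \<eta> where "\<eta> = e' / 2 / (M + norm K + 1)"
    have MK: "0 \<le> M + norm K" using M0 by simp
    have \<eta>: "0 < \<eta>" using e' MK by (auto simp: \<eta>_def intro!: divide_pos_pos add_nonneg_pos)
    have \<eta>2: "(M + norm K) * \<eta> \<le> e' / 2" using e' MK by (simp add: \<eta>_def field_simps)
    \<comment> \<open>Only \<open>\<tau>\<close> is approximated on \<open>{0..1}\<close>; the
      factor \<open>exp (- u)\<close> stays outside and makes the uniform error integrable over the
      half-line.\<close>
    obtain p where p: "real_polynomial_function p" and pa: "\<And>w. w \<in> {0..1} \<Longrightarrow> \<bar>\<tau> w - p w\<bar> < \<eta>"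
      using Stone_Weierstrass_real_polynomial_function[of "{0..1}" \<tau> \<eta>] cont\<tau> \<eta> by auto
    obtain q n where q: "p = (\<lambda>x. \<Sum>i\<le>n. q i * x ^ i)" using p real_polynomial_function_iff_sum by blast
    define P where "P = (\<lambda>r. \<integral>u. (\<psi> (r * u) - K * L r) * (\<Sum>i\<le>n. of_real (q i) * edk (of_nat (Suc i)) u) \<partial>lborel)"
    have P_eq: "P r = (\<Sum>i\<le>n. of_real (q i) * (\<integral>u. (\<psi> (r * u) - K * L r) * edk (of_nat (Suc i)) u \<partial>lborel))"
      and P_int: "integrable lborel (\<lambda>u. (\<psi> (r * u) - K * L r) * (\<Sum>i\<le>n. of_real (q i) * edk (of_nat (Suc i)) u))" if "0 < r" for r
    proof -
      have i: "integrable lborel (\<lambda>u. of_real (q i) * ((\<psi> (r * u) - K * L r) * edk (of_nat (Suc i)) u))" for i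
        using int_edk[OF that, of "real (Suc i)"] by (intro integrable_mult_right) simp
      have eq: "(\<lambda>u. (\<psi> (r * u) - K * L r) * (\<Sum>i\<le>n. of_real (q i) * edk (of_nat (Suc i)) u))
         = (\<lambda>u. \<Sum>i\<le>n. of_real (q i) * ((\<psi> (r * u) - K * L r) * edk (of_nat (Suc i)) u))"
        by (simp only: sum_distrib_left mult.left_commute)
      show "P r = (\<Sum>i\<le>n. of_real (q i) * (\<integral>u. (\<psi> (r * u) - K * L r) * edk (of_nat (Suc i)) u \<partial>lborel))"
        unfolding P_def eq by (subst Bochner_Integration.integral_sum[OF i]) (simp only: integral_mult_right_zero)
      show "integrable lborel (\<lambda>u. (\<psi> (r * u) - K * L r) * (\<Sum>i\<le>n. of_real (q i) * edk (of_nat (Suc i)) u))"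
        unfolding eq by (intro Bochner_Integration.integrable_sum i)
    qed
    have "((\<lambda>r. \<Sum>i\<le>n. of_real (q i) * (\<integral>u. (\<psi> (r * u) - K * L r) * edk (of_nat (Suc i)) u \<partial>lborel)) \<longlongrightarrow> (\<Sum>i\<le>n. of_real (q i) * 0)) at_top"
      by (intro tendsto_sum tendsto_mult tendsto_const lim)
    moreover have "\<forall>\<^sub>F r in at_top. (\<Sum>i\<le>n. of_real (q i) * (\<integral>u. (\<psi> (r * u) - K * L r) * edk (of_nat (Suc i)) u \<partial>lborel)) = P r"
      using eventually_gt_at_top[of 0] by eventually_elim (simp only: P_eq)
    ultimately have "(P \<longlongrightarrow> 0) at_top" by (simp add: tendsto_cong)
    then have "\<forall>\<^sub>F r in at_top. dist (P r) 0 < e' / 2" using e' by (intro tendstoD) auto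
    then show "\<forall>\<^sub>F r in at_top. dist (J r) 0 < e'"
      using eventually_gt_at_top[of 0]
    proof eventually_elim
      case (elim r)
      have edkpow: "complex_of_real (p (exp (- u))) * edk 1 u = (\<Sum>i\<le>n. of_real (q i) * edk (of_nat (Suc i)) u)" for u
      proof (cases "u < 0")
        case False
        have "complex_of_real (exp (- u) ^ i) * edk 1 u = edk (of_nat (Suc i)) u" for i
          using False by (simp add: edk_nonneg exp_of_real[symmetric] exp_of_nat_mult[symmetric] exp_add[symmetric] algebra_simps)
        then show ?thesis unfolding q by (simp add: sum_distrib_right mult.assoc del: of_real_power)
      qed (simp add: edk_neg)
      have int1: "integrable lborel (\<lambda>u. (\<psi> (r * u) - K * L r) * complex_of_real (g u))"
      proof (rule Bochner_Integration.integrable_bound)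
        show "integrable lborel (\<lambda>u. (M + norm K) * g u)" using intg by simp
        show "AE u in lborel. norm ((\<psi> (r * u) - K * L r) * complex_of_real (g u)) \<le> norm ((M + norm K) * g u)"
          using f_bd[of r] elim M0 g0 by (intro AE_I2) (auto simp: norm_mult abs_mult intro!: mult_right_mono)
      qed measurable
      have JP: "J r - P r = (\<integral>u. (\<psi> (r * u) - K * L r) * complex_of_real (g u)
           - (\<psi> (r * u) - K * L r) * (\<Sum>i\<le>n. of_real (q i) * edk (of_nat (Suc i)) u) \<partial>lborel)"
        unfolding J_def P_def using int1 P_int elim by simp
      have "norm (J r - P r) \<le> (\<integral>u. norm ((\<psi> (r * u) - K * L r) * complex_of_real (g u)
           - (\<psi> (r * u) - K * L r) * (\<Sum>i\<le>n. of_real (q i) * edk (of_nat (Suc i)) u)) \<partial>lborel)"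
        unfolding JP by (rule integral_norm_bound)
      also have "\<dots> \<le> (\<integral>u. (M + norm K) * \<eta> * edk 1 u \<partial>lborel)"
      proof (rule integral_mono')
        show "integrable lborel (\<lambda>u. (M + norm K) * \<eta> * edk 1 u)" using edk_integrable_real[of 1] by simp
        show "0 \<le> (M + norm K) * \<eta> * edk 1 u" for u
          using MK \<eta> by (intro mult_nonneg_nonneg edk_real_nonneg) auto
        fix u
        have c1: "complex_of_real (edk 1 u) = edk 1 u"
          by (simp add: edk_def scaleR_conv_of_real exp_of_real[symmetric])
        have split: "(\<psi> (r * u) - K * L r) * complex_of_real (g u)
           - (\<psi> (r * u) - K * L r) * (\<Sum>i\<le>n. of_real (q i) * edk (of_nat (Suc i)) u)
           = (\<psi> (r * u) - K * L r) * (complex_of_real (\<tau> (exp (- u)) - p (exp (- u))) * edk 1 u)"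
          unfolding edkpow[symmetric] gedk of_real_mult c1 by (simp add: algebra_simps)
        have "norm ((\<psi> (r * u) - K * L r) * (complex_of_real (\<tau> (exp (- u)) - p (exp (- u))) * edk 1 u)) \<le> (M + norm K) * (\<eta> * edk 1 u)"
        proof (cases "u < 0")
          case False
          then have "\<bar>\<tau> (exp (- u)) - p (exp (- u))\<bar> \<le> \<eta>" using pa[of "exp (- u)"] by simp
          then show ?thesis unfolding norm_mult norm_edk norm_of_real
            using f_bd[of r u] elim MK \<eta> by (intro mult_mono) (auto intro!: mult_nonneg_nonneg edk_real_nonneg)
        qed (simp add: edk_neg)
        then show "norm ((\<psi> (r * u) - K * L r) * complex_of_real (g u)
           - (\<psi> (r * u) - K * L r) * (\<Sum>i\<le>n. of_real (q i) * edk (of_nat (Suc i)) u)) \<le> (M + norm K) * \<eta> * edk 1 u"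
          unfolding split by (simp only: mult.assoc)
      qed
      also have "\<dots> = (M + norm K) * \<eta>" by (simp add: edk_integral_real)
      finally have "norm (J r - P r) \<le> e' / 2" using \<eta>2 by simp
      then show ?case using elim(1) norm_triangle_sub[of "J r" "P r"] by simp
    qed
  qed
  then have "\<forall>\<^sub>F r in at_top. dist (J r) 0 < \<delta> * I" using \<delta> I by (intro tendstoD) auto
  then show "\<forall>\<^sub>F y in at_top. dist (\<psi> y - K * L y) 0 < e"
    using eventually_gt_at_top[of 0] eventually_ge_at_top[of y0]
  proof eventually_elim
    case (elim r)
    have int1: "integrable lborel (\<lambda>u. (\<psi> (r * u) - K * L r) * complex_of_real (g u))"
    proof (rule Bochner_Integration.integrable_bound)
      show "integrable lborel (\<lambda>u. (M + norm K) * g u)" using intg by simp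
      show "AE u in lborel. norm ((\<psi> (r * u) - K * L r) * complex_of_real (g u)) \<le> norm ((M + norm K) * g u)"
        using f_bd[of r] elim M0 g0 by (intro AE_I2) (auto simp: norm_mult abs_mult intro!: mult_right_mono)
    qed measurable
    have int2: "integrable lborel (\<lambda>u. (\<psi> r - K * L r) * complex_of_real (g u))" using intg by simp
    have "(\<psi> r - K * L r) * complex_of_real I = (\<integral>u. (\<psi> r - K * L r) * complex_of_real (g u) \<partial>lborel)"
      by (simp add: I_def)
    then have JI: "(\<psi> r - K * L r) * complex_of_real I - J r
      = (\<integral>u. (\<psi> r - K * L r) * complex_of_real (g u) - (\<psi> (r * u) - K * L r) * complex_of_real (g u) \<partial>lborel)"
      unfolding J_def using int1 int2 by simp
    have "norm ((\<psi> r - K * L r) * complex_of_real I - J r) \<le> (\<integral>u. norm ((\<psi> r - K * L r) * complex_of_real (g u) - (\<psi> (r * u) - K * L r) * complex_of_real (g u)) \<partial>lborel)"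
      unfolding JI by (rule integral_norm_bound)
    also have "\<dots> \<le> (\<integral>u. \<delta> * g u \<partial>lborel)"
    proof (rule integral_mono')
      show "integrable lborel (\<lambda>u. \<delta> * g u)" using intg by simp
      show "0 \<le> \<delta> * g u" for u using \<delta> g0 by simp
      fix u
      have eq: "(\<psi> r - K * L r) * complex_of_real (g u) - (\<psi> (r * u) - K * L r) * complex_of_real (g u)
        = (\<psi> r - \<psi> (r * u)) * complex_of_real (g u)" by (simp add: algebra_simps)
      have "norm (\<psi> r - \<psi> (r * u)) * g u \<le> \<delta> * g u"
      proof (cases "g u = 0")
        case False
        then have u: "1 - \<epsilon> \<le> u" "u \<le> 1" using gsupp by auto
        have "norm (\<psi> r - \<psi> (r - r * (1 - u))) \<le> \<delta>"
        proof (rule osc')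
          show "0 \<le> r * (1 - u)" using elim u by simp
          have "r * (1 - u) \<le> r * \<epsilon>'" using elim u \<epsilon> by (intro mult_left_mono) auto
          then show "r * (1 - u) \<le> \<epsilon>' * r" by (simp add: mult.commute)
        qed (use elim in simp)
        moreover have "r - r * (1 - u) = r * u" by (simp add: algebra_simps)
        ultimately show ?thesis using g0 by (intro mult_right_mono) auto
      qed simp
      then show "norm ((\<psi> r - K * L r) * complex_of_real (g u) - (\<psi> (r * u) - K * L r) * complex_of_real (g u)) \<le> \<delta> * g u"
        unfolding eq using g0[of u] by (simp add: norm_mult)
    qed
    also have "\<dots> = \<delta> * I" by (simp add: I_def)
    finally have "norm ((\<psi> r - K * L r) * complex_of_real I) \<le> norm (J r) + \<delta> * I"
      using norm_triangle_sub[of "(\<psi> r - K * L r) * complex_of_real I" "J r"] by linarith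
    then have "norm (\<psi> r - K * L r) * I \<le> norm (J r) + \<delta> * I" using I by (simp add: norm_mult)
    moreover have "norm (J r) < \<delta> * I" using elim(1) by simp
    ultimately have "norm (\<psi> r - K * L r) * I \<le> (2 * \<delta>) * I" by linarith
    then have "norm (\<psi> r - K * L r) \<le> 2 * \<delta>" using I by (simp only: mult_le_cancel_right_pos)
    then show ?case using e by (simp add: \<delta>_def)
  qed
qed

section \<open>Kernels of finite mass act asymptotically as constants\<close>

text \<open>A bounded function that is asymptotically invariant under each fixed shift looks
  constant to a finite kernel; dominated convergence with the majorant
  \<open>2 * M * norm (k v)\<close> makes this precise.\<close>

lemma lconv_asymp:
  fixes k f :: "real \<Rightarrow> complex"
  assumes k: "loc_kernel m k" and ik: "integrable m k" and f: "loc_bdd f" and M: "\<And>y. norm (f y) \<le> M"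
    and sh: "\<And>v. 0 \<le> v \<Longrightarrow> ((\<lambda>y. f (y - v) - f y) \<longlongrightarrow> 0) at_top"
  shows "((\<lambda>y. lconv m k f y - (\<integral>v. k v \<partial>m) * f y) \<longlongrightarrow> 0) at_top"
proof -
  note [measurable_cong] = loc_kernelD(2)[OF k]
  note [measurable] = loc_kernelD(3)[OF k] loc_bddD(1)[OF f]
  have "((\<lambda>y. \<integral>v. (f (y - v) - f y) * k v \<partial>m) \<longlongrightarrow> (\<integral>v. 0 \<partial>m)) at_top"
  proof (rule integral_dominated_convergence_at_top[where w="\<lambda>v. (2 * M) * norm (k v)"])
    show "integrable m (\<lambda>v. (2 * M) * norm (k v))" using ik by simp
    show "AE v in m. ((\<lambda>y. (f (y - v) - f y) * k v) \<longlongrightarrow> 0) at_top"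
    proof (rule AE_I2)
      fix v
      show "((\<lambda>y. (f (y - v) - f y) * k v) \<longlongrightarrow> 0) at_top"
        using tendsto_mult[OF sh tendsto_const[of "k v"], of v] loc_kernelD(4)[OF k, of v]
        by (cases "v < 0") auto
    qed
    have "norm (f (y - v) - f y) \<le> 2 * M" for y v
      using norm_triangle_ineq4[of "f (y - v)" "f y"] M[of y] M[of "y - v"] by linarith
    then show "\<forall>\<^sub>F y in at_top. AE v in m. norm ((f (y - v) - f y) * k v) \<le> (2 * M) * norm (k v)"
      by (intro always_eventually allI AE_I2) (auto simp: norm_mult intro!: mult_right_mono)
  qed measurable
  moreover have "(\<integral>v. (f (y - v) - f y) * k v \<partial>m) = lconv m k f y - (\<integral>v. k v \<partial>m) * f y" for y
  proof -
    have "(\<integral>v. (f (y - v) - f y) * k v \<partial>m) = (\<integral>v. f (y - v) * k v - f y * k v \<partial>m)"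
      by (simp only: left_diff_distrib)
    also have "\<dots> = lconv m k f y - f y * (\<integral>v. k v \<partial>m)"
      unfolding lconv_def
      by (subst Bochner_Integration.integral_diff[OF lconv_integrable[OF k f] integrable_mult_right[OF ik]])
         (simp only: integral_mult_right_zero)
    finally show ?thesis by (simp only: mult.commute)
  qed
  ultimately show ?thesis by simp
qed

text \<open>Each iterate is asymptotic to a multiple of \<open>f\<close>, so it inherits asymptotic
  shift invariance and the induction continues. Tannery's theorem then interchanges the limit with
  the exponential series.\<close>

lemma xconv_asymp:
  fixes k f :: "real \<Rightarrow> complex"
  assumes k: "loc_kernel m k" and ik: "integrable m k" and f: "loc_bdd f" and M: "\<And>y. norm (f y) \<le> M"
    and sh: "\<And>v. 0 \<le> v \<Longrightarrow> ((\<lambda>y. f (y - v) - f y) \<longlongrightarrow> 0) at_top"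
  shows "((\<lambda>y. xconv m k f y - exp (\<integral>v. k v \<partial>m) * f y) \<longlongrightarrow> 0) at_top"
proof -
  let ?\<kappa> = "\<integral>v. k v \<partial>m" and ?N = "\<integral>v. norm (k v) \<partial>m"
  note bd = loc_bdd_lconv_pow[OF k f]
  have shift: "filterlim (\<lambda>y. y - v) at_top at_top" for v :: real
    using filterlim_tendsto_add_at_top[OF tendsto_const[of "-v"] filterlim_ident] by simp
  have P: "(\<forall>y. norm ((lconv m k ^^ n) f y) \<le> M * ?N ^ n) \<and>
      ((\<lambda>y. (lconv m k ^^ n) f y - ?\<kappa> ^ n * f y) \<longlongrightarrow> 0) at_top" for n
  proof (induction n)
    case 0 then show ?case using M by simp
  next
    case (Suc n)
    let ?g = "(lconv m k ^^ n) f"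
    have b: "norm (lconv m k ?g y) \<le> M * ?N ^ n * ?N" for y
    proof -
      have "norm (lconv m k ?g y) \<le> (\<integral>v. norm (?g (y - v) * k v) \<partial>m)"
        unfolding lconv_def by (rule integral_norm_bound)
      also have "\<dots> \<le> (\<integral>v. M * ?N ^ n * norm (k v) \<partial>m)"
      proof (rule integral_mono)
        show "integrable m (\<lambda>v. norm (?g (y - v) * k v))" by (rule integrable_norm[OF lconv_integrable[OF k bd]])
      qed (use ik Suc in \<open>auto simp: norm_mult intro!: mult_right_mono\<close>)
      finally show ?thesis by simp
    qed
    have r: "((\<lambda>y. ?g y - ?\<kappa> ^ n * f y) \<longlongrightarrow> 0) at_top" using Suc by blast
    have gs: "((\<lambda>y. ?g (y - v) - ?g y) \<longlongrightarrow> 0) at_top" if "0 \<le> v" for v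
    proof -
      have "((\<lambda>y. (?g (y - v) - ?\<kappa> ^ n * f (y - v)) - (?g y - ?\<kappa> ^ n * f y) + ?\<kappa> ^ n * (f (y - v) - f y)) \<longlongrightarrow> 0 - 0 + ?\<kappa> ^ n * 0) at_top"
        by (intro tendsto_intros r sh[OF that] filterlim_compose[OF r shift])
      then show ?thesis by (simp add: algebra_simps)
    qed
    have "((\<lambda>y. (lconv m k ?g y - ?\<kappa> * ?g y) + ?\<kappa> * (?g y - ?\<kappa> ^ n * f y)) \<longlongrightarrow> 0 + ?\<kappa> * 0) at_top"
      using Suc by (intro tendsto_intros lconv_asymp[OF k ik bd, where M="M * ?N ^ n"] gs r) auto
    then have "((\<lambda>y. lconv m k ?g y - ?\<kappa> ^ Suc n * f y) \<longlongrightarrow> 0) at_top" by (simp add: algebra_simps)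
    then show ?case using b by (simp add: mult_ac)
  qed
  let ?a = "\<lambda>n y. ((lconv m k ^^ n) f y - ?\<kappa> ^ n * f y) /\<^sub>R fact n"
  have lim: "((\<lambda>y. ?a n y) \<longlongrightarrow> 0) at_top" for n
    using tendsto_scaleR[OF tendsto_const[of "inverse (fact n)"] conjunct2[OF P[of n]]] by simp
  have M0: "0 \<le> M" using M[of 0] norm_ge_zero order_trans by blast
  have "((\<lambda>y. \<Sum>n. ?a n y) \<longlongrightarrow> (\<Sum>n. 0)) at_top"
  proof (rule conjunct2[OF conjunct2[OF tannerys_theorem[OF lim]]])
    show "summable (\<lambda>n. M * (?N ^ n /\<^sub>R fact n) + M * (norm ?\<kappa> ^ n /\<^sub>R fact n))"
      by (intro summable_add summable_mult summable_exp_real)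
    have "norm (?a n y) \<le> M * (?N ^ n /\<^sub>R fact n) + M * (norm ?\<kappa> ^ n /\<^sub>R fact n)" for n y
    proof -
      have "norm ((lconv m k ^^ n) f y - ?\<kappa> ^ n * f y) \<le> M * ?N ^ n + norm ?\<kappa> ^ n * M"
        using norm_triangle_ineq4[of "(lconv m k ^^ n) f y" "?\<kappa> ^ n * f y"] conjunct1[OF P[of n]]
          mult_left_mono[OF M[of y], of "norm ?\<kappa> ^ n"]
        by (simp add: norm_mult norm_power) (smt (verit, best))
      then have "inverse (fact n) * norm ((lconv m k ^^ n) f y - ?\<kappa> ^ n * f y) \<le> inverse (fact n) * (M * ?N ^ n + norm ?\<kappa> ^ n * M)"
        by (intro mult_left_mono) auto
      moreover have "norm (?a n y) = inverse (fact n) * norm ((lconv m k ^^ n) f y - ?\<kappa> ^ n * f y)"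
        by (simp only: norm_scaleR) simp
      ultimately show ?thesis by (simp add: distrib_left mult_ac)
    qed
    then show "\<forall>\<^sub>F (n, y) in at_top \<times>\<^sub>F at_top. norm (?a n y) \<le> M * (?N ^ n /\<^sub>R fact n) + M * (norm ?\<kappa> ^ n /\<^sub>R fact n)"
      by (intro always_eventually) auto
  qed auto
  moreover have "(\<Sum>n. ?a n y) = xconv m k f y - exp ?\<kappa> * f y" for y
  proof -
    have "(\<lambda>n. (lconv m k ^^ n) f y /\<^sub>R fact n - (?\<kappa> ^ n /\<^sub>R fact n) * f y) sums (xconv m k f y - exp ?\<kappa> * f y)"
      unfolding xconv_def exp_def
      by (intro sums_diff summable_sums[OF xconv_summable[OF k f]] sums_mult2 summable_sums[OF summable_exp_generic])
    then show ?thesis by (simp add: sums_iff scaleR_right_diff_distrib)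
  qed
  ultimately show ?thesis by simp
qed

lemma lconv_pow_diff:
  assumes k: "loc_kernel m k" and f: "loc_bdd f" and g: "loc_bdd g"
  shows "(lconv m k ^^ n) (\<lambda>y. f y - g y) = (\<lambda>y. (lconv m k ^^ n) f y - (lconv m k ^^ n) g y)"
proof (induction n)
  case (Suc n)
  have "lconv m k (\<lambda>y. (lconv m k ^^ n) f y - (lconv m k ^^ n) g y)
     = (\<lambda>y. lconv m k ((lconv m k ^^ n) f) y - lconv m k ((lconv m k ^^ n) g) y)"
    by (rule ext) (rule lconv_diff[OF k loc_bdd_lconv_pow[OF k f] loc_bdd_lconv_pow[OF k g]])
  then show ?case using Suc by simp
qed simp

lemma xconv_diff:
  assumes k: "loc_kernel m k" and f: "loc_bdd f" and g: "loc_bdd g"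
  shows "xconv m k (\<lambda>y. f y - g y) y = xconv m k f y - xconv m k g y"
  unfolding xconv_def lconv_pow_diff[OF assms]
  by (subst suminf_diff[OF xconv_summable[OF k f] xconv_summable[OF k g]]) (simp add: scaleR_right_diff_distrib)

lemma lconv_pow_shift: "(lconv m k ^^ n) (\<lambda>y. f (y - u)) = (\<lambda>y. (lconv m k ^^ n) f (y - u))"
proof (induction n)
  case (Suc n)
  have "lconv m k (\<lambda>y. g (y - u)) = (\<lambda>y. lconv m k g (y - u))" for g
    by (rule ext) (rule lconv_shift)
  then show ?case using Suc by simp
qed simp

lemma xconv_shift: "xconv m k (\<lambda>y. f (y - u)) y = xconv m k f (y - u)"
  unfolding xconv_def lconv_pow_shift ..

lemma loc_kernel_add:
  assumes k: "loc_kernel m k" and l: "loc_kernel m l"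
  shows "loc_kernel m (\<lambda>v. k v + l v)"
  using k l by (auto simp: loc_kernel_def scaleR_add_right)

section \<open>Restoring the finite part \<open>k2\<close> of the kernel\<close>

locale halasz_pair = halasz_kernel +
  fixes k2 :: "real \<Rightarrow> complex"
  assumes k2: "loc_kernel Q k2" and ik2: "integrable Q k2"
begin

definition "K2 = (\<integral>v. norm (k2 v) \<partial>Q)"
definition kh2 where "kh2 s = (\<integral>v. exp (- s * of_real v) * k2 v \<partial>Q)"
definition \<psi> where "\<psi> = lconv lborel (edk \<beta>) (xconv Q (\<lambda>v. k1 v + k2 v) (edk \<beta>))"
definition \<Phi> where "\<Phi> s = exp (kh s + kh2 s)"

lemma loc_kernel_k12: "loc_kernel Q (\<lambda>v. k1 v + k2 v)" by (rule loc_kernel_add[OF k1 k2])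

lemma twist_int2:
  assumes s: "0 \<le> Re s"
  shows "integrable Q (\<lambda>v. exp (- s * of_real v) * k2 v)" and "norm (exp (- s * of_real v) * k2 v) \<le> norm (k2 v)"
proof -
  note [measurable_cong] = loc_kernelD(2)[OF k2]
  note [measurable] = loc_kernelD(3)[OF k2]
  show le: "norm (exp (- s * of_real v) * k2 v) \<le> norm (k2 v)" for v
  proof (cases "v < 0")
    case False
    then show ?thesis using norm_exp_le_1[of s v] s by (simp only: norm_mult) (simp add: mult_left_le_one_le)
  qed (use loc_kernelD(4)[OF k2] in simp)
  show "integrable Q (\<lambda>v. exp (- s * of_real v) * k2 v)"
    by (rule Bochner_Integration.integrable_bound[OF ik2 _ AE_I2[OF le]]) measurable
qed

lemma kh2_le: assumes "0 \<le> Re s" shows "norm (kh2 s) \<le> K2"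
proof -
  have "norm (kh2 s) \<le> (\<integral>v. norm (exp (- s * of_real v) * k2 v) \<partial>Q)"
    unfolding kh2_def by (rule integral_norm_bound)
  also have "\<dots> \<le> K2" unfolding K2_def using twist_int2[OF assms] ik2 by (intro integral_mono) auto
  finally show ?thesis .
qed

text \<open>Finite mass keeps \<open>exp (kh2 s)\<close> away from zero, so an upper bound on
  \<open>\<Phi>\<close> becomes one on the transform belonging to \<open>g\<^sub>1\<close>.\<close>

lemma \<Phi>_kh: assumes "0 \<le> Re s" shows "norm (exp (kh s)) \<le> exp K2 * norm (\<Phi> s)"
proof -
  have "exp (kh s) = exp (- kh2 s) * \<Phi> s" by (simp add: \<Phi>_def exp_add[symmetric])
  then have "norm (exp (kh s)) = norm (exp (- kh2 s)) * norm (\<Phi> s)" by (simp only: norm_mult)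
  moreover have "norm (exp (- kh2 s)) \<le> exp K2"
    using kh2_le[OF assms] complex_Re_le_cmod[of "- kh2 s"] by simp
  ultimately show ?thesis by (simp add: mult_right_mono)
qed

text \<open>Rankin's bound at \<open>\<sigma> = 0\<close>, legitimate because \<open>k2\<close> has
  finite mass.\<close>

lemma xconv_k2_bound:
  assumes f: "loc_bdd f" and M: "\<And>y. norm (f y) \<le> M"
  shows "norm (xconv Q k2 f y) \<le> M * exp K2"
proof -
  have "norm (xconv Q k2 f y) \<le> M * exp (0 * y) * exp (\<integral>v. exp (- 0 * v) * norm (k2 v) \<partial>Q)"
    by (rule xconv_exp_bound[OF k2 f]) (use ik2 M in auto)
  then show ?thesis by (simp add: K2_def)
qed

lemma \<psi>_loc_bdd: "loc_bdd \<psi>"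
  unfolding \<psi>_def by (intro loc_bdd_lconv loc_kernel_lborel loc_bdd_edk loc_bdd_xconv loc_kernel_k12)

lemma \<gamma>12_lap:
  assumes s: "0 < Re s" "Re s \<le> 1"
  shows "integrable lborel (\<lambda>y. exp (- s * of_real y) * xconv Q (\<lambda>v. k1 v + k2 v) (edk \<beta>) y)"
    and "lap (xconv Q (\<lambda>v. k1 v + k2 v) (edk \<beta>)) s = \<Phi> s / (\<beta> + s)"
proof -
  have ck: "loc_kernel Q (\<lambda>v. exp (- s * of_real v) * (k1 v + k2 v))"
    by (rule loc_kernel_mult_ctns[OF loc_kernel_k12 continuous_on_exp_of_real])
  have eq: "(\<lambda>y. exp (- s * of_real y) * xconv Q (\<lambda>v. k1 v + k2 v) (edk \<beta>) y) = xconv Q (\<lambda>v. exp (- s * of_real v) * (k1 v + k2 v)) (edk (\<beta> + s))"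
    by (rule ext, rule sym) (rule xconv_twist[OF loc_kernel_k12 loc_bdd_edk, of s \<beta>, unfolded edk_twist])
  have i: "integrable Q (\<lambda>v. exp (- s * of_real v) * (k1 v + k2 v))"
    "(\<integral>v. exp (- s * of_real v) * (k1 v + k2 v) \<partial>Q) = kh s + kh2 s"
    unfolding distrib_left kh_def kh2_def using twist_int[OF s] twist_int2(1)[of s] s by simp_all
  have re: "0 < Re (\<beta> + s)" using s \<beta> by simp
  note * = xconv_integral[OF ck loc_bdd_edk i(1) edk_integral(1)[OF re]]
  show "integrable lborel (\<lambda>y. exp (- s * of_real y) * xconv Q (\<lambda>v. k1 v + k2 v) (edk \<beta>) y)" unfolding eq by (rule *(1))
  show "lap (xconv Q (\<lambda>v. k1 v + k2 v) (edk \<beta>)) s = \<Phi> s / (\<beta> + s)" unfolding lap_def eq *(2) edk_integral(2)[OF re] i(2) \<Phi>_def by simp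
qed

text \<open>This is the rule that the exponential of a sum is the composition of the exponentials.
  Instead of rearranging a double series, both sides are compared through their Laplace transforms
  on the line \<open>Re s = 1\<close>; both are continuous, so equality holds at every
  point.\<close>

lemma \<psi>_eq: "\<psi> = xconv Q k2 \<psi>1"
proof
  fix y
  let ?X = "xconv Q k2 \<psi>1" and ?\<gamma> = "xconv Q (\<lambda>v. k1 v + k2 v) (edk \<beta>)"
  have X: "loc_bdd ?X" by (rule loc_bdd_xconv[OF k2 loc_bdd_\<psi>1])
  have \<gamma>: "loc_bdd ?\<gamma>" by (rule loc_bdd_xconv[OF loc_kernel_k12 loc_bdd_edk])
  \<comment> \<open>Boundedness of \<open>\<psi>\<close> is a consequence of this lemma and not yet
    known. Damping by \<open>exp (- y)\<close> makes both sides bounded and integrable; for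
    \<open>\<psi>\<close> this follows from Rankin's bound at \<open>\<sigma> = 1\<close>.\<close>
  let ?t = "\<lambda>f y. exp (- 1 * complex_of_real y) * f y"
  let ?f = "\<lambda>y. ?t \<psi> y - ?t ?X y"
  have Xlip: "norm (?X y - ?X (y - u)) \<le> (\<Lambda> * exp K2) * u" if "0 \<le> u" for y u
  proof -
    have "?X y - ?X (y - u) = xconv Q k2 (\<theta> u) y"
      unfolding \<theta>_def[abs_def]
      by (subst xconv_diff[OF k2 loc_bdd_\<psi>1 loc_bdd_shift[OF loc_bdd_\<psi>1 that]]) (simp add: xconv_shift)
    also have "norm \<dots> \<le> (\<Lambda> * u) * exp K2"
      by (rule xconv_k2_bound[OF loc_bdd_\<theta>[OF that]]) (simp add: \<theta>_def \<psi>1_lip[OF that])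
    finally show ?thesis by (simp add: mult_ac)
  qed
  have Xcont: "continuous_on UNIV ?X" by (rule continuous_on_lipschitz_shift[OF Xlip])
  have Xbd: "norm (?X y) \<le> D * exp K2" for y by (rule xconv_k2_bound[OF loc_bdd_\<psi>1 \<psi>1_le])
  have tg: "norm (?t ?\<gamma> y) \<le> exp (\<integral>v. exp (- 1 * v) * norm (k1 v + k2 v) \<partial>Q)" for y
  proof (cases "y < 0")
    case True
    then show ?thesis using loc_bddD(2)[OF \<gamma> True] by simp
  next
    case False
    have i1: "integrable Q (\<lambda>v. exp (- 1 * v) * norm (k1 v))" by (rule zeta) auto
    have "integrable Q (\<lambda>v. exp (- 1 * of_real v) * (k1 v + k2 v))"
      using Bochner_Integration.integrable_add[OF twist_int[of 1] twist_int2(1)[of 1]] by (simp add: distrib_left)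
    then have "integrable Q (\<lambda>v. exp (- 1 * v) * norm (k1 v + k2 v))"
      using integrable_norm by (fastforce simp: norm_mult)
    then have "norm (?\<gamma> y) \<le> 1 * exp (1 * y) * exp (\<integral>v. exp (- 1 * v) * norm (k1 v + k2 v) \<partial>Q)"
      using \<beta> by (intro xconv_exp_bound[OF loc_kernel_k12 loc_bdd_edk])
        (auto simp: norm_edk edk_def indicator_def intro: order_trans[of _ 1])
    then have "exp (- y) * norm (?\<gamma> y) \<le> exp (- y) * (exp y * exp (\<integral>v. exp (- 1 * v) * norm (k1 v + k2 v) \<partial>Q))"
      by (intro mult_left_mono) auto
    also have "\<dots> = exp (\<integral>v. exp (- 1 * v) * norm (k1 v + k2 v) \<partial>Q)"
      by (simp only: mult.assoc[symmetric] exp_add[symmetric]) simp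
    finally show ?thesis by (simp only: norm_mult) simp
  qed
  have tpsi: "?t \<psi> = lconv lborel (edk (\<beta> + 1)) (?t ?\<gamma>)"
    using lconv_pow_twist[where m=lborel and s=1 and k="edk \<beta>" and n=1 and f="?\<gamma>"]
    unfolding \<psi>_def by (simp only: One_nat_def funpow.simps o_apply id_apply edk_twist)
  have tgl: "loc_bdd (?t ?\<gamma>)" by (rule loc_bdd_mult_ctns[OF \<gamma> continuous_on_exp_of_real])
  have re: "1 \<le> Re (\<beta> + 1)" using \<beta> by simp
  have pcont: "continuous_on UNIV (?t \<psi>)"
    unfolding tpsi by (rule continuous_on_lipschitz_shift) (rule conv_edk_lipschitz(2)[OF tgl tg re])
  have pbd: "norm (?t \<psi> y) \<le> exp (\<integral>v. exp (- 1 * v) * norm (k1 v + k2 v) \<partial>Q)" for y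
    using conv_edk_lipschitz(1)[OF tgl tg re, of y] unfolding tpsi[symmetric] .
  have tXbd: "norm (?t ?X y) \<le> D * exp K2" for y
  proof (cases "y < 0")
    case True
    then show ?thesis using loc_bddD(2)[OF X True] majorant_const_nonneg by simp
  next
    case False
    have "norm (exp (- 1 * complex_of_real y)) * norm (?X y) \<le> 1 * (D * exp K2)"
      using False Xbd by (intro mult_mono) auto
    then show ?thesis by (simp only: norm_mult)
  qed
  have cont: "continuous_on UNIV ?f" by (intro continuous_on_diff pcont continuous_intros Xcont)
  have bd: "norm (?f y) \<le> exp (\<integral>v. exp (- 1 * v) * norm (k1 v + k2 v) \<partial>Q) + D * exp K2" for y
    using norm_triangle_ineq4[of "?t \<psi> y" "?t ?X y"] pbd[of y] tXbd[of y] by linarith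
  have lapX: "integrable lborel (\<lambda>y. exp (- s * of_real y) * ?X y)" "lap ?X s = exp (kh2 s) * lap \<psi>1 s"
    if s: "0 < Re s" "Re s \<le> 1" for s
  proof -
    have ck: "loc_kernel Q (\<lambda>v. exp (- s * of_real v) * k2 v)"
      by (rule loc_kernel_mult_ctns[OF k2 continuous_on_exp_of_real])
    have eq: "(\<lambda>y. exp (- s * of_real y) * ?X y)
       = xconv Q (\<lambda>v. exp (- s * of_real v) * k2 v) (\<lambda>y. exp (- s * of_real y) * \<psi>1 y)"
      by (rule ext, rule sym) (rule xconv_twist[OF k2 loc_bdd_\<psi>1])
    note * = xconv_integral[OF ck loc_bdd_mult_ctns[OF loc_bdd_\<psi>1 continuous_on_exp_of_real] twist_int2(1) \<psi>1_lap(1)[OF s]]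
    show "integrable lborel (\<lambda>y. exp (- s * of_real y) * ?X y)" unfolding eq by (rule *(1)) (use s in simp)
    show "lap ?X s = exp (kh2 s) * lap \<psi>1 s" unfolding lap_def eq kh2_def by (rule *(2)) (use s in simp)
  qed
  have s1: "0 < Re (Complex 1 t)" "Re (Complex 1 t) \<le> 1" for t by auto
  have i\<psi>: "integrable lborel (\<lambda>y. exp (- s * of_real y) * \<psi> y)" "lap \<psi> s = \<Phi> s / (\<beta> + s) / (\<beta> + s)"
    if s: "0 < Re s" "Re s \<le> 1" for s
    using conv_edk_lap[OF s(1) \<gamma> \<gamma>12_lap(1)[OF s]] \<gamma>12_lap(2)[OF s] by (simp_all add: \<psi>_def)
  have intf: "integrable lborel ?f"
    using i\<psi>(1)[of 1] lapX(1)[of 1] by (intro Bochner_Integration.integrable_diff) auto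
  have "fourier ?f t = 0" for t
  proof -
    have f1: "?f = (\<lambda>y. exp (- complex_of_real 1 * of_real y) * (\<psi> y - ?X y))"
      by (simp add: fun_eq_iff algebra_simps)
    have "fourier ?f t = lap (\<lambda>y. \<psi> y - ?X y) (Complex 1 t)" unfolding f1 by (rule fourier_lap)
    also have "\<dots> = lap \<psi> (Complex 1 t) - lap ?X (Complex 1 t)"
      unfolding lap_def right_diff_distrib
      by (rule Bochner_Integration.integral_diff[OF i\<psi>(1)[OF s1] lapX(1)[OF s1]])
    also have "\<dots> = 0"
      unfolding i\<psi>(2)[OF s1] lapX(2)[OF s1] \<psi>1_lap(2)[OF s1] \<Phi>_def
      by (simp add: exp_add power2_eq_square)
    finally show ?thesis .
  qed
  then have "?f y = 0" by (rule fourier_zero_imp_zero[OF intf bd cont])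
  then show "\<psi> y = ?X y" by simp
qed

lemma \<psi>_lap:
  assumes s: "0 < Re s" "Re s \<le> 1"
  shows "integrable lborel (\<lambda>y. exp (- s * of_real y) * \<psi> y)" "lap \<psi> s = \<Phi> s / (\<beta> + s)\<^sup>2"
proof -
  have ck: "loc_kernel Q (\<lambda>v. exp (- s * of_real v) * k2 v)"
    by (rule loc_kernel_mult_ctns[OF k2 continuous_on_exp_of_real])
  have eq: "(\<lambda>y. exp (- s * of_real y) * \<psi> y)
     = xconv Q (\<lambda>v. exp (- s * of_real v) * k2 v) (\<lambda>y. exp (- s * of_real y) * \<psi>1 y)"
    unfolding \<psi>_eq by (rule ext, rule sym) (rule xconv_twist[OF k2 loc_bdd_\<psi>1])
  have s': "0 \<le> Re s" using s by simp
  note * = xconv_integral[OF ck loc_bdd_mult_ctns[OF loc_bdd_\<psi>1 continuous_on_exp_of_real] twist_int2(1)[OF s'] \<psi>1_lap(1)[OF s]]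
  show "integrable lborel (\<lambda>y. exp (- s * of_real y) * \<psi> y)" unfolding eq by (rule *(1))
  have "lap \<psi> s = exp (kh2 s) * lap \<psi>1 s" unfolding lap_def eq kh2_def by (rule *(2))
  then show "lap \<psi> s = \<Phi> s / (\<beta> + s)\<^sup>2" by (simp add: \<psi>1_lap(2)[OF s] \<Phi>_def exp_add)
qed

lemma \<psi>_bdd: "norm (\<psi> y) \<le> D * exp K2"
  unfolding \<psi>_eq by (rule xconv_k2_bound[OF loc_bdd_\<psi>1 \<psi>1_le])

end

section \<open>The two implications for \<open>\<psi>\<close> and \<open>\<Phi>\<close>\<close>

lemma lap_dilate:
  assumes r: "0 < r"
  shows "(\<integral>u. f (r * u) * exp (- s * complex_of_real u) \<partial>lborel) = lap f (s / r) / r"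
proof -
  have "(\<integral>y. exp (- (s / r) * of_real y) * f y \<partial>lborel)
     = \<bar>r\<bar> *\<^sub>R (\<integral>u. exp (- (s / r) * of_real (0 + r * u)) * f (0 + r * u) \<partial>lborel)"
    using r by (intro lborel_integral_real_affine) auto
  also have "(\<lambda>u. exp (- (s / r) * of_real (0 + r * u)) * f (0 + r * u)) = (\<lambda>u. f (r * u) * exp (- s * complex_of_real u))"
    using r by (simp add: fun_eq_iff)
  finally show ?thesis using r by (simp add: lap_def scaleR_conv_of_real)
qed

context halasz_pair begin

lemma \<beta>_nz: "\<beta> \<noteq> 0" using \<beta> by auto

text \<open>Slow oscillation of \<open>\<psi>1\<close> implies invariance under fixed shifts, so
  \<open>\<psi>\<close> is asymptotic to a constant multiple of \<open>\<psi>1\<close> and inherits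
  its oscillation bound up to two further errors.\<close>

lemma \<psi>_osc:
  assumes c0: "0 \<le> c0"
    and hyp: "\<And>T e. 0 < e \<Longrightarrow> \<exists>\<sigma>0>0. \<forall>\<sigma> t. 0 < \<sigma> \<longrightarrow> \<sigma> \<le> \<sigma>0 \<longrightarrow> \<bar>t\<bar> \<le> T \<longrightarrow>
      norm (\<Phi> (Complex \<sigma> t)) \<le> c0 / norm (Complex \<sigma> t) + e / \<sigma>"
    and \<delta>: "0 < \<delta>"
  shows "\<exists>\<epsilon>>0. \<exists>y0. \<forall>y\<ge>y0. \<forall>u. 0 \<le> u \<longrightarrow> u \<le> \<epsilon> * y \<longrightarrow> norm (\<psi> y - \<psi> (y - u)) \<le> \<delta>"
proof -
  have osc1: "\<exists>\<epsilon>>0. \<exists>y0. \<forall>y\<ge>y0. \<forall>u. 0 \<le> u \<longrightarrow> u \<le> \<epsilon> * y \<longrightarrow> norm (\<psi>1 y - \<psi>1 (y - u)) \<le> \<delta>" if \<delta>: "0 < \<delta>" for \<delta>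
  proof (rule slow_oscillation[OF _ _ \<delta>, of "exp K2 * c0"])
    show "0 \<le> exp K2 * c0" using c0 by simp
    fix T e :: real assume e: "0 < e"
    obtain \<sigma>0 where \<sigma>0: "0 < \<sigma>0" and h: "\<And>\<sigma> t. 0 < \<sigma> \<Longrightarrow> \<sigma> \<le> \<sigma>0 \<Longrightarrow> \<bar>t\<bar> \<le> T \<Longrightarrow>
      norm (\<Phi> (Complex \<sigma> t)) \<le> c0 / norm (Complex \<sigma> t) + (e / exp K2) / \<sigma>"
      using hyp[of "e / exp K2" T] e by auto
    show "\<exists>\<sigma>0>0. \<forall>\<sigma> t. 0 < \<sigma> \<longrightarrow> \<sigma> \<le> \<sigma>0 \<longrightarrow> \<bar>t\<bar> \<le> T \<longrightarrow>
      norm (exp (kh (Complex \<sigma> t))) \<le> exp K2 * c0 / norm (Complex \<sigma> t) + e / \<sigma>"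
    proof (rule exI[of _ \<sigma>0], rule conjI[OF \<sigma>0], intro allI impI)
      fix \<sigma> t assume s: "0 < \<sigma>" "\<sigma> \<le> \<sigma>0" "\<bar>t\<bar> \<le> T"
      have "norm (exp (kh (Complex \<sigma> t))) \<le> exp K2 * norm (\<Phi> (Complex \<sigma> t))" using s by (intro \<Phi>_kh) auto
      also have "\<dots> \<le> exp K2 * (c0 / norm (Complex \<sigma> t) + (e / exp K2) / \<sigma>)" using h[OF s] by (intro mult_left_mono) auto
      also have "\<dots> = exp K2 * c0 / norm (Complex \<sigma> t) + e / \<sigma>" by (simp add: distrib_left)
      finally show "norm (exp (kh (Complex \<sigma> t))) \<le> exp K2 * c0 / norm (Complex \<sigma> t) + e / \<sigma>" .
    qed
  qed
  let ?E = "exp (\<integral>v. k2 v \<partial>Q)"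
  have sh: "((\<lambda>y. \<psi>1 (y - v) - \<psi>1 y) \<longlongrightarrow> 0) at_top" if v: "0 \<le> v" for v
  proof (rule tendstoI)
    fix e :: real assume e: "0 < e"
    obtain \<epsilon> y0 where \<epsilon>: "0 < \<epsilon>" and o: "\<And>y u. y0 \<le> y \<Longrightarrow> 0 \<le> u \<Longrightarrow> u \<le> \<epsilon> * y \<Longrightarrow> norm (\<psi>1 y - \<psi>1 (y - u)) \<le> e / 2"
      using osc1[of "e / 2"] e by (metis half_gt_zero)
    show "\<forall>\<^sub>F y in at_top. dist (\<psi>1 (y - v) - \<psi>1 y) 0 < e"
      using eventually_ge_at_top[of y0] eventually_ge_at_top[of "v / \<epsilon>"]
    proof eventually_elim
      case (elim y)
      have "v \<le> \<epsilon> * y" using elim \<epsilon> by (simp add: field_simps)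
      then have "norm (\<psi>1 y - \<psi>1 (y - v)) \<le> e / 2" using o elim v by blast
      then show ?case using e by (simp add: norm_minus_commute)
    qed
  qed
  have as: "((\<lambda>y. \<psi> y - ?E * \<psi>1 y) \<longlongrightarrow> 0) at_top"
    unfolding \<psi>_eq by (rule xconv_asymp[OF k2 ik2 loc_bdd_\<psi>1 \<psi>1_le sh])
  define d where "d = \<delta> / 3"
  have d: "0 < d" using \<delta> by (simp add: d_def)
  obtain y1 where y1: "\<And>y. y1 \<le> y \<Longrightarrow> norm (\<psi> y - ?E * \<psi>1 y) < d"
    using tendstoD[OF as d] by (auto simp: eventually_at_top_linorder)
  have E: "0 < norm ?E" by simp
  obtain \<epsilon> y0 where \<epsilon>: "0 < \<epsilon>" and o: "\<And>y u. y0 \<le> y \<Longrightarrow> 0 \<le> u \<Longrightarrow> u \<le> \<epsilon> * y \<Longrightarrow> norm (\<psi>1 y - \<psi>1 (y - u)) \<le> d / norm ?E"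
    using osc1[of "d / norm ?E"] d E by (metis divide_pos_pos)
  show ?thesis
  \<comment> \<open>The cap \<open>1/2\<close> keeps \<open>y - u \<ge> y / 2\<close>, so that the
    asymptotic relation holds at \<open>y - u\<close> as well as at \<open>y\<close>.\<close>
  proof (rule exI[of _ "min \<epsilon> (1/2)"], rule conjI, use \<epsilon> in simp, rule exI[of _ "max y0 (max 1 (2 * \<bar>y1\<bar>))"], intro allI impI)
    fix y u assume y: "max y0 (max 1 (2 * \<bar>y1\<bar>)) \<le> y" and u: "0 \<le> u" "u \<le> min \<epsilon> (1/2) * y"
    have y': "y0 \<le> y" "1 \<le> y" "2 * \<bar>y1\<bar> \<le> y" using y by auto
    have "min \<epsilon> (1/2) * y \<le> \<epsilon> * y" "min \<epsilon> (1/2) * y \<le> (1/2) * y" using y' by (intro mult_right_mono; simp)+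
    then have u': "u \<le> \<epsilon> * y" "u \<le> y / 2" using u by linarith+
    have "norm (\<psi>1 y - \<psi>1 (y - u)) \<le> d / norm ?E" using o y' u u' by blast
    then have a: "norm (?E * (\<psi>1 y - \<psi>1 (y - u))) \<le> d" using E by (simp only: norm_mult) (simp add: field_simps)
    have b: "norm (\<psi> y - ?E * \<psi>1 y) < d" by (rule y1) (use y' in linarith)
    have c: "norm (\<psi> (y - u) - ?E * \<psi>1 (y - u)) < d" by (rule y1) (use y' u' in linarith)
    have "\<psi> y - \<psi> (y - u) = (\<psi> y - ?E * \<psi>1 y) - (\<psi> (y - u) - ?E * \<psi>1 (y - u)) + ?E * (\<psi>1 y - \<psi>1 (y - u))"
      by (simp add: algebra_simps)
    moreover have "norm (p - q + w) \<le> norm p + norm q + norm w" for p q w :: complex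
      using norm_triangle_ineq[of "p - q" w] norm_triangle_ineq4[of p q] by linarith
    ultimately have "norm (\<psi> y - \<psi> (y - u)) \<le> norm (\<psi> y - ?E * \<psi>1 y) + norm (\<psi> (y - u) - ?E * \<psi>1 (y - u)) + norm (?E * (\<psi>1 y - \<psi>1 (y - u)))"
      by (simp only:)
    then show "norm (\<psi> y - \<psi> (y - u)) \<le> \<delta>" using a b c by (simp add: d_def)
  qed
qed

text \<open>The hypothesis is used twice: for all \<open>t\<close> in compact sets to obtain slow
  oscillation, and at \<open>t = 0\<close> to evaluate the transforms in Karamata's argument. The
  constant \<open>c / \<beta>^2\<close> arises because \<open>lap \<psi> s\<close> is
  \<open>\<Phi> s / (\<beta> + s)^2\<close> and \<open>s\<close> tends to \<open>0\<close>.\<close>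

theorem tauber:
  fixes L :: "real \<Rightarrow> complex" and c :: complex
  assumes L: "\<And>u. 0 < u \<Longrightarrow> norm (L u) = 1" and sv: "\<And>l. 0 < l \<Longrightarrow> ((\<lambda>u. L (l * u) / L u) \<longlongrightarrow> 1) at_top"
    and hyp: "\<And>T e. 0 < e \<Longrightarrow> \<exists>\<sigma>0>0. \<forall>\<sigma> t. 0 < \<sigma> \<longrightarrow> \<sigma> \<le> \<sigma>0 \<longrightarrow> \<bar>t\<bar> \<le> T \<longrightarrow>
      norm (\<Phi> (Complex \<sigma> t) - c / Complex \<sigma> t * L (1 / \<sigma>)) \<le> e / \<sigma>"
  shows "((\<lambda>y. \<psi> y - c / \<beta>\<^sup>2 * L y) \<longlongrightarrow> 0) at_top"
proof (rule karamata[OF loc_bddD(1)[OF \<psi>_loc_bdd] \<psi>_bdd L])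
  fix \<delta> :: real assume \<delta>: "0 < \<delta>"
  show "\<exists>\<epsilon>>0. \<exists>y0. \<forall>y\<ge>y0. \<forall>u. 0 \<le> u \<longrightarrow> u \<le> \<epsilon> * y \<longrightarrow> norm (\<psi> y - \<psi> (y - u)) \<le> \<delta>"
  proof (rule \<psi>_osc[OF norm_ge_zero[of c] _ \<delta>])
    fix T e :: real assume e: "0 < e"
    obtain \<sigma>0 where \<sigma>0: "0 < \<sigma>0" and h: "\<And>\<sigma> t. 0 < \<sigma> \<Longrightarrow> \<sigma> \<le> \<sigma>0 \<Longrightarrow> \<bar>t\<bar> \<le> T \<Longrightarrow>
      norm (\<Phi> (Complex \<sigma> t) - c / Complex \<sigma> t * L (1 / \<sigma>)) \<le> e / \<sigma>"
      using hyp[OF e, of T] by auto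
    show "\<exists>\<sigma>0>0. \<forall>\<sigma> t. 0 < \<sigma> \<longrightarrow> \<sigma> \<le> \<sigma>0 \<longrightarrow> \<bar>t\<bar> \<le> T \<longrightarrow>
      norm (\<Phi> (Complex \<sigma> t)) \<le> norm c / norm (Complex \<sigma> t) + e / \<sigma>"
    proof (rule exI[of _ \<sigma>0], rule conjI[OF \<sigma>0], intro allI impI)
      fix \<sigma> t assume s: "0 < \<sigma>" "\<sigma> \<le> \<sigma>0" "\<bar>t\<bar> \<le> T"
      have "norm (c / Complex \<sigma> t * L (1 / \<sigma>)) = norm c / norm (Complex \<sigma> t)"
        using L[of "1 / \<sigma>"] s by (simp add: norm_mult norm_divide)
      then show "norm (\<Phi> (Complex \<sigma> t)) \<le> norm c / norm (Complex \<sigma> t) + e / \<sigma>"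
        using h[OF s] norm_triangle_sub[of "\<Phi> (Complex \<sigma> t)" "c / Complex \<sigma> t * L (1 / \<sigma>)"] by linarith
    qed
  qed
next
  fix n :: nat
  define x where "x = real (Suc n)"
  have x: "0 < x" by (simp add: x_def)
  let ?K = "c / \<beta>\<^sup>2"
  \<comment> \<open>Since \<open>L\<close> has modulus \<open>1\<close>, the ratio tending to
    \<open>1\<close> and the difference tending to \<open>0\<close> say the same.\<close>
  have Lsh: "((\<lambda>r. L (r / x) - L r) \<longlongrightarrow> 0) at_top"
  proof -
    have "((\<lambda>r. L ((1 / x) * r) / L r - 1) \<longlongrightarrow> 1 - 1) at_top" using x by (intro tendsto_intros sv) auto
    then have "((\<lambda>r. norm (L ((1 / x) * r) / L r - 1)) \<longlongrightarrow> 0) at_top" by (simp add: tendsto_norm_zero)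
    moreover have "\<forall>\<^sub>F r in at_top. norm (L ((1 / x) * r) / L r - 1) = norm (L (r / x) - L r)"
      using eventually_gt_at_top[of 0]
    proof eventually_elim
      case (elim r)
      have "L r \<noteq> 0" using L[OF elim] by auto
      then have "L ((1 / x) * r) / L r - 1 = (L (r / x) - L r) / L r" by (simp add: diff_divide_distrib)
      then show ?case using L[OF elim] by (simp add: norm_divide)
    qed
    ultimately have "((\<lambda>r. norm (L (r / x) - L r)) \<longlongrightarrow> 0) at_top" by (simp add: tendsto_cong)
    then show ?thesis by (rule tendsto_norm_zero_cancel)
  qed
  \<comment> \<open>Take \<open>\<sigma> = x / r\<close> and \<open>t = 0\<close>; then
    \<open>1 / \<sigma> = r / x\<close>, and the dilation factor \<open>1 / r\<close> turns the
    error \<open>o (1 / \<sigma>)\<close> into \<open>o (1)\<close>.\<close>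
  have A: "((\<lambda>r. (1 / complex_of_real r) * \<Phi> (of_real (x / r)) - (c / of_real x) * L (r / x)) \<longlongrightarrow> 0) at_top"
  proof (rule tendstoI)
    fix e :: real assume e: "0 < e"
    obtain \<sigma>0 where \<sigma>0: "0 < \<sigma>0" and h: "\<And>\<sigma> t. 0 < \<sigma> \<Longrightarrow> \<sigma> \<le> \<sigma>0 \<Longrightarrow> \<bar>t\<bar> \<le> 0 \<Longrightarrow>
      norm (\<Phi> (Complex \<sigma> t) - c / Complex \<sigma> t * L (1 / \<sigma>)) \<le> (e * x / 2) / \<sigma>"
      using hyp[of "e * x / 2" 0] e x by auto
    show "\<forall>\<^sub>F r in at_top. dist ((1 / complex_of_real r) * \<Phi> (of_real (x / r)) - (c / of_real x) * L (r / x)) 0 < e"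
      using eventually_ge_at_top[of "x / \<sigma>0"] eventually_gt_at_top[of 0]
    proof eventually_elim
      case (elim r)
      have "x / r \<le> \<sigma>0" using elim \<sigma>0 by (simp add: field_simps)
      then have "norm (\<Phi> (Complex (x / r) 0) - c / Complex (x / r) 0 * L (1 / (x / r))) \<le> (e * x / 2) / (x / r)"
        using elim x by (intro h) auto
      then have b: "norm (\<Phi> (of_real (x / r)) - c / of_real (x / r) * L (r / x)) \<le> (e / 2) * r"
        using x elim by (simp add: complex_of_real_def)
      have "(1 / complex_of_real r) * \<Phi> (of_real (x / r)) - (c / of_real x) * L (r / x)
        = (1 / complex_of_real r) * (\<Phi> (of_real (x / r)) - c / of_real (x / r) * L (r / x))"
        using x elim by (simp add: right_diff_distrib)
      then have "norm ((1 / complex_of_real r) * \<Phi> (of_real (x / r)) - (c / of_real x) * L (r / x))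
        = (1 / r) * norm (\<Phi> (of_real (x / r)) - c / of_real (x / r) * L (r / x))"
        using elim by (simp only: norm_mult) (simp add: norm_divide)
      also have "\<dots> \<le> (1 / r) * ((e / 2) * r)" using b elim by (intro mult_left_mono) auto
      also have "\<dots> < e" using elim e by simp
      finally show ?case by (simp only: dist_norm diff_0_right)
    qed
  qed
  have xr: "((\<lambda>r. complex_of_real (x / r)) \<longlongrightarrow> 0) at_top"
  proof -
    have "((\<lambda>r. x / r) \<longlongrightarrow> 0) at_top" by real_asymp
    then show ?thesis using tendsto_of_real_iff[of "\<lambda>r. x / r" 0 at_top] by simp
  qed
  have B: "((\<lambda>r. 1 / (\<beta> + complex_of_real (x / r))\<^sup>2) \<longlongrightarrow> 1 / (\<beta> + 0)\<^sup>2) at_top"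
    by (intro tendsto_intros xr) (use \<beta>_nz in auto)
  have C: "((\<lambda>r. L r * (1 / (\<beta> + complex_of_real (x / r))\<^sup>2 - 1 / \<beta>\<^sup>2)) \<longlongrightarrow> 0) at_top"
  proof (rule tendsto_norm_zero_cancel)
    have "((\<lambda>r. norm (1 / (\<beta> + complex_of_real (x / r))\<^sup>2 - 1 / \<beta>\<^sup>2)) \<longlongrightarrow> 0) at_top"
      using tendsto_diff[OF B tendsto_const[of "1 / \<beta>\<^sup>2"]] by (intro tendsto_norm_zero) simp
    moreover have "\<forall>\<^sub>F r in at_top. norm (1 / (\<beta> + complex_of_real (x / r))\<^sup>2 - 1 / \<beta>\<^sup>2)
       = norm (L r * (1 / (\<beta> + complex_of_real (x / r))\<^sup>2 - 1 / \<beta>\<^sup>2))"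
      using eventually_gt_at_top[of 0] by eventually_elim (simp only: norm_mult L mult_1_left)
    ultimately show "((\<lambda>r. norm (L r * (1 / (\<beta> + complex_of_real (x / r))\<^sup>2 - 1 / \<beta>\<^sup>2))) \<longlongrightarrow> 0) at_top"
      by (rule Lim_transform_eventually)
  qed
  \<comment> \<open>A telescoping sum: first \<open>\<Phi>\<close> is replaced by its main term,
    then \<open>L (r / x)\<close> by \<open>L r\<close>, then \<open>\<beta> + x / r\<close> by
    \<open>\<beta>\<close>.\<close>
  have lim: "((\<lambda>r. ((1 / complex_of_real r) * \<Phi> (of_real (x / r)) - (c / of_real x) * L (r / x)) * (1 / (\<beta> + complex_of_real (x / r))\<^sup>2)
     + (c / of_real x) * (L (r / x) - L r) * (1 / (\<beta> + complex_of_real (x / r))\<^sup>2)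
     + (c / of_real x) * (L r * (1 / (\<beta> + complex_of_real (x / r))\<^sup>2 - 1 / \<beta>\<^sup>2)))
     \<longlongrightarrow> 0 * (1 / (\<beta> + 0)\<^sup>2) + (c / of_real x) * 0 * (1 / (\<beta> + 0)\<^sup>2) + (c / of_real x) * 0) at_top"
    by (intro tendsto_add tendsto_mult A B C Lsh tendsto_const)
  have ev: "\<forall>\<^sub>F r in at_top. ((1 / complex_of_real r) * \<Phi> (of_real (x / r)) - (c / of_real x) * L (r / x)) * (1 / (\<beta> + complex_of_real (x / r))\<^sup>2)
     + (c / of_real x) * (L (r / x) - L r) * (1 / (\<beta> + complex_of_real (x / r))\<^sup>2)
     + (c / of_real x) * (L r * (1 / (\<beta> + complex_of_real (x / r))\<^sup>2 - 1 / \<beta>\<^sup>2))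
     = (\<integral>u. (\<psi> (r * u) - ?K * L r) * edk (of_nat (Suc n)) u \<partial>lborel)"
    using eventually_ge_at_top[of x]
  proof eventually_elim
    case (elim r)
    have r: "0 < r" using elim x by simp
    define s where "s = complex_of_real (x / r)"
    have s: "0 < Re s" "Re s \<le> 1" using elim x by (auto simp: s_def)
    have ed: "edk (of_nat (Suc n)) u = edk (complex_of_real x) u" for u by (simp add: x_def)
    have e: "\<psi> (r * u) * edk (complex_of_real x) u = \<psi> (r * u) * exp (- complex_of_real x * complex_of_real u)" for u
      using loc_bddD(2)[OF \<psi>_loc_bdd, of "r * u"] r
      by (cases "u < 0") (auto simp: edk_neg edk_nonneg mult_less_0_iff)
    have "integrable lborel (\<lambda>u. exp (- s * of_real (0 + r * u)) * \<psi> (0 + r * u))"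
      using lborel_integrable_real_affine[OF \<psi>_lap(1)[OF s], of r 0] r by simp
    moreover have "exp (- s * of_real (0 + r * u)) * \<psi> (0 + r * u) = \<psi> (r * u) * edk (complex_of_real x) u" for u
      unfolding e using r by (simp add: s_def)
    ultimately have i1: "integrable lborel (\<lambda>u. \<psi> (r * u) * edk (complex_of_real x) u)" by (simp only:)
    have re: "0 < Re (complex_of_real x)" using x by simp
    have i2: "integrable lborel (\<lambda>u. ?K * L r * edk (complex_of_real x) u)"
      by (intro integrable_mult_right edk_integral(1)[OF re])
    have "(\<integral>u. (\<psi> (r * u) - ?K * L r) * edk (of_nat (Suc n)) u \<partial>lborel)
       = (\<integral>u. \<psi> (r * u) * edk (complex_of_real x) u \<partial>lborel) - ?K * L r * (1 / complex_of_real x)"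
      unfolding ed left_diff_distrib Bochner_Integration.integral_diff[OF i1 i2] integral_mult_right_zero edk_integral(2)[OF re] ..
    also have "(\<integral>u. \<psi> (r * u) * edk (complex_of_real x) u \<partial>lborel) = lap \<psi> s / r"
      unfolding e lap_dilate[OF r] by (simp add: s_def)
    also have "lap \<psi> s = \<Phi> s * (1 / (\<beta> + s)\<^sup>2)" using \<psi>_lap(2)[OF s] by simp
    finally have I: "(\<integral>u. (\<psi> (r * u) - ?K * L r) * edk (of_nat (Suc n)) u \<partial>lborel)
       = \<Phi> s * (1 / (\<beta> + s)\<^sup>2) / r - c * (1 / \<beta>\<^sup>2) * L r * (1 / complex_of_real x)" by simp
    have alg: "(R * P - X * a) * b + X * (a - l) * b + X * (l * (b - g)) = R * P * b - X * l * g" for R P X a b l g :: complex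
      by (simp add: algebra_simps)
    show ?case unfolding I alg s_def[symmetric] by (simp add: mult.commute)
  qed
  show "((\<lambda>r. \<integral>u. (\<psi> (r * u) - ?K * L r) * edk (of_nat (Suc n)) u \<partial>lborel) \<longlongrightarrow> 0) at_top"
    by (rule Lim_transform_eventually[OF _ ev]) (use lim in simp)
qed

text \<open>Uniformity in \<open>t\<close> is automatic: once absolute values are taken inside the
  Laplace integral, the modulus of \<open>exp (- s * y)\<close> depends only on
  \<open>\<sigma>\<close>. Compactness enters only through the bound for
  \<open>norm (\<beta> + s)\<close>.\<close>

theorem abel:
  fixes L :: "real \<Rightarrow> complex" and c :: complex
  assumes L: "\<And>u. 0 < u \<Longrightarrow> norm (L u) = 1" and sv: "\<And>l. 0 < l \<Longrightarrow> ((\<lambda>u. L (l * u) / L u) \<longlongrightarrow> 1) at_top"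
    and lim: "((\<lambda>y. \<psi> y - c / \<beta>\<^sup>2 * L y) \<longlongrightarrow> 0) at_top" and e: "0 < e"
  shows "\<exists>\<sigma>0>0. \<forall>\<sigma> t. 0 < \<sigma> \<longrightarrow> \<sigma> \<le> \<sigma>0 \<longrightarrow> \<bar>t\<bar> \<le> T \<longrightarrow>
      norm (\<Phi> (Complex \<sigma> t) - c / Complex \<sigma> t * L (1 / \<sigma>)) \<le> e / \<sigma>"
proof -
  let ?K = "c / \<beta>\<^sup>2"
  note [measurable] = loc_bddD(1)[OF \<psi>_loc_bdd]
  have [measurable]: "edk (1::real) \<in> borel_measurable borel" by (rule loc_bddD(1)[OF loc_bdd_edk])
  let ?M = "D * exp K2 + norm ?K"
  have M0: "0 \<le> D * exp K2" using majorant_const_nonneg by simp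
  have bd: "norm (\<psi> z - ?K * L r) \<le> ?M" if "0 < r" for r z
  proof -
    have "norm (?K * L r) = norm ?K" by (simp only: norm_mult L[OF that] mult_1_right)
    then show ?thesis using norm_triangle_ineq4[of "\<psi> z" "?K * L r"] \<psi>_bdd[of z] by linarith
  qed
  have Lsh: "((\<lambda>r. L (l * r) - L r) \<longlongrightarrow> 0) at_top" if l: "0 < l" for l
  proof -
    have "((\<lambda>r. norm (L (l * r) / L r - 1)) \<longlongrightarrow> 0) at_top"
      using tendsto_diff[OF sv[OF l] tendsto_const[of 1]] by (intro tendsto_norm_zero) simp
    moreover have "\<forall>\<^sub>F r in at_top. norm (L (l * r) / L r - 1) = norm (L (l * r) - L r)"
      using eventually_gt_at_top[of 0]
    proof eventually_elim
      case (elim r)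
      have "L r \<noteq> 0" using L[OF elim] by auto
      then have "L (l * r) / L r - 1 = (L (l * r) - L r) / L r" by (simp add: diff_divide_distrib)
      then show ?case using L[OF elim] by (simp add: norm_divide)
    qed
    ultimately have "((\<lambda>r. norm (L (l * r) - L r)) \<longlongrightarrow> 0) at_top" by (rule Lim_transform_eventually)
    then show ?thesis by (rule tendsto_norm_zero_cancel)
  qed
  have h: "((\<lambda>r. \<integral>u. norm (\<psi> (r * u) - ?K * L r) * edk 1 u \<partial>lborel) \<longlongrightarrow> integral\<^sup>L lborel (\<lambda>u::real. 0)) at_top"
  proof (rule integral_dominated_convergence_at_top[where w="\<lambda>u. ?M * edk 1 u"])
    show "integrable lborel (\<lambda>u. ?M * edk (1::real) u)" using edk_integrable_real[of 1] by simp
    show "AE u in lborel. ((\<lambda>r. norm (\<psi> (r * u) - ?K * L r) * edk 1 u) \<longlongrightarrow> 0) at_top"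
      using AE_lborel_singleton[of 0]
    proof eventually_elim
      case (elim u)
      show ?case
      proof (cases "u < 0")
        case False
        then have u: "0 < u" using elim by simp
        have "filterlim (\<lambda>r. u * r) at_top at_top" using u by real_asymp
        from filterlim_compose[OF lim this]
        have "((\<lambda>r. (\<psi> (u * r) - ?K * L (u * r)) + ?K * (L (u * r) - L r)) \<longlongrightarrow> 0 + ?K * 0) at_top"
          by (intro tendsto_intros Lsh u)
        moreover have "(p - k * a) + k * (a - l) = p - k * l" for p k a l :: complex
          by (simp add: algebra_simps)
        ultimately have "((\<lambda>r. \<psi> (r * u) - ?K * L r) \<longlongrightarrow> 0) at_top" by (simp only: mult.commute[of u]) simp
        from tendsto_mult[OF tendsto_norm_zero[OF this] tendsto_const[of "edk 1 u"]] show ?thesis by simp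
      qed (simp add: edk_neg)
    qed
    show "\<forall>\<^sub>F r in at_top. AE u in lborel. norm (norm (\<psi> (r * u) - ?K * L r) * edk 1 u) \<le> ?M * edk 1 u"
      using eventually_gt_at_top[of 0]
    proof eventually_elim
      case (elim r)
      show ?case
      proof (rule AE_I2)
        fix u
        have "norm (norm (\<psi> (r * u) - ?K * L r) * edk 1 u) = norm (\<psi> (r * u) - ?K * L r) * edk 1 u"
          by (simp add: abs_mult edk_real_nonneg)
        also have "\<dots> \<le> ?M * edk 1 u" by (intro mult_right_mono bd elim edk_real_nonneg)
        finally show "norm (norm (\<psi> (r * u) - ?K * L r) * edk 1 u) \<le> ?M * edk 1 u" .
      qed
    qed
  qed measurable
  define B where "B = (norm \<beta> + 1 + \<bar>T\<bar>)\<^sup>2"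
  have "0 < norm \<beta> + 1 + \<bar>T\<bar>" using norm_ge_zero[of \<beta>] abs_ge_zero[of T] by linarith
  then have B: "0 < B" by (simp add: B_def)
  \<comment> \<open>Multiplying the main term of \<open>lap \<psi> s\<close> by
    \<open>(\<beta> + s)^2\<close> overshoots \<open>c / s * L r\<close> by
    \<open>c * (2 * \<beta> + s) / \<beta>^2 * L r\<close>. \<open>C\<close> bounds this remainder,
    which is negligible against \<open>e / \<sigma>\<close>.\<close>
  define C where "C = norm c * (2 * norm \<beta> + 1 + \<bar>T\<bar>) / (norm \<beta>)\<^sup>2"
  have C: "0 \<le> C" by (simp add: C_def)
  define e1 where "e1 = e / 2 / B"
  have e1: "0 < e1" using e B by (simp add: e1_def)
  obtain r0 where r0: "\<And>r. r0 \<le> r \<Longrightarrow> norm (\<integral>u. norm (\<psi> (r * u) - ?K * L r) * edk 1 u \<partial>lborel) < e1"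
    using tendstoD[OF h e1] by (auto simp: eventually_at_top_linorder)
  define \<sigma>0 where "\<sigma>0 = min 1 (min (1 / (\<bar>r0\<bar> + 1)) (e / 2 / (C + 1)))"
  have \<sigma>0: "0 < \<sigma>0" "\<sigma>0 \<le> 1" using e C by (auto simp: \<sigma>0_def intro!: divide_pos_pos add_nonneg_pos)
  show ?thesis
  proof (rule exI[of _ \<sigma>0], rule conjI[OF \<sigma>0(1)], intro allI impI)
    fix \<sigma> t assume \<sigma>: "0 < \<sigma>" "\<sigma> \<le> \<sigma>0" and t: "\<bar>t\<bar> \<le> T"
    define s where "s = Complex \<sigma> t"
    have s: "0 < Re s" "Re s \<le> 1" using \<sigma> \<sigma>0 by (auto simp: s_def)
    define r where "r = 1 / \<sigma>"
    have r: "0 < r" using \<sigma> by (simp add: r_def)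
    have "\<sigma> \<le> 1 / (\<bar>r0\<bar> + 1)" using \<sigma> by (simp add: \<sigma>0_def)
    then have "\<bar>r0\<bar> + 1 \<le> r" using \<sigma> by (simp add: r_def field_simps)
    then have r0r: "r0 \<le> r" by linarith
    have s0: "s \<noteq> 0" using s by auto
    have ns: "norm s \<le> 1 + \<bar>T\<bar>"
      using cmod_le[of s] s t by (simp add: s_def)
    have i2: "integrable lborel (\<lambda>y. ?K * L r * edk s y)"
      by (intro integrable_mult_right edk_integral(1)[OF s(1)])
    have "lap \<psi> s - ?K * L r * (1 / s) = (\<integral>y. exp (- s * of_real y) * \<psi> y - ?K * L r * edk s y \<partial>lborel)"
      unfolding Bochner_Integration.integral_diff[OF \<psi>_lap(1)[OF s] i2] integral_mult_right_zero edk_integral(2)[OF s(1)] lap_def ..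
    then have n1: "norm (lap \<psi> s - ?K * L r * (1 / s)) \<le> (\<integral>y. norm (exp (- s * of_real y) * \<psi> y - ?K * L r * edk s y) \<partial>lborel)"
      by (simp only: integral_norm_bound)
    have pt: "norm (exp (- s * of_real y) * \<psi> y - ?K * L r * edk s y) = norm (\<psi> y - ?K * L r) * edk \<sigma> y" for y
    proof (cases "y < 0")
      case False
      then have "exp (- s * of_real y) * \<psi> y - ?K * L r * edk s y = edk s y * (\<psi> y - ?K * L r)"
        by (simp add: edk_nonneg algebra_simps)
      then show ?thesis by (simp only: norm_mult norm_edk) (simp add: s_def)
    qed (simp add: edk_neg loc_bddD(2)[OF \<psi>_loc_bdd])
    have ed: "edk \<sigma> (0 + r * u) = edk 1 u" for u
      using \<sigma> by (auto simp: edk_def r_def indicator_def zero_le_divide_iff)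
    have "(\<integral>y. norm (\<psi> y - ?K * L r) * edk \<sigma> y \<partial>lborel)
       = \<bar>r\<bar> *\<^sub>R (\<integral>u. norm (\<psi> (0 + r * u) - ?K * L r) * edk \<sigma> (0 + r * u) \<partial>lborel)"
      using r by (intro lborel_integral_real_affine) auto
    then have n2: "(\<integral>y. norm (\<psi> y - ?K * L r) * edk \<sigma> y \<partial>lborel) = r * (\<integral>u. norm (\<psi> (r * u) - ?K * L r) * edk 1 u \<partial>lborel)"
      unfolding ed using r by simp
    have n3: "(\<integral>u. norm (\<psi> (r * u) - ?K * L r) * edk 1 u \<partial>lborel) \<le> e1"
      using r0[OF r0r] by simp
    have n: "norm (lap \<psi> s - ?K * L r * (1 / s)) \<le> r * e1"
      using n1 mult_left_mono[OF n3, of r] r unfolding pt n2 by linarith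
    have bs: "\<beta> + s \<noteq> 0"
    proof
      assume "\<beta> + s = 0"
      then have "Re (\<beta> + s) = 0" by simp
      then show False using \<beta> s by simp
    qed
    have "\<Phi> s = (\<beta> + s)\<^sup>2 * lap \<psi> s" using \<psi>_lap(2)[OF s] bs by simp
    then have eq: "\<Phi> s - c / s * L r = (\<beta> + s)\<^sup>2 * (lap \<psi> s - ?K * L r * (1 / s)) + c * (2 * \<beta> + s) / \<beta>\<^sup>2 * L r"
      using s0 \<beta>_nz by (simp add: field_simps power2_eq_square)
    have "norm ((\<beta> + s)\<^sup>2 * (lap \<psi> s - ?K * L r * (1 / s))) \<le> B * (r * e1)"
    proof -
      have "norm (\<beta> + s) \<le> norm \<beta> + 1 + \<bar>T\<bar>" using norm_triangle_ineq[of \<beta> s] ns by linarith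
      then have "(norm (\<beta> + s))\<^sup>2 \<le> B" unfolding B_def by (intro power_mono) auto
      then show ?thesis unfolding norm_mult norm_power using n B by (intro mult_mono) auto
    qed
    also have "\<dots> = (e / 2) / \<sigma>" using B by (simp add: e1_def r_def)
    finally have p1: "norm ((\<beta> + s)\<^sup>2 * (lap \<psi> s - ?K * L r * (1 / s))) \<le> (e / 2) / \<sigma>" .
    have "norm (c * (2 * \<beta> + s) / \<beta>\<^sup>2 * L r) = norm c * norm (2 * \<beta> + s) / (norm \<beta>)\<^sup>2"
      using L[OF r] by (simp add: norm_mult norm_divide norm_power)
    also have "\<dots> \<le> C"
    proof -
      have "norm (2 * \<beta> + s) \<le> norm (2 * \<beta>) + norm s" by (rule norm_triangle_ineq)
      then have "norm (2 * \<beta> + s) \<le> 2 * norm \<beta> + 1 + \<bar>T\<bar>" using ns by (simp add: norm_mult)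
      then show ?thesis unfolding C_def by (intro divide_right_mono mult_left_mono) auto
    qed
    also have "C \<le> (e / 2) / \<sigma>"
    proof -
      have "\<sigma> \<le> e / 2 / (C + 1)" using \<sigma> by (simp add: \<sigma>0_def)
      moreover have "0 < C + 1" using C by linarith
      ultimately have "\<sigma> * (C + 1) \<le> e / 2" by (simp only: pos_le_divide_eq)
      moreover have "\<sigma> * C \<le> \<sigma> * (C + 1)" using \<sigma> by simp
      ultimately have "\<sigma> * C \<le> e / 2" by linarith
      then show ?thesis using \<sigma> by (simp add: pos_le_divide_eq mult.commute)
    qed
    finally have p2: "norm (c * (2 * \<beta> + s) / \<beta>\<^sup>2 * L r) \<le> (e / 2) / \<sigma>" .
    have "norm (\<Phi> s - c / s * L r) \<le> (e / 2) / \<sigma> + (e / 2) / \<sigma>"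
      unfolding eq by (intro order_trans[OF norm_triangle_ineq] add_mono p1 p2)
    then show "norm (\<Phi> (Complex \<sigma> t) - c / Complex \<sigma> t * L (1 / \<sigma>)) \<le> e / \<sigma>"
      by (simp add: s_def r_def add_divide_distrib[symmetric])
  qed
qed

end

section \<open>Multiplicative convolution in logarithmic coordinates\<close>

lemma pos_variation_eqI:
  assumes M: "sets M = sets borel"
    and eq: "\<And>B. B \<in> sets borel \<Longrightarrow> (SUP A\<in>{A \<in> bdd_borel. A \<subseteq> B}. ennreal (\<nu> A)) = emeasure M B"
  shows "pos_variation \<nu> = M"
proof -
  have sp: "space M = UNIV" using sets_eq_imp_space_eq[OF M] by simp
  have "sigma_sets UNIV (sets borel) = (sets borel :: real set set)"
    using sets.sigma_sets_eq[of "borel :: real measure"] by simp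
  then have "pos_variation \<nu> = measure_of UNIV (sets borel) (emeasure M)"
    unfolding pos_variation_def by (intro measure_of_eq) (auto simp: eq)
  also have "\<dots> = M" using measure_of_of_measure[of M] by (simp add: sp M)
  finally show ?thesis .
qed

lemma bdd_borel_Int: "B \<in> sets borel \<Longrightarrow> A \<in> bdd_borel \<Longrightarrow> B \<inter> A \<in> bdd_borel"
  by (auto simp: bdd_borel_def intro: bounded_subset)

lemma bdd_borel_Icc: "1 \<le> a \<Longrightarrow> {a..b} \<in> bdd_borel" by (auto simp: bdd_borel_def)

text \<open>The variation has the positive part of \<open>f\<close> as its density, cut to
  \<open>{1..}\<close> since the competing sets lie there.\<close>

lemma pos_variation_density:
  fixes f :: "real \<Rightarrow> real"
  assumes M: "sets M = sets borel" and f[measurable]: "f \<in> borel_measurable borel"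
    and int: "\<And>B. B \<in> bdd_borel \<Longrightarrow> set_integrable M B f"
    and \<nu>: "\<And>B. B \<in> bdd_borel \<Longrightarrow> \<nu> B = (LINT x:B|M. f x)"
  shows "pos_variation \<nu> = density M (\<lambda>x. ennreal (f x) * indicator {1..} x)"
proof (rule pos_variation_eqI)
  let ?D = "density M (\<lambda>x. ennreal (f x) * indicator {1..} x)"
  note [measurable_cong] = M
  show "sets ?D = sets borel" by (simp add: M)
  fix B :: "real set" assume B: "B \<in> sets borel"
  have em: "emeasure ?D A = (\<integral>\<^sup>+x. ennreal (f x) * indicator (A \<inter> {1..}) x \<partial>M)" if "A \<in> sets borel" for A
    using that by (subst emeasure_density) (auto simp: M mult.assoc indicator_inter_arith[symmetric] Int_commute intro!: nn_integral_cong)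
  have le: "ennreal (\<nu> A) \<le> emeasure ?D A" if A: "A \<in> bdd_borel" for A
  proof -
    have A': "A \<in> sets borel" "A \<subseteq> {1..}" using A by (auto simp: bdd_borel_def)
    have i: "integrable M (\<lambda>x. indicator A x * max 0 (f x))"
    proof (rule Bochner_Integration.integrable_bound[OF int[OF A, unfolded set_integrable_def]])
      note [measurable] = A'(1)
      show "(\<lambda>x. indicator A x * max 0 (f x)) \<in> borel_measurable M" by measurable
    qed (auto simp: indicator_def)
    have "\<nu> A \<le> (\<integral>x. indicator A x * max 0 (f x) \<partial>M)"
      unfolding \<nu>[OF A] set_lebesgue_integral_def
      using int[OF A] i unfolding set_integrable_def
      by (intro integral_mono) (auto simp: indicator_def)
    then have "ennreal (\<nu> A) \<le> ennreal (\<integral>x. indicator A x * max 0 (f x) \<partial>M)" by (rule ennreal_leI)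
    also have "\<dots> = (\<integral>\<^sup>+x. ennreal (indicator A x * max 0 (f x)) \<partial>M)"
      by (rule nn_integral_eq_integral[OF i, symmetric]) auto
    also have "\<dots> = (\<integral>\<^sup>+x. ennreal (f x) * indicator (A \<inter> {1..}) x \<partial>M)"
      using A' by (intro nn_integral_cong) (auto simp: indicator_def max_def ennreal_neg)
    finally show ?thesis unfolding em[OF A'(1)] .
  qed
  have ge: "emeasure ?D (B \<inter> {1..real n}) \<le> (SUP A\<in>{A \<in> bdd_borel. A \<subseteq> B}. ennreal (\<nu> A))" for n
  proof -
    \<comment> \<open>The optimal competitor is the part of \<open>B\<close> where \<open>f\<close>
      is nonnegative, truncated to be bounded; letting \<open>n\<close> grow recovers all of
      \<open>B\<close> in \<open>{1..}\<close>.\<close>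
    define A where "A = B \<inter> {x. 0 \<le> f x} \<inter> {1..real n}"
    have s: "{x. 0 \<le> f x} \<in> sets borel" by measurable
    have A: "A \<in> bdd_borel" unfolding A_def using B s by (intro bdd_borel_Int bdd_borel_Icc) auto
    have A': "A \<in> sets borel" "A \<subseteq> {1..}" using A by (auto simp: bdd_borel_def)
    have Bn: "B \<inter> {1..real n} \<in> sets borel" using B by auto
    have i: "integrable M (\<lambda>x. indicator A x * f x)" using int[OF A] by (simp add: set_integrable_def)
    have "emeasure ?D (B \<inter> {1..real n}) = (\<integral>\<^sup>+x. ennreal (indicator A x * f x) \<partial>M)"
      unfolding em[OF Bn] by (intro nn_integral_cong) (auto simp: A_def indicator_def ennreal_neg)
    also have "\<dots> = ennreal (\<nu> A)"
      unfolding \<nu>[OF A] set_lebesgue_integral_def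
      by (subst nn_integral_eq_integral[OF i]) (auto simp: A_def indicator_def)
    also have "\<dots> \<le> (SUP A\<in>{A \<in> bdd_borel. A \<subseteq> B}. ennreal (\<nu> A))"
      using A by (intro SUP_upper) (auto simp: A_def)
    finally show ?thesis .
  qed
  show "(SUP A\<in>{A \<in> bdd_borel. A \<subseteq> B}. ennreal (\<nu> A)) = emeasure ?D B"
  proof (rule antisym)
    show "(SUP A\<in>{A \<in> bdd_borel. A \<subseteq> B}. ennreal (\<nu> A)) \<le> emeasure ?D B"
    proof (rule SUP_least)
      fix A assume "A \<in> {A \<in> bdd_borel. A \<subseteq> B}"
      then have "ennreal (\<nu> A) \<le> emeasure ?D A" "A \<subseteq> B" using le by auto
      moreover have "emeasure ?D A \<le> emeasure ?D B" using \<open>A \<subseteq> B\<close> B by (intro emeasure_mono) (auto simp: M)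
      ultimately show "ennreal (\<nu> A) \<le> emeasure ?D B" by (metis order_trans)
    qed
    have "emeasure ?D B = emeasure ?D (\<Union>n. B \<inter> {1..real n})"
    proof -
      have u: "(\<Union>n. B \<inter> {1..real n}) = B \<inter> {1..}" by (auto intro: real_arch_simple)
      have "B \<inter> {1..} \<in> sets borel" using B by auto
      then show ?thesis unfolding u em[OF B] em[OF \<open>B \<inter> {1..} \<in> sets borel\<close>] by (simp add: Int_assoc)
    qed
    also have "\<dots> = (SUP n. emeasure ?D (B \<inter> {1..real n}))"
      using B by (intro SUP_emeasure_incseq[symmetric]) (auto simp: M incseq_def)
    also have "\<dots> \<le> (SUP A\<in>{A \<in> bdd_borel. A \<subseteq> B}. ennreal (\<nu> A))" by (intro SUP_least ge)
    finally show "emeasure ?D B \<le> (SUP A\<in>{A \<in> bdd_borel. A \<subseteq> B}. ennreal (\<nu> A))" .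
  qed
qed

text \<open>The four variations have the positive and negative parts of \<open>Re w\<close> and
  \<open>Im w\<close> as densities, and these recombine to \<open>w\<close>. Integrability over the
  whole half-line is required of the product \<open>h * w\<close>, while \<open>w\<close> itself is
  only locally integrable.\<close>

lemma cm_integral_density:
  fixes w h :: "real \<Rightarrow> complex"
  assumes M: "sets M = sets borel" and w[measurable]: "w \<in> borel_measurable borel"
    and h[measurable]: "h \<in> borel_measurable borel"
    and int: "\<And>B. B \<in> bdd_borel \<Longrightarrow> set_integrable M B w"
    and \<mu>: "\<And>B. B \<in> bdd_borel \<Longrightarrow> \<mu> B = (LINT x:B|M. w x)"
    and hw: "integrable M (\<lambda>x. indicator {1..} x *\<^sub>R (h x * w x))"
  shows "cm_integral \<mu> h = (\<integral>x. indicator {1..} x *\<^sub>R (h x * w x) \<partial>M)"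
proof -
  note [measurable_cong] = M
  have re: "set_integrable M B (\<lambda>x. Re (w x))" and im: "set_integrable M B (\<lambda>x. Im (w x))"
    and reL: "Re (\<mu> B) = (LINT x:B|M. Re (w x))" and imL: "Im (\<mu> B) = (LINT x:B|M. Im (w x))" if "B \<in> bdd_borel" for B
    using integrable_Re[OF int[OF that, unfolded set_integrable_def]] integrable_Im[OF int[OF that, unfolded set_integrable_def]]
      integral_Re[OF int[OF that, unfolded set_integrable_def]] integral_Im[OF int[OF that, unfolded set_integrable_def]] \<mu>[OF that]
    by (auto simp: set_integrable_def set_lebesgue_integral_def)
  have pv: "(LINT x|pos_variation \<nu>. h x) = (\<integral>x. (indicator {1..} x * max 0 (f x)) *\<^sub>R h x \<partial>M)"
    if f[measurable]: "f \<in> borel_measurable borel" and i: "\<And>B. B \<in> bdd_borel \<Longrightarrow> set_integrable M B f"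
      and n: "\<And>B. B \<in> bdd_borel \<Longrightarrow> \<nu> B = (LINT x:B|M. f x)" for f \<nu>
  proof -
    have "pos_variation \<nu> = density M (\<lambda>x. ennreal (f x) * indicator {1..} x)"
      by (rule pos_variation_density[OF M f i n])
    also have "(\<lambda>x. ennreal (f x) * indicator {1..} x) = (\<lambda>x. ennreal (indicator {1..} x * max 0 (f x)))"
      by (auto simp: fun_eq_iff indicator_def max_def ennreal_neg)
    finally show ?thesis by (simp add: integral_density)
  qed
  let ?g = "\<lambda>f x. (indicator {1..} x * max 0 (f x)) *\<^sub>R h x"
  have gi: "integrable M (?g f)" if "f \<in> borel_measurable borel" "\<And>x. \<bar>f x\<bar> \<le> norm (w x)" for f
  proof (rule Bochner_Integration.integrable_bound[OF hw])
    note [measurable] = that(1)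
    show "?g f \<in> borel_measurable M" by measurable
    show "AE x in M. norm (?g f x) \<le> norm (indicator {1..} x *\<^sub>R (h x * w x))"
    proof (rule AE_I2)
      fix x
      have "\<bar>max 0 (f x)\<bar> \<le> norm (w x)" using that(2)[of x] by (auto simp: max_def)
      then show "norm (?g f x) \<le> norm (indicator {1..} x *\<^sub>R (h x * w x))"
        by (auto simp: indicator_def norm_mult mult.commute[of "norm (h x)"] intro!: mult_right_mono)
    qed
  qed
  have g1: "integrable M (?g (\<lambda>x. Re (w x)))" "integrable M (?g (\<lambda>x. - Re (w x)))"
    "integrable M (?g (\<lambda>x. Im (w x)))" "integrable M (?g (\<lambda>x. - Im (w x)))"
    by (intro gi; simp add: abs_Re_le_cmod abs_Im_le_cmod)+
  have "cm_integral \<mu> h = integral\<^sup>L M (?g (\<lambda>x. Re (w x))) - integral\<^sup>L M (?g (\<lambda>x. - Re (w x)))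
     + \<i> * (integral\<^sup>L M (?g (\<lambda>x. Im (w x))) - integral\<^sup>L M (?g (\<lambda>x. - Im (w x))))"
  proof -
    have neg: "set_integrable M B (\<lambda>x. - f x)" if "set_integrable M B f" for B and f :: "real \<Rightarrow> real"
      using that by (simp add: set_integrable_def)
    have "(LINT x|pos_variation (\<lambda>A. Re (\<mu> A)). h x) = integral\<^sup>L M (?g (\<lambda>x. Re (w x)))"
      by (rule pv) (auto simp: reL intro: re)
    moreover have "(LINT x|pos_variation (\<lambda>A. - Re (\<mu> A)). h x) = integral\<^sup>L M (?g (\<lambda>x. - Re (w x)))"
      by (rule pv) (auto simp: reL set_integral_uminus[OF re] intro: neg re)
    moreover have "(LINT x|pos_variation (\<lambda>A. Im (\<mu> A)). h x) = integral\<^sup>L M (?g (\<lambda>x. Im (w x)))"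
      by (rule pv) (auto simp: imL intro: im)
    moreover have "(LINT x|pos_variation (\<lambda>A. - Im (\<mu> A)). h x) = integral\<^sup>L M (?g (\<lambda>x. - Im (w x)))"
      by (rule pv) (auto simp: imL set_integral_uminus[OF im] intro: neg im)
    ultimately show ?thesis unfolding cm_integral_def by (simp only:)
  qed
  also have "\<dots> = (\<integral>x. ?g (\<lambda>x. Re (w x)) x - ?g (\<lambda>x. - Re (w x)) x + \<i> * (?g (\<lambda>x. Im (w x)) x - ?g (\<lambda>x. - Im (w x)) x) \<partial>M)"
    using g1 by simp
  also have "\<dots> = (\<integral>x. indicator {1..} x *\<^sub>R (h x * w x) \<partial>M)"
  proof (intro Bochner_Integration.integral_cong refl)
    fix x
    have "max 0 a *\<^sub>R z - max 0 (- a) *\<^sub>R z = complex_of_real a * z" for a and z :: complex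
      by (auto simp: max_def scaleR_conv_of_real)
    then have "indicator {1..} x *\<^sub>R ((max 0 (Re (w x)) *\<^sub>R h x - max 0 (- Re (w x)) *\<^sub>R h x)
       + \<i> * (max 0 (Im (w x)) *\<^sub>R h x - max 0 (- Im (w x)) *\<^sub>R h x))
       = indicator {1..} x *\<^sub>R ((complex_of_real (Re (w x)) + \<i> * complex_of_real (Im (w x))) * h x)"
      by (simp only:) (simp add: algebra_simps)
    also have "complex_of_real (Re (w x)) + \<i> * complex_of_real (Im (w x)) = w x" by (rule complex_eq[symmetric])
    finally show "?g (\<lambda>x. Re (w x)) x - ?g (\<lambda>x. - Re (w x)) x + \<i> * (?g (\<lambda>x. Im (w x)) x - ?g (\<lambda>x. - Im (w x)) x)
       = indicator {1..} x *\<^sub>R (h x * w x)"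
      by (simp add: algebra_simps indicator_def)
  qed
  finally show ?thesis .
qed

text \<open>The adjoint of multiplicative convolution with \<open>w\<close> times \<open>M\<close>.
  It acts on test functions, so that a convolution power evaluated at a set becomes an iterate
  applied to the indicator of that set.\<close>

definition mdil :: "real measure \<Rightarrow> (real \<Rightarrow> complex) \<Rightarrow> (real \<Rightarrow> complex) \<Rightarrow> real \<Rightarrow> complex" where
  "mdil M w f u = (\<integral>v. indicator {1..} v *\<^sub>R (f (u * v) * w v) \<partial>M)"

lemma mdil_pow_measurable:
  assumes M: "sigma_finite_measure M" "sets M = sets borel" and w[measurable]: "w \<in> borel_measurable borel"
    and f: "f \<in> borel_measurable borel"
  shows "(mdil M w ^^ n) f \<in> borel_measurable borel"
proof (induction n)
  case (Suc n)
  interpret sigma_finite_measure M by fact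
  note [measurable_cong] = M(2)
  define g where "g = (mdil M w ^^ n) f"
  have [measurable]: "g \<in> borel_measurable borel" using Suc by (simp add: g_def)
  have "mdil M w g \<in> borel_measurable borel" unfolding mdil_def[abs_def] by measurable
  then show ?case by (simp add: g_def)
qed (use f in simp)

text \<open>Dilations commute with the operator, and from an argument at least \<open>1\<close> only
  arguments at least \<open>1\<close> are reached.\<close>

lemma mdil_pow_dilate:
  assumes "\<And>v. 1 \<le> v \<Longrightarrow> f v = g (u * v)" "1 \<le> v"
  shows "(mdil M w ^^ n) f v = (mdil M w ^^ n) g (u * v)"
  using assms(2)
proof (induction n arbitrary: v)
  case (Suc n)
  have "1 \<le> v * v'" if "1 \<le> v'" for v' using mult_mono[of 1 v 1 v'] that Suc.prems by simp
  then have eq: "(mdil M w ^^ n) f (v * v') = (mdil M w ^^ n) g (u * v * v')" if "1 \<le> v'" for v'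
    using Suc.IH that by (simp add: mult.assoc)
  show ?case
    unfolding funpow.simps o_apply mdil_def[of M w "(mdil M w ^^ n) f"] mdil_def[of M w "(mdil M w ^^ n) g"]
  proof (intro Bochner_Integration.integral_cong refl)
    fix x
    show "indicator {1..} x *\<^sub>R ((mdil M w ^^ n) f (v * x) * w x) = indicator {1..} x *\<^sub>R ((mdil M w ^^ n) g (u * v * x) * w x)"
      using eq by (cases "1 \<le> x") auto
  qed
qed (use assms in auto)

text \<open>Arguments only grow under dilation by \<open>v \<ge> 1\<close>, so every iterate
  vanishes beyond \<open>b\<close>, and integrability of \<open>w\<close> on \<open>{1..b}\<close>
  is enough for all powers.\<close>

lemma mdil_pow_bound:
  assumes M: "sets M = sets borel" and w[measurable]: "w \<in> borel_measurable borel"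
    and int: "\<And>B. B \<in> bdd_borel \<Longrightarrow> set_integrable M B w"
    and B: "B \<subseteq> {..b}" and v: "1 \<le> v"
  shows "norm ((mdil M w ^^ n) (indicator B) v) \<le> (\<integral>x. indicator {1..b} x * norm (w x) \<partial>M) ^ n * indicator {..b} v"
  using v
proof (induction n arbitrary: v)
  case 0
  then show ?case using B by (auto simp: indicator_def)
next
  case (Suc n)
  let ?W = "\<integral>x. indicator {1..b} x * norm (w x) \<partial>M"
  have iw: "integrable M (\<lambda>x. indicator {1..b} x * norm (w x))"
    using integrable_norm[OF int[OF bdd_borel_Icc[of 1 b], unfolded set_integrable_def]] by simp
  have W0: "0 \<le> ?W" by (intro integral_nonneg_AE) auto
  have "norm (mdil M w ((mdil M w ^^ n) (indicator B)) v)
     \<le> (\<integral>x. norm (indicator {1..} x *\<^sub>R ((mdil M w ^^ n) (indicator B) (v * x) * w x)) \<partial>M)"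
    unfolding mdil_def[of M w "(mdil M w ^^ n) (indicator B)"] by (rule integral_norm_bound)
  also have "\<dots> \<le> (\<integral>x. (?W ^ n * indicator {..b} v) * (indicator {1..b} x * norm (w x)) \<partial>M)"
  proof (rule integral_mono')
    show "integrable M (\<lambda>x. (?W ^ n * indicator {..b} v) * (indicator {1..b} x * norm (w x)))"
      using iw by (rule integrable_mult_right)
    show "0 \<le> (?W ^ n * indicator {..b} v) * (indicator {1..b} x * norm (w x))" for x
      using W0 by (intro mult_nonneg_nonneg) auto
    fix x
    show "norm (indicator {1..} x *\<^sub>R ((mdil M w ^^ n) (indicator B) (v * x) * w x))
       \<le> (?W ^ n * indicator {..b} v) * (indicator {1..b} x * norm (w x))"
    proof (cases "1 \<le> x")
      case True
      have vx: "1 \<le> v * x" "v \<le> v * x" "x \<le> v * x"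
        using True Suc.prems mult_mono[of 1 v 1 x] mult_left_mono[of 1 x v] mult_right_mono[of 1 v x] by auto
      have "norm ((mdil M w ^^ n) (indicator B) (v * x)) \<le> ?W ^ n * indicator {..b} (v * x)" by (rule Suc.IH[OF vx(1)])
      also have "\<dots> \<le> ?W ^ n * (indicator {..b} v * indicator {1..b} x)"
      proof (rule mult_left_mono)
        show "indicator {..b} (v * x) \<le> (indicator {..b} v * indicator {1..b} x :: real)"
          using order_trans[OF vx(2), of b] order_trans[OF vx(3), of b] True
          by (cases "v * x \<le> b") (auto simp: indicator_def)
      qed (use W0 in simp)
      finally have "norm ((mdil M w ^^ n) (indicator B) (v * x)) * norm (w x) \<le> ?W ^ n * (indicator {..b} v * indicator {1..b} x) * norm (w x)"
        by (rule mult_right_mono) simp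
      then show ?thesis using True by (simp add: norm_mult mult_ac)
    qed (use W0 in \<open>simp add: indicator_def\<close>)
  qed
  also have "\<dots> = ?W ^ Suc n * indicator {..b} v" by simp
  finally show ?case by simp
qed

text \<open>The parameter \<open>u\<close> makes the induction work, because
  \<open>mult_conv\<close> evaluates its second argument at dilated sets
  \<open>{v \<in> {1..}. u * v \<in> B}\<close>.\<close>

lemma mult_conv_pow:
  assumes M: "sigma_finite_measure M" "sets M = sets borel" and w[measurable]: "w \<in> borel_measurable borel"
    and int: "\<And>B. B \<in> bdd_borel \<Longrightarrow> set_integrable M B w"
    and \<mu>: "\<And>B. B \<in> bdd_borel \<Longrightarrow> \<mu> B = (LINT x:B|M. w x)"
    and B: "B \<in> bdd_borel"
  shows "((mult_conv \<mu> ^^ n) dirac_one) {v \<in> {1..}. u * v \<in> B} = (mdil M w ^^ n) (indicator B) u"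
  using B
proof (induction n arbitrary: u B)
  case 0
  then show ?case by (auto simp: dirac_one_def indicator_def)
next
  case (Suc n)
  note [measurable_cong] = M(2)
  define C where "C = {v \<in> {1..}. u * v \<in> B}"
  have B: "B \<in> sets borel" "B \<subseteq> {1..}" "bounded B" using Suc.prems by (auto simp: bdd_borel_def)
  have C: "C \<in> bdd_borel"
  proof -
    have "(\<lambda>v. u * v) -` B \<inter> space borel \<in> sets borel" using B(1) by (intro measurable_sets) auto
    moreover have "C = {1..} \<inter> ((\<lambda>v. u * v) -` B \<inter> space borel)" by (auto simp: C_def)
    ultimately have "C \<in> sets borel" by auto
    moreover have "bounded C"
    proof (cases "u = 0")
      case False
      have "C \<subseteq> (\<lambda>x. (1 / u) *\<^sub>R x) ` B" using False by (auto simp: C_def image_iff intro!: bexI[of _ "u * _"])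
      then show ?thesis using bounded_scaling[OF B(3), of "1 / u"] bounded_subset by blast
    next
      case True
      then have "C = {}" using B(2) by (auto simp: C_def)
      then show ?thesis by simp
    qed
    ultimately show ?thesis by (auto simp: bdd_borel_def C_def)
  qed
  have Cb: "C \<in> sets borel" using C by (simp add: bdd_borel_def)
  obtain b where b: "C \<subseteq> {..b}"
  proof -
    obtain a where "\<forall>x\<in>C. norm x \<le> a" using C by (auto simp: bdd_borel_def bounded_iff)
    then have "C \<subseteq> {..a}" by force
    then show ?thesis using that by blast
  qed
  let ?h = "(mdil M w ^^ n) (indicator C)"
  have h[measurable]: "?h \<in> borel_measurable borel"
    by (rule mdil_pow_measurable[OF M w]) (use Cb in simp)
  have hw: "integrable M (\<lambda>x. indicator {1..} x *\<^sub>R (?h x * w x))"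
  proof (rule Bochner_Integration.integrable_bound)
    let ?W = "(\<integral>x. indicator {1..b} x * norm (w x) \<partial>M) ^ n"
    have W0: "0 \<le> ?W" by (intro zero_le_power integral_nonneg_AE) auto
    show "integrable M (\<lambda>x. ?W *\<^sub>R (indicator {1..b} x *\<^sub>R w x))"
      using int[OF bdd_borel_Icc[of 1 b], unfolded set_integrable_def] by (intro integrable_scaleR_right) simp
    show "AE x in M. norm (indicator {1..} x *\<^sub>R (?h x * w x)) \<le> norm (?W *\<^sub>R (indicator {1..b} x *\<^sub>R w x))"
    proof (rule AE_I2)
      fix x
      show "norm (indicator {1..} x *\<^sub>R (?h x * w x)) \<le> norm (?W *\<^sub>R (indicator {1..b} x *\<^sub>R w x))"
      proof (cases "1 \<le> x")
        case True
        have "norm (?h x) \<le> ?W * indicator {..b} x" by (rule mdil_pow_bound[OF M(2) w int b True])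
        then have "norm (?h x) * norm (w x) \<le> ?W * indicator {..b} x * norm (w x)" by (rule mult_right_mono) simp
        then show ?thesis using True W0 by (simp add: norm_mult indicator_def split: if_splits)
      qed simp
    qed
  qed measurable
  have "((mult_conv \<mu> ^^ Suc n) dirac_one) C = cm_integral \<mu> (\<lambda>v. ((mult_conv \<mu> ^^ n) dirac_one) {v' \<in> {1..}. v * v' \<in> C})"
    by (simp add: mult_conv_def)
  also have "\<dots> = cm_integral \<mu> ?h" by (simp only: Suc.IH[OF C])
  also have "\<dots> = (\<integral>x. indicator {1..} x *\<^sub>R (?h x * w x) \<partial>M)"
    by (rule cm_integral_density[OF M(2) w h int \<mu> hw])
  also have "\<dots> = (\<integral>x. indicator {1..} x *\<^sub>R ((mdil M w ^^ n) (indicator B) (u * x) * w x) \<partial>M)"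
  proof (intro Bochner_Integration.integral_cong refl)
    fix x
    have "?h x = (mdil M w ^^ n) (indicator B) (u * x)" if "1 \<le> x"
      by (rule mdil_pow_dilate[OF _ that]) (auto simp: C_def indicator_def)
    then show "indicator {1..} x *\<^sub>R (?h x * w x) = indicator {1..} x *\<^sub>R ((mdil M w ^^ n) (indicator B) (u * x) * w x)"
      by (cases "1 \<le> x") auto
  qed
  also have "\<dots> = (mdil M w ^^ Suc n) (indicator B) u" by (simp add: mdil_def)
  finally show ?case by (simp only: C_def)
qed

lemma exp_star_eq:
  assumes M: "sigma_finite_measure M" "sets M = sets borel" and w: "w \<in> borel_measurable borel"
    and int: "\<And>B. B \<in> bdd_borel \<Longrightarrow> set_integrable M B w"
    and \<mu>: "\<And>B. B \<in> bdd_borel \<Longrightarrow> \<mu> B = (LINT x:B|M. w x)"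
    and B: "B \<in> bdd_borel"
  shows "exp_star \<mu> B = (\<Sum>n. (mdil M w ^^ n) (indicator B) 1 /\<^sub>R fact n)"
proof -
  have "{v \<in> {1..}. 1 * v \<in> B} = B" using B by (auto simp: bdd_borel_def)
  then have "((mult_conv \<mu> ^^ n) dirac_one) B = (mdil M w ^^ n) (indicator B) 1" for n
    using mult_conv_pow[OF assms, of n 1] by simp
  then show ?thesis by (simp add: exp_star_def scaleR_conv_of_real divide_inverse mult.commute)
qed

section \<open>Mellin transforms as Laplace transforms of distribution functions\<close>

lemma exp_tail_nn:
  assumes s: "0 < s"
  shows "(\<integral>\<^sup>+y. ennreal (s * exp (- s * y)) * indicator {a..} y \<partial>lborel) = ennreal (exp (- s * a))"
proof -
  have int: "integrable lborel (\<lambda>y. (s * exp (- s * a)) * edk s (y - a))"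
    using integrable_lborel_shift[OF edk_integrable_real[OF s], of a] by simp
  have "(\<integral>\<^sup>+y. ennreal (s * exp (- s * y)) * indicator {a..} y \<partial>lborel)
      = (\<integral>\<^sup>+y. ennreal ((s * exp (- s * a)) * edk s (y - a)) \<partial>lborel)"
  proof (intro nn_integral_cong)
    fix y
    have "exp (- s * y) = exp (- s * a) * exp (- s * (y - a))"
      unfolding exp_add[symmetric] by (simp add: algebra_simps)
    then show "ennreal (s * exp (- s * y)) * indicator {a..} y = ennreal ((s * exp (- s * a)) * edk s (y - a))"
      by (auto simp: edk_def indicator_def mult.assoc)
  qed
  also have "\<dots> = ennreal ((s * exp (- s * a)) * (\<integral>y. edk s (y - a) \<partial>lborel))"
    by (subst nn_integral_eq_integral[OF int]) (use s in \<open>auto intro!: mult_nonneg_nonneg edk_real_nonneg\<close>)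
  also have "(\<integral>y. edk s (y - a) \<partial>lborel) = 1 / s"
    unfolding integral_lborel_shift by (rule edk_integral_real[OF s])
  finally show ?thesis using s by simp
qed

text \<open>Write \<open>x powr (- s)\<close> as the integral of \<open>s * exp (- s * y)\<close>
  over \<open>y \<ge> ln x\<close> and apply Tonelli. Nothing has to be finite, so the formula is
  available before convergence is known.\<close>

lemma layer_cake_nn:
  assumes V: "sigma_finite_measure V" "sets V = sets borel" and ge1: "AE x in V. 1 \<le> x" and s: "0 < s"
  shows "(\<integral>\<^sup>+x. ennreal (x powr (- s)) \<partial>V) = (\<integral>\<^sup>+y. ennreal (s * exp (- s * y)) * emeasure V {1..exp y} \<partial>lborel)"
proof -
  interpret V: sigma_finite_measure V by fact
  interpret pair_sigma_finite V lborel ..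
  note [measurable_cong] = V(2)
  \<comment> \<open>The condition \<open>x \<le> exp y\<close> is written as an indicator of
    \<open>exp y - x\<close>, which makes joint measurability evident.\<close>
  have "(\<integral>\<^sup>+x. ennreal (x powr (- s)) \<partial>V)
     = (\<integral>\<^sup>+x. (\<integral>\<^sup>+y. ennreal (s * exp (- s * y)) * indicator {0..} (exp y - x) * indicator {1..} x \<partial>lborel) \<partial>V)"
  proof (rule nn_integral_cong_AE)
    show "AE x in V. ennreal (x powr (- s)) = (\<integral>\<^sup>+y. ennreal (s * exp (- s * y)) * indicator {0..} (exp y - x) * indicator {1..} x \<partial>lborel)"
      using ge1
    proof eventually_elim
    case (elim x)
    note x = elim
    have "(\<integral>\<^sup>+y. ennreal (s * exp (- s * y)) * indicator {0..} (exp y - x) * indicator {1..} x \<partial>lborel)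
       = (\<integral>\<^sup>+y. ennreal (s * exp (- s * y)) * indicator {ln x..} y \<partial>lborel)"
    proof (intro nn_integral_cong)
      fix y
      have "ln x \<le> y \<longleftrightarrow> x \<le> exp y" using x by (metis exp_le_cancel_iff exp_ln less_le_trans zero_less_one)
      then show "ennreal (s * exp (- s * y)) * indicator {0..} (exp y - x) * indicator {1..} x = ennreal (s * exp (- s * y)) * indicator {ln x..} y"
        using x by (auto simp: indicator_def)
    qed
    then show ?case
      unfolding exp_tail_nn[OF s] using x by (simp add: powr_def)
    qed
  qed
  also have "\<dots> = (\<integral>\<^sup>+y. (\<integral>\<^sup>+x. ennreal (s * exp (- s * y)) * indicator {0..} (exp y - x) * indicator {1..} x \<partial>V) \<partial>lborel)"
    by (rule Fubini'[symmetric]) measurable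
  also have "\<dots> = (\<integral>\<^sup>+y. ennreal (s * exp (- s * y)) * emeasure V {1..exp y} \<partial>lborel)"
  proof (intro nn_integral_cong)
    fix y
    have "(\<integral>\<^sup>+x. ennreal (s * exp (- s * y)) * indicator {0..} (exp y - x) * indicator {1..} x \<partial>V)
       = (\<integral>\<^sup>+x. ennreal (s * exp (- s * y)) * indicator {1..exp y} x \<partial>V)"
      by (intro nn_integral_cong) (auto simp: indicator_def)
    also have "\<dots> = ennreal (s * exp (- s * y)) * emeasure V {1..exp y}"
      by (rule nn_integral_cmult_indicator) (simp add: V)
    finally show "(\<integral>\<^sup>+x. ennreal (s * exp (- s * y)) * indicator {0..} (exp y - x) * indicator {1..} x \<partial>V)
       = ennreal (s * exp (- s * y)) * emeasure V {1..exp y}" .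
  qed
  finally show ?thesis .
qed

text \<open>The principal logarithm jumps across the negative axis, so the power is written out
  according to the sign of \<open>x\<close>.\<close>

lemma borel_measurable_of_real_powr [measurable]:
  "(\<lambda>x. complex_of_real x powr z) \<in> borel_measurable borel"
proof -
  have "complex_of_real x powr z = (if 0 < x then exp (z * of_real (ln x))
     else if x < 0 then exp (z * (of_real (ln (- x)) + \<i> * of_real pi)) else 0)" for x
  proof -
    have "ln (complex_of_real x) = of_real (ln (- x)) + \<i> * of_real pi" if "x < 0"
    proof -
      have "ln (- complex_of_real (- x)) = ln (complex_of_real (- x)) + \<i> * of_real pi"
        using that by (subst Ln_minus) (auto simp: Ln_of_real)
      then show ?thesis using that Ln_of_real[of "- x"] by simp
    qed
    then show ?thesis by (auto simp: powr_def Ln_of_real)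
  qed
  then have "(\<lambda>x. complex_of_real x powr z) = (\<lambda>x. if 0 < x then exp (z * of_real (ln x))
     else if x < 0 then exp (z * (of_real (ln (- x)) + \<i> * of_real pi)) else 0)" by (rule ext)
  also have "\<dots> \<in> borel_measurable borel" by measurable
  finally show ?thesis .
qed

text \<open>The complex form of the same identity; \<open>D\<close> bounds the distribution function
  and supplies the absolute integrability that Fubini requires.\<close>

lemma layer_cake:
  assumes V: "sigma_finite_measure V" "sets V = sets borel" and ge1: "AE x in V. 1 \<le> x" and s: "0 < Re s"
    and D: "\<And>y. emeasure V {1..exp y} \<le> ennreal (D y)" "\<And>y. 0 \<le> D y"
    and Di: "integrable lborel (\<lambda>y. exp (- Re s * y) * D y)"
  shows "integrable V (\<lambda>x. complex_of_real x powr (- s))"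
    and "integrable lborel (\<lambda>y. exp (- s * of_real y) * of_real (measure V {1..exp y}))"
    and "(\<integral>x. complex_of_real x powr (- s) \<partial>V) = s * (\<integral>y. exp (- s * of_real y) * of_real (measure V {1..exp y}) \<partial>lborel)"
proof -
  interpret V: sigma_finite_measure V by fact
  interpret pair_sigma_finite V lborel ..
  note [measurable_cong] = V(2)
  let ?f = "\<lambda>x y. s * (exp (- s * of_real y) * of_real (indicator {0..} (exp y - x) * indicator {1..} x))"
  have fin: "emeasure V {1..exp y} < \<infinity>" for y
    using D(1)[of y] by (rule le_less_trans) simp
  have em: "emeasure V {1..exp y} = ennreal (measure V {1..exp y})" for y
    using fin[of y] by (simp add: emeasure_eq_ennreal_measure)
  have inner: "integrable V (\<lambda>x. indicator {0..} (exp y - x) * indicator {1..} x :: real)"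
    "(\<integral>x. indicator {0..} (exp y - x) * indicator {1..} x \<partial>V) = measure V {1..exp y}" for y
  proof -
    have eq: "(\<lambda>x. indicator {0..} (exp y - x) * indicator {1..} x) = (indicator {1..exp y} :: real \<Rightarrow> real)"
      by (auto simp: indicator_def)
    show "integrable V (\<lambda>x. indicator {0..} (exp y - x) * indicator {1..} x :: real)"
      unfolding eq using fin[of y] by (intro integrable_real_indicator) (auto simp: V)
    show "(\<integral>x. indicator {0..} (exp y - x) * indicator {1..} x \<partial>V) = measure V {1..exp y}"
      unfolding eq using V by (simp add: sets_eq_imp_space_eq[OF V(2)])
  qed
  have int: "integrable (V \<Otimes>\<^sub>M lborel) (case_prod ?f)"
  proof (rule integrableI_bounded)
    show "case_prod ?f \<in> borel_measurable (V \<Otimes>\<^sub>M lborel)" by measurable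
    have "(\<integral>\<^sup>+p. ennreal (norm (case_prod ?f p)) \<partial>(V \<Otimes>\<^sub>M lborel))
       = (\<integral>\<^sup>+y. (\<integral>\<^sup>+x. ennreal (norm (?f x y)) \<partial>V) \<partial>lborel)"
    proof (subst nn_integral_snd[symmetric])
      show "(\<lambda>p. ennreal (norm (case_prod ?f p))) \<in> borel_measurable (V \<Otimes>\<^sub>M lborel)"
        unfolding case_prod_unfold by measurable
    qed simp
    also have "\<dots> \<le> (\<integral>\<^sup>+y. ennreal (norm s * (exp (- Re s * y) * D y)) \<partial>lborel)"
    proof (intro nn_integral_mono)
      fix y
      have "(\<integral>\<^sup>+x. ennreal (norm (?f x y)) \<partial>V) = (\<integral>\<^sup>+x. ennreal (norm s * exp (- Re s * y)) * indicator {1..exp y} x \<partial>V)"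
        by (intro nn_integral_cong) (auto simp: norm_mult indicator_def)
      also have "\<dots> = ennreal (norm s * exp (- Re s * y)) * emeasure V {1..exp y}"
        by (rule nn_integral_cmult_indicator) (simp add: V)
      also have "\<dots> \<le> ennreal (norm s * exp (- Re s * y)) * ennreal (D y)"
        using D(1) by (intro mult_left_mono) auto
      also have "\<dots> = ennreal (norm s * (exp (- Re s * y) * D y))"
        using D(2) by (subst ennreal_mult[symmetric]) (auto simp: mult.assoc)
      finally show "(\<integral>\<^sup>+x. ennreal (norm (?f x y)) \<partial>V) \<le> ennreal (norm s * (exp (- Re s * y) * D y))" .
    qed
    also have "\<dots> < \<infinity>"
      using integrable_mult_right[OF Di, of "norm s"] D(2) by (subst nn_integral_eq_integral) auto
    finally show "(\<integral>\<^sup>+p. ennreal (norm (case_prod ?f p)) \<partial>(V \<Otimes>\<^sub>M lborel)) < \<infinity>" .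
  qed
  have fx: "(\<integral>y. ?f x y \<partial>lborel) = complex_of_real x powr (- s)" if x: "1 \<le> x" for x
  proof -
    let ?a = "ln x"
    have "?f x y = (s * exp (- s * of_real ?a)) * edk s (y - ?a)" for y
    proof -
      have "ln x \<le> y \<longleftrightarrow> x \<le> exp y" using x by (metis exp_le_cancel_iff exp_ln less_le_trans zero_less_one)
      moreover have "exp (- s * of_real y) = exp (- s * of_real ?a) * exp (- s * of_real (y - ?a))"
        unfolding exp_add[symmetric] by (simp add: algebra_simps)
      ultimately show ?thesis using x by (cases "ln x \<le> y") (auto simp: edk_def)
    qed
    then have "(\<integral>y. ?f x y \<partial>lborel) = (s * exp (- s * of_real ?a)) * (\<integral>y. edk s (y - ?a) \<partial>lborel)"
      by (simp only: integral_mult_right_zero)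
    also have "(\<integral>y. edk s (y - ?a) \<partial>lborel) = 1 / s"
      unfolding integral_lborel_shift by (rule edk_integral(2)[OF s])
    finally show ?thesis using x s by (auto simp: powr_def Ln_of_real)
  qed
  have fy: "(\<integral>x. ?f x y \<partial>V) = s * (exp (- s * of_real y) * of_real (measure V {1..exp y}))" for y
  proof -
    have "(\<integral>x. ?f x y \<partial>V) = s * (exp (- s * of_real y) * (\<integral>x. complex_of_real (indicator {0..} (exp y - x) * indicator {1..} x) \<partial>V))"
      by (simp only: integral_mult_right_zero)
    then show ?thesis by (simp only: integral_complex_of_real inner(2))
  qed
  have ae: "AE x in V. (\<integral>y. ?f x y \<partial>lborel) = complex_of_real x powr (- s)"
    using ge1 by eventually_elim (rule fx)
  have m: "(\<lambda>x. complex_of_real x powr (- s)) \<in> borel_measurable V" by measurable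
  show "integrable V (\<lambda>x. complex_of_real x powr (- s))"
    using integrable_fst[OF int] ae m by (subst (asm) integrable_cong_AE) auto
  have "integrable lborel (\<lambda>y. (1 / s) * (s * (exp (- s * of_real y) * of_real (measure V {1..exp y}))))"
    using integrable_snd[OF int] unfolding fy by (rule integrable_mult_right)
  then show "integrable lborel (\<lambda>y. exp (- s * of_real y) * of_real (measure V {1..exp y}))"
  proof -
    have "s \<noteq> 0" using s by auto
    then have "(1 / s) * (s * z) = z" for z by simp
    then show ?thesis using \<open>integrable lborel (\<lambda>y. (1 / s) * _ y)\<close> by (simp only:)
  qed
  have "(\<integral>x. complex_of_real x powr (- s) \<partial>V) = (\<integral>x. (\<integral>y. ?f x y \<partial>lborel) \<partial>V)"
    using ae m borel_measurable_integrable[OF integrable_fst[OF int]] by (intro integral_cong_AE) auto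
  also have "\<dots> = (\<integral>y. (\<integral>x. ?f x y \<partial>V) \<partial>lborel)" by (rule Fubini_integral[OF int, symmetric])
  finally show "(\<integral>x. complex_of_real x powr (- s) \<partial>V) = s * (\<integral>y. exp (- s * of_real y) * of_real (measure V {1..exp y}) \<partial>lborel)"
    unfolding fy by (simp only: integral_mult_right_zero)
qed

section \<open>The prime measure in the logarithmic variable\<close>

definition lker :: "(real \<Rightarrow> 'a) \<Rightarrow> real \<Rightarrow> 'a::{real_normed_field, banach, second_countable_topology}" where
  "lker w v = indicator {0..} v *\<^sub>R w (exp v)"

locale beurling_primes =
  fixes P :: "real \<Rightarrow> real"
  assumes mono: "mono P" and rcont: "\<And>x. continuous (at_right x) P" and P0: "\<And>x. x \<le> 1 \<Longrightarrow> P x = 0"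
begin

abbreviation "dP \<equiv> interval_measure P"
definition "logP = distr dP borel (ln :: real \<Rightarrow> real)"

lemma P_Ioc: "a \<le> b \<Longrightarrow> emeasure dP {a<..b} = ennreal (P b - P a)"
  by (rule emeasure_interval_measure_Ioc) (use mono rcont in \<open>auto simp: mono_def\<close>)

lemma sigma_finite_dP: "sigma_finite_measure dP"
  by (rule sigma_finite_interval_measure) (use mono rcont in \<open>auto simp: mono_def\<close>)

text \<open>There is neither mass below \<open>1\<close> nor an atom at \<open>1\<close>, so
  \<open>ln\<close> maps the prime measure into the positive axis, and its values at nonpositive
  arguments do not matter.\<close>

lemma P_ge1: "AE x in dP. 1 < x"
proof -
  have "{..1::real} = (\<Union>n::nat. {- real n - 1<..1})"
  proof (intro equalityI subsetI)
    fix x :: real assume "x \<in> {..1}"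
    moreover obtain n where "- x \<le> real n" using real_arch_simple by blast
    ultimately show "x \<in> (\<Union>n::nat. {- real n - 1<..1})" by (auto intro!: exI[of _ n])
  qed auto
  moreover have "{- real n - 1<..1} \<in> null_sets dP" for n
    by (rule null_setsI) (auto simp: P_Ioc P0)
  ultimately have "{..1} \<in> null_sets dP" by (metis null_sets_UN)
  then show ?thesis by (rule AE_I') (auto simp: not_less)
qed

lemma P_finite: "emeasure dP {1..b} < \<infinity>"
proof -
  have "emeasure dP {1..b} \<le> emeasure dP {0<..max 1 b}" by (intro emeasure_mono) auto
  also have "\<dots> < \<infinity>" by (simp add: P_Ioc)
  finally show ?thesis .
qed

lemma sets_logP [simp, measurable_cong]: "sets logP = sets borel" and space_logP [simp]: "space logP = UNIV"
  by (auto simp: logP_def)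

lemma logP_integral: "f \<in> borel_measurable borel \<Longrightarrow> (\<integral>v. f v \<partial>logP) = (\<integral>x. f (ln x) \<partial>dP)"
  for f :: "real \<Rightarrow> 'a::{banach, second_countable_topology}"
  unfolding logP_def by (intro integral_distr) auto

lemma logP_integrable: "f \<in> borel_measurable borel \<Longrightarrow> integrable logP f \<longleftrightarrow> integrable dP (\<lambda>x. f (ln x))"
  for f :: "real \<Rightarrow> 'a::{banach, second_countable_topology}"
  unfolding logP_def by (intro integrable_distr_eq) auto

lemma logP_emeasure: "emeasure logP {..y} = emeasure dP {1..exp y}"
proof -
  have "emeasure logP {..y} = emeasure dP (ln -` {..y} \<inter> space dP)"
    unfolding logP_def by (intro emeasure_distr) auto
  also have "\<dots> = emeasure dP {1..exp y}"
  proof (rule emeasure_eq_AE)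
    show "AE x in dP. x \<in> ln -` {..y} \<inter> space dP \<longleftrightarrow> x \<in> {1..exp y}"
      using P_ge1
    proof eventually_elim
      case (elim x)
      then have "ln x \<le> y \<longleftrightarrow> x \<le> exp y" by (metis exp_le_cancel_iff exp_ln less_trans zero_less_one)
      then show ?case using elim by auto
    qed
    have "ln \<in> measurable dP borel" by measurable
    then show "ln -` {..y} \<inter> space dP \<in> sets dP" by (rule measurable_sets) auto
  qed auto
  finally show ?thesis .
qed

lemma sf_logP: "sigma_finite_measure logP"
proof
  show "\<exists>A. countable A \<and> A \<subseteq> sets logP \<and> \<Union>A = space logP \<and> (\<forall>a\<in>A. emeasure logP a \<noteq> \<infinity>)"
    by (rule exI[of _ "range (\<lambda>n::nat. {..real n})"])
       (use P_finite in \<open>auto simp: logP_emeasure less_top[symmetric] intro: real_arch_simple\<close>)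
qed

lemma exp_ln_AE: "AE x in dP. exp (ln x) = x \<and> 0 \<le> ln x \<and> 1 \<le> x"
  using P_ge1 by eventually_elim auto

lemma loc_kernel_lker:
  fixes w :: "real \<Rightarrow> 'a::{real_normed_field, banach, second_countable_topology}"
  assumes w[measurable]: "w \<in> borel_measurable borel"
    and int: "\<And>B. B \<in> bdd_borel \<Longrightarrow> set_integrable dP B w"
  shows "loc_kernel logP (lker w)"
proof -
  have m[measurable]: "lker w \<in> borel_measurable borel" unfolding lker_def[abs_def] by measurable
  have "integrable logP (\<lambda>v. indicator {..y} v *\<^sub>R lker w v)" for y
  proof -
    have "integrable dP (\<lambda>x. indicator {1..exp y} x *\<^sub>R w x)"
      using int[OF bdd_borel_Icc[of 1 "exp y"]] by (simp add: set_integrable_def)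
    moreover have "AE x in dP. indicator {1..exp y} x *\<^sub>R w x = indicator {..y} (ln x) *\<^sub>R lker w (ln x)"
      using exp_ln_AE
    proof eventually_elim
      case (elim x)
      then have "ln x \<le> y \<longleftrightarrow> x \<le> exp y" by (metis exp_le_cancel_iff)
      then show ?case using elim by (simp add: lker_def indicator_def)
    qed
    ultimately have "integrable dP (\<lambda>x. indicator {..y} (ln x) *\<^sub>R lker w (ln x))"
      by (subst (asm) integrable_cong_AE) auto
    then show ?thesis by (subst logP_integrable) auto
  qed
  then show ?thesis using m sf_logP by (auto simp: loc_kernel_def lker_def)
qed

lemma lconv_lker:
  assumes w[measurable]: "w \<in> borel_measurable borel" and f[measurable]: "f \<in> borel_measurable borel"
  shows "lconv logP (lker w) f y = (\<integral>x. indicator {1..} x *\<^sub>R (f (y - ln x) * w x) \<partial>dP)"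
proof -
  have m[measurable]: "lker w \<in> borel_measurable borel" unfolding lker_def[abs_def] by measurable
  have "lconv logP (lker w) f y = (\<integral>x. f (y - ln x) * lker w (ln x) \<partial>dP)"
    unfolding lconv_def by (rule logP_integral) measurable
  also have "\<dots> = (\<integral>x. indicator {1..} x *\<^sub>R (f (y - ln x) * w x) \<partial>dP)"
  proof (rule integral_cong_AE)
    show "AE x in dP. f (y - ln x) * lker w (ln x) = indicator {1..} x *\<^sub>R (f (y - ln x) * w x)"
      using exp_ln_AE by eventually_elim (simp add: lker_def)
  qed measurable
  finally show ?thesis .
qed

text \<open>With \<open>u = exp a\<close> dilation becomes translation, and the indicator of
  \<open>{1..exp y}\<close> becomes the unit step at \<open>y - a\<close>.\<close>

lemma mdil_lconv:
  assumes w: "w \<in> borel_measurable borel" and int: "\<And>B. B \<in> bdd_borel \<Longrightarrow> set_integrable dP B w" and a: "0 \<le> a"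
  shows "(mdil dP w ^^ n) (indicator {1..exp y}) (exp a) = (lconv logP (lker w) ^^ n) (edk 0) (y - a)"
  using a
proof (induction n arbitrary: a)
  case 0
  have "1 \<le> exp a" using 0 by simp
  then show ?case by (auto simp: indicator_def edk_def)
next
  case (Suc n)
  let ?F = "(lconv logP (lker w) ^^ n) (edk 0)"
  have F: "?F \<in> borel_measurable borel"
    by (rule loc_bddD(1)[OF loc_bdd_lconv_pow[OF loc_kernel_lker[OF w int] loc_bdd_edk]])
  have "(mdil dP w ^^ n) (indicator {1..exp y}) (exp a * x) = ?F (y - a - ln x)" if x: "1 \<le> x" for x
  proof -
    have "exp a * x = exp (a + ln x)" using x by (simp add: exp_add)
    then show ?thesis using Suc.IH[of "a + ln x"] Suc.prems x by (simp add: algebra_simps)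
  qed
  then have "(mdil dP w ^^ Suc n) (indicator {1..exp y}) (exp a) = (\<integral>x. indicator {1..} x *\<^sub>R (?F (y - a - ln x) * w x) \<partial>dP)"
    unfolding funpow.simps o_apply mdil_def[of dP w "(mdil dP w ^^ n) (indicator {1..exp y})"]
    by (intro Bochner_Integration.integral_cong refl) (simp split: split_indicator)
  also have "\<dots> = lconv logP (lker w) ?F (y - a)" by (rule lconv_lker[OF w F, symmetric])
  finally show ?case by simp
qed

text \<open>For a general set there is no exact translation, but enlarging it to
  \<open>{1..exp y}\<close> and taking norms gives one that dominates. This controls the total
  variation of the measure, not only its summatory function.\<close>

lemma mdil_le:
  assumes w: "w \<in> borel_measurable borel" and int: "\<And>B. B \<in> bdd_borel \<Longrightarrow> set_integrable dP B w" and a: "0 \<le> a"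
    and A: "A \<subseteq> {1..exp y}"
  shows "norm ((mdil dP w ^^ n) (indicator A) (exp a)) \<le> (lconv logP (\<lambda>v. norm (lker w v)) ^^ n) (edk 0) (y - a)"
  using a
proof (induction n arbitrary: a)
  case 0
  show ?case using A by (auto simp: edk_def indicator_def)
next
  case (Suc n)
  note k = loc_kernel_norm[OF loc_kernel_lker[OF w int]]
  let ?F = "(lconv logP (\<lambda>v. norm (lker w v)) ^^ n) (edk 0) :: real \<Rightarrow> real"
  have F: "loc_bdd ?F" by (rule loc_bdd_lconv_pow[OF k loc_bdd_edk])
  note [measurable] = loc_bddD(1)[OF F] w loc_kernelD(3)[OF loc_kernel_lker[OF w int]]
  have nl: "(\<lambda>v. norm (lker w v)) = lker (\<lambda>x. norm (w x))" by (auto simp: lker_def fun_eq_iff)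
  have nw: "(\<lambda>x. norm (w x)) \<in> borel_measurable borel" by measurable
  have le: "norm ((mdil dP w ^^ n) (indicator A) (exp a * x)) \<le> ?F (y - a - ln x)" if x: "1 \<le> x" for x
  proof -
    have "exp a * x = exp (a + ln x)" using x by (simp add: exp_add)
    then show ?thesis using Suc.IH[of "a + ln x"] Suc.prems x by (simp add: algebra_simps)
  qed
  have "norm (mdil dP w ((mdil dP w ^^ n) (indicator A)) (exp a))
     \<le> (\<integral>x. norm (indicator {1..} x *\<^sub>R ((mdil dP w ^^ n) (indicator A) (exp a * x) * w x)) \<partial>dP)"
    unfolding mdil_def[of dP w "(mdil dP w ^^ n) (indicator A)"] by (rule integral_norm_bound)
  also have "\<dots> \<le> (\<integral>x. indicator {1..} x *\<^sub>R (?F (y - a - ln x) * norm (w x)) \<partial>dP)"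
  proof (rule integral_mono')
    have "integrable logP (\<lambda>v. ?F (y - a - v) * norm (lker w v))" by (rule lconv_integrable[OF k F])
    then have i: "integrable dP (\<lambda>x. ?F (y - a - ln x) * norm (lker w (ln x)))"
      by (rule logP_integrable[THEN iffD1, rotated]) measurable
    have ae: "AE x in dP. ?F (y - a - ln x) * norm (lker w (ln x)) = indicator {1..} x *\<^sub>R (?F (y - a - ln x) * norm (w x))"
      using exp_ln_AE by eventually_elim (simp add: lker_def)
    show "integrable dP (\<lambda>x. indicator {1..} x *\<^sub>R (?F (y - a - ln x) * norm (w x)))"
      by (rule integrable_cong_AE_imp[OF i _ ae]) measurable
    fix x
    show "norm (indicator {1..} x *\<^sub>R ((mdil dP w ^^ n) (indicator A) (exp a * x) * w x)) \<le> indicator {1..} x *\<^sub>R (?F (y - a - ln x) * norm (w x))"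
      using le[of x] by (auto simp: indicator_def norm_mult intro!: mult_right_mono)
    show "0 \<le> indicator {1..} x *\<^sub>R (?F (y - a - ln x) * norm (w x))"
      using order_trans[OF norm_ge_zero le[of x]] by (auto simp: indicator_def)
  qed
  also have "\<dots> = lconv logP (\<lambda>v. norm (lker w v)) ?F (y - a)"
    using lconv_lker[OF nw loc_bddD(1)[OF F], of "y - a"] by (simp only: nl)
  finally show ?case by simp
qed

lemma exp_star_Icc:
  assumes w: "w \<in> borel_measurable borel" and int: "\<And>B. B \<in> bdd_borel \<Longrightarrow> set_integrable dP B w"
    and \<mu>: "\<And>B. B \<in> bdd_borel \<Longrightarrow> \<mu> B = (LINT x:B|dP. w x)"
  shows "exp_star \<mu> {1..exp y} = xconv logP (lker w) (edk 0) y"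
  using exp_star_eq[OF sigma_finite_dP sets_interval_measure w int \<mu> bdd_borel_Icc[of 1 "exp y"]] mdil_lconv[OF w int, of 0 _ y]
  by (simp add: xconv_def)

lemma exp_star_norm_le:
  assumes w: "w \<in> borel_measurable borel" and int: "\<And>B. B \<in> bdd_borel \<Longrightarrow> set_integrable dP B w"
    and \<mu>: "\<And>B. B \<in> bdd_borel \<Longrightarrow> \<mu> B = (LINT x:B|dP. w x)"
    and A: "A \<in> bdd_borel" "A \<subseteq> {1..exp y}"
  shows "norm (exp_star \<mu> A) \<le> xconv logP (\<lambda>v. norm (lker w v)) (edk 0) y"
proof -
  note k = loc_kernel_norm[OF loc_kernel_lker[OF w int]]
  have le: "norm ((mdil dP w ^^ n) (indicator A) 1 /\<^sub>R fact n) \<le> (lconv logP (\<lambda>v. norm (lker w v)) ^^ n) (edk 0) y /\<^sub>R fact n" for n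
    using mdil_le[OF w int order_refl A(2), of n] by (simp add: field_simps)
  have s: "summable (\<lambda>n. (lconv logP (\<lambda>v. norm (lker w v)) ^^ n) (edk 0) y /\<^sub>R fact n)"
    by (rule xconv_summable[OF k loc_bdd_edk])
  have s': "summable (\<lambda>n. norm ((mdil dP w ^^ n) (indicator A) 1 /\<^sub>R fact n))"
    by (rule summable_comparison_test'[OF s]) (use le in simp)
  have "norm (exp_star \<mu> A) \<le> (\<Sum>n. norm ((mdil dP w ^^ n) (indicator A) 1 /\<^sub>R fact n))"
  proof -
    have "exp_star \<mu> A = (\<Sum>n. (mdil dP w ^^ n) (indicator A) 1 /\<^sub>R fact n)"
      by (rule exp_star_eq[OF sigma_finite_dP sets_interval_measure w int \<mu> A(1)])
    then show ?thesis using summable_norm[OF s'] by simp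
  qed
  also have "\<dots> \<le> xconv logP (\<lambda>v. norm (lker w v)) (edk 0) y"
    unfolding xconv_def by (rule suminf_le[OF le s' s])
  finally show ?thesis .
qed

end

section \<open>Jordan decomposition and Mellin transforms\<close>

lemma bdd_borel_empty [simp]: "{} \<in> bdd_borel" by (auto simp: bdd_borel_def)

lemma bdd_borel_Un: "A \<in> bdd_borel \<Longrightarrow> B \<in> bdd_borel \<Longrightarrow> A \<union> B \<in> bdd_borel"
  by (auto simp: bdd_borel_def)

lemma bdd_borel_Diff: "A \<in> bdd_borel \<Longrightarrow> B \<in> bdd_borel \<Longrightarrow> A - B \<in> bdd_borel"
  by (auto simp: bdd_borel_def intro: bounded_subset)

text \<open>Countable additivity is available inside bounded sets only, so finite signed measure
  theory on the whole line does not apply; the bound \<open>D\<close> takes the place of finiteness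
  on each interval.\<close>

locale local_signed_measure =
  fixes \<nu> :: "real set \<Rightarrow> real" and D :: "real \<Rightarrow> real"
  assumes sums: "\<And>A :: nat \<Rightarrow> real set. range A \<subseteq> bdd_borel \<Longrightarrow> disjoint_family A \<Longrightarrow> bounded (\<Union>n. A n) \<Longrightarrow>
      (\<lambda>n. \<nu> (A n)) sums \<nu> (\<Union>n. A n)"
    and D: "\<And>A y. A \<in> bdd_borel \<Longrightarrow> A \<subseteq> {1..exp y} \<Longrightarrow> \<bar>\<nu> A\<bar> \<le> D y"
begin

lemma empty: "\<nu> {} = 0"
proof -
  have "(\<lambda>n::nat. \<nu> {}) sums \<nu> (\<Union>n::nat. {})"
    by (rule sums) (auto simp: disjoint_family_on_def)
  then have "(\<lambda>n::nat. \<nu> {}) \<longlonglongrightarrow> 0" using sums_summable summable_LIMSEQ_zero by blast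
  then show ?thesis by (simp add: LIMSEQ_const_iff)
qed

lemma Un:
  assumes A: "A \<in> bdd_borel" and B: "B \<in> bdd_borel" and AB: "A \<inter> B = {}"
  shows "\<nu> (A \<union> B) = \<nu> A + \<nu> B"
proof -
  let ?F = "\<lambda>n::nat. if n = 0 then A else if n = 1 then B else {}"
  have U: "(\<Union>n. ?F n) = A \<union> B" by (auto split: if_splits)
  have "(\<lambda>n. \<nu> (?F n)) sums \<nu> (\<Union>n. ?F n)"
  proof (rule sums)
    show "range ?F \<subseteq> bdd_borel" using A B by auto
    show "disjoint_family ?F" using AB by (auto simp: disjoint_family_on_def)
    show "bounded (\<Union>n. ?F n)" unfolding U using A B by (auto simp: bdd_borel_def)
  qed
  moreover have "(\<lambda>n. \<nu> (?F n)) sums (\<Sum>n\<in>{0, 1}. \<nu> (?F n))"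
    by (rule sums_finite) (auto simp: empty)
  ultimately show ?thesis unfolding U using sums_unique2 by fastforce
qed

definition V where "V B = (SUP A\<in>{A \<in> bdd_borel. A \<subseteq> B}. ennreal (\<nu> A))"

lemma V_upper: "A \<in> bdd_borel \<Longrightarrow> A \<subseteq> B \<Longrightarrow> ennreal (\<nu> A) \<le> V B"
  unfolding V_def by (rule SUP_upper) auto

lemma V_mono: "A \<subseteq> B \<Longrightarrow> V A \<le> V B"
  unfolding V_def by (intro SUP_subset_mono) auto

text \<open>Unite a competitor in \<open>A\<close> with one in \<open>B\<close>. The conversion to
  \<open>ennreal\<close> truncates negative values to \<open>0\<close>, so a competitor of negative
  value is simply dropped.\<close>

lemma V_superadd:
  assumes "A \<inter> B = {}" shows "V A + V B \<le> V (A \<union> B)"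
proof -
  have 1: "ennreal (\<nu> A') + ennreal (\<nu> B') \<le> V (A \<union> B)"
    if A': "A' \<in> bdd_borel" "A' \<subseteq> A" and B': "B' \<in> bdd_borel" "B' \<subseteq> B" for A' B'
  proof -
    consider "\<nu> A' \<le> 0" | "\<nu> B' \<le> 0" | "0 \<le> \<nu> A'" "0 \<le> \<nu> B'" by linarith
    then show ?thesis
    proof cases
      case 1 then show ?thesis using V_upper[OF B'(1), of "A \<union> B"] B' by (simp add: ennreal_neg le_supI2)
    next
      case 2 then show ?thesis using V_upper[OF A'(1), of "A \<union> B"] A' by (simp add: ennreal_neg le_supI1)
    next
      case 3
      then have "ennreal (\<nu> A') + ennreal (\<nu> B') = ennreal (\<nu> A' + \<nu> B')" by (simp add: ennreal_plus)
      also have "\<nu> A' + \<nu> B' = \<nu> (A' \<union> B')" using A' B' assms by (intro Un[symmetric]) auto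
      also have "ennreal \<dots> \<le> V (A \<union> B)" using A' B' by (intro V_upper bdd_borel_Un) auto
      finally show ?thesis .
    qed
  qed
  have ne: "{A' \<in> bdd_borel. A' \<subseteq> X} \<noteq> {}" for X by (auto intro: exI[of _ "{}"])
  have "ennreal (\<nu> A') + V B \<le> V (A \<union> B)" if "A' \<in> bdd_borel" "A' \<subseteq> A" for A'
  proof -
    have "ennreal (\<nu> A') + V B = (SUP B'\<in>{B' \<in> bdd_borel. B' \<subseteq> B}. ennreal (\<nu> A') + ennreal (\<nu> B'))"
      unfolding V_def by (rule ennreal_SUP_add_right[OF ne])
    also have "\<dots> \<le> V (A \<union> B)" using 1 that by (intro SUP_least) auto
    finally show ?thesis .
  qed
  note 2 = this
  have "V A + V B = (SUP A'\<in>{A' \<in> bdd_borel. A' \<subseteq> A}. ennreal (\<nu> A') + V B)"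
    unfolding V_def[of A] by (rule ennreal_SUP_add_left[OF ne, symmetric])
  also have "\<dots> \<le> V (A \<union> B)" using 2 by (intro SUP_least) auto
  finally show ?thesis .
qed

lemma V_empty: "V {} = 0"
  unfolding V_def by (rule antisym, rule SUP_least) (auto simp: empty)

text \<open>One direction is superadditivity over finite unions; for the other, a competitor in the
  union is cut along the pieces, and countable additivity is applied to the bounded parts.\<close>

lemma V_countably_additive: "countably_additive (sets borel) V"
proof (rule countably_additiveI)
  fix B :: "nat \<Rightarrow> real set" assume B: "range B \<subseteq> sets borel" and dj: "disjoint_family B"
  show "(\<Sum>n. V (B n)) = V (\<Union>n. B n)"
  proof (rule antisym)
    have "(\<Sum>n<k. V (B n)) \<le> V (\<Union>n<k. B n)" for k
    proof (induction k)
      case (Suc k)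
      have "(\<Sum>n<Suc k. V (B n)) \<le> V (\<Union>n<k. B n) + V (B k)" using Suc by (simp add: add_right_mono)
      also have "\<dots> \<le> V ((\<Union>n<k. B n) \<union> B k)"
      proof (rule V_superadd)
        have "B n \<inter> B k = {}" if "n < k" for n using dj that by (auto simp: disjoint_family_on_def)
        then show "(\<Union>n<k. B n) \<inter> B k = {}" by blast
      qed
      also have "(\<Union>n<k. B n) \<union> B k = (\<Union>n<Suc k. B n)" by (auto simp: lessThan_Suc)
      finally show ?case .
    qed (simp add: V_empty)
    then have "(\<Sum>n<k. V (B n)) \<le> V (\<Union>n. B n)" for k
      by (rule order_trans) (intro V_mono, auto)
    then show "(\<Sum>n. V (B n)) \<le> V (\<Union>n. B n)" by (intro suminf_le_const) auto
    show "V (\<Union>n. B n) \<le> (\<Sum>n. V (B n))"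
      unfolding V_def[of "\<Union>n. B n"]
    proof (rule SUP_least)
      fix A assume "A \<in> {A \<in> bdd_borel. A \<subseteq> (\<Union>n. B n)}"
      then have A: "A \<in> bdd_borel" "A \<subseteq> (\<Union>n. B n)" by auto
      have Bn: "B n \<inter> A \<in> bdd_borel" for n using B A by (intro bdd_borel_Int) auto
      have U: "(\<Union>n. B n \<inter> A) = A" using A by auto
      have "(\<lambda>n. \<nu> (B n \<inter> A)) sums \<nu> (\<Union>n. B n \<inter> A)"
      proof (rule sums)
        show "range (\<lambda>n. B n \<inter> A) \<subseteq> bdd_borel" using Bn by auto
        show "disjoint_family (\<lambda>n. B n \<inter> A)" using dj by (auto simp: disjoint_family_on_def)
        show "bounded (\<Union>n. B n \<inter> A)" unfolding U using A by (auto simp: bdd_borel_def)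
      qed
      then have lim: "(\<lambda>k. ennreal (\<Sum>n<k. \<nu> (B n \<inter> A))) \<longlonglongrightarrow> ennreal (\<nu> A)"
        unfolding U sums_def by (rule tendsto_ennrealI)
      have "ennreal (\<Sum>n<k. \<nu> (B n \<inter> A)) \<le> (\<Sum>n. V (B n))" for k
      proof -
        have "ennreal (\<Sum>n<k. \<nu> (B n \<inter> A)) \<le> ennreal (\<Sum>n<k. max 0 (\<nu> (B n \<inter> A)))"
          by (intro ennreal_leI sum_mono) auto
        also have "\<dots> = (\<Sum>n<k. ennreal (max 0 (\<nu> (B n \<inter> A))))" by (rule sum_ennreal[symmetric]) auto
        also have "\<dots> \<le> (\<Sum>n<k. V (B n))"
        proof (rule sum_mono)
          fix n
          show "ennreal (max 0 (\<nu> (B n \<inter> A))) \<le> V (B n)"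
            using V_upper[OF Bn, of n "B n"] by (auto simp: max_def)
        qed
        also have "\<dots> \<le> (\<Sum>n. V (B n))" by (rule sum_le_suminf) auto
        finally show ?thesis .
      qed
      then show "ennreal (\<nu> A) \<le> (\<Sum>n. V (B n))" by (intro LIMSEQ_le_const2[OF lim]) auto
    qed
  qed
qed

lemma sets_pv [simp, measurable_cong]: "sets (pos_variation \<nu>) = sets borel"
proof -
  have "sigma_sets UNIV (sets borel) = (sets borel :: real set set)"
    using sets.sigma_sets_eq[of "borel :: real measure"] by simp
  then show ?thesis unfolding pos_variation_def by (subst sets_measure_of) auto
qed

lemma emeasure_pv: "B \<in> sets borel \<Longrightarrow> emeasure (pos_variation \<nu>) B = V B"
  unfolding pos_variation_def V_def[abs_def, symmetric] V_def[symmetric]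
  by (rule emeasure_measure_of_sigma)
    (use V_empty V_countably_additive sets.sigma_algebra_axioms[of borel] in \<open>auto simp: positive_def\<close>)

lemma pv_le: "emeasure (pos_variation \<nu>) {1..exp y} \<le> ennreal (D y)"
proof -
  have "ennreal (\<nu> A) \<le> ennreal (D y)" if "A \<in> bdd_borel" "A \<subseteq> {1..exp y}" for A
    using D[OF that] by (intro ennreal_leI) auto
  then have "V {1..exp y} \<le> ennreal (D y)" unfolding V_def by (intro SUP_least) auto
  then show ?thesis by (simp add: emeasure_pv)
qed

lemma pv_ge1: "AE x in pos_variation \<nu>. 1 \<le> x"
proof -
  have "V {..<1} = 0"
    unfolding V_def
  proof (rule antisym, rule SUP_least)
    fix A assume "A \<in> {A \<in> bdd_borel. A \<subseteq> {..<1}}"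
    then have "A \<subseteq> {1..}" "A \<subseteq> {..<1}" by (simp_all add: bdd_borel_def)
    then have "A \<subseteq> {1..} \<inter> {..<1}" by (rule Int_greatest)
    moreover have "{1..} \<inter> {..<1} = ({} :: real set)" by auto
    ultimately have "A = {}" by simp
    then show "ennreal (\<nu> A) \<le> 0" by (simp add: empty)
  qed auto
  then have "{..<1} \<in> null_sets (pos_variation \<nu>)" by (intro null_setsI) (auto simp: emeasure_pv)
  then show ?thesis by (rule AE_I') auto
qed

lemma pv_sf: "sigma_finite_measure (pos_variation \<nu>)"
proof
  have sp: "space (pos_variation \<nu>) = UNIV" using sets_eq_imp_space_eq[OF sets_pv] by simp
  have fin: "emeasure (pos_variation \<nu>) {..exp (real n)} \<noteq> \<infinity>" for n
  proof -
    have "emeasure (pos_variation \<nu>) {..exp (real n)} = emeasure (pos_variation \<nu>) {1..exp (real n)}"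
      using pv_ge1 by (intro emeasure_eq_AE) (auto elim: eventually_mono)
    also have "\<dots> < \<infinity>" using pv_le[of "real n"] by (rule le_less_trans) simp
    finally show ?thesis by simp
  qed
  have "x \<in> (\<Union>n. {..exp (real n)})" for x
  proof -
    obtain n where "x \<le> real n" using real_arch_simple by blast
    also have "real n \<le> exp (real n)" using exp_ge_add_one_self[of "real n"] by linarith
    finally show ?thesis by auto
  qed
  then have "(\<Union>n. {..exp (real n)}) = UNIV" by blast
  then show "\<exists>A. countable A \<and> A \<subseteq> sets (pos_variation \<nu>) \<and> \<Union>A = space (pos_variation \<nu>) \<and> (\<forall>a\<in>A. emeasure (pos_variation \<nu>) a \<noteq> \<infinity>)"
    using fin by (intro exI[of _ "range (\<lambda>n::nat. {..exp (real n)})"]) (auto simp: sp)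
qed

lemma local_signed_measure_uminus: "local_signed_measure (\<lambda>A. - \<nu> A) D"
  by unfold_locales (use sums D in \<open>auto intro!: sums_minus\<close>)

end

text \<open>Complementation: a set with large \<open>\<nu>\<close> inside \<open>B\<close> is the
  complement of one with large \<open>- \<nu>\<close>, and the two values differ by
  \<open>\<nu> B\<close>. Finiteness of both suprema, guaranteed by \<open>D\<close>, permits the
  subtraction.\<close>

lemma (in local_signed_measure) jordan:
  assumes B: "B \<in> bdd_borel"
  shows "\<nu> B = measure (pos_variation \<nu>) B - measure (pos_variation (\<lambda>A. - \<nu> A)) B"
proof -
  interpret N: local_signed_measure "\<lambda>A. - \<nu> A" D by (rule local_signed_measure_uminus)
  have Bb: "B \<in> sets borel" using B by (simp add: bdd_borel_def)
  obtain y where y: "B \<subseteq> {1..exp y}"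
  proof -
    obtain a where a: "\<forall>x\<in>B. norm x \<le> a" using B by (auto simp: bdd_borel_def bounded_iff)
    have "a \<le> exp a" using exp_ge_add_one_self[of a] by linarith
    then have "B \<subseteq> {1..exp a}" using a B by (force simp: bdd_borel_def)
    then show ?thesis using that by blast
  qed
  have fin: "V B < \<infinity>" "N.V B < \<infinity>"
  proof -
    have "V B \<le> V {1..exp y}" "N.V B \<le> N.V {1..exp y}" using y by (auto intro: V_mono N.V_mono)
    moreover have "V {1..exp y} < \<infinity>" "N.V {1..exp y} < \<infinity>"
      using pv_le[of y] N.pv_le[of y] by (auto simp: emeasure_pv N.emeasure_pv intro: le_less_trans)
    ultimately show "V B < \<infinity>" "N.V B < \<infinity>" by (auto intro: le_less_trans)
  qed
  define p where "p = measure (pos_variation \<nu>) B"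
  define n where "n = measure (pos_variation (\<lambda>A. - \<nu> A)) B"
  have p: "V B = ennreal p" and n: "N.V B = ennreal n"
    using fin emeasure_pv[OF Bb] N.emeasure_pv[OF Bb]
      emeasure_eq_ennreal_measure[of "pos_variation \<nu>" B] emeasure_eq_ennreal_measure[of "pos_variation (\<lambda>A. - \<nu> A)" B]
    by (simp_all add: p_def n_def)
  have p0: "0 \<le> p" "0 \<le> n" by (auto simp: p_def n_def)
  have up: "\<nu> A \<le> p" "- \<nu> A \<le> n" if "A \<in> bdd_borel" "A \<subseteq> B" for A
    using V_upper[OF that] N.V_upper[OF that] p0 unfolding p n by (auto simp: ennreal_le_iff)
  have split: "\<nu> B = \<nu> A + \<nu> (B - A)" if "A \<in> bdd_borel" "A \<subseteq> B" for A
    using Un[OF that(1) bdd_borel_Diff[OF B that(1)]] that(2) by (simp add: Un_absorb1)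
  have "ennreal p \<le> ennreal (\<nu> B + n)"
    unfolding p[symmetric] V_def
  proof (rule SUP_least)
    fix A assume "A \<in> {A \<in> bdd_borel. A \<subseteq> B}"
    then have A: "A \<in> bdd_borel" "A \<subseteq> B" by auto
    have "\<nu> A = \<nu> B + - \<nu> (B - A)" using split[OF A] by simp
    also have "\<dots> \<le> \<nu> B + n" using up(2)[OF bdd_borel_Diff[OF B A(1)]] by auto
    finally show "ennreal (\<nu> A) \<le> ennreal (\<nu> B + n)" by (rule ennreal_leI)
  qed
  moreover have "0 \<le> \<nu> B + n" using up(2)[OF B order_refl] by simp
  ultimately have 1: "p \<le> \<nu> B + n" by (simp add: ennreal_le_iff)
  have "ennreal n \<le> ennreal (p - \<nu> B)"
    unfolding n[symmetric] N.V_def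
  proof (rule SUP_least)
    fix A assume "A \<in> {A \<in> bdd_borel. A \<subseteq> B}"
    then have A: "A \<in> bdd_borel" "A \<subseteq> B" by auto
    have "- \<nu> A = \<nu> (B - A) - \<nu> B" using split[OF A] by simp
    also have "\<dots> \<le> p - \<nu> B" using up(1)[OF bdd_borel_Diff[OF B A(1)]] by auto
    finally show "ennreal (- \<nu> A) \<le> ennreal (p - \<nu> B)" by (rule ennreal_leI)
  qed
  moreover have "0 \<le> p - \<nu> B" using up(1)[OF B order_refl] by simp
  ultimately have "n \<le> p - \<nu> B" by (simp add: ennreal_le_iff)
  with 1 show ?thesis by (simp add: p_def n_def)
qed

lemma integral_jordan:
  fixes a b c d :: "real \<Rightarrow> complex"
  assumes "integrable M a" "integrable M b" "integrable M c" "integrable M d"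
  shows "(\<integral>y. a y - b y + \<i> * (c y - d y) \<partial>M)
    = integral\<^sup>L M a - integral\<^sup>L M b + \<i> * (integral\<^sup>L M c - integral\<^sup>L M d)"
  using assms by simp

text \<open>The layer-cake formula for each of the four variations of \<open>dG\<close>, recombined
  on the intervals \<open>{1..exp y}\<close> by the Jordan decomposition. \<open>cm_integral\<close>
  refers to the variations of \<open>dG\<close> itself, so no density for \<open>dG\<close> has to
  be found.\<close>

lemma cm_integral_powr:
  assumes dG: "complex_measure dG" and D: "\<And>A y. A \<in> bdd_borel \<Longrightarrow> A \<subseteq> {1..exp y} \<Longrightarrow> norm (dG A) \<le> D y"
    and s: "0 < Re s" and Di: "integrable lborel (\<lambda>y. exp (- Re s * y) * D y)"
  shows "mellin_stieltjes dG s = s * (\<integral>y. exp (- s * of_real y) * dG {1..exp y} \<partial>lborel)"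
proof -
  have D0: "0 \<le> D y" for y by (rule order_trans[OF norm_ge_zero D[of "{}"]]) auto
  have cs: "(\<lambda>n. dG (A n)) sums dG (\<Union>n. A n)"
    if "range A \<subseteq> bdd_borel" "disjoint_family A" "bounded (\<Union>n. A n)" for A :: "nat \<Rightarrow> real set"
    using dG that by (auto simp: complex_measure_def)
  interpret R: local_signed_measure "\<lambda>A. Re (dG A)" D
    by unfold_locales (use cs D in \<open>auto intro: sums_Re order_trans[OF abs_Re_le_cmod]\<close>)
  interpret I: local_signed_measure "\<lambda>A. Im (dG A)" D
    by unfold_locales (use cs D in \<open>auto intro: sums_Im order_trans[OF abs_Im_le_cmod]\<close>)
  interpret RN: local_signed_measure "\<lambda>A. - Re (dG A)" D by (rule R.local_signed_measure_uminus)
  interpret IN: local_signed_measure "\<lambda>A. - Im (dG A)" D by (rule I.local_signed_measure_uminus)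
  note lR = layer_cake[OF R.pv_sf R.sets_pv R.pv_ge1 s R.pv_le D0 Di]
  note lI = layer_cake[OF I.pv_sf I.sets_pv I.pv_ge1 s I.pv_le D0 Di]
  note lRN = layer_cake[OF RN.pv_sf RN.sets_pv RN.pv_ge1 s RN.pv_le D0 Di]
  note lIN = layer_cake[OF IN.pv_sf IN.sets_pv IN.pv_ge1 s IN.pv_le D0 Di]
  let ?m = "\<lambda>\<nu> y. exp (- s * of_real y) * complex_of_real (measure (pos_variation \<nu>) {1..exp y})"
  have "exp (- s * of_real y) * dG {1..exp y}
     = ?m (\<lambda>A. Re (dG A)) y - ?m (\<lambda>A. - Re (dG A)) y + \<i> * (?m (\<lambda>A. Im (dG A)) y - ?m (\<lambda>A. - Im (dG A)) y)" for y
  proof -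
    have "dG {1..exp y} = complex_of_real (Re (dG {1..exp y})) + \<i> * complex_of_real (Im (dG {1..exp y}))"
      by (rule complex_eq)
    also have "\<dots> = (complex_of_real (measure (pos_variation (\<lambda>A. Re (dG A))) {1..exp y}) - complex_of_real (measure (pos_variation (\<lambda>A. - Re (dG A))) {1..exp y}))
       + \<i> * (complex_of_real (measure (pos_variation (\<lambda>A. Im (dG A))) {1..exp y}) - complex_of_real (measure (pos_variation (\<lambda>A. - Im (dG A))) {1..exp y}))"
      unfolding R.jordan[OF bdd_borel_Icc[OF order_refl]] I.jordan[OF bdd_borel_Icc[OF order_refl]] by simp
    finally show ?thesis by (simp only: distrib_left right_diff_distrib mult.left_commute)
  qed
  then have "(\<integral>y. exp (- s * of_real y) * dG {1..exp y} \<partial>lborel)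
     = integral\<^sup>L lborel (?m (\<lambda>A. Re (dG A))) - integral\<^sup>L lborel (?m (\<lambda>A. - Re (dG A)))
       + \<i> * (integral\<^sup>L lborel (?m (\<lambda>A. Im (dG A))) - integral\<^sup>L lborel (?m (\<lambda>A. - Im (dG A))))"
    unfolding integral_jordan[OF lR(2) lRN(2) lI(2) lIN(2), symmetric] by (intro Bochner_Integration.integral_cong refl)
  moreover have "mellin_stieltjes dG s = s * integral\<^sup>L lborel (?m (\<lambda>A. Re (dG A))) - s * integral\<^sup>L lborel (?m (\<lambda>A. - Re (dG A)))
       + \<i> * (s * integral\<^sup>L lborel (?m (\<lambda>A. Im (dG A))) - s * integral\<^sup>L lborel (?m (\<lambda>A. - Im (dG A))))"
    unfolding mellin_stieltjes_def cm_integral_def lR(3) lI(3) lRN(3) lIN(3) ..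
  moreover have "s * a - s * b + \<i> * (s * c - s * d) = s * (a - b + \<i> * (c - d))" for a b c d
    by (simp add: algebra_simps)
  ultimately show ?thesis by (simp only:)
qed

section \<open>The logarithmic density bound and the equivalence\<close>

lemma lconv_pow_of_real:
  fixes k f :: "real \<Rightarrow> real"
  shows "(lconv m (\<lambda>v. complex_of_real (k v)) ^^ n) (\<lambda>y. complex_of_real (f y)) = (\<lambda>y. complex_of_real ((lconv m k ^^ n) f y))"
proof (induction n)
  case (Suc n)
  have "lconv m (\<lambda>v. complex_of_real (k v)) (\<lambda>y. complex_of_real (h y)) = (\<lambda>y. complex_of_real (lconv m k h y))" for h
    unfolding lconv_def by (simp only: of_real_mult[symmetric] integral_complex_of_real)
  then show ?case using Suc by simp
qed simp

lemma xconv_of_real: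
  fixes k f :: "real \<Rightarrow> real"
  assumes "loc_kernel m k" "loc_bdd f"
  shows "xconv m (\<lambda>v. complex_of_real (k v)) (\<lambda>y. complex_of_real (f y)) y = complex_of_real (xconv m k f y)"
  unfolding xconv_def lconv_pow_of_real
  by (subst suminf_of_real[OF xconv_summable[OF assms]]) (simp add: scaleR_conv_of_real)

lemma edk_moment_integral:
  assumes s: "0 < (s::real)"
  shows "integrable lborel (\<lambda>y. (1 + y) * edk s y)" "(\<integral>y. (1 + y) * edk s y \<partial>lborel) = 1 / s + 1 / s\<^sup>2"
proof -
  note * = lconv_integral[OF loc_kernel_lborel[OF loc_bdd_edk] loc_bdd_edk edk_integrable_real[OF s] edk_integrable_real[OF s]]
  have eq: "lconv lborel (edk s) (edk s) = (\<lambda>y. y * edk s y)" by (simp add: fun_eq_iff edk_conv_self)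
  have i: "integrable lborel (\<lambda>y. y * edk s y)" using *(1) unfolding eq .
  have v: "(\<integral>y. y * edk s y \<partial>lborel) = 1 / s\<^sup>2"
    using *(2) unfolding eq edk_integral_real[OF s] by (simp add: power2_eq_square)
  have eq2: "(\<lambda>y. (1 + y) * edk s y) = (\<lambda>y. edk s y + y * edk s y)" by (simp add: fun_eq_iff distrib_right)
  show "integrable lborel (\<lambda>y. (1 + y) * edk s y)"
    unfolding eq2 by (intro Bochner_Integration.integrable_add edk_integrable_real[OF s] i)
  show "(\<integral>y. (1 + y) * edk s y \<partial>lborel) = 1 / s + 1 / s\<^sup>2"
    unfolding eq2 Bochner_Integration.integral_add[OF edk_integrable_real[OF s] i] v edk_integral_real[OF s] ..
qed

text \<open>Beyond a threshold the asymptotic bound applies; before it monotonicity gives a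
  constant, which \<open>b x \<ge> 1\<close> absorbs.\<close>

lemma bigo_extend:
  fixes h :: "real \<Rightarrow> real"
  assumes O: "h \<in> O[at_top](\<lambda>x. f x)" and mono: "\<And>x y. 1 \<le> x \<Longrightarrow> x \<le> y \<Longrightarrow> h x \<le> h y"
    and f: "\<And>x. 1 \<le> x \<Longrightarrow> \<bar>f x\<bar> \<le> b x" and b: "\<And>x. 1 \<le> x \<Longrightarrow> 1 \<le> b x"
  shows "\<exists>C\<ge>0. \<forall>x\<ge>1. h x \<le> C * b x"
proof -
  obtain c where c: "0 < c" "eventually (\<lambda>x. norm (h x) \<le> c * norm (f x)) at_top"
    using landau_o.bigE[OF O] by blast
  then obtain x0 where x0: "\<And>x. x0 \<le> x \<Longrightarrow> \<bar>h x\<bar> \<le> c * \<bar>f x\<bar>" by (auto simp: eventually_at_top_linorder)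
  define x1 where "x1 = max x0 1"
  define C where "C = max c \<bar>h x1\<bar>"
  have "h x \<le> C * b x" if x: "1 \<le> x" for x
  proof (cases "x1 \<le> x")
    case True
    then have "h x \<le> c * \<bar>f x\<bar>" using x0[of x] by (simp add: x1_def)
    also have "\<dots> \<le> C * b x" using f[OF x] c by (intro mult_mono) (auto simp: C_def)
    finally show ?thesis .
  next
    case False
    have "h x \<le> h x1" using False x by (intro mono) auto
    also have "\<dots> \<le> C * 1" by (simp add: C_def)
    also have "\<dots> \<le> C * b x" using b[OF x] c by (intro mult_left_mono) (auto simp: C_def)
    finally show ?thesis .
  qed
  moreover have "0 \<le> C" using c by (simp add: C_def)
  ultimately show ?thesis by blast
qed

context beurling_primes begin

lemma bdd_borel_finite:
  assumes "B \<in> bdd_borel" shows "emeasure dP B < \<infinity>"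
proof -
  obtain b where b: "\<And>x. x \<in> B \<Longrightarrow> norm x \<le> b" using assms unfolding bdd_borel_def bounded_iff by blast
  have "B \<subseteq> {1..b}"
  proof
    fix x assume x: "x \<in> B"
    then have "1 \<le> x" using assms by (auto simp: bdd_borel_def)
    then show "x \<in> {1..b}" using b[OF x] by simp
  qed
  then have "emeasure dP B \<le> emeasure dP {1..b}" by (intro emeasure_mono) auto
  then show ?thesis using P_finite[of b] by (rule le_less_trans)
qed

lemma set_integrable_const:
  assumes "B \<in> bdd_borel"
  shows "set_integrable dP B (\<lambda>_. c :: 'a::{real_normed_field, banach, second_countable_topology})"
proof -
  have "B \<in> sets dP" using assms by (simp add: bdd_borel_def)
  then show ?thesis unfolding set_integrable_def using bdd_borel_finite[OF assms]
    by (intro integrable_scaleR_left integrable_real_indicator)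
qed

lemma loc_kernel_const: "loc_kernel logP (lker (\<lambda>_. 1 :: 'a::{real_normed_field, banach, second_countable_topology}))"
  by (rule loc_kernel_lker[OF _ set_integrable_const]) simp

text \<open>The identity between the zeta function and the exponential of the prime transform
  requires convergence on the prime side. This is obtained first, from \<open>P \<le> N\<close> and
  a crude bound for \<open>N\<close>; summation by parts against the logarithmic density then gives
  the sharp order \<open>1 / \<sigma>\<close>.\<close>

lemma zeta_bound:
  assumes monoN: "mono N" and rcN: "\<And>x. continuous (at_right x) N" and N0: "\<And>x. x < 1 \<Longrightarrow> N x = 0"
    and NP: "\<And>B. B \<in> bdd_borel \<Longrightarrow> stieltjes N B = exp_star (stieltjes P) B"
    and log: "(\<lambda>x. LINT u:{1..x}|interval_measure N. 1 / u) \<in> O[at_top](\<lambda>x. ln x)"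
  shows "\<exists>CZ. \<forall>\<sigma>. 0 < \<sigma> \<longrightarrow> \<sigma> \<le> 1 \<longrightarrow> integrable logP (\<lambda>v. exp (- (1 + \<sigma>) * v) * lker (\<lambda>_. 1) v) \<and>
     exp (\<integral>v. exp (- (1 + \<sigma>) * v) * lker (\<lambda>_. 1) v \<partial>logP) \<le> CZ / \<sigma>"
proof -
  let ?N = "interval_measure N"
  have NIoc: "emeasure ?N {a<..b} = ennreal (N b - N a)" if "a \<le> b" for a b
    by (rule emeasure_interval_measure_Ioc) (use that monoN rcN in \<open>auto simp: mono_def\<close>)
  have sfN: "sigma_finite_measure ?N"
    by (rule sigma_finite_interval_measure) (use monoN rcN in \<open>auto simp: mono_def\<close>)
  have N_ge1: "AE x in ?N. 1 \<le> x"
  proof -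
    \<comment> \<open>\<open>interval_measure\<close> is known on half-open intervals closed at the
      right, so the open half-line is exhausted by intervals ending just before
      \<open>1\<close>.\<close>
    have U: "{..<1::real} = (\<Union>n::nat. {- real n - 1<..1 - 1 / real (Suc n)})"
    proof (intro equalityI subsetI)
      fix x :: real assume x: "x \<in> {..<1}"
      obtain n1 where n1: "- x \<le> real n1" using real_arch_simple by blast
      obtain n2 where n2: "inverse (real (Suc n2)) < 1 - x" using reals_Archimedean[of "1 - x"] x by auto
      have "1 / real (Suc (max n1 n2)) \<le> 1 / real (Suc n2)" by (intro divide_left_mono) auto
      then have "x \<in> {- real (max n1 n2) - 1<..1 - 1 / real (Suc (max n1 n2))}"
        using n1 n2 by (auto simp: inverse_eq_divide max_def)
      then show "x \<in> (\<Union>n::nat. {- real n - 1<..1 - 1 / real (Suc n)})" by blast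
    next
      fix x assume "x \<in> (\<Union>n::nat. {- real n - 1<..1 - 1 / real (Suc n)})"
      then obtain n where "x \<le> 1 - 1 / real (Suc n)" by auto
      moreover have "0 < 1 / real (Suc n)" by simp
      ultimately have "x < 1" by linarith
      then show "x \<in> {..<1}" by simp
    qed
    have ns: "{- real n - 1<..1 - 1 / real (Suc n)} \<in> null_sets ?N" for n
    proof (rule null_setsI)
      have b: "(0::real) < 1 / real (Suc n)" "1 / real (Suc n) \<le> 1" by auto
      have le: "- real n - 1 \<le> 1 - 1 / real (Suc n)" using b by linarith
      have "N (1 - 1 / real (Suc n)) = 0" by (rule N0) (use b in linarith)
      moreover have "N (- real n - 1) = 0" by (rule N0) linarith
      ultimately show "emeasure ?N {- real n - 1<..1 - 1 / real (Suc n)} = 0" unfolding NIoc[OF le] by simp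
    qed auto
    have "{..<1} \<in> null_sets ?N" unfolding U by (rule null_sets_UN) (rule ns)
    then show ?thesis by (rule AE_I') (auto simp: not_le)
  qed
  have Nfin: "emeasure ?N {1..b} < \<infinity>" for b
  proof -
    have "emeasure ?N {1..b} \<le> emeasure ?N {0<..max 1 b}" by (intro emeasure_mono) auto
    also have "\<dots> < \<infinity>" by (simp add: NIoc)
    finally show ?thesis .
  qed
  define V where "V y = measure ?N {1..exp y}" for y
  have emV: "emeasure ?N {1..exp y} = ennreal (V y)" for y
    using Nfin[of "exp y"] by (simp add: V_def emeasure_eq_ennreal_measure)
  let ?k = "lker (\<lambda>_. 1) :: real \<Rightarrow> real"
  note k = loc_kernel_const[where 'a=real]
  let ?X = "xconv logP ?k (edk 0) :: real \<Rightarrow> real"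
  have VX: "V y = ?X y" for y
  proof -
    have "complex_of_real (V y) = stieltjes N {1..exp y}" by (simp add: V_def stieltjes_def)
    also have "\<dots> = exp_star (stieltjes P) {1..exp y}" by (rule NP[OF bdd_borel_Icc]) simp
    also have "\<dots> = xconv logP (lker (\<lambda>_. 1 :: complex)) (edk 0) y"
    proof (rule exp_star_Icc)
      fix B :: "real set" assume B: "B \<in> bdd_borel"
      then show "set_integrable dP B (\<lambda>_. 1 :: complex)" by (rule set_integrable_const)
      show "stieltjes P B = (LINT x:B|dP. 1)"
        using B bdd_borel_finite[OF B] by (simp add: stieltjes_def set_lebesgue_integral_def bdd_borel_def scaleR_conv_of_real)
    qed simp
    also have "lker (\<lambda>_. 1 :: complex) = (\<lambda>v. complex_of_real (?k v))" by (auto simp: lker_def fun_eq_iff indicator_def)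
    also have "edk 0 = (\<lambda>y. complex_of_real (edk 0 y))" by (auto simp: edk_def fun_eq_iff indicator_def)
    also have "xconv logP (\<lambda>v. complex_of_real (?k v)) (\<lambda>y. complex_of_real (edk 0 y)) y = complex_of_real (?X y)"
      by (rule xconv_of_real[OF k loc_bdd_edk])
    finally show ?thesis by simp
  qed
  have k0: "0 \<le> ?k v" for v by (simp add: lker_def)
  \<comment> \<open>The mass of the primes is the term with \<open>n = 1\<close> of the exponential
    series, all of whose terms are nonnegative.\<close>
  have PV: "emeasure dP {1..exp y} \<le> ennreal (V y)" for y
  proof -
    have "measure dP {1..exp y} = lconv logP ?k (edk 0) y"
    proof -
      have [measurable]: "edk (0::real) \<in> borel_measurable borel" "?k \<in> borel_measurable borel"
        using loc_bddD(1)[OF loc_bdd_edk] loc_kernelD(3)[OF k] by auto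
      have "lconv logP ?k (edk 0) y = (\<integral>x. edk 0 (y - ln x) * ?k (ln x) \<partial>dP)"
        unfolding lconv_def by (intro logP_integral) measurable
      also have "\<dots> = (\<integral>x. indicator {1..exp y} x \<partial>dP)"
      proof (rule integral_cong_AE)
        show "(\<lambda>x. edk 0 (y - ln x) * ?k (ln x)) \<in> borel_measurable dP" by measurable
        show "AE x in dP. edk 0 (y - ln x) * ?k (ln x) = indicator {1..exp y} x"
          using exp_ln_AE
        proof eventually_elim
          case (elim x)
          then have "ln x \<le> y \<longleftrightarrow> x \<le> exp y" by (metis exp_le_cancel_iff)
          then show ?case using elim by (auto simp: edk_def lker_def indicator_def)
        qed
      qed auto
      finally show ?thesis by simp
    qed
    also have "\<dots> = (lconv logP ?k ^^ 1) (edk 0) y /\<^sub>R fact 1" by simp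
    also have "\<dots> \<le> ?X y"
    proof -
      have nn: "0 \<le> (lconv logP ?k ^^ n) (edk 0) y" for n
      proof -
        have "norm ((lconv logP ?k ^^ n) (edk 0) y) \<le> (lconv logP ?k ^^ n) (edk 0) y"
          by (rule lconv_pow_le[OF k loc_bdd_edk k loc_bdd_edk]) (use k0 in \<open>auto simp: edk_real_nonneg\<close>)
        then show ?thesis by (rule order_trans[OF norm_ge_zero])
      qed
      have "sum (\<lambda>n. (lconv logP ?k ^^ n) (edk 0) y /\<^sub>R fact n) {1} \<le> ?X y"
        unfolding xconv_def by (rule sum_le_suminf[OF xconv_summable[OF k loc_bdd_edk]]) (use nn in auto)
      then show ?thesis by simp
    qed
    finally show ?thesis using P_finite[of "exp y"] by (simp add: VX[symmetric] emeasure_eq_ennreal_measure ennreal_leI)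
  qed
  define R where "R x = (LINT u:{1..x}|?N. 1 / u)" for x
  have intR: "set_integrable ?N {1..x} (\<lambda>u. 1 / u)" for x
  proof -
    have "integrable ?N (\<lambda>u. indicator {1..x} u :: real)" using Nfin[of x] by (intro integrable_real_indicator) auto
    then show ?thesis unfolding set_integrable_def
      by (rule Bochner_Integration.integrable_bound) (auto simp: indicator_def)
  qed
  obtain C where C: "0 \<le> C" "\<And>x. 1 \<le> x \<Longrightarrow> R x \<le> C * (1 + ln x)"
  proof -
    have "\<exists>C\<ge>0. \<forall>x\<ge>1. R x \<le> C * (1 + ln x)"
    proof (rule bigo_extend)
      show "R \<in> O[at_top](\<lambda>x. ln x)" using log by (simp add: R_def[abs_def])
      show "R x \<le> R y" if "1 \<le> x" "x \<le> y" for x y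
        unfolding R_def set_lebesgue_integral_def
        using that intR[unfolded set_integrable_def] by (intro integral_mono) (auto simp: indicator_def)
    qed auto
    then show ?thesis using that by blast
  qed
  \<comment> \<open>On \<open>{1..exp y}\<close> one has
    \<open>1 \<le> exp y * (1 / u)\<close>.\<close>
  have VR: "V y \<le> exp y * R (exp y)" for y
  proof -
    have "V y = (\<integral>u. indicator {1..exp y} u \<partial>?N)" by (simp add: V_def)
    also have "\<dots> \<le> (\<integral>u. exp y * (indicator {1..exp y} u *\<^sub>R (1 / u)) \<partial>?N)"
    proof (rule integral_mono)
      show "integrable ?N (\<lambda>u. exp y * (indicator {1..exp y} u *\<^sub>R (1 / u)))"
        using intR[of "exp y"] unfolding set_integrable_def by (rule integrable_mult_right)
      show "integrable ?N (\<lambda>u. indicator {1..exp y} u :: real)"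
        using Nfin[of "exp y"] by (intro integrable_real_indicator) auto
    qed (auto simp: indicator_def divide_simps)
    also have "\<dots> = exp y * R (exp y)"
      unfolding R_def set_lebesgue_integral_def by (rule integral_mult_right_zero)
    finally show ?thesis .
  qed
  have V0: "V y = 0" if "y < 0" for y using that by (simp add: V_def)
  have Vb: "V y \<le> C * (1 + y) * exp y" if "0 \<le> y" for y
  proof -
    have "exp y * R (exp y) \<le> exp y * (C * (1 + ln (exp y)))" using C(2)[of "exp y"] that by (intro mult_left_mono) auto
    then show ?thesis using VR[of y] by (simp only: ln_exp mult_ac)
  qed
  show ?thesis
  \<comment> \<open>The computation ends with \<open>C + C / \<sigma>\<close>, and
    \<open>\<sigma> \<le> 1\<close>.\<close>
  proof (intro exI[of _ "2 * C"] allI impI)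
    fix \<sigma> :: real assume \<sigma>: "0 < \<sigma>" "\<sigma> \<le> 1"
    have s1: "0 < 1 + \<sigma>" using \<sigma> by simp
    note mom = edk_moment_integral[OF \<sigma>(1)]
    have fin: "(\<integral>\<^sup>+x. ennreal (x powr (- (1 + \<sigma>))) \<partial>dP) < \<infinity>"
    proof -
      have "(\<integral>\<^sup>+x. ennreal (x powr (- (1 + \<sigma>))) \<partial>dP)
         = (\<integral>\<^sup>+y. ennreal ((1 + \<sigma>) * exp (- (1 + \<sigma>) * y)) * emeasure dP {1..exp y} \<partial>lborel)"
        by (rule layer_cake_nn[OF sigma_finite_dP sets_interval_measure _ s1]) (use P_ge1 in \<open>auto elim: eventually_mono\<close>)
      also have "\<dots> \<le> (\<integral>\<^sup>+y. ennreal ((1 + \<sigma>) * C * ((1 + y) * edk \<sigma> y)) \<partial>lborel)"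
      proof (intro nn_integral_mono)
        fix y
        show "ennreal ((1 + \<sigma>) * exp (- (1 + \<sigma>) * y)) * emeasure dP {1..exp y} \<le> ennreal ((1 + \<sigma>) * C * ((1 + y) * edk \<sigma> y))"
        proof (cases "y < 0")
          case True
          then show ?thesis by (simp add: edk_neg)
        next
          case False
          then have y: "0 \<le> y" by simp
          have "ennreal ((1 + \<sigma>) * exp (- (1 + \<sigma>) * y)) * emeasure dP {1..exp y}
             \<le> ennreal ((1 + \<sigma>) * exp (- (1 + \<sigma>) * y)) * ennreal (C * (1 + y) * exp y)"
            using Vb[OF y] by (intro mult_left_mono order_trans[OF PV ennreal_leI]) auto
          also have "\<dots> = ennreal ((1 + \<sigma>) * C * (1 + y) * (exp (- (1 + \<sigma>) * y) * exp y))"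
            using \<sigma> C y by (subst ennreal_mult[symmetric]) (auto simp: mult_ac)
          also have "exp (- (1 + \<sigma>) * y) * exp y = edk \<sigma> y"
            unfolding exp_add[symmetric] using y by (simp add: edk_nonneg algebra_simps)
          finally show ?thesis by (simp add: mult.assoc)
        qed
      qed
      also have "\<dots> < \<infinity>"
      proof -
        have i: "integrable lborel (\<lambda>y. (1 + \<sigma>) * C * ((1 + y) * edk \<sigma> y))" using mom(1) by (rule integrable_mult_right)
        have nn: "0 \<le> (1 + \<sigma>) * C * ((1 + y) * edk \<sigma> y)" for y
          using C \<sigma> by (cases "y < 0") (auto simp: edk_neg edk_real_nonneg intro!: mult_nonneg_nonneg)
        show ?thesis by (subst nn_integral_eq_integral[OF i]) (use nn in auto)
      qed
      finally show ?thesis .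
    qed
    have mk[measurable]: "?k \<in> borel_measurable borel" by (rule loc_kernelD(3)[OF k])
    have ik: "integrable logP (\<lambda>v. exp (- (1 + \<sigma>) * v) * ?k v)"
    proof -
      have 1: "integrable dP (\<lambda>x. x powr (- (1 + \<sigma>)))" by (rule integrableI_nonneg) (use fin in auto)
      have 2: "AE x in dP. x powr (- (1 + \<sigma>)) = exp (- (1 + \<sigma>) * ln x) * ?k (ln x)"
        using exp_ln_AE by eventually_elim (auto simp: powr_def lker_def)
      have "integrable dP (\<lambda>x. exp (- (1 + \<sigma>) * ln x) * ?k (ln x))"
        by (rule integrable_cong_AE_imp[OF 1 _ 2]) measurable
      then show ?thesis by (subst logP_integrable) auto
    qed
    let ?p = "\<integral>v. exp (- (1 + \<sigma>) * v) * ?k v \<partial>logP"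
    have tk: "loc_kernel logP (\<lambda>v. exp (- (1 + \<sigma>) * v) * ?k v)"
      using loc_kernel_mult_ctns[OF k continuous_on_exp_of_real, of "1 + \<sigma>"] by simp
    have tX: "xconv logP (\<lambda>v. exp (- (1 + \<sigma>) * v) * ?k v) (edk (1 + \<sigma>)) = (\<lambda>y. exp (- (1 + \<sigma>) * y) * V y)"
    proof
      fix y
      show "xconv logP (\<lambda>v. exp (- (1 + \<sigma>) * v) * ?k v) (edk (1 + \<sigma>)) y = exp (- (1 + \<sigma>) * y) * V y"
        using xconv_twist[OF k loc_bdd_edk, of "1 + \<sigma>" 0 y, unfolded edk_twist] by (simp add: VX)
    qed
    note XI = xconv_integral[OF tk loc_bdd_edk ik edk_integrable_real[OF s1], unfolded tX edk_integral_real[OF s1]]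
    have "ennreal (exp ?p) = (\<integral>\<^sup>+y. ennreal ((1 + \<sigma>) * (exp (- (1 + \<sigma>) * y) * V y)) \<partial>lborel)"
    proof -
      have "(\<integral>y. (1 + \<sigma>) * (exp (- (1 + \<sigma>) * y) * V y) \<partial>lborel) = exp ?p"
        unfolding integral_mult_right_zero XI(2) using s1 by simp
      then show ?thesis
        using integrable_mult_right[OF XI(1), of "1 + \<sigma>"] s1
        by (subst nn_integral_eq_integral) (auto simp: V_def)
    qed
    also have "\<dots> = (\<integral>\<^sup>+y. ennreal ((1 + \<sigma>) * exp (- (1 + \<sigma>) * y)) * emeasure ?N {1..exp y} \<partial>lborel)"
      unfolding emV using s1 by (intro nn_integral_cong) (subst ennreal_mult[symmetric], auto simp: V_def mult.assoc)
    also have "\<dots> = (\<integral>\<^sup>+x. ennreal (x powr (- (1 + \<sigma>))) \<partial>?N)"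
      by (rule layer_cake_nn[OF sfN sets_interval_measure N_ge1 s1, symmetric])
    \<comment> \<open>Moving \<open>1 / x\<close> into the measure lowers the exponent from
      \<open>1 + \<sigma>\<close> to \<open>\<sigma>\<close>; the second layer-cake step then meets
      the logarithmically growing \<open>R\<close>, whose transform has the right order.\<close>
    also have "\<dots> = (\<integral>\<^sup>+x. ennreal (x powr (- \<sigma>)) \<partial>(density ?N (\<lambda>x. ennreal (1 / x) * indicator {1..} x)))"
    proof -
      have "(\<integral>\<^sup>+x. ennreal (x powr (- \<sigma>)) \<partial>(density ?N (\<lambda>x. ennreal (1 / x) * indicator {1..} x)))
         = (\<integral>\<^sup>+x. (ennreal (1 / x) * indicator {1..} x) * ennreal (x powr (- \<sigma>)) \<partial>?N)"
        by (rule nn_integral_density) auto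
      also have "\<dots> = (\<integral>\<^sup>+x. ennreal (x powr (- (1 + \<sigma>))) \<partial>?N)"
      proof (rule nn_integral_cong_AE)
        show "AE x in ?N. (ennreal (1 / x) * indicator {1..} x) * ennreal (x powr (- \<sigma>)) = ennreal (x powr (- (1 + \<sigma>)))"
          using N_ge1
        proof eventually_elim
          case (elim x)
          have "x powr (- (1 + \<sigma>)) = (1 / x) * x powr (- \<sigma>)"
            using elim by (simp add: powr_diff powr_minus divide_simps)
          then show ?case using elim by (simp add: ennreal_mult[symmetric])
        qed
      qed
      finally show ?thesis by simp
    qed
    also have "\<dots> = (\<integral>\<^sup>+y. ennreal (\<sigma> * exp (- \<sigma> * y)) * emeasure (density ?N (\<lambda>x. ennreal (1 / x) * indicator {1..} x)) {1..exp y} \<partial>lborel)"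
    proof (rule layer_cake_nn[OF _ _ _ \<sigma>(1)])
      show "sets (density ?N (\<lambda>x. ennreal (1 / x) * indicator {1..} x)) = sets borel" by simp
      show "AE x in density ?N (\<lambda>x. ennreal (1 / x) * indicator {1..} x). 1 \<le> x"
        using N_ge1 by (subst AE_density) (auto elim: eventually_mono)
      interpret SN: sigma_finite_measure ?N by (rule sfN)
      show "sigma_finite_measure (density ?N (\<lambda>x. ennreal (1 / x) * indicator {1..} x))"
        by (subst SN.sigma_finite_iff_density_finite) (auto simp: indicator_def)
    qed
    also have "\<dots> \<le> (\<integral>\<^sup>+y. ennreal (\<sigma> * C * ((1 + y) * edk \<sigma> y)) \<partial>lborel)"
    proof (intro nn_integral_mono)
      fix y
      have em: "emeasure (density ?N (\<lambda>x. ennreal (1 / x) * indicator {1..} x)) {1..exp y} = ennreal (R (exp y))"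
      proof -
        have "emeasure (density ?N (\<lambda>x. ennreal (1 / x) * indicator {1..} x)) {1..exp y}
           = (\<integral>\<^sup>+x. ennreal (indicator {1..exp y} x *\<^sub>R (1 / x)) \<partial>?N)"
          by (subst emeasure_density) (auto intro!: nn_integral_cong simp: indicator_def)
        also have "\<dots> = ennreal (R (exp y))"
          unfolding R_def set_lebesgue_integral_def
          by (rule nn_integral_eq_integral[OF intR[unfolded set_integrable_def]]) (auto simp: indicator_def)
        finally show ?thesis .
      qed
      show "ennreal (\<sigma> * exp (- \<sigma> * y)) * emeasure (density ?N (\<lambda>x. ennreal (1 / x) * indicator {1..} x)) {1..exp y}
         \<le> ennreal (\<sigma> * C * ((1 + y) * edk \<sigma> y))"
      proof (cases "y < 0")
        case True
        then have "R (exp y) = 0" by (simp add: R_def set_lebesgue_integral_def)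
        then show ?thesis unfolding em by simp
      next
        case False
        then have y: "0 \<le> y" by simp
        have "ennreal (\<sigma> * exp (- \<sigma> * y)) * ennreal (R (exp y)) \<le> ennreal (\<sigma> * exp (- \<sigma> * y)) * ennreal (C * (1 + y))"
          using C(2)[of "exp y"] y by (intro mult_left_mono ennreal_leI) auto
        also have "\<dots> = ennreal (\<sigma> * C * ((1 + y) * edk \<sigma> y))"
          using \<sigma> C y by (subst ennreal_mult[symmetric]) (auto simp: edk_nonneg mult_ac)
        finally show ?thesis unfolding em .
      qed
    qed
    also have "\<dots> = ennreal (\<sigma> * C * (1 / \<sigma> + 1 / \<sigma>\<^sup>2))"
    proof -
      have i: "integrable lborel (\<lambda>y. \<sigma> * C * ((1 + y) * edk \<sigma> y))" using mom(1) by (rule integrable_mult_right)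
      have nn: "0 \<le> \<sigma> * C * ((1 + y) * edk \<sigma> y)" for y
        using C \<sigma> by (cases "y < 0") (auto simp: edk_neg edk_real_nonneg intro!: mult_nonneg_nonneg)
      show ?thesis
        unfolding mom(2)[symmetric] integral_mult_right_zero[symmetric]
        by (subst nn_integral_eq_integral[OF i]) (use nn in auto)
    qed
    finally have "exp ?p \<le> \<sigma> * C * (1 / \<sigma> + 1 / \<sigma>\<^sup>2)"
      using C \<sigma> by (subst (asm) ennreal_le_iff) auto
    also have "\<dots> = C + C / \<sigma>" using \<sigma> by (simp add: field_simps power2_eq_square)
    also have "\<dots> \<le> 2 * C / \<sigma>"
    proof -
      have "C * 1 \<le> C * (1 / \<sigma>)" using C \<sigma> by (intro mult_left_mono) (auto simp: divide_simps)
      then show ?thesis by simp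
    qed
    finally show "integrable logP (\<lambda>v. exp (- (1 + \<sigma>) * v) * ?k v) \<and> exp ?p \<le> 2 * C / \<sigma>" using ik by blast
  qed
qed

end

section \<open>Translation of the two asymptotic statements\<close>

lemma integral_log_subst:
  fixes f :: "real \<Rightarrow> complex"
  assumes f: "set_integrable lborel {1..exp y} f" and y: "0 \<le> y"
  shows "(LINT u:{1..exp y}|lborel. f u) = (\<integral>v. indicator {0..y} v *\<^sub>R (f (exp v) * of_real (exp v)) \<partial>lborel)"
    and "set_integrable lborel {0..y} (\<lambda>v. f (exp v) * of_real (exp v))"
proof -
  have sub: "set_integrable lborel {0..y} (\<lambda>v. h (exp v) * exp v)"
    "(LBINT u. h u * indicator {1..exp y} u) = (LBINT v. h (exp v) * exp v * indicator {0..y} v)"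
    if "set_integrable lborel {1..exp y} h" for h :: "real \<Rightarrow> real"
  proof -
    have h: "set_integrable lborel {exp 0..exp y} h" using that by simp
    have "set_integrable lborel {0..y} (\<lambda>x. h (exp x) * exp x)"
      "(LBINT x. h x * indicator {exp 0..exp y} x) = (LBINT x. h (exp x) * exp x * indicator {0..y} x)"
      by (rule integral_substitution[OF h DERIV_exp continuous_on_exp[OF continuous_on_id] _ y]; simp)+
    then show "set_integrable lborel {0..y} (\<lambda>v. h (exp v) * exp v)"
      "(LBINT u. h u * indicator {1..exp y} u) = (LBINT v. h (exp v) * exp v * indicator {0..y} v)" by simp_all
  qed
  have fi: "integrable lborel (\<lambda>u. indicator {1..exp y} u *\<^sub>R f u)" using f by (simp add: set_integrable_def)
  have re: "set_integrable lborel {1..exp y} (\<lambda>u. Re (f u))" and im: "set_integrable lborel {1..exp y} (\<lambda>u. Im (f u))"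
    using integrable_Re[OF fi] integrable_Im[OF fi] by (simp_all add: set_integrable_def)
  let ?g = "\<lambda>v. indicator {0..y} v *\<^sub>R (f (exp v) * of_real (exp v))"
  have gre: "integrable lborel (\<lambda>v. Re (?g v))" and gim: "integrable lborel (\<lambda>v. Im (?g v))"
    using sub(1)[OF re] sub(1)[OF im] by (simp_all add: set_integrable_def)
  have "integrable lborel (\<lambda>v. complex_of_real (Re (?g v)) + \<i> * complex_of_real (Im (?g v)))"
    using gre gim by (intro Bochner_Integration.integrable_add integrable_mult_right) (simp_all only: complex_of_real_integrable_eq)
  then have g: "integrable lborel ?g" by (simp only: complex_eq[symmetric])
  then show "set_integrable lborel {0..y} (\<lambda>v. f (exp v) * of_real (exp v))" by (simp add: set_integrable_def)
  show "(LINT u:{1..exp y}|lborel. f u) = integral\<^sup>L lborel ?g"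
    unfolding set_lebesgue_integral_def
  proof (rule complex_eqI)
    show "Re (\<integral>u. indicator {1..exp y} u *\<^sub>R f u \<partial>lborel) = Re (integral\<^sup>L lborel ?g)"
      unfolding integral_Re[OF fi, symmetric] integral_Re[OF g, symmetric]
      using sub(2)[OF re] by (simp add: mult_ac)
    show "Im (\<integral>u. indicator {1..exp y} u *\<^sub>R f u \<partial>lborel) = Im (integral\<^sup>L lborel ?g)"
      unfolding integral_Im[OF fi, symmetric] integral_Im[OF g, symmetric]
      using sub(2)[OF im] by (simp add: mult_ac)
  qed
qed

text \<open>Since \<open>Re \<beta> = 1\<close>, the modulus of \<open>exp (\<beta> * y)\<close> is
  \<open>x = exp y\<close>, so dividing by \<open>x\<close> leaves
  \<open>norm (h y)\<close>.\<close>

lemma smallo_iff_tendsto_log: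
  fixes F h :: "real \<Rightarrow> complex"
  assumes \<beta>: "Re \<beta> = 1" and F: "\<And>y. 0 < y \<Longrightarrow> F (exp y) = exp (\<beta> * of_real y) * h y"
  shows "F \<in> o[at_top](\<lambda>x. complex_of_real x) \<longleftrightarrow> (h \<longlongrightarrow> 0) at_top"
proof -
  have n: "norm (F (exp y) / complex_of_real (exp y)) = norm (h y)" if "0 < y" for y
    using that \<beta> unfolding F[OF that] norm_divide norm_mult norm_exp_eq_Re by simp
  have "F \<in> o[at_top](\<lambda>x. complex_of_real x) \<longleftrightarrow> ((\<lambda>x. F x / complex_of_real x) \<longlongrightarrow> 0) at_top"
  proof
    assume "F \<in> o[at_top](\<lambda>x. complex_of_real x)"
    then show "((\<lambda>x. F x / complex_of_real x) \<longlongrightarrow> 0) at_top" by (rule smalloD_tendsto)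
  next
    assume "((\<lambda>x. F x / complex_of_real x) \<longlongrightarrow> 0) at_top"
    moreover have "\<forall>\<^sub>F x in at_top. complex_of_real x \<noteq> 0"
      using eventually_gt_at_top[of 0] by eventually_elim simp
    ultimately show "F \<in> o[at_top](\<lambda>x. complex_of_real x)" by (rule smalloI_tendsto)
  qed
  also have "\<dots> \<longleftrightarrow> ((\<lambda>y. norm (F (exp y) / complex_of_real (exp y))) \<longlongrightarrow> 0) at_top"
  proof
    assume "((\<lambda>x. F x / complex_of_real x) \<longlongrightarrow> 0) at_top"
    from tendsto_norm_zero[OF filterlim_compose[OF this exp_at_top]]
    show "((\<lambda>y. norm (F (exp y) / complex_of_real (exp y))) \<longlongrightarrow> 0) at_top" .
  next
    assume "((\<lambda>y. norm (F (exp y) / complex_of_real (exp y))) \<longlongrightarrow> 0) at_top"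
    from filterlim_compose[OF this ln_at_top]
    have "((\<lambda>x. norm (F (exp (ln x)) / complex_of_real (exp (ln x)))) \<longlongrightarrow> 0) at_top" .
    moreover have "\<forall>\<^sub>F x in at_top. norm (F (exp (ln x)) / complex_of_real (exp (ln x))) = norm (F x / complex_of_real x)"
      using eventually_gt_at_top[of 0] by eventually_elim simp
    ultimately have "((\<lambda>x. norm (F x / complex_of_real x)) \<longlongrightarrow> 0) at_top" by (rule Lim_transform_eventually)
    then show "((\<lambda>x. F x / complex_of_real x) \<longlongrightarrow> 0) at_top" by (rule tendsto_norm_zero_cancel)
  qed
  also have "\<dots> \<longleftrightarrow> ((\<lambda>y. norm (h y)) \<longlongrightarrow> 0) at_top"
    by (rule tendsto_cong) (rule eventually_mono[OF eventually_gt_at_top n])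
  also have "\<dots> \<longleftrightarrow> (h \<longlongrightarrow> 0) at_top" by (rule tendsto_norm_zero_iff)
  finally show ?thesis .
qed

text \<open>Translation by \<open>\<alpha>\<close> sends compact intervals to compact intervals,
  each contained in a symmetric one, so only the quantifiers change. The transforms are identified
  for \<open>0 < Re s \<le> 1\<close>, hence the restriction to
  \<open>\<sigma> \<le> 2\<close>.\<close>

lemma uniform_limit_shift_iff:
  fixes M \<Phi> :: "complex \<Rightarrow> complex" and L :: "real \<Rightarrow> complex" and \<alpha> :: real
  assumes M: "\<And>s. 0 < Re s \<Longrightarrow> Re s \<le> 1 \<Longrightarrow> M (1 + \<i> * of_real \<alpha> + s) = \<Phi> s"
  shows "(\<forall>a b. \<forall>\<epsilon>>0. \<forall>\<^sub>F \<sigma> in at_right 1. \<forall>t\<in>{a..b}.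
        norm (M (Complex \<sigma> t) - c / (Complex \<sigma> t - 1 - \<i> * of_real \<alpha>) * L (1 / (\<sigma> - 1))) \<le> \<epsilon> * (1 / (\<sigma> - 1)))
    \<longleftrightarrow> (\<forall>T e. 0 < e \<longrightarrow> (\<exists>\<sigma>0>0. \<forall>\<sigma> t. 0 < \<sigma> \<longrightarrow> \<sigma> \<le> \<sigma>0 \<longrightarrow> \<bar>t\<bar> \<le> T \<longrightarrow>
        norm (\<Phi> (Complex \<sigma> t) - c / Complex \<sigma> t * L (1 / \<sigma>)) \<le> e / \<sigma>))"
    (is "?A \<longleftrightarrow> ?B")
proof -
  have eq: "norm (M (Complex \<sigma> t) - c / (Complex \<sigma> t - 1 - \<i> * of_real \<alpha>) * L (1 / (\<sigma> - 1)))
     = norm (\<Phi> (Complex (\<sigma> - 1) (t - \<alpha>)) - c / Complex (\<sigma> - 1) (t - \<alpha>) * L (1 / (\<sigma> - 1)))"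
    if "1 < \<sigma>" "\<sigma> \<le> 2" for \<sigma> t
  proof -
    have s: "Complex \<sigma> t - 1 - \<i> * of_real \<alpha> = Complex (\<sigma> - 1) (t - \<alpha>)" by (simp add: complex_eq_iff)
    have "Complex \<sigma> t = 1 + \<i> * of_real \<alpha> + Complex (\<sigma> - 1) (t - \<alpha>)" by (simp add: complex_eq_iff)
    then have "M (Complex \<sigma> t) = \<Phi> (Complex (\<sigma> - 1) (t - \<alpha>))" using M[of "Complex (\<sigma> - 1) (t - \<alpha>)"] that by simp
    then show ?thesis by (simp only: s)
  qed
  show ?thesis
  proof
    assume A: ?A
    show ?B
    proof (intro allI impI)
      fix T e :: real assume e: "0 < e"
      have "\<forall>\<^sub>F \<sigma> in at_right 1. \<forall>t\<in>{\<alpha> - T..\<alpha> + T}.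
        norm (M (Complex \<sigma> t) - c / (Complex \<sigma> t - 1 - \<i> * of_real \<alpha>) * L (1 / (\<sigma> - 1))) \<le> e * (1 / (\<sigma> - 1))"
        using A e by blast
      then obtain b where b: "1 < b" and h: "\<And>\<sigma> t. 1 < \<sigma> \<Longrightarrow> \<sigma> < b \<Longrightarrow> t \<in> {\<alpha> - T..\<alpha> + T} \<Longrightarrow>
        norm (M (Complex \<sigma> t) - c / (Complex \<sigma> t - 1 - \<i> * of_real \<alpha>) * L (1 / (\<sigma> - 1))) \<le> e * (1 / (\<sigma> - 1))"
        unfolding eventually_at_right_field by blast
      show "\<exists>\<sigma>0>0. \<forall>\<sigma> t. 0 < \<sigma> \<longrightarrow> \<sigma> \<le> \<sigma>0 \<longrightarrow> \<bar>t\<bar> \<le> T \<longrightarrow>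
        norm (\<Phi> (Complex \<sigma> t) - c / Complex \<sigma> t * L (1 / \<sigma>)) \<le> e / \<sigma>"
      proof (rule exI[of _ "min 1 ((b - 1) / 2)"], rule conjI, use b in simp, intro allI impI)
        fix \<sigma> t assume s: "0 < \<sigma>" "\<sigma> \<le> min 1 ((b - 1) / 2)" "\<bar>t\<bar> \<le> T"
        have "1 + \<sigma> < b" using s b by (simp add: min_def split: if_splits)
        then show "norm (\<Phi> (Complex \<sigma> t) - c / Complex \<sigma> t * L (1 / \<sigma>)) \<le> e / \<sigma>"
          using h[of "1 + \<sigma>" "\<alpha> + t"] eq[of "1 + \<sigma>" "\<alpha> + t"] s by (simp add: abs_le_iff)
      qed
    qed
  next
    assume B: ?B
    show ?A
    proof (intro allI impI)
      fix a b e :: real assume e: "0 < e"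
      obtain \<sigma>0 where \<sigma>0: "0 < \<sigma>0" and h: "\<And>\<sigma> t. 0 < \<sigma> \<Longrightarrow> \<sigma> \<le> \<sigma>0 \<Longrightarrow> \<bar>t\<bar> \<le> \<bar>a\<bar> + \<bar>b\<bar> + \<bar>\<alpha>\<bar> \<Longrightarrow>
        norm (\<Phi> (Complex \<sigma> t) - c / Complex \<sigma> t * L (1 / \<sigma>)) \<le> e / \<sigma>"
        using B e by meson
      have "\<forall>\<^sub>F \<sigma> in at_right (1::real). \<sigma> \<in> {1<..<1 + min 1 \<sigma>0}"
        using \<sigma>0 by (intro eventually_at_right_real) simp
      then show "\<forall>\<^sub>F \<sigma> in at_right 1. \<forall>t\<in>{a..b}.
        norm (M (Complex \<sigma> t) - c / (Complex \<sigma> t - 1 - \<i> * of_real \<alpha>) * L (1 / (\<sigma> - 1))) \<le> e * (1 / (\<sigma> - 1))"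
      proof eventually_elim
        case (elim \<sigma>)
        show ?case
        proof
          fix t assume t: "t \<in> {a..b}"
          have "\<bar>t - \<alpha>\<bar> \<le> \<bar>a\<bar> + \<bar>b\<bar> + \<bar>\<alpha>\<bar>" using t by auto
          then show "norm (M (Complex \<sigma> t) - c / (Complex \<sigma> t - 1 - \<i> * of_real \<alpha>) * L (1 / (\<sigma> - 1))) \<le> e * (1 / (\<sigma> - 1))"
            using h[of "\<sigma> - 1" "t - \<alpha>"] eq[of \<sigma> t] elim by (simp add: min_def split: if_splits)
        qed
      qed
    qed
  qed
qed

theorem theorem2p1:
  fixes N P :: "real \<Rightarrow> real"
    and dG :: cmeasure
    and g g\<^sub>1 g\<^sub>2 L :: "real \<Rightarrow> complex"
    and c \<alpha> :: real
  assumes "beurling_system N P"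
    and "(\<lambda>x. LINT u:{1..x}|interval_measure N. 1 / u) \<in> \<Theta>[at_top](\<lambda>x. ln x)"
    and "arithmetic_measure N dG"
    and "multiplicative_with P g dG"
    and "\<And>x. x \<ge> 1 \<Longrightarrow> g x = g\<^sub>1 x + g\<^sub>2 x"
    and "g\<^sub>1 \<in> borel_measurable borel"
    and "g\<^sub>2 \<in> borel_measurable borel"
    and "\<And>x. x \<ge> 1 \<Longrightarrow> norm (g\<^sub>1 x) \<le> 1"
    and "(\<lambda>x. LINT u:{1..x}|interval_measure P. norm (g\<^sub>1 u) * ln u) \<in> O[at_top](\<lambda>x. x)"
    and "set_integrable (interval_measure P) {1..} (\<lambda>x. norm (g\<^sub>2 x) / x)"
    and "slowly_varying L"
    and "\<And>u. u > 0 \<Longrightarrow> norm (L u) = 1"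
  shows
    "(\<lambda>x. (LINT u:{1..x}|lborel. summatory dG u / complex_of_real u)
          - complex_of_real c * complex_of_real x powr (1 + \<i> * complex_of_real \<alpha>)
              / (1 + \<i> * complex_of_real \<alpha>)\<^sup>2 * L (ln x))
       \<in> o[at_top](\<lambda>x. complex_of_real x)
     \<longleftrightarrow>
     (\<forall>a b. \<forall>\<epsilon>>0. \<forall>\<^sub>F \<sigma> in at_right 1. \<forall>t\<in>{a..b}.
        norm (mellin_stieltjes dG (Complex \<sigma> t)
              - complex_of_real c / (Complex \<sigma> t - 1 - \<i> * complex_of_real \<alpha>) * L (1 / (\<sigma> - 1)))
        \<le> \<epsilon> * (1 / (\<sigma> - 1)))"
proof -
  define \<beta> where "\<beta> = 1 + \<i> * complex_of_real \<alpha>"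
  have \<beta>: "Re \<beta> = 1" by (simp add: \<beta>_def)
  have bs: "mono N" "mono P" "\<And>x. continuous (at_right x) N" "\<And>x. continuous (at_right x) P"
    "\<And>x. x < 1 \<Longrightarrow> N x = 0" "\<And>x. x < 1 \<Longrightarrow> P x = 0" "P 1 = 0"
    "\<And>B. B \<in> bdd_borel \<Longrightarrow> stieltjes N B = exp_star (stieltjes P) B"
    using assms(1) by (auto simp: beurling_system_def)
  interpret beurling_primes P
    by unfold_locales (use bs in \<open>auto simp: le_less\<close>)
  note [measurable] = assms(6,7)
  define w where "w = (\<lambda>x. g\<^sub>1 x + g\<^sub>2 x)"
  have w[measurable]: "w \<in> borel_measurable borel" by (simp add: w_def)
  have int1: "set_integrable dP B g\<^sub>1" if B: "B \<in> bdd_borel" for B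
  proof -
    have [measurable]: "B \<in> sets borel" using B by (simp add: bdd_borel_def)
    show ?thesis unfolding set_integrable_def
    proof (rule Bochner_Integration.integrable_bound[OF set_integrable_const[OF B, of "1::real", unfolded set_integrable_def]])
      show "AE x in dP. norm (indicator B x *\<^sub>R g\<^sub>1 x) \<le> norm (indicator B x *\<^sub>R (1::real))"
        using B assms(8) by (intro AE_I2) (auto simp: bdd_borel_def indicator_def)
    qed measurable
  qed
  have g2i: "integrable dP (\<lambda>x. indicator {1..} x *\<^sub>R (norm (g\<^sub>2 x) / x))" using assms(10) by (simp add: set_integrable_def)
  have int2: "set_integrable dP B g\<^sub>2" if B: "B \<in> bdd_borel" for B
  proof -
    have [measurable]: "B \<in> sets borel" using B by (simp add: bdd_borel_def)
    obtain b where b: "\<And>x. x \<in> B \<Longrightarrow> norm x \<le> b" using B unfolding bdd_borel_def bounded_iff by blast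
    show ?thesis unfolding set_integrable_def
    proof (rule Bochner_Integration.integrable_bound[OF integrable_mult_right[OF g2i, of b]])
      show "AE x in dP. norm (indicator B x *\<^sub>R g\<^sub>2 x) \<le> norm (b * (indicator {1..} x *\<^sub>R (norm (g\<^sub>2 x) / x)))"
      proof (rule AE_I2)
        fix x
        show "norm (indicator B x *\<^sub>R g\<^sub>2 x) \<le> norm (b * (indicator {1..} x *\<^sub>R (norm (g\<^sub>2 x) / x)))"
        proof (cases "x \<in> B")
          case True
          then have x: "1 \<le> x" "x \<le> b" using B b[OF True] by (auto simp: bdd_borel_def)
          have "norm (g\<^sub>2 x) * x \<le> norm (g\<^sub>2 x) * b" using x by (intro mult_left_mono) auto
          then show ?thesis using True x by (simp add: divide_simps mult.commute)
        qed simp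
      qed
    qed measurable
  qed
  have intw: "set_integrable dP B w" if "B \<in> bdd_borel" for B
    unfolding w_def using int1[OF that] int2[OF that] by (rule set_integral_add(1))
  have \<mu>: "stieltjes_density g P B = (LINT x:B|dP. w x)" if B: "B \<in> bdd_borel" for B
    unfolding stieltjes_density_def
    by (rule set_lebesgue_integral_cong) (use B assms(5) in \<open>auto simp: bdd_borel_def w_def\<close>)
  \<comment> \<open>The factor \<open>exp (- \<beta> * v)\<close> builds both the division by
    \<open>x\<close> and the twist by \<open>x powr (- i * \<alpha>)\<close> into the kernels, so
    that the expected singularity sits at \<open>s = 0\<close>.\<close>
  define k1 where "k1 = (\<lambda>v. exp (- \<beta> * complex_of_real v) * lker g\<^sub>1 v)"
  define k2 where "k2 = (\<lambda>v. exp (- \<beta> * complex_of_real v) * lker g\<^sub>2 v)"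
  note kg1 = loc_kernel_lker[OF assms(6) int1] and kg2 = loc_kernel_lker[OF assms(7) int2]
    and kw = loc_kernel_lker[OF w intw]
  have k1: "loc_kernel logP k1" unfolding k1_def by (rule loc_kernel_mult_ctns[OF kg1 continuous_on_exp_of_real])
  have k2: "loc_kernel logP k2" unfolding k2_def by (rule loc_kernel_mult_ctns[OF kg2 continuous_on_exp_of_real])
  note [measurable] = loc_kernelD(3)[OF k1] loc_kernelD(3)[OF k2]
  have nk1: "norm (k1 v) = indicator {0..} v * (exp (- v) * norm (g\<^sub>1 (exp v)))" for v
    using \<beta> by (simp add: k1_def norm_mult lker_def indicator_def)
  have nk2: "norm (k2 v) = indicator {0..} v * (exp (- v) * norm (g\<^sub>2 (exp v)))" for v
    using \<beta> by (simp add: k2_def norm_mult lker_def indicator_def)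
  obtain CZ where CZ: "\<And>\<sigma>. 0 < \<sigma> \<Longrightarrow> \<sigma> \<le> 1 \<Longrightarrow> integrable logP (\<lambda>v. exp (- (1 + \<sigma>) * v) * lker (\<lambda>_. 1) v)"
     "\<And>\<sigma>. 0 < \<sigma> \<Longrightarrow> \<sigma> \<le> 1 \<Longrightarrow> exp (\<integral>v. exp (- (1 + \<sigma>) * v) * lker (\<lambda>_. 1) v \<partial>logP) \<le> CZ / \<sigma>"
    using zeta_bound[OF bs(1,3,5,8) bigthetaD1[OF assms(2)]] by blast
  \<comment> \<open>The bound \<open>norm (g\<^sub>1 x) \<le> 1\<close> makes the kernel of the zeta
    function dominate \<open>k1\<close>; this is how the zeta bound reaches the locale
    assumption.\<close>
  have le1: "exp (- \<sigma> * v) * norm (k1 v) \<le> exp (- (1 + \<sigma>) * v) * lker (\<lambda>_. 1) v" for \<sigma> v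
  proof (cases "v < 0")
    case False
    then have "norm (g\<^sub>1 (exp v)) \<le> 1" using assms(8)[of "exp v"] by simp
    then have "(exp (- \<sigma> * v) * exp (- v)) * norm (g\<^sub>1 (exp v)) \<le> (exp (- \<sigma> * v) * exp (- v)) * 1"
      by (intro mult_left_mono) auto
    also have "(exp (- \<sigma> * v) * exp (- v)) * 1 = exp (- (1 + \<sigma>) * v)"
      unfolding exp_add[symmetric] by (simp add: algebra_simps)
    finally show ?thesis using False by (simp add: nk1 lker_def mult.assoc)
  qed (simp add: nk1 lker_def)
  have zint: "integrable logP (\<lambda>v. exp (- \<sigma> * v) * norm (k1 v))" if \<sigma>: "0 < \<sigma>" "\<sigma> \<le> 1" for \<sigma>
  proof (rule Bochner_Integration.integrable_bound[OF CZ(1)[OF \<sigma>]])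
    show "AE v in logP. norm (exp (- \<sigma> * v) * norm (k1 v)) \<le> norm (exp (- (1 + \<sigma>) * v) * lker (\<lambda>_. 1::real) v)"
      using le1[of \<sigma>] by (intro AE_I2) (auto intro: order_trans[OF _ abs_ge_self] simp del: minus_add_distrib)
  qed measurable
  obtain C where C: "0 \<le> C" "\<And>x. 1 \<le> x \<Longrightarrow> (LINT u:{1..x}|dP. norm (g\<^sub>1 u) * ln u) \<le> C * x"
  proof -
    have gl: "set_integrable dP {1..x} (\<lambda>u. norm (g\<^sub>1 u) * ln u)" if "1 \<le> x" for x
      unfolding set_integrable_def
    proof (rule Bochner_Integration.integrable_bound)
      show "integrable dP (\<lambda>u. ln x * (indicator {1..x} u *\<^sub>R norm (g\<^sub>1 u)))"
        using integrable_norm[OF int1[OF bdd_borel_Icc[of 1 x], unfolded set_integrable_def]] by (intro integrable_mult_right) simp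
      show "AE u in dP. norm (indicator {1..x} u *\<^sub>R (norm (g\<^sub>1 u) * ln u)) \<le> norm (ln x * (indicator {1..x} u *\<^sub>R norm (g\<^sub>1 u)))"
        using that by (intro AE_I2) (auto simp: indicator_def abs_mult mult.commute[of "ln x"] intro!: mult_left_mono)
    qed measurable
    have "\<exists>C\<ge>0. \<forall>x\<ge>1. (LINT u:{1..x}|dP. norm (g\<^sub>1 u) * ln u) \<le> C * x"
    proof (rule bigo_extend[OF assms(9)])
      show "(LINT u:{1..x}|dP. norm (g\<^sub>1 u) * ln u) \<le> (LINT u:{1..y}|dP. norm (g\<^sub>1 u) * ln u)" if "1 \<le> x" "x \<le> y" for x y
        unfolding set_lebesgue_integral_def
        using that gl[of x, unfolded set_integrable_def] gl[of y, unfolded set_integrable_def]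
        by (intro integral_mono) (auto simp: indicator_def)
    qed auto
    then show ?thesis using that by blast
  qed
  interpret H: halasz_pair logP k1 \<beta> C CZ k2
  proof unfold_locales
    show "loc_kernel logP k1" "loc_kernel logP k2" "Re \<beta> = 1" by fact+
    show "integrable logP (\<lambda>v. exp (- \<sigma> * v) * norm (k1 v))" if "0 < \<sigma>" "\<sigma> \<le> 1" for \<sigma>
      by (rule zint[OF that])
    show "exp (\<integral>v. exp (- \<sigma> * v) * norm (k1 v) \<partial>logP) \<le> CZ / \<sigma>" if \<sigma>: "0 < \<sigma>" "\<sigma> \<le> 1" for \<sigma>
    proof -
      have "(\<integral>v. exp (- \<sigma> * v) * norm (k1 v) \<partial>logP) \<le> (\<integral>v. exp (- (1 + \<sigma>) * v) * lker (\<lambda>_. 1) v \<partial>logP)"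
        by (rule integral_mono[OF zint[OF \<sigma>] CZ(1)[OF \<sigma>] le1])
      then show ?thesis using CZ(2)[OF \<sigma>] by (meson exp_le_cancel_iff order_trans)
    qed
    \<comment> \<open>As \<open>exp (- ln x) = 1 / x\<close>, the mass of \<open>k2\<close> is the
      convergent integral assumed for \<open>g\<^sub>2\<close>.\<close>
    show "integrable logP k2"
    proof -
      have "integrable dP (\<lambda>x. norm (k2 (ln x)))"
      proof (rule integrable_cong_AE_imp[OF g2i])
        show "AE x in dP. indicator {1..} x *\<^sub>R (norm (g\<^sub>2 x) / x) = norm (k2 (ln x))"
          using exp_ln_AE by eventually_elim (auto simp: nk2 exp_minus divide_inverse mult.commute)
      qed measurable
      then have "integrable dP (\<lambda>x. k2 (ln x))" by (rule integrable_norm_cancel) measurable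
      then show ?thesis by (subst logP_integrable) measurable
    qed
    show "lconv logP (\<lambda>v. v *\<^sub>R norm (k1 v)) (edk 1) y \<le> C" for y
    proof (cases "y < 0")
      case True
      then show ?thesis
        using loc_bddD(2)[OF loc_bdd_lconv[OF loc_kernel_times_id[OF loc_kernel_norm[OF k1]] loc_bdd_edk] True, of 1] C by simp
    next
      case False
      have [measurable]: "edk (1::real) \<in> borel_measurable borel" by (rule loc_bddD(1)[OF loc_bdd_edk])
      have "lconv logP (\<lambda>v. v *\<^sub>R norm (k1 v)) (edk 1) y = (\<integral>x. edk 1 (y - ln x) * (ln x *\<^sub>R norm (k1 (ln x))) \<partial>dP)"
        unfolding lconv_def by (rule logP_integral) measurable
      \<comment> \<open>The window and the normalization of \<open>k1\<close> multiply to the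
        constant \<open>exp (- y)\<close>, so the locale assumption \<open>cheb\<close> is exactly
        the Chebyshev bound for \<open>g\<^sub>1\<close> at \<open>x = exp y\<close>.\<close>
      also have "\<dots> = (\<integral>x. exp (- y) * (indicator {1..exp y} x *\<^sub>R (norm (g\<^sub>1 x) * ln x)) \<partial>dP)"
      proof (rule integral_cong_AE)
        show "AE x in dP. edk 1 (y - ln x) * (ln x *\<^sub>R norm (k1 (ln x))) = exp (- y) * (indicator {1..exp y} x *\<^sub>R (norm (g\<^sub>1 x) * ln x))"
          using exp_ln_AE
        proof eventually_elim
          case (elim x)
          then have "ln x \<le> y \<longleftrightarrow> x \<le> exp y" by (metis exp_le_cancel_iff)
          moreover have "exp (- (y - ln x)) * exp (- ln x) = exp (- y)" unfolding exp_add[symmetric] by simp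
          then have "exp (- (y - ln x)) * (ln x * (exp (- ln x) * norm (g\<^sub>1 x))) = exp (- y) * (norm (g\<^sub>1 x) * ln x)"
            by (metis (no_types, lifting) mult.assoc mult.commute)
          ultimately show ?case using elim by (auto simp: edk_def nk1 indicator_def)
        qed
      qed measurable
      also have "\<dots> = exp (- y) * (LINT u:{1..exp y}|dP. norm (g\<^sub>1 u) * ln u)"
        unfolding set_lebesgue_integral_def by (rule integral_mult_right_zero)
      also have "\<dots> \<le> exp (- y) * (C * exp y)" using C(2)[of "exp y"] False by (intro mult_left_mono) auto
      also have "\<dots> = C" by (simp add: exp_minus)
      finally show ?thesis .
    qed
  qed
  define \<gamma> where "\<gamma> = xconv logP (\<lambda>v. k1 v + k2 v) (edk \<beta>)"
  have \<gamma>_bd: "loc_bdd \<gamma>" unfolding \<gamma>_def by (rule loc_bdd_xconv[OF H.loc_kernel_k12 loc_bdd_edk])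
  have dGP: "dG B = exp_star (stieltjes_density g P) B" if "B \<in> bdd_borel" for B
    using assms(4) that by (simp add: multiplicative_with_def)
  have kk: "(\<lambda>v. exp (- \<beta> * complex_of_real v) * lker w v) = (\<lambda>v. k1 v + k2 v)"
    by (auto simp: fun_eq_iff k1_def k2_def lker_def w_def algebra_simps)
  have G: "dG {1..exp y} = xconv logP (lker w) (edk 0) y" for y
    using dGP[OF bdd_borel_Icc[of 1 "exp y"]] exp_star_Icc[OF w intw \<mu>, of y] by simp
  have \<gamma>G: "\<gamma> y = exp (- \<beta> * of_real y) * dG {1..exp y}" for y
    unfolding \<gamma>_def G kk[symmetric] using xconv_twist[OF kw loc_bdd_edk, of \<beta> 0 y, unfolded edk_twist] by simp
  have mellin: "mellin_stieltjes dG (\<beta> + s) = H.\<Phi> s" if s: "0 < Re s" "Re s \<le> 1" for s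
  proof -
    define D where "D = (xconv logP (\<lambda>v. norm (lker w v)) (edk 0) :: real \<Rightarrow> real)"
    have re: "Re (\<beta> + s) = 1 + Re s" using \<beta> by simp
    have "mellin_stieltjes dG (\<beta> + s) = (\<beta> + s) * (\<integral>y. exp (- (\<beta> + s) * of_real y) * dG {1..exp y} \<partial>lborel)"
    proof (rule cm_integral_powr)
      show "complex_measure dG" using assms(3) by (simp add: arithmetic_measure_def)
      show "norm (dG A) \<le> D y" if "A \<in> bdd_borel" "A \<subseteq> {1..exp y}" for A y
        unfolding dGP[OF that(1)] D_def by (rule exp_star_norm_le[OF w intw \<mu> that])
      show "0 < Re (\<beta> + s)" using s re by simp
      have nkw: "loc_kernel logP (\<lambda>v. norm (lker w v))" by (rule loc_kernel_norm[OF kw])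
      let ?t = "1 + Re s"
      have tk: "loc_kernel logP (\<lambda>v. exp (- ?t * of_real v) * norm (lker w v))"
        by (rule loc_kernel_mult_ctns[OF nkw continuous_on_exp_of_real])
      have ti: "integrable logP (\<lambda>v. exp (- ?t * of_real v) * norm (lker w v))"
      proof -
        \<comment> \<open>The two parts converge for different reasons, \<open>k1\<close> by the
          zeta bound and \<open>k2\<close> by its finite mass, so integrability of \<open>w\<close>
          is assembled from them.\<close>
        have "integrable logP (\<lambda>v. norm (exp (- s * of_real v) * k1 v + exp (- s * of_real v) * k2 v))"
          using s by (intro integrable_norm Bochner_Integration.integrable_add H.twist_int H.twist_int2(1)) auto
        moreover have "norm (exp (- s * of_real v) * k1 v + exp (- s * of_real v) * k2 v) = exp (- ?t * of_real v) * norm (lker w v)" for v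
        proof -
          have "exp (- s * of_real v) * k1 v + exp (- s * of_real v) * k2 v = exp (- s * of_real v) * (exp (- \<beta> * of_real v) * lker w v)"
            using fun_cong[OF kk, of v] by (simp only: distrib_left)
          also have "norm \<dots> = (exp (- Re s * v) * exp (- v)) * norm (lker w v)"
            unfolding norm_mult norm_exp_eq_Re using \<beta> by simp
          also have "exp (- Re s * v) * exp (- v) = exp (- ?t * of_real v)"
            unfolding exp_add[symmetric] by (simp add: algebra_simps)
          finally show ?thesis .
        qed
        ultimately show ?thesis by (simp only:)
      qed
      have eq: "(\<lambda>y. exp (- ?t * of_real y) * D y) = xconv logP (\<lambda>v. exp (- ?t * of_real v) * norm (lker w v)) (edk (0 + ?t))"
        unfolding D_def by (rule ext, rule sym) (rule xconv_twist[OF nkw loc_bdd_edk, of ?t 0, unfolded edk_twist])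
      have "integrable lborel (\<lambda>y. exp (- ?t * of_real y) * D y)"
        unfolding eq by (rule xconv_integral(1)[OF tk loc_bdd_edk ti edk_integrable_real]) (use s in simp)
      then show "integrable lborel (\<lambda>y. exp (- Re (\<beta> + s) * y) * D y)" unfolding re by simp
    qed
    also have "(\<integral>y. exp (- (\<beta> + s) * of_real y) * dG {1..exp y} \<partial>lborel) = lap \<gamma> s"
      unfolding lap_def
    proof (intro Bochner_Integration.integral_cong refl)
      fix y
      have "exp (- (\<beta> + s) * of_real y) = exp (- s * of_real y) * exp (- \<beta> * of_real y)"
        unfolding exp_add[symmetric] by (simp add: algebra_simps)
      then show "exp (- (\<beta> + s) * of_real y) * dG {1..exp y} = exp (- s * of_real y) * \<gamma> y"
        unfolding \<gamma>G by (simp only: mult.assoc)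
    qed
    also have "\<dots> = H.\<Phi> s / (\<beta> + s)" unfolding \<gamma>_def by (rule H.\<gamma>12_lap(2)[OF s])
    also have "(\<beta> + s) * (H.\<Phi> s / (\<beta> + s)) = H.\<Phi> s"
    proof -
      have "\<beta> + s \<noteq> 0" using s re by (metis add_pos_pos less_irrefl zero_complex.simps(1) zero_less_one)
      then show ?thesis by simp
    qed
    finally show ?thesis .
  qed
  have F: "(LINT u:{1..exp y}|lborel. summatory dG u / complex_of_real u) = exp (\<beta> * of_real y) * H.\<psi> y" if y: "0 < y" for y
  proof -
    note [measurable] = loc_bddD(1)[OF loc_bdd_xconv[OF kw loc_bdd_edk, of 0]]
    let ?f = "\<lambda>u. xconv logP (lker w) (edk 0) (ln u) / complex_of_real u"
    obtain M where M: "\<And>x. x \<le> y \<Longrightarrow> norm (xconv logP (lker w) (edk 0) x) \<le> M"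
      using loc_bddE[OF loc_bdd_xconv[OF kw loc_bdd_edk]] by metis
    have fi: "set_integrable lborel {1..exp y} ?f"
      unfolding set_integrable_def
    proof (rule Bochner_Integration.integrable_bound)
      show "integrable lborel (\<lambda>u. indicator {1..exp y} u * M)"
        by (intro integrable_mult_left integrable_real_indicator) (auto simp: emeasure_lborel_Icc_eq)
      show "AE u in lborel. norm (indicator {1..exp y} u *\<^sub>R ?f u) \<le> norm (indicator {1..exp y} u * M)"
      proof (rule AE_I2)
        fix u
        show "norm (indicator {1..exp y} u *\<^sub>R ?f u) \<le> norm (indicator {1..exp y} u * M)"
        proof (cases "u \<in> {1..exp y}")
          case True
          then have "ln u \<le> y" by (metis atLeastAtMost_iff exp_le_cancel_iff exp_ln less_le_trans zero_less_one)
          have "norm (?f u) \<le> norm (xconv logP (lker w) (edk 0) (ln u))"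
            using True by (simp add: norm_divide divide_le_eq mult_le_cancel_left1)
          also have "\<dots> \<le> M" by (rule M) fact
          finally show ?thesis using True by simp
        qed simp
      qed
    qed measurable
    have "(LINT u:{1..exp y}|lborel. summatory dG u / complex_of_real u) = (LINT u:{1..exp y}|lborel. ?f u)"
      by (rule set_lebesgue_integral_cong) (auto simp: summatory_def G[symmetric])
    also have "\<dots> = (\<integral>v. indicator {0..y} v *\<^sub>R (?f (exp v) * of_real (exp v)) \<partial>lborel)"
      by (rule integral_log_subst(1)[OF fi]) (use y in simp)
    \<comment> \<open>For \<open>0 \<le> v \<le> y\<close> the weights
      \<open>exp (- \<beta> * (y - v))\<close> and \<open>exp (- \<beta> * v)\<close> multiply to
      \<open>exp (- \<beta> * y)\<close>, which the outer factor cancels; the plain integral of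
      \<open>G\<close> thus becomes a convolution of normalized functions.\<close>
    also have "\<dots> = (\<integral>v. exp (\<beta> * of_real y) * (edk \<beta> (y - v) * \<gamma> v) \<partial>lborel)"
    proof (intro Bochner_Integration.integral_cong refl)
      fix v
      show "indicator {0..y} v *\<^sub>R (?f (exp v) * of_real (exp v)) = exp (\<beta> * of_real y) * (edk \<beta> (y - v) * \<gamma> v)"
      proof (cases "0 \<le> v \<and> v \<le> y")
        case True
        have "exp (\<beta> * of_real y) * (exp (- \<beta> * of_real (y - v)) * exp (- \<beta> * of_real v)) = 1"
          unfolding exp_add[symmetric] by (simp add: algebra_simps)
        then have "exp (\<beta> * of_real y) * (exp (- \<beta> * of_real (y - v)) * (exp (- \<beta> * of_real v) * dG {1..exp v})) = dG {1..exp v}"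
          by (metis mult.assoc mult_1_left)
        then show ?thesis using True by (simp only: \<gamma>G) (simp add: edk_nonneg G)
      next
        case False
        then show ?thesis using loc_bddD(2)[OF \<gamma>_bd, of v] by (cases "v < 0") (auto simp: edk_neg)
      qed
    qed
    also have "\<dots> = exp (\<beta> * of_real y) * lconv lborel \<gamma> (edk \<beta>) y"
      unfolding lconv_def by (rule integral_mult_right_zero)
    also have "lconv lborel \<gamma> (edk \<beta>) = H.\<psi>"
      unfolding H.\<psi>_def \<gamma>_def by (rule lconv_lborel_sym)
    finally show ?thesis .
  qed
  have sv: "((\<lambda>u. L (l * u) / L u) \<longlongrightarrow> 1) at_top" if "0 < l" for l
    using assms(11) that by (simp add: slowly_varying_def)
  let ?F = "\<lambda>x. (LINT u:{1..x}|lborel. summatory dG u / complex_of_real u)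
          - complex_of_real c * complex_of_real x powr \<beta> / \<beta>\<^sup>2 * L (ln x)"
  have FF: "?F (exp y) = exp (\<beta> * of_real y) * (H.\<psi> y - complex_of_real c / \<beta>\<^sup>2 * L y)" if "0 < y" for y
    unfolding F[OF that] by (simp add: powr_def Ln_of_real right_diff_distrib mult_ac)
  have "?F \<in> o[at_top](\<lambda>x. complex_of_real x) \<longleftrightarrow> ((\<lambda>y. H.\<psi> y - complex_of_real c / \<beta>\<^sup>2 * L y) \<longlongrightarrow> 0) at_top"
    by (rule smallo_iff_tendsto_log[OF \<beta> FF])
  also have "\<dots> \<longleftrightarrow> (\<forall>T e. 0 < e \<longrightarrow> (\<exists>\<sigma>0>0. \<forall>\<sigma> t. 0 < \<sigma> \<longrightarrow> \<sigma> \<le> \<sigma>0 \<longrightarrow> \<bar>t\<bar> \<le> T \<longrightarrow>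
        norm (H.\<Phi> (Complex \<sigma> t) - complex_of_real c / Complex \<sigma> t * L (1 / \<sigma>)) \<le> e / \<sigma>))"
  proof
    assume "((\<lambda>y. H.\<psi> y - complex_of_real c / \<beta>\<^sup>2 * L y) \<longlongrightarrow> 0) at_top"
    then show "\<forall>T e. 0 < e \<longrightarrow> (\<exists>\<sigma>0>0. \<forall>\<sigma> t. 0 < \<sigma> \<longrightarrow> \<sigma> \<le> \<sigma>0 \<longrightarrow> \<bar>t\<bar> \<le> T \<longrightarrow>
        norm (H.\<Phi> (Complex \<sigma> t) - complex_of_real c / Complex \<sigma> t * L (1 / \<sigma>)) \<le> e / \<sigma>)"
      using H.abel[OF assms(12) sv] by blast
  next
    assume "\<forall>T e. 0 < e \<longrightarrow> (\<exists>\<sigma>0>0. \<forall>\<sigma> t. 0 < \<sigma> \<longrightarrow> \<sigma> \<le> \<sigma>0 \<longrightarrow> \<bar>t\<bar> \<le> T \<longrightarrow>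
        norm (H.\<Phi> (Complex \<sigma> t) - complex_of_real c / Complex \<sigma> t * L (1 / \<sigma>)) \<le> e / \<sigma>)"
    then show "((\<lambda>y. H.\<psi> y - complex_of_real c / \<beta>\<^sup>2 * L y) \<longlongrightarrow> 0) at_top"
      by (intro H.tauber[OF assms(12) sv]) blast+
  qed
  also have "\<dots> \<longleftrightarrow> (\<forall>a b. \<forall>\<epsilon>>0. \<forall>\<^sub>F \<sigma> in at_right 1. \<forall>t\<in>{a..b}.
        norm (mellin_stieltjes dG (Complex \<sigma> t)
              - complex_of_real c / (Complex \<sigma> t - 1 - \<i> * complex_of_real \<alpha>) * L (1 / (\<sigma> - 1)))
        \<le> \<epsilon> * (1 / (\<sigma> - 1)))"
    by (rule uniform_limit_shift_iff[symmetric]) (rule mellin[unfolded \<beta>_def])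
  finally show ?thesis unfolding \<beta>_def .
qed

end
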